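(* Let $K$ be a field of characteristic zero. Any smooth quintic surface $X_5\subset\mathbb{P}^3_K$ contains at most $127$ lines. In other words, $M(5)\leq 127$.
   Context: $M(d)$ denotes the maximum number of lines on a smooth surface of degree $d$ in $\mathbb{P}^3$ (here over the field $K$). *)

theory Defs
  imports
    "HOL-Analysis.Cartesian_Space"
    "HOL-Library.Poly_Mapping"
    "HOL-Library.Numeral_Type"
    "HOL-Library.Extended_Nat"
    "HOL-Algebra.Algebraic_Closure_Type"
begin

text \<open>
  Polynomials in four variables: a monomial is its exponent vector, and a polynomial is the
  finitely supported family of its coefficients.
\<close>

type_synonym monomial4 = "4 \<Rightarrow>\<^sub>0 nat"
type_synonym 'a poly4 = "monomial4 \<Rightarrow>\<^sub>0 'a"

definition monomial_degree :: "monomial4 \<Rightarrow> nat" where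
  "monomial_degree m = (\<Sum>i\<in>UNIV. Poly_Mapping.lookup m i)"

definition homogeneous :: "nat \<Rightarrow> 'a::zero poly4 \<Rightarrow> bool" where
  "homogeneous d F \<longleftrightarrow> (\<forall>m\<in>Poly_Mapping.keys F. monomial_degree m = d)"

definition poly4_eval :: "'a::comm_semiring_1 poly4 \<Rightarrow> 'a ^ 4 \<Rightarrow> 'a" where
  "poly4_eval F x =
     (\<Sum>m\<in>Poly_Mapping.keys F.
        Poly_Mapping.lookup F m * (\<Prod>i\<in>UNIV. (x $ i) ^ Poly_Mapping.lookup m i))"

text \<open>
  If \<open>m\<close> does not involve the \<open>i\<close>-th variable, the truncated subtraction below is
  harmless because the coefficient is then zero.
\<close>

definition partial :: "4 \<Rightarrow> 'a::comm_semiring_1 poly4 \<Rightarrow> 'a poly4" where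
  "partial i F =
     (\<Sum>m\<in>Poly_Mapping.keys F.
        Poly_Mapping.single (m - Poly_Mapping.single i 1)
          (of_nat (Poly_Mapping.lookup m i) * Poly_Mapping.lookup F m))"

definition base_change :: "'a::field poly4 \<Rightarrow> 'a alg_closure poly4" where
  "base_change F = Poly_Mapping.map to_ac F"

text \<open>
  A surface of degree \<open>d\<close> in projective 3-space over the field \<open>'a\<close> is given by a nonzero
  quaternary form \<open>F\<close> of degree \<open>d\<close>. It is smooth (over the base field, i.e. geometrically
  nonsingular) when \<open>F\<close> and its partial derivatives have no common zero in projective
  3-space over the algebraic closure.
\<close>

definition smooth_surface :: "nat \<Rightarrow> 'a::field poly4 \<Rightarrow> bool" where
  "smooth_surface d F \<longleftrightarrow>
     F \<noteq> 0 \<and> homogeneous d F \<and>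
     (\<forall>x :: 'a alg_closure ^ 4. x \<noteq> 0 \<longrightarrow>
        \<not> (poly4_eval (base_change F) x = 0 \<and>
           (\<forall>i. poly4_eval (base_change (partial i F)) x = 0)))"

text \<open>
  A line in projective 3-space over \<open>'a\<close> is a 2-dimensional linear subspace of \<open>'a ^ 4\<close>.
  Its geometric points come from the subspace spanned over the algebraic closure; it is
  contained in the surface \<open>F = 0\<close> when all its geometric points are.
\<close>

definition is_line :: "('a::field ^ 4) set \<Rightarrow> bool" where
  "is_line L \<longleftrightarrow> vec.subspace L \<and> vec.dim L = 2"

definition geometric_points :: "('a::field ^ 4) set \<Rightarrow> ('a alg_closure ^ 4) set" where
  "geometric_points L = vec.span ((\<lambda>v. \<chi> i. to_ac (v $ i)) ` L)"

definition lines_on :: "'a::field poly4 \<Rightarrow> ('a ^ 4) set set" where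
  "lines_on F =
     {L. is_line L \<and> (\<forall>x\<in>geometric_points L. poly4_eval (base_change F) x = 0)}"

text \<open>
  The values are extended naturals, so that neither a surface with infinitely many lines nor an
  unbounded family of surfaces gets the value 0 by the conventions for \<^const>\<open>card\<close> and
  suprema on \<^typ>\<open>nat\<close>.
\<close>

definition num_lines :: "'a::field poly4 \<Rightarrow> enat" where
  "num_lines F = (if finite (lines_on F) then enat (card (lines_on F)) else \<infinity>)"

definition max_lines :: "'a::field itself \<Rightarrow> nat \<Rightarrow> enat" where
  "max_lines K d = Sup {num_lines F |F :: 'a poly4. smooth_surface d F}"

end

theory Submission
  imports Defs "HOL-Analysis.Determinants"
begin

text \<open>
  For a line \<open>L\<close> on the quintic \<open>F = 0\<close> and two directions \<open>n\<^sub>1, n\<^sub>2\<close> transversal to it, the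
  residues of \<open>g / (a b)\<close> on \<open>L\<close>, where \<open>a, b\<close> are the derivatives of \<open>F\<close> along \<open>n\<^sub>1, n\<^sub>2\<close>, give
  a functional on sextics which kills the Jacobian ideal. The four partial derivatives are a
  regular sequence of quartics, so the sextics modulo the Jacobian ideal have dimension
  \<open>84 - 40 = 44\<close>. Every line \<open>M\<close> also determines a sextic, on which the functional of \<open>L\<close> takes
  the value \<open>16\<close>, \<open>-4\<close> or \<open>1\<close> according to whether \<open>M\<close> equals, meets or misses \<open>L\<close>. Hence, for
  the adjacency matrix \<open>A\<close> of any set of lines, \<open>15 I - 5 A + J\<close> has rank at most \<open>44\<close>.

  For \<open>128\<close> lines this contradicts a local count. Contact of order two, three and four with the
  surface along \<open>L\<close> shows that \<open>L\<close> meets at most \<open>26\<close> further lines, or at most \<open>29\<close> if it is of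
  the second kind. If no plane contains four of the lines, a triangle on a line of the second kind
  lies in the tangent plane at a ramification point of the Gauss map of \<open>L\<close>, so such a line lies on
  few triangles. Comparing the traces of the first three powers of \<open>15 I - 5 A + J\<close> then excludes
  \<open>128\<close> lines. A plane with four of the lines meets the surface in five lines, counted with
  multiplicity; every other line meets one of these, and a Schwarzian derivative shows that they
  cannot all meet the maximal number of lines.
\<close>

section \<open>Forms as functions and their restrictions to lines\<close>

text \<open>The sextic attached to a line \<open>M\<close> is the Jacobian determinant, in the
  directions of \<open>M\<close>, of the quartics \<open>A, B\<close> in a decomposition F = cg A +
  cd B by two equations of \<open>M\<close>. The values 16, -4, 1 come from one transformation law
  for residues: Euler's relation for a quartic, with its factor 4, enters twice when
  \<open>M\<close> is \<open>L\<close>, once when \<open>M\<close> meets \<open>L\<close>, and never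
  when they are skew. The rank bound fixes the mean of the at most 44 nonzero eigenvalues; the
  contradiction comes from the third moment about this mean, bounded above by the Frobenius norm and
  below by valencies and triangles. Hence triangles must be rare on lines of valency above 26. The
  valency bounds count zeros of three contact polynomials on \<open>L\<close>, of degrees at most
  26, 35 and 44. If all three vanish identically nothing can be counted, but then infinitely many
  lines issue from \<open>L\<close>, 45 of them pairwise skew, and for these 15 I + J has rank 45.
  Dependence is obtained over the algebraic closure, whereas the trace estimates need real matrices;
  a rational functional on that field carries relations between integer rows across.\<close>

no_notation fps_nth (infixl "$" 75)

abbreviation "lookup \<equiv> Poly_Mapping.lookup"
abbreviation "single \<equiv> Poly_Mapping.single"
abbreviation "keys \<equiv> Poly_Mapping.keys"

text \<open>Polynomial functions instead of formal polynomials, so that substituting parametrised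
  points is plain composition. In characteristic zero the values still determine all coefficients.
  The zero function is a form of every degree.\<close>

inductive form :: "nat \<Rightarrow> ('k::comm_ring_1 ^ 4 \<Rightarrow> 'k) \<Rightarrow> bool" where
  form_zero: "form d (\<lambda>x. 0)"
| form_const: "form 0 (\<lambda>x. c)"
| form_add: "form d f \<Longrightarrow> form d g \<Longrightarrow> form d (\<lambda>x. f x + g x)"
| form_coord: "form d f \<Longrightarrow> form (Suc d) (\<lambda>x. x $ i * f x)"

lemma form_cmult: "form d f \<Longrightarrow> form d (\<lambda>x. c * f x)"
proof (induction rule: form.induct)
  case (form_add d f g)
  thus ?case using form.form_add[OF form_add.IH] by (simp add: algebra_simps)
next
  case (form_coord d f i)
  thus ?case using form.form_coord[OF form_coord.IH, of i] by (simp add: algebra_simps)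
qed (auto intro: form.intros)

lemma form_uminus: "form d f \<Longrightarrow> form d (\<lambda>x. - f x)"
  using form_cmult[of d f "-1"] by simp

lemma form_diff: "form d f \<Longrightarrow> form d g \<Longrightarrow> form d (\<lambda>x. f x - g x)"
  using form_add[OF _ form_uminus, of d f g] by simp

lemma form_mult: "form d f \<Longrightarrow> form e g \<Longrightarrow> form (d + e) (\<lambda>x. f x * g x)"
proof (induction rule: form.induct)
  case (form_const c) thus ?case using form_cmult by simp
next
  case (form_add d f g')
  thus ?case using form.form_add[OF form_add.IH] by (simp add: algebra_simps)
next
  case (form_coord d f i)
  thus ?case using form.form_coord[of "d+e" "\<lambda>x. f x * g x" i] by (simp add: algebra_simps)
qed (auto intro: form.intros)

lemma form_sum: "finite A \<Longrightarrow> (\<And>i. i \<in> A \<Longrightarrow> form d (f i)) \<Longrightarrow> form d (\<lambda>x. \<Sum>i\<in>A. f i x)"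
  by (induction A rule: finite_induct) (auto intro: form.intros)

lemma form_nth: "form 1 (\<lambda>x. x $ i)"
  using form_coord[OF form_const[of 1], of i] by simp

lemma form_power: "form d f \<Longrightarrow> form (d * n) (\<lambda>x. f x ^ n)"
proof (induction n)
  case 0 thus ?case using form_const[of 1] by simp
next
  case (Suc n)
  have "form (d + d * n) (\<lambda>x. f x * f x ^ n)" by (rule form_mult) (fact Suc.prems, rule Suc.IH, fact Suc.prems)
  thus ?case by (simp only: power_Suc mult_Suc_right)
qed

lemma form_nth_power: "form n (\<lambda>x. x $ i ^ n)"
  using form_power[OF form_nth[of i], of n] by (simp only: mult_1)

lemma form_prod: "finite A \<Longrightarrow> (\<And>i. i \<in> A \<Longrightarrow> form (d i) (f i)) \<Longrightarrow> form (\<Sum>i\<in>A. d i) (\<lambda>x. \<Prod>i\<in>A. f i x)"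
proof (induction A rule: finite_induct)
  case empty thus ?case using form_const[of 1] by simp
next
  case (insert a A) thus ?case using form_mult[of "d a" "f a"] by simp
qed

lemma form_poly4_eval:
  fixes F :: "'k::field poly4"
  assumes "homogeneous d F" shows "form d (poly4_eval F)"
proof -
  have "form d (\<lambda>x::'k^4. lookup F m * (\<Prod>i\<in>UNIV. (x $ i) ^ lookup m i))"
    if m: "m \<in> keys F" for m
  proof -
    have "form (\<Sum>i\<in>UNIV. lookup m i) (\<lambda>x::'k^4. \<Prod>i\<in>UNIV. (x $ i) ^ lookup m i)"
      by (rule form_prod) (rule finite, rule form_nth_power)
    moreover have "(\<Sum>i\<in>UNIV. lookup m i) = d"
      using assms m unfolding homogeneous_def monomial_degree_def by simp
    ultimately show ?thesis by (intro form_cmult) (simp only:)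
  qed
  thus ?thesis unfolding poly4_eval_def[abs_def] by (intro form_sum) auto
qed

lemma form_comp:
  assumes "form d f" "\<And>i. form 1 (\<lambda>x. L x $ i)"
  shows "form d (\<lambda>x. f (L x))"
  using assms(1)
proof (induction rule: form.induct)
  case (form_coord d f i)
  thus ?case using form_mult[OF assms(2)[of i] form_coord.IH] by simp
qed (auto intro: form.intros)

lemma form_scale: "form d f \<Longrightarrow> f (c *s x) = c ^ d * f x"
  by (induction rule: form.induct) (auto simp: algebra_simps)

section \<open>Polynomial families of points and expansions in three parameters\<close>

definition pv :: "(4 \<Rightarrow> 'k::comm_ring_1 poly) \<Rightarrow> 'k \<Rightarrow> 'k ^ 4" where
  "pv V z = (\<chi> i. poly (V i) z)"

text \<open>The nesting is k[z][\<sigma>][s] with \<open>s\<close> outermost, so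
  \<open>coeff (coeff P m) i\<close> is the coefficient of s^m \<sigma>^i, a polynomial in
  z.\<close>

definition ev3 :: "'k::comm_ring_1 poly poly poly \<Rightarrow> 'k \<Rightarrow> 'k \<Rightarrow> 'k \<Rightarrow> 'k" where
  "ev3 P z \<sigma> s = poly (poly (poly P [:[:s:]:]) [:\<sigma>:]) z"

lemma ev3_simps [simp]: "ev3 0 z \<sigma> s = 0" "ev3 (P + Q) z \<sigma> s = ev3 P z \<sigma> s + ev3 Q z \<sigma> s"
  "ev3 (P * Q) z \<sigma> s = ev3 P z \<sigma> s * ev3 Q z \<sigma> s"
  by (simp_all add: ev3_def)

lemma poly_eq_by_values:
  fixes p q :: "'k::field_char_0 poly"
  assumes "\<And>z. poly p z = poly q z" shows "p = q"
  using assms poly_eq_poly_eq_iff by (metis ext)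

text \<open>A nonzero polynomial has finitely many roots, so vanishing at the infinitely many
  constants \<open>[:\<sigma>:]\<close> and \<open>[:[:s:]:]\<close> removes the outer variables one
  at a time.\<close>

lemma ev3_eqI:
  fixes P Q :: "'k::field_char_0 poly poly poly"
  assumes "\<And>z \<sigma> s. ev3 P z \<sigma> s = ev3 Q z \<sigma> s" shows "P = Q"
proof -
  have 1: "p = 0" if "\<And>\<sigma>. poly p [:\<sigma>:] = 0" for p :: "'k poly poly"
  proof (rule ccontr)
    assume "p \<noteq> 0"
    hence "finite {x. poly p x = 0}" by (rule poly_roots_finite)
    moreover have "range (\<lambda>\<sigma>::'k. [:\<sigma>:]) \<subseteq> {x. poly p x = 0}" using that by auto
    moreover have "inj (\<lambda>\<sigma>::'k. [:\<sigma>:])" by (auto simp: inj_def)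
    ultimately show False using infinite_UNIV_char_0[where 'a='k] by (meson finite_imageD finite_subset)
  qed
  have "poly (P - Q) [:[:s:]:] = 0" for s
  proof (rule 1)
    fix \<sigma> show "poly (poly (P - Q) [:[:s:]:]) [:\<sigma>:] = 0"
      using assms by (intro poly_eq_by_values) (simp add: ev3_def)
  qed
  have "P - Q = 0"
  proof (rule ccontr)
    assume "P - Q \<noteq> 0"
    hence "finite {x. poly (P-Q) x = 0}" by (rule poly_roots_finite)
    moreover have "range (\<lambda>\<sigma>::'k. [:[:\<sigma>:]:]) \<subseteq> {x. poly (P-Q) x = 0}"
      using \<open>\<And>s. poly (P - Q) [:[:s:]:] = 0\<close> by auto
    moreover have "inj (\<lambda>\<sigma>::'k. [:[:\<sigma>:]:])" by (auto simp: inj_def)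
    ultimately show False using infinite_UNIV_char_0[where 'a='k] by (meson finite_imageD finite_subset)
  qed
  thus ?thesis by simp
qed

lemma form_exp3:
  assumes "form d f"
  shows "\<exists>P. \<forall>z \<sigma> s. f (pv V0 z + \<sigma> *s pv V1 z + s *s pv V2 z) = ev3 P z \<sigma> s"
  using assms
proof (induction rule: form.induct)
  case (form_zero d) show ?case by (rule exI[of _ 0]) simp
next
  case (form_const c) show ?case by (rule exI[of _ "[:[:[:c:]:]:]"]) (simp add: ev3_def)
next
  case (form_add d f g)
  then obtain P Q where "\<forall>z \<sigma> s. f (pv V0 z + \<sigma> *s pv V1 z + s *s pv V2 z) = ev3 P z \<sigma> s"
    "\<forall>z \<sigma> s. g (pv V0 z + \<sigma> *s pv V1 z + s *s pv V2 z) = ev3 Q z \<sigma> s" by blast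
  thus ?case by (intro exI[of _ "P + Q"]) simp
next
  case (form_coord d f i)
  then obtain P where P: "\<forall>z \<sigma> s. f (pv V0 z + \<sigma> *s pv V1 z + s *s pv V2 z) = ev3 P z \<sigma> s" by blast
  have "(pv V0 z + \<sigma> *s pv V1 z + s *s pv V2 z) $ i = ev3 [:[:V0 i, V1 i:], [:V2 i:]:] z \<sigma> s" for z \<sigma> s
    by (simp add: ev3_def pv_def)
  with P show ?case by (intro exI[of _ "[:[:V0 i, V1 i:], [:V2 i:]:] * P"]) (simp only: ev3_simps simp_thms)
qed

section \<open>Restriction to a line and directional derivatives\<close>

definition lp :: "('k::comm_ring_1 ^ 4 \<Rightarrow> 'k) \<Rightarrow> 'k ^ 4 \<Rightarrow> 'k ^ 4 \<Rightarrow> 'k poly" where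
  "lp f x w = (SOME p. \<forall>t. poly p t = f (x + t *s w))"

definition D :: "('k::comm_ring_1 ^ 4 \<Rightarrow> 'k) \<Rightarrow> 'k ^ 4 \<Rightarrow> 'k ^ 4 \<Rightarrow> 'k" where
  "D f x w = coeff (lp f x w) 1"

text \<open>The direction \<open>w\<close> is the point at infinity of the line, which is why the
  coefficient in degree d is \<open>f w\<close>. Statements at the point \<open>u\<close> of a line
  are later read off from leading coefficients in this way.\<close>

lemma form_line_poly:
  assumes "form d f"
  shows "\<exists>p. degree p \<le> d \<and> coeff p d = f w \<and> coeff p 0 = f x \<and> (\<forall>t. poly p t = f (x + t *s w))"
  using assms
proof (induction rule: form.induct)
  case (form_zero d) show ?case by (rule exI[of _ 0]) simp
next
  case (form_const c) show ?case by (rule exI[of _ "[:c:]"]) simp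
next
  case (form_add d f g)
  then obtain p q where "degree p \<le> d \<and> coeff p d = f w \<and> coeff p 0 = f x \<and> (\<forall>t. poly p t = f (x + t *s w))"
    "degree q \<le> d \<and> coeff q d = g w \<and> coeff q 0 = g x \<and> (\<forall>t. poly q t = g (x + t *s w))" by blast
  thus ?case by (intro exI[of _ "p + q"]) (simp add: degree_add_le)
next
  case (form_coord d f i)
  then obtain p where p: "degree p \<le> d" "coeff p d = f w" "coeff p 0 = f x" "\<And>t. poly p t = f (x + t *s w)" by blast
  have "degree ([:x $ i, w $ i:] * p) \<le> Suc d"
    using degree_mult_le[of "[:x $ i, w $ i:]" p] p(1) by (auto split: if_splits)
  moreover have "coeff p (Suc d) = 0" using p(1) by (simp add: coeff_eq_0)
  ultimately show ?case using p
    by (intro exI[of _ "[:x $ i, w $ i:] * p"]) (simp add: algebra_simps)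
qed

text \<open>Makes the choice in \<open>lp\<close> harmless: any polynomial with the right values is
  the chosen one.\<close>

lemma lp_unique:
  fixes f :: "'k::field_char_0 ^ 4 \<Rightarrow> 'k"
  assumes "\<And>t. poly p t = f (x + t *s w)" shows "lp f x w = p"
proof -
  have "\<forall>t. poly (lp f x w) t = f (x + t *s w)"
    unfolding lp_def using assms by (intro someI[of "\<lambda>p. \<forall>t. poly p t = f (x + t *s w)" p]) simp
  thus ?thesis using assms by (intro poly_eq_by_values) simp
qed

context
  fixes f :: "'k::field_char_0 ^ 4 \<Rightarrow> 'k" and d :: nat
  assumes f: "form d f"
begin

lemma poly_lp: "poly (lp f x w) t = f (x + t *s w)"
  using form_line_poly[OF f, of w x] lp_unique by metis

lemma degree_lp: "degree (lp f x w) \<le> d"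
  using form_line_poly[OF f, of w x] lp_unique by metis

lemma coeff_lp_top: "coeff (lp f x w) d = f w"
  using form_line_poly[OF f, of w x] lp_unique by metis

lemma coeff_lp_0: "coeff (lp f x w) 0 = f x"
  using form_line_poly[OF f, of w x] lp_unique by metis

end

lemma lp_zero: "lp (\<lambda>x. 0 :: 'k::field_char_0) x w = 0"
  by (rule lp_unique) simp

lemma lp_const: "lp (\<lambda>x. c :: 'k::field_char_0) x w = [:c:]"
  by (rule lp_unique) simp

lemma lp_nth: "lp (\<lambda>x. x $ i :: 'k::field_char_0) x w = [:x $ i, w $ i:]"
  by (rule lp_unique) simp

lemma lp_add:
  fixes f :: "'k::field_char_0 ^ 4 \<Rightarrow> 'k"
  shows "form d f \<Longrightarrow> form e g \<Longrightarrow> lp (\<lambda>x. f x + g x) x w = lp f x w + lp g x w"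
  by (rule lp_unique) (simp add: poly_lp)

lemma lp_mult:
  fixes f :: "'k::field_char_0 ^ 4 \<Rightarrow> 'k"
  shows "form d f \<Longrightarrow> form e g \<Longrightarrow> lp (\<lambda>x. f x * g x) x w = lp f x w * lp g x w"
  by (rule lp_unique) (simp add: poly_lp)

lemma lp_cmult:
  fixes f :: "'k::field_char_0 ^ 4 \<Rightarrow> 'k"
  shows "form d f \<Longrightarrow> lp (\<lambda>x. c * f x) x w = smult c (lp f x w)"
  by (rule lp_unique) (simp add: poly_lp)

lemma coeff_mult_1: "coeff (p * q) 1 = coeff p 0 * coeff q 1 + coeff p 1 * (coeff q 0 :: 'a::comm_semiring_0)"
  by (simp add: coeff_mult atMost_Suc numeral_eq_Suc add.commute)

lemma D_const [simp]: "D (\<lambda>x. c :: 'k::field_char_0) x w = 0" by (simp add: D_def lp_const)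
lemma D_nth [simp]: "D (\<lambda>x. x $ i :: 'k::field_char_0) x w = w $ i" by (simp add: D_def lp_nth)

lemma D_add:
  fixes f :: "'k::field_char_0 ^ 4 \<Rightarrow> 'k"
  shows "form d f \<Longrightarrow> form e g \<Longrightarrow> D (\<lambda>x. f x + g x) x w = D f x w + D g x w"
  by (simp add: D_def lp_add)

lemma D_cmult:
  fixes f :: "'k::field_char_0 ^ 4 \<Rightarrow> 'k"
  shows "form d f \<Longrightarrow> D (\<lambda>x. c * f x) x w = c * D f x w"
  by (simp add: D_def lp_cmult)

lemma D_mult:
  fixes f :: "'k::field_char_0 ^ 4 \<Rightarrow> 'k"
  shows "form d f \<Longrightarrow> form e g \<Longrightarrow> D (\<lambda>x. f x * g x) x w = f x * D g x w + D f x w * g x"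
  by (simp only: D_def lp_mult coeff_mult_1 coeff_lp_0)

lemma D_coord:
  fixes f :: "'k::field_char_0 ^ 4 \<Rightarrow> 'k"
  shows "form d f \<Longrightarrow> D (\<lambda>x. x $ i * f x) x w = x $ i * D f x w + w $ i * f x"
  by (simp only: D_mult[OF form_nth] D_nth)

lemma D_linear:
  fixes f :: "'k::field_char_0 ^ 4 \<Rightarrow> 'k"
  assumes "form d f"
  shows "D f x (a *s v + b *s w) = a * D f x v + b * D f x w"
  using assms
proof (induction rule: form.induct)
  case (form_add d f g) thus ?case by (simp add: D_add algebra_simps)
next
  case (form_coord d f i)
  thus ?case by (simp only: D_coord[OF form_coord.hyps]) (simp add: algebra_simps)
qed simp_all

lemma D_scale:
  fixes f :: "'k::field_char_0 ^ 4 \<Rightarrow> 'k"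
  shows "form d f \<Longrightarrow> D f x (a *s v) = a * D f x v"
  using D_linear[of d f x a v 0 0] by simp

lemma D_plus:
  fixes f :: "'k::field_char_0 ^ 4 \<Rightarrow> 'k"
  shows "form d f \<Longrightarrow> D f x (v + w) = D f x v + D f x w"
  using D_linear[of d f x 1 v 1 w] by simp

lemma D_euler:
  fixes f :: "'k::field_char_0 ^ 4 \<Rightarrow> 'k"
  assumes "form d f"
  shows "D f x x = of_nat d * f x"
  using assms
proof (induction rule: form.induct)
  case (form_add d f g) thus ?case by (simp add: D_add algebra_simps)
next
  case (form_coord d f i)
  thus ?case by (simp only: D_coord[OF form_coord.hyps]) (simp add: algebra_simps)
qed simp_all

lemma form_D:
  fixes f :: "'k::field_char_0 ^ 4 \<Rightarrow> 'k"
  assumes "form d f"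
  shows "form (d - 1) (\<lambda>x. D f x w)"
  using assms
proof (induction rule: form.induct)
  case (form_add d f g) thus ?case by (simp add: D_add form.form_add)
next
  case (form_coord d f i)
  thus ?case
  \<comment> \<open>For d = 0 the induction hypothesis gives only the truncated degree 0 - 1 = 0,
    and multiplying by a coordinate would raise it to 1; the derivative has to be shown
    zero.\<close>
  proof (cases "d = 0")
    case True
    have "D f x w = 0" for x
    proof -
      have "coeff (lp f x w) 1 = 0" using degree_lp[OF form_coord.hyps, of x w] True by (simp add: coeff_eq_0)
      thus ?thesis by (simp add: D_def)
    qed
    moreover have "form d (\<lambda>x. w $ i * f x)" using form_cmult[OF form_coord.hyps] .
    ultimately show ?thesis by (simp add: D_coord[OF form_coord.hyps])
  next
    case False
    hence "form d (\<lambda>x. x $ i * D f x w)" using form.form_coord[OF form_coord.IH, of i] by simp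
    thus ?thesis using form.form_add[OF _ form_cmult[OF form_coord.hyps, of "w $ i"]]
      by (simp add: D_coord[OF form_coord.hyps])
  qed
qed (auto intro: form.intros)

lemma D_along_zero:
  fixes f :: "'k::field_char_0 ^ 4 \<Rightarrow> 'k"
  assumes "form d f" "\<And>t. f (x + t *s w) = 0" shows "D f x w = 0"
proof -
  have "lp f x w = 0" using assms(2) by (intro lp_unique) simp
  thus ?thesis by (simp add: D_def)
qed

lemma D_sum:
  fixes f :: "'i \<Rightarrow> 'k::field_char_0 ^ 4 \<Rightarrow> 'k"
  assumes "finite A" "\<And>i. i \<in> A \<Longrightarrow> form d (f i)"
  shows "D (\<lambda>x. \<Sum>i\<in>A. f i x) x w = (\<Sum>i\<in>A. D (f i) x w)"
  using assms
proof (induction A rule: finite_induct)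
  case (insert a A)
  have "D (\<lambda>x. f a x + (\<Sum>i\<in>A. f i x)) x w = D (f a) x w + D (\<lambda>x. \<Sum>i\<in>A. f i x) x w"
    using insert by (intro D_add[of d _ d] form_sum) auto
  thus ?case using insert by simp
qed simp

section \<open>Comparison with the formal partial derivatives\<close>

lemma lp_prod_nth:
  "lp (\<lambda>x. \<Prod>i\<in>UNIV. (x $ i :: 'k::field_char_0) ^ m i) x w = (\<Prod>i\<in>UNIV. [:x $ i, w $ i:] ^ m i)"
  by (rule lp_unique) (simp add: poly_prod)

lemma coeff_1_eq_pderiv: "coeff p 1 = poly (pderiv p) (0 :: 'k::field_char_0)"
  by (simp add: poly_0_coeff_0 coeff_pderiv)

lemma D_monomial:
  "D (\<lambda>x. \<Prod>i\<in>UNIV. (x $ i :: 'k::field_char_0) ^ m i) x w =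
   (\<Sum>j\<in>UNIV. w $ j * (of_nat (m j) * (\<Prod>i\<in>UNIV. (x $ i) ^ (if i = j then m i - 1 else m i))))"
proof -
  have "D (\<lambda>x. \<Prod>i\<in>UNIV. (x $ i :: 'k) ^ m i) x w = poly (pderiv (\<Prod>i\<in>UNIV. [:x $ i, w $ i:] ^ m i)) 0"
    unfolding D_def lp_prod_nth by (rule coeff_1_eq_pderiv)
  also have "\<dots> = (\<Sum>j\<in>UNIV. (\<Prod>i\<in>UNIV - {j}. (x $ i) ^ m i) * (of_nat (m j) * (x $ j) ^ (m j - 1) * w $ j))"
    by (simp add: pderiv_prod poly_sum poly_prod pderiv_power pderiv_pCons algebra_simps)
  also have "\<dots> = (\<Sum>j\<in>UNIV. w $ j * (of_nat (m j) * (\<Prod>i\<in>UNIV. (x $ i) ^ (if i = j then m i - 1 else m i))))"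
  proof (rule sum.cong[OF refl])
    fix j :: 4
    have "(\<Prod>i\<in>UNIV. (x $ i) ^ (if i = j then m i - 1 else m i)) = (x $ j) ^ (m j - 1) * (\<Prod>i\<in>UNIV - {j}. (x $ i) ^ m i)"
      by (subst prod.remove[of UNIV j]) (auto intro!: prod.cong)
    thus "(\<Prod>i\<in>UNIV - {j}. (x $ i) ^ m i) * (of_nat (m j) * (x $ j) ^ (m j - 1) * w $ j) =
      w $ j * (of_nat (m j) * (\<Prod>i\<in>UNIV. (x $ i) ^ (if i = j then m i - 1 else m i)))"
      by simp
  qed
  finally show ?thesis .
qed

lemma poly4_eval_alt:
  assumes "finite S" "keys F \<subseteq> S"
  shows "poly4_eval F x = (\<Sum>m\<in>S. lookup F m * (\<Prod>i\<in>UNIV. (x $ i) ^ lookup m i))"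
  unfolding poly4_eval_def using assms by (intro sum.mono_neutral_left) (auto simp: in_keys_iff)

lemma poly4_eval_zero [simp]: "poly4_eval 0 x = 0"
  by (simp add: poly4_eval_def)

lemma poly4_eval_add: "poly4_eval (F + G) x = poly4_eval F x + poly4_eval G x"
proof -
  let ?S = "keys F \<union> keys G"
  have "keys (F + G) \<subseteq> ?S" by (rule keys_add)
  thus ?thesis
    by (simp add: poly4_eval_alt[of ?S] lookup_add algebra_simps sum.distrib)
qed

lemma poly4_eval_sum: "poly4_eval (\<Sum>i\<in>A. F i) x = (\<Sum>i\<in>A. poly4_eval (F i) x)"
  by (induction A rule: infinite_finite_induct) (auto simp: poly4_eval_add)

lemma poly4_eval_single:
  "poly4_eval (single m c) x = c * (\<Prod>i\<in>UNIV. (x $ i) ^ lookup m i)"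
  by (subst poly4_eval_alt[of "{m}"]) auto

text \<open>Turns smoothness, which is stated with \<open>partial\<close>, into the existence of a
  direction with nonzero derivative.\<close>

lemma D_poly4_eval:
  fixes F :: "'k::field_char_0 poly4"
  assumes "homogeneous d F"
  shows "D (poly4_eval F) x w = (\<Sum>i\<in>UNIV. w $ i * poly4_eval (partial i F) x)"
proof -
  let ?mon = "\<lambda>m x. \<Prod>i\<in>UNIV. (x $ i :: 'k) ^ lookup m i"
  have fm: "form d (?mon m)" if "m \<in> keys F" for m
  proof -
    have "form (\<Sum>i\<in>UNIV. lookup m i) (?mon m)"
      by (rule form_prod) (rule finite, rule form_nth_power)
    moreover have "(\<Sum>i\<in>UNIV. lookup m i) = d"
      using assms that unfolding homogeneous_def monomial_degree_def by simp
    ultimately show ?thesis by simp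
  qed
  have "D (poly4_eval F) x w = (\<Sum>m\<in>keys F. D (\<lambda>x. lookup F m * ?mon m x) x w)"
    unfolding poly4_eval_def[abs_def] by (rule D_sum[of _ d]) (auto intro: form_cmult fm)
  also have "\<dots> = (\<Sum>m\<in>keys F. lookup F m * (\<Sum>j\<in>UNIV. w $ j * (of_nat (lookup m j) *
      (\<Prod>i\<in>UNIV. (x $ i) ^ (if i = j then lookup m i - 1 else lookup m i)))))"
    by (intro sum.cong refl) (simp add: D_cmult[OF fm] D_monomial)
  also have "\<dots> = (\<Sum>j\<in>UNIV. w $ j * (\<Sum>m\<in>keys F. of_nat (lookup m j) * lookup F m *
      (\<Prod>i\<in>UNIV. (x $ i) ^ (lookup (m - single j 1) i))))"
    unfolding sum_distrib_left
    by (subst sum.swap, intro sum.cong refl)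
      (auto simp: lookup_minus lookup_single when_def algebra_simps intro!: prod.cong)
  also have "\<dots> = (\<Sum>i\<in>UNIV. w $ i * poly4_eval (partial i F) x)"
    by (simp add: partial_def poly4_eval_sum poly4_eval_single)
  finally show ?thesis .
qed

section \<open>Contact conditions at one point of a line\<close>

text \<open>
  \<open>h m i\<close> is the coefficient of \<open>\<kappa>\<^sup>i\<close> in the contact condition number \<open>m + i\<close> for the line of slope \<open>\<kappa>\<close>,
  as a polynomial in the position on the base line. The first condition is \<open>W \<kappa> + Q = 0\<close>, and
  \<open>e2, e3, e4\<close> result from substituting \<open>\<kappa> = - Q / W\<close> into the later ones and clearing denominators. \<open>j\<close> is
  the order of \<open>W\<close> at the point, and \<open>K\<close> the set of slopes of the lines through it.
\<close>

locale local_data =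
  fixes h :: "nat \<Rightarrow> nat \<Rightarrow> 'k::field_char_0 poly" and g :: "nat \<Rightarrow> nat \<Rightarrow> 'k" and j :: nat
    and Z W Q e2 e3 e4 :: "'k poly" and K :: "'k set" and n :: nat
  defines "Z \<equiv> [:0, 1:]" and "W \<equiv> h 0 1" and "Q \<equiv> h 1 0"
    and "e2 \<equiv> h 0 2 * Q^2 - W * Q * h 1 1 + W^2 * h 2 0"
    and "e3 \<equiv> h 0 3 * Q^3 - W * Q^2 * h 1 2 + W^2 * Q * h 2 1 - W^3 * h 3 0"
    and "e4 \<equiv> h 0 4 * Q^4 - W * Q^3 * h 1 3 + W^2 * Q^2 * h 2 2 - W^3 * Q * h 3 1 + W^4 * h 4 0"
    and "n \<equiv> card K"
  \<comment> \<open>\<open>g m i\<close> is the value of \<open>h m i\<close> at the point. Modulo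
    Z^(j+1), moving the base point along the line is a Taylor shift of the values
    \<open>g m\<close>, up to a factor that is 1 at the point; hence the binomial
    coefficient.\<close>
  assumes lead: "\<And>m i k. k \<le> j \<Longrightarrow> (\<And>l. i \<le> l \<Longrightarrow> l < i + k \<Longrightarrow> g m l = 0) \<Longrightarrow>
            \<exists>r. h m i = Z^k * r \<and> poly r 0 = of_nat ((i + k) choose i) * g m (i + k)"
    and g0: "\<And>l. l \<le> j \<Longrightarrow> g 0 l = 0" and gj: "g 0 (Suc j) \<noteq> 0"
    and finK: "finite K"
    and C1: "\<And>\<kappa>. \<kappa> \<in> K \<Longrightarrow> g 0 1 * \<kappa> + g 1 0 = 0"
    and C2: "\<And>\<kappa>. \<kappa> \<in> K \<Longrightarrow> g 0 2 * \<kappa>^2 + g 1 1 * \<kappa> + g 2 0 = 0"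
    and C3: "\<And>\<kappa>. \<kappa> \<in> K \<Longrightarrow> g 0 3 * \<kappa>^3 + g 1 2 * \<kappa>^2 + g 2 1 * \<kappa> + g 3 0 = 0"
    and C4: "\<And>\<kappa>. \<kappa> \<in> K \<Longrightarrow> g 0 4 * \<kappa>^4 + g 1 3 * \<kappa>^3 + g 2 2 * \<kappa>^2 + g 3 1 * \<kappa> + g 4 0 = 0"
begin

lemma h_at_0: "poly (h m i) 0 = g m i"
  using lead[of 0 i m] by auto

lemma leadX:
  assumes "k \<le> j" "\<forall>l<k. g m (i + l) = 0" "b = of_nat ((i + k) choose i)" "t = i + k"
  shows "\<exists>r. h m i = Z^k * r \<and> poly r 0 = b * g m t"
proof -
  have "g m l = 0" if "i \<le> l" "l < i + k" for l
    using assms(2)[rule_format, of "l - i"] that by simp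
  thus ?thesis using lead[of k i m] assms(1,3,4) by blast
qed

lemma leadZ:
  assumes "1 \<le> j" "g m i = 0" "b = of_nat (Suc i)" "t = Suc i"
  shows "\<exists>r. h m i = Z * r \<and> poly r 0 = b * g m t"
  using leadX[of 1 m i b t] assms by simp

lemma Qx:
  assumes "1 \<le> j" "g 1 0 = 0" shows "\<exists>Q1. Q = Z * Q1 \<and> poly Q1 0 = g 1 1"
proof -
  have "\<exists>r. h 1 0 = Z * r \<and> poly r 0 = 1 * g 1 1" by (rule leadZ) (use assms in simp_all)
  thus ?thesis unfolding Q_def mult_1_left .
qed

lemma Z_dvd_iff: "Z dvd p \<longleftrightarrow> poly p 0 = 0"
  unfolding Z_def using poly_eq_0_iff_dvd[of p 0] by simp

lemma Z_nz: "Z \<noteq> 0" and Z_at_0: "poly Z 0 = 0" by (simp_all add: Z_def)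

lemma card_K_le_degree:
  assumes "p \<noteq> 0" "\<And>\<kappa>. \<kappa> \<in> K \<Longrightarrow> poly p \<kappa> = 0" shows "n \<le> degree p"
proof -
  have "n \<le> card {x. poly p x = 0}"
    unfolding n_def using assms by (intro card_mono poly_roots_finite) auto
  thus ?thesis using card_poly_roots_bound[OF assms(1)] by linarith
qed

lemma n_le_1: assumes "\<And>\<kappa>. \<kappa> \<in> K \<Longrightarrow> \<kappa> = c" shows "n \<le> 1"
proof -
  have "K \<subseteq> {c}" using assms by auto
  thus ?thesis unfolding n_def using card_mono[of "{c}" K] by simp
qed

lemma n_0: assumes "\<And>\<kappa>. \<kappa> \<in> K \<Longrightarrow> False" shows "n = 0"
  using assms unfolding n_def by (metis card.empty ex_in_conv)

lemma ord_dvd: "Z^a dvd p \<Longrightarrow> b \<le> a \<Longrightarrow> Z^b dvd p"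
  using power_le_dvd by blast

lemma n_pos: "n \<noteq> 0 \<Longrightarrow> \<exists>\<kappa>. \<kappa> \<in> K" unfolding n_def by (metis card.empty ex_in_conv)

text \<open>At an unramified point C1 fixes the slope, and with Q = - \<kappa> W the values of
  \<open>e2, e3, e4\<close> are, up to sign, powers of W times the conditions C2, C3, C4.\<close>

lemma case_0:
  assumes j: "j = 0"
  shows "n \<le> 1" "Z^n dvd e2" "Z^n dvd e3" "Z^n dvd e4"
proof -
  have w: "g 0 1 \<noteq> 0" using gj j by simp
  have k: "\<kappa> = - g 1 0 / g 0 1" if "\<kappa> \<in> K" for \<kappa>
    using C1[OF that] w by (simp add: field_simps eq_neg_iff_add_eq_0)
  show n1: "n \<le> 1" using n_le_1 k by blast
  have "n = 0 \<or> (n = 1 \<and> Z dvd e2 \<and> Z dvd e3 \<and> Z dvd e4)"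
  proof (cases "n = 0")
    case False
    then obtain \<kappa> where \<kappa>: "\<kappa> \<in> K" using n_pos by blast
    have q: "g 1 0 = - \<kappa> * g 0 1" using C1[OF \<kappa>] by (simp add: eq_neg_iff_add_eq_0 mult.commute add.commute)
    have id2: "a * (- k * w)^2 - w * (- k * w) * b + w^2 * c = w^2 * (a * k^2 + b * k + c)" for a b c k w :: 'k
      by (simp add: algebra_simps power2_eq_square)
    have id3: "a * (- k * w)^3 - w * (- k * w)^2 * b + w^2 * (- k * w) * c - w^3 * d = - (w^3) * (a * k^3 + b * k^2 + c * k + d)"
      for a b c d k w :: 'k by (simp add: algebra_simps power2_eq_square power3_eq_cube)
    have id4: "a * (- k * w)^4 - w * (- k * w)^3 * b + w^2 * (- k * w)^2 * c - w^3 * (- k * w) * d + w^4 * e =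
       w^4 * (a * k^4 + b * k^3 + c * k^2 + d * k + e)"
      for a b c d e k w :: 'k by (simp add: algebra_simps power2_eq_square power3_eq_cube power4_eq_xxxx)
    have "poly e2 0 = (g 0 1)^2 * (g 0 2 * \<kappa>^2 + g 1 1 * \<kappa> + g 2 0)"
      unfolding e2_def W_def Q_def poly_diff poly_add poly_mult poly_power h_at_0 q id2 ..
    moreover have "poly e3 0 = - ((g 0 1)^3) * (g 0 3 * \<kappa>^3 + g 1 2 * \<kappa>^2 + g 2 1 * \<kappa> + g 3 0)"
      unfolding e3_def W_def Q_def poly_diff poly_add poly_mult poly_power h_at_0 q id3 ..
    moreover have "poly e4 0 = (g 0 1)^4 * (g 0 4 * \<kappa>^4 + g 1 3 * \<kappa>^3 + g 2 2 * \<kappa>^2 + g 3 1 * \<kappa> + g 4 0)"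
      unfolding e4_def W_def Q_def poly_diff poly_add poly_mult poly_power h_at_0 q id4 ..
    ultimately show ?thesis using C2[OF \<kappa>] C3[OF \<kappa>] C4[OF \<kappa>] False n1 unfolding Z_dvd_iff by auto
  qed auto
  thus "Z^n dvd e2" "Z^n dvd e3" "Z^n dvd e4" by auto
qed

text \<open>At simple ramification C1 leaves the slope free and C2 is a quadratic with leading
  coefficient \<open>?c\<close>. If \<open>e2\<close> vanishes identically, then g 1 0 = 0, and the
  next coefficient of \<open>e2\<close> is a multiple of the discriminant of C2, so only a double
  root remains.\<close>

lemma case_1:
  assumes j: "j = 1"
  shows "Z^n dvd e2" "e2 = 0 \<Longrightarrow> Z^(n + 2) dvd e3" "e2 = 0 \<Longrightarrow> Z^(n + 4) dvd e4"
proof -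
  let ?c = "g 0 2"
  have c: "?c \<noteq> 0" using gj j by (simp add: numeral_2_eq_2)
  have z: "g 0 0 = 0" "g 0 1 = 0" using g0 j by auto
  have "\<exists>r. W = Z * r \<and> poly r 0 = 2 * ?c" unfolding W_def by (rule leadZ) (use j z in simp_all)
  then obtain W1 where W1: "W = Z * W1" "poly W1 0 = 2 * ?c" by blast
  have "n \<le> degree [:g 2 0, g 1 1, ?c:]"
    using c C2 by (intro card_K_le_degree) (auto simp: algebra_simps power2_eq_square)
  hence n2: "n \<le> 2" using c by simp
  show "Z^n dvd e2"
  proof (cases "n = 0")
    case False
    then obtain \<kappa> where \<kappa>: "\<kappa> \<in> K" using n_pos by blast
    hence "g 1 0 = 0" using C1 z by fastforce
    then obtain Q1 where Q1: "Q = Z * Q1" using Qx j by auto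
    have "e2 = Z^2 * (h 0 2 * Q1^2 - W1 * Q1 * h 1 1 + W1^2 * h 2 0)"
      unfolding e2_def Q1 W1 by (simp add: algebra_simps eval_nat_numeral)
    hence "Z^2 dvd e2" by simp
    thus ?thesis using ord_dvd n2 by blast
  qed simp
  assume e: "e2 = 0"
  have "poly e2 0 = ?c * (g 1 0)^2"
    unfolding e2_def W1(1) Q_def by (simp add: h_at_0 Z_at_0)
  hence "g 1 0 = 0" using e c by simp
  then obtain Q1 where Q1: "Q = Z * Q1" "poly Q1 0 = g 1 1" using Qx j by auto
  have "e2 = Z^2 * (h 0 2 * Q1^2 - W1 * Q1 * h 1 1 + W1^2 * h 2 0)"
    unfolding e2_def Q1 W1 by (simp add: algebra_simps eval_nat_numeral)
  hence "h 0 2 * Q1^2 - W1 * Q1 * h 1 1 + W1^2 * h 2 0 = 0" using e Z_nz by simp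
  hence "poly (h 0 2 * Q1^2 - W1 * Q1 * h 1 1 + W1^2 * h 2 0) 0 = 0" by simp
  hence "?c * (g 1 1)^2 - 2 * ?c * g 1 1 * g 1 1 + (2 * ?c)^2 * g 2 0 = 0"
    by (simp only: h_at_0 W1(2) Q1(2) poly_diff poly_add poly_mult poly_power)
  moreover have "?c * (4 * ?c * g 2 0 - (g 1 1)^2) = ?c * (g 1 1)^2 - 2 * ?c * g 1 1 * g 1 1 + (2 * ?c)^2 * g 2 0"
    by (simp add: algebra_simps power2_eq_square)
  ultimately have "?c * (4 * ?c * g 2 0 - (g 1 1)^2) = 0" by simp
  hence disc: "4 * ?c * g 2 0 = (g 1 1)^2" using c by simp
  have k: "g 1 1 = - 2 * ?c * \<kappa>" if "\<kappa> \<in> K" for \<kappa>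
  proof -
    have "(2 * ?c * \<kappa> + g 1 1)^2 = 4 * ?c * (?c * \<kappa>^2 + g 1 1 * \<kappa> + g 2 0) - (4 * ?c * g 2 0 - (g 1 1)^2)"
      by (simp add: algebra_simps power2_eq_square)
    hence "2 * ?c * \<kappa> + g 1 1 = 0" using C2[OF that] disc by simp
    thus ?thesis by (simp add: eq_neg_iff_add_eq_0 add.commute)
  qed
  have n1: "n \<le> 1"
  proof (rule n_le_1)
    fix \<kappa> assume "\<kappa> \<in> K" thus "\<kappa> = - g 1 1 / (2 * ?c)" using k[of \<kappa>] c by (simp add: field_simps)
  qed
  have "e3 = Z^3 * (h 0 3 * Q1^3 - W1 * Q1^2 * h 1 2 + W1^2 * Q1 * h 2 1 - W1^3 * h 3 0)"
    unfolding e3_def Q1 W1 by (simp add: algebra_simps eval_nat_numeral)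
  hence "Z^3 dvd e3" by simp
  thus "Z^(n + 2) dvd e3" using ord_dvd[of 3 e3 "n + 2"] n1 by simp
  define r where "r = h 0 4 * Q1^4 - W1 * Q1^3 * h 1 3 + W1^2 * Q1^2 * h 2 2 - W1^3 * Q1 * h 3 1 + W1^4 * h 4 0"
  have e4: "e4 = Z^4 * r" unfolding e4_def Q1 W1 r_def by (simp add: algebra_simps eval_nat_numeral)
  show "Z^(n + 4) dvd e4"
  proof (cases "n = 0")
    case True thus ?thesis using e4 by simp
  next
    case False
    then obtain \<kappa> where \<kappa>: "\<kappa> \<in> K" using n_pos by blast
    \<comment> \<open>At the point Q1 = - \<kappa> W1, so the cofactor of Z^4 is the last contact
      condition times a power of W1.\<close>
    have "poly r 0 = (2 * ?c)^4 * (g 0 4 * \<kappa>^4 + g 1 3 * \<kappa>^3 + g 2 2 * \<kappa>^2 + g 3 1 * \<kappa> + g 4 0)"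
      unfolding r_def poly_diff poly_add poly_mult poly_power h_at_0 W1(2) Q1(2) k[OF \<kappa>] by (simp add: algebra_simps eval_nat_numeral)
    hence "Z dvd r" using C4[OF \<kappa>] unfolding Z_dvd_iff by simp
    hence "Z^4 * Z dvd e4" unfolding e4 by (intro mult_dvd_mono) auto
    hence "Z^5 dvd e4" by (simp add: power_Suc2[symmetric] del: power_Suc)
    thus ?thesis using ord_dvd[of 5 e4 "n + 4"] n1 by simp
  qed
qed

text \<open>C3 is now the condition with surviving leading coefficient, whence n \<le> 3. The lowest
  coefficients of \<open>e2\<close> and \<open>e3\<close>, if both vanish, make C3 the cube of a
  linear polynomial, so one slope is left. The exceptional alternative arises for g 1 1 nonzero,
  where C2 is linear in the slope.\<close>

lemma case_2:
  assumes j: "j = 2"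
  shows "n \<le> 3" "Z^n dvd e2" "e2 = 0 \<Longrightarrow> Z^(n + 3) dvd e3 \<or> (Z^(n + 2) dvd e3 \<and> n \<le> 1)"
    "e2 = 0 \<Longrightarrow> e3 = 0 \<Longrightarrow> Z^(n + 6) dvd e4"
proof -
  let ?c = "g 0 3"
  have c: "?c \<noteq> 0" using gj j by (simp add: numeral_2_eq_2 numeral_3_eq_3)
  have z: "g 0 0 = 0" "g 0 1 = 0" "g 0 2 = 0" using g0 j by auto
  have "\<exists>r. h 0 1 = Z^2 * r \<and> poly r 0 = 3 * g 0 3"
    by (rule leadX[of 2 0 1 3 3]) (use j z in \<open>simp_all add: All_less_Suc eval_nat_numeral\<close>)
  then obtain W1 where "h 0 1 = Z^2 * W1" "poly W1 0 = 3 * ?c" by blast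
  hence W1: "W = Z^2 * W1" "poly W1 0 = 3 * ?c" by (simp_all add: W_def)
  have "\<exists>r. h 0 2 = Z * r \<and> poly r 0 = 3 * ?c" by (rule leadZ) (use j z in simp_all)
  then obtain A where A: "h 0 2 = Z * A" and A0: "poly A 0 = 3 * ?c" by blast
  have "n \<le> degree [:g 3 0, g 2 1, g 1 2, ?c:]"
    using c C3 by (intro card_K_le_degree) (auto simp: algebra_simps power2_eq_square power3_eq_cube)
  thus n3: "n \<le> 3" using c by simp
  show "Z^n dvd e2"
  proof (cases "n = 0")
    case False
    then obtain \<kappa> where \<kappa>: "\<kappa> \<in> K" using n_pos by blast
    hence "g 1 0 = 0" using C1 z by fastforce
    then obtain Q1 where Q1: "Q = Z * Q1" using Qx j by auto
    have "e2 = Z^3 * (A * Q1^2 - W1 * Q1 * h 1 1 + Z * W1^2 * h 2 0)"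
      unfolding e2_def Q1 W1 A by (simp add: algebra_simps eval_nat_numeral)
    hence "Z^3 dvd e2" by simp
    thus ?thesis using ord_dvd n3 by blast
  qed simp
  assume e: "e2 = 0"
  have "e2 = Z * (A * Q^2 - Z * W1 * Q * h 1 1 + Z^3 * W1^2 * h 2 0)"
    unfolding e2_def W1 A by (simp add: algebra_simps eval_nat_numeral)
  hence "A * Q^2 - Z * W1 * Q * h 1 1 + Z^3 * W1^2 * h 2 0 = 0" using e Z_nz by simp
  hence "poly (A * Q^2 - Z * W1 * Q * h 1 1 + Z^3 * W1^2 * h 2 0) 0 = 0" by simp
  hence "3 * ?c * (g 1 0)^2 = 0" by (simp add: Z_at_0 A0 Q_def h_at_0)
  hence q0: "g 1 0 = 0" using c by simp
  obtain Q1 where Q1: "Q = Z * Q1" "poly Q1 0 = g 1 1" using Qx j q0 by auto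
  define r where "r = h 0 3 * Q1^3 - Z * W1 * Q1^2 * h 1 2 + Z^2 * W1^2 * Q1 * h 2 1 - Z^3 * W1^3 * h 3 0"
  have e3r: "e3 = Z^3 * r" unfolding e3_def Q1 W1 r_def by (simp add: algebra_simps eval_nat_numeral)
  have r0: "poly r 0 = ?c * (g 1 1)^3" unfolding r_def by (simp add: Z_at_0 h_at_0 Q1)
  have Q2x: "\<exists>Q1. Q = Z^2 * Q1 \<and> poly Q1 0 = g 1 2" if q1: "g 1 1 = 0"
  proof -
    have "\<exists>r. h 1 0 = Z^2 * r \<and> poly r 0 = 1 * g 1 2"
      by (rule leadX[of 2 1 0 1 2]) (use j q0 q1 in \<open>simp_all add: All_less_Suc eval_nat_numeral\<close>)
    then obtain r where "h 1 0 = Z^2 * r" "poly r 0 = 1 * g 1 2" by blast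
    thus ?thesis unfolding Q_def by (intro exI[of _ r]) simp
  qed
  show "Z^(n + 3) dvd e3 \<or> (Z^(n + 2) dvd e3 \<and> n \<le> 1)"
  proof (cases "g 1 1 = 0")
    case False
    have "n \<le> 1"
    proof (rule n_le_1)
      fix \<kappa> assume "\<kappa> \<in> K"
      hence "g 1 1 * \<kappa> + g 2 0 = 0" using C2 z by fastforce
      thus "\<kappa> = - g 2 0 / g 1 1" using False by (simp add: field_simps eq_neg_iff_add_eq_0)
    qed
    moreover have "Z^3 dvd e3" using e3r by simp
    ultimately show ?thesis using ord_dvd[of 3 e3 "n + 2"] by simp
  next
    case True
    then obtain Q2 where Q2: "Q = Z^2 * Q2" using Q2x by blast
    have "e3 = Z^6 * (h 0 3 * Q2^3 - W1 * Q2^2 * h 1 2 + W1^2 * Q2 * h 2 1 - W1^3 * h 3 0)"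
      unfolding e3_def Q2 W1 by (simp add: algebra_simps eval_nat_numeral)
    hence "Z^6 dvd e3" by simp
    thus ?thesis using ord_dvd[of 6 e3 "n + 3"] n3 by simp
  qed
  assume e3: "e3 = 0"
  hence "r = 0" using e3r Z_nz by simp
  hence q1: "g 1 1 = 0" using r0 c by simp
  define b where "b = g 1 2"
  obtain Q2 where Q2: "Q = Z^2 * Q2" "poly Q2 0 = b" using Q2x q1 unfolding b_def by blast
  have "\<exists>r. h 1 1 = Z * r \<and> poly r 0 = 2 * b" unfolding b_def by (rule leadZ) (use j q1 in simp_all)
  then obtain B where B: "h 1 1 = Z * B" and B0: "poly B 0 = 2 * b" by blast
  have "e2 = Z^4 * (Z * A * Q2^2 - Z * W1 * Q2 * B + W1^2 * h 2 0)"
    unfolding e2_def Q2 W1 A B by (simp add: algebra_simps eval_nat_numeral)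
  hence x: "Z * A * Q2^2 - Z * W1 * Q2 * B + W1^2 * h 2 0 = 0" using e Z_nz by simp
  hence "poly (Z * A * Q2^2 - Z * W1 * Q2 * B + W1^2 * h 2 0) 0 = 0" by simp
  hence g20: "g 2 0 = 0" using c by (simp add: Z_at_0 W1 h_at_0)
  have "\<exists>r. h 2 0 = Z * r \<and> poly r 0 = 1 * g 2 1" by (rule leadZ) (use j g20 in simp_all)
  then obtain E where E: "h 2 0 = Z * E" and E0: "poly E 0 = 1 * g 2 1" by blast
  have "Z * A * Q2^2 - Z * W1 * Q2 * B + W1^2 * h 2 0 = Z * (A * Q2^2 - W1 * Q2 * B + W1^2 * E)"
    unfolding E by (simp add: algebra_simps)
  hence "A * Q2^2 - W1 * Q2 * B + W1^2 * E = 0" using x Z_nz by simp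
  hence "poly (A * Q2^2 - W1 * Q2 * B + W1^2 * E) 0 = 0" by simp
  hence "3 * ?c * b^2 - 3 * ?c * b * (2 * b) + (3 * ?c)^2 * g 2 1 = 0"
    by (simp add: A0 Q2 W1 B0 E0)
  moreover have "3 * ?c * (3 * ?c * g 2 1 - b^2) = 3 * ?c * b^2 - 3 * ?c * b * (2 * b) + (3 * ?c)^2 * g 2 1"
    by (simp add: algebra_simps power2_eq_square)
  ultimately have "3 * ?c * (3 * ?c * g 2 1 - b^2) = 0" by simp
  hence c1: "3 * ?c * g 2 1 = b^2" using c by simp
  have "e3 = Z^6 * (h 0 3 * Q2^3 - W1 * Q2^2 * h 1 2 + W1^2 * Q2 * h 2 1 - W1^3 * h 3 0)"
    unfolding e3_def Q2 W1 by (simp add: algebra_simps eval_nat_numeral)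
  hence "h 0 3 * Q2^3 - W1 * Q2^2 * h 1 2 + W1^2 * Q2 * h 2 1 - W1^3 * h 3 0 = 0" using e3 Z_nz by simp
  hence "poly (h 0 3 * Q2^3 - W1 * Q2^2 * h 1 2 + W1^2 * Q2 * h 2 1 - W1^3 * h 3 0) 0 = 0" by simp
  hence "?c * b^3 - 3 * ?c * b^2 * b + (3 * ?c)^2 * b * g 2 1 - (3 * ?c)^3 * g 3 0 = 0"
    by (simp add: Q2 W1 h_at_0 b_def)
  moreover have "?c * (b^3 - 27 * ?c^2 * g 3 0) = ?c * b^3 - 3 * ?c * b^2 * b + (3 * ?c)^2 * b * g 2 1 - (3 * ?c)^3 * g 3 0
      - 3 * ?c * b * (3 * ?c * g 2 1 - b^2)"
    by (simp add: algebra_simps power2_eq_square power3_eq_cube)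
  ultimately have "?c * (b^3 - 27 * ?c^2 * g 3 0) = 0" using c1 by simp
  hence c2: "27 * ?c^2 * g 3 0 = b^3" using c by simp
  have "n \<le> 1"
  proof (rule n_le_1)
    fix \<kappa> assume "\<kappa> \<in> K"
    hence "?c * \<kappa>^3 + b * \<kappa>^2 + g 2 1 * \<kappa> + g 3 0 = 0" using C3 unfolding b_def by blast
    moreover have "(3 * ?c * \<kappa> + b)^3 = 27 * ?c^2 * (?c * \<kappa>^3 + b * \<kappa>^2 + g 2 1 * \<kappa> + g 3 0)
        - 9 * ?c * \<kappa> * (3 * ?c * g 2 1 - b^2) - (27 * ?c^2 * g 3 0 - b^3)"
      by (simp add: algebra_simps power2_eq_square power3_eq_cube)
    ultimately have "(3 * ?c * \<kappa> + b)^3 = 0" using c1 c2 by simp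
    hence "3 * ?c * \<kappa> + b = 0" by simp
    thus "\<kappa> = - b / (3 * ?c)" using c by (simp add: field_simps eq_neg_iff_add_eq_0)
  qed
  moreover have "e4 = Z^8 * (h 0 4 * Q2^4 - W1 * Q2^3 * h 1 3 + W1^2 * Q2^2 * h 2 2 - W1^3 * Q2 * h 3 1 + W1^4 * h 4 0)"
    unfolding e4_def Q2 W1 by (simp add: algebra_simps eval_nat_numeral)
  hence "Z^8 dvd e4" by simp
  ultimately show "Z^(n + 6) dvd e4" using ord_dvd[of 8 e4 "n + 6"] by simp
qed

text \<open>The largest ramification of a map of degree four; C4 gives n \<le> 4. From
  \<open>e2 = 0\<close> follow g 1 0 = g 1 1 = 0 and 8 ?c g 2 0 = b^2. For b nonzero C2 then has no
  solution, and for b = 0 a third factor Z of Q gives ample divisibility.\<close>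

lemma case_3:
  assumes j: "j = 3"
  shows "Z^n dvd e2" "e2 = 0 \<Longrightarrow> Z^(n + 4) dvd e3" "e2 = 0 \<Longrightarrow> Z^(n + 8) dvd e4"
proof -
  let ?c = "g 0 4"
  have c: "?c \<noteq> 0" using gj j by (simp add: eval_nat_numeral)
  have z: "g 0 0 = 0" "g 0 1 = 0" "g 0 2 = 0" "g 0 3 = 0" using g0 j by auto
  have "\<exists>r. h 0 1 = Z^3 * r \<and> poly r 0 = 4 * g 0 4"
    by (rule leadX[of 3 0 1 4 4]) (use j z in \<open>simp_all add: All_less_Suc eval_nat_numeral\<close>)
  then obtain W1 where "h 0 1 = Z^3 * W1" "poly W1 0 = 4 * ?c" by blast
  hence W1: "W = Z^3 * W1" "poly W1 0 = 4 * ?c" by (simp_all add: W_def)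
  have "\<exists>r. h 0 2 = Z^2 * r \<and> poly r 0 = 6 * g 0 4"
    by (rule leadX[of 2 0 2 6 4]) (use j z in \<open>simp_all add: All_less_Suc eval_nat_numeral\<close>)
  then obtain A where A: "h 0 2 = Z^2 * A" and A0: "poly A 0 = 6 * ?c" by blast
  have "\<exists>r. h 0 3 = Z * r \<and> poly r 0 = 4 * ?c" by (rule leadZ) (use j z in simp_all)
  then obtain A' where A': "h 0 3 = Z * A'" by blast
  have "n \<le> degree [:g 4 0, g 3 1, g 2 2, g 1 3, ?c:]"
    using c C4 by (intro card_K_le_degree) (auto simp: algebra_simps power2_eq_square power3_eq_cube power4_eq_xxxx)
  hence n4: "n \<le> 4" using c by simp
  show "Z^n dvd e2"
  proof (cases "n = 0")
    case False
    then obtain \<kappa> where \<kappa>: "\<kappa> \<in> K" using n_pos by blast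
    hence "g 1 0 = 0" using C1 z by fastforce
    then obtain Q1 where Q1: "Q = Z * Q1" using Qx j by auto
    have "e2 = Z^4 * (A * Q1^2 - W1 * Q1 * h 1 1 + Z^2 * W1^2 * h 2 0)"
      unfolding e2_def Q1 W1 A by (simp add: algebra_simps eval_nat_numeral)
    hence "Z^4 dvd e2" by simp
    thus ?thesis using ord_dvd n4 by blast
  qed simp
  assume e: "e2 = 0"
  have "e2 = Z^2 * (A * Q^2 - Z * W1 * Q * h 1 1 + Z^4 * W1^2 * h 2 0)"
    unfolding e2_def W1 A by (simp add: algebra_simps eval_nat_numeral)
  hence "A * Q^2 - Z * W1 * Q * h 1 1 + Z^4 * W1^2 * h 2 0 = 0" using e Z_nz by simp
  hence "poly (A * Q^2 - Z * W1 * Q * h 1 1 + Z^4 * W1^2 * h 2 0) 0 = 0" by simp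
  hence "6 * ?c * (g 1 0)^2 = 0" by (simp add: Z_at_0 A0 Q_def h_at_0)
  hence q0: "g 1 0 = 0" using c by simp
  obtain Q1 where Q1: "Q = Z * Q1" "poly Q1 0 = g 1 1" using Qx j q0 by auto
  have "e2 = Z^4 * (A * Q1^2 - W1 * Q1 * h 1 1 + Z^2 * W1^2 * h 2 0)"
    unfolding e2_def Q1 W1 A by (simp add: algebra_simps eval_nat_numeral)
  hence "A * Q1^2 - W1 * Q1 * h 1 1 + Z^2 * W1^2 * h 2 0 = 0" using e Z_nz by simp
  hence "poly (A * Q1^2 - W1 * Q1 * h 1 1 + Z^2 * W1^2 * h 2 0) 0 = 0" by simp
  hence "6 * ?c * (g 1 1)^2 - 4 * ?c * g 1 1 * g 1 1 = 0" by (simp add: Z_at_0 A0 Q1 W1 h_at_0)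
  moreover have "2 * ?c * (g 1 1)^2 = 6 * ?c * (g 1 1)^2 - 4 * ?c * g 1 1 * g 1 1"
    by (simp add: algebra_simps power2_eq_square)
  ultimately have "2 * ?c * (g 1 1)^2 = 0" by (simp only:)
  hence q1: "g 1 1 = 0" using c by simp
  define b where "b = g 1 2"
  have "\<exists>r. h 1 0 = Z^2 * r \<and> poly r 0 = 1 * g 1 2"
    by (rule leadX[of 2 1 0 1 2]) (use j q0 q1 in \<open>simp_all add: All_less_Suc eval_nat_numeral\<close>)
  then obtain Q2 where "h 1 0 = Z^2 * Q2" "poly Q2 0 = 1 * g 1 2" unfolding b_def by blast
  hence Q2: "Q = Z^2 * Q2" "poly Q2 0 = b" unfolding Q_def b_def by auto
  have "\<exists>r. h 1 1 = Z * r \<and> poly r 0 = 2 * b" unfolding b_def by (rule leadZ) (use j q1 in simp_all)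
  then obtain B where B: "h 1 1 = Z * B" and B0: "poly B 0 = 2 * b" by blast
  have "e2 = Z^6 * (A * Q2^2 - W1 * Q2 * B + W1^2 * h 2 0)"
    unfolding e2_def Q2 W1 A B by (simp add: algebra_simps eval_nat_numeral)
  hence "A * Q2^2 - W1 * Q2 * B + W1^2 * h 2 0 = 0" using e Z_nz by simp
  hence "poly (A * Q2^2 - W1 * Q2 * B + W1^2 * h 2 0) 0 = 0" by simp
  hence "6 * ?c * b^2 - 4 * ?c * b * (2 * b) + (4 * ?c)^2 * g 2 0 = 0" by (simp add: A0 Q2 W1 B0 h_at_0)
  moreover have "2 * ?c * (8 * ?c * g 2 0 - b^2) = 6 * ?c * b^2 - 4 * ?c * b * (2 * b) + (4 * ?c)^2 * g 2 0"
    by (simp add: algebra_simps power2_eq_square)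
  ultimately have "2 * ?c * (8 * ?c * g 2 0 - b^2) = 0" by (simp only:)
  hence g20: "8 * ?c * g 2 0 = b^2" using c by simp
  have "(Z^7 dvd e3 \<and> Z^8 dvd e4 \<and> n = 0) \<or> (Z^9 dvd e3 \<and> Z^12 dvd e4)"
  proof (cases "b = 0")
    case False
    hence "g 2 0 \<noteq> 0" using g20 by auto
    hence "n = 0" using C2 z q1 by (intro n_0) fastforce
    moreover have "e3 = Z^7 * (A' * Q2^3 - W1 * Q2^2 * h 1 2 + Z * W1^2 * Q2 * h 2 1 - Z^2 * W1^3 * h 3 0)"
      unfolding e3_def Q2 W1 A' by (simp add: algebra_simps eval_nat_numeral)
    moreover have "e4 = Z^8 * (h 0 4 * Q2^4 - Z * W1 * Q2^3 * h 1 3 + Z^2 * W1^2 * Q2^2 * h 2 2 - Z^3 * W1^3 * Q2 * h 3 1 + Z^4 * W1^4 * h 4 0)"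
      unfolding e4_def Q2 W1 by (simp add: algebra_simps eval_nat_numeral)
    ultimately show ?thesis by simp
  next
    case True
    have "\<exists>r. h 1 0 = Z^3 * r \<and> poly r 0 = 1 * g 1 3"
      by (rule leadX[of 3 1 0 1 3]) (use j q0 q1 True in \<open>simp_all add: All_less_Suc eval_nat_numeral b_def\<close>)
    then obtain Q3 where "h 1 0 = Z^3 * Q3" unfolding b_def by blast
    hence Q3: "Q = Z^3 * Q3" unfolding Q_def by auto
    have "e3 = Z^9 * (Z * A' * Q3^3 - W1 * Q3^2 * h 1 2 + W1^2 * Q3 * h 2 1 - W1^3 * h 3 0)"
      unfolding e3_def Q3 W1 A' by (simp add: algebra_simps eval_nat_numeral)
    moreover have "e4 = Z^12 * (h 0 4 * Q3^4 - W1 * Q3^3 * h 1 3 + W1^2 * Q3^2 * h 2 2 - W1^3 * Q3 * h 3 1 + W1^4 * h 4 0)"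
      unfolding e4_def Q3 W1 by (simp add: algebra_simps eval_nat_numeral)
    ultimately show ?thesis by simp
  qed
  thus "Z^(n + 4) dvd e3" "Z^(n + 8) dvd e4"
    using ord_dvd[of 7 e3 "n + 4"] ord_dvd[of 9 e3 "n + 4"] ord_dvd[of 8 e4 "n + 8"] ord_dvd[of 12 e4 "n + 8"] n4 by auto
qed

text \<open>These are the local weights of the global count, in which the orders \<open>j\<close>
  add up to deg W = 6. The surplus unit in the fourth clause fails only for j = 2 and n \<le> 1,
  which becomes the only possible ramification type when the valency is 29.\<close>

lemma local_bounds:
  assumes j: "j \<le> 3"
  shows "Z^n dvd e2" "e2 = 0 \<Longrightarrow> Z^(j + n) dvd e3" "e2 = 0 \<Longrightarrow> e3 = 0 \<Longrightarrow> Z^n dvd e4"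
    "e2 = 0 \<Longrightarrow> 0 < j \<Longrightarrow> Z^(j + n + 1) dvd e3 \<or> (j = 2 \<and> n \<le> 1)"
    "e2 = 0 \<Longrightarrow> e3 = 0 \<Longrightarrow> 0 < j \<Longrightarrow> Z^(2 * j + n + 2) dvd e4"
proof -
  consider "j = 0" | "j = 1" | "j = 2" | "j = 3" using j by linarith
  note cs = this
  show "Z^n dvd e2"
    using cs
  proof cases
    case 1 thus ?thesis by (rule case_0(2))
  next
    case 2 thus ?thesis by (rule case_1(1))
  next
    case 3 thus ?thesis by (rule case_2(2))
  next
    case 4 thus ?thesis by (rule case_3(1))
  qed
  show r5: "Z^(2 * j + n + 2) dvd e4" if "e2 = 0" "e3 = 0" "0 < j"
    using cs
  proof cases
    case 2
    have e: "2 * j + n + 2 = n + 4" using 2 by simp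
    show ?thesis unfolding e by (rule case_1(3)[OF 2 that(1)])
  next
    case 3
    have e: "2 * j + n + 2 = n + 6" using 3 by simp
    show ?thesis unfolding e by (rule case_2(4)[OF 3 that(1,2)])
  next
    case 4
    have e: "2 * j + n + 2 = n + 8" using 4 by simp
    show ?thesis unfolding e by (rule case_3(3)[OF 4 that(1)])
  qed (use that in simp)
  show "Z^n dvd e4" if "e2 = 0" "e3 = 0"
  proof (cases "j = 0")
    case True thus ?thesis by (rule case_0(4))
  next
    case False
    thus ?thesis using r5[OF that] by (intro ord_dvd[of "2 * j + n + 2" e4 n]) auto
  qed
  show r4: "Z^(j + n + 1) dvd e3 \<or> (j = 2 \<and> n \<le> 1)" if "e2 = 0" "0 < j"
    using cs
  proof cases
    case 2
    have e: "j + n + 1 = n + 2" using 2 by simp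
    show ?thesis unfolding e using case_1(2)[OF 2 that(1)] by blast
  next
    case 3
    have e: "j + n + 1 = n + 3" using 3 by simp
    show ?thesis unfolding e using case_2(3)[OF 3 that(1)] 3 by blast
  next
    case 4
    have e: "j + n + 1 = n + 4" using 4 by simp
    show ?thesis unfolding e using case_3(2)[OF 4 that(1)] by blast
  qed (use that in simp)
  show "Z^(j + n) dvd e3" if "e2 = 0"
  proof (cases "j = 0")
    case True thus ?thesis using case_0(3) by simp
  next
    case False
    hence "0 < j" by simp
    show ?thesis
    proof (cases "j = 2")
      case True
      have e: "j + n + 1 = n + 3" "j + n = n + 2" using True by auto
      have "Z^(n + 3) dvd e3 \<or> Z^(n + 2) dvd e3" using case_2(3)[OF True that] by blast
      thus ?thesis unfolding e using ord_dvd[of "n + 3" e3 "n + 2"] by auto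
    next
      case False
      hence "Z^(j + n + 1) dvd e3" using r4[OF that \<open>0 < j\<close>] by blast
      thus ?thesis by (rule ord_dvd) simp
    qed
  qed
qed

end

section \<open>Specialisation of parameters and Taylor shifts\<close>

definition spec :: "'k::comm_ring_1 poly poly poly \<Rightarrow> 'k \<Rightarrow> 'k \<Rightarrow> 'k poly" where
  "spec P z \<sigma> = map_poly (\<lambda>q. poly (poly q [:\<sigma>:]) z) P"

lemma coeff_spec: "coeff (spec P z \<sigma>) m = poly (poly (coeff P m) [:\<sigma>:]) z"
  by (simp add: spec_def coeff_map_poly)

lemma poly_spec: "poly (spec P z \<sigma>) s = ev3 P z \<sigma> s"
proof (induction P)
  case (pCons q P)
  have "spec (pCons q P) z \<sigma> = pCons (poly (poly q [:\<sigma>:]) z) (spec P z \<sigma>)"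
    by (rule poly_eqI) (simp add: coeff_spec coeff_pCons split: nat.split)
  thus ?case using pCons by (simp add: ev3_def)
qed (simp add: spec_def ev3_def)

definition spec2 :: "'k::comm_ring_1 poly poly \<Rightarrow> 'k \<Rightarrow> 'k poly" where
  "spec2 q z = map_poly (\<lambda>r. poly r z) q"

lemma coeff_spec2: "coeff (spec2 q z) i = poly (coeff q i) z"
  by (simp add: spec2_def coeff_map_poly)

lemma poly_spec2: "poly (spec2 q z) \<sigma> = poly (poly q [:\<sigma>:]) z"
proof (induction q)
  case (pCons r q)
  have "spec2 (pCons r q) z = pCons (poly r z) (spec2 q z)"
    by (rule poly_eqI) (simp add: coeff_spec2 coeff_pCons split: nat.split)
  thus ?case using pCons by simp
qed (simp add: spec2_def)

lemma poly_bounded_sum: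
  fixes p :: "'a::comm_semiring_1 poly"
  assumes "degree p \<le> M" shows "poly p x = (\<Sum>i\<le>M. coeff p i * x ^ i)"
  unfolding poly_altdef using assms by (intro sum.mono_neutral_left) (auto simp: coeff_eq_0)

lemma ev3_sum:
  fixes P :: "'k::comm_ring_1 poly poly poly"
  assumes "degree P \<le> M" "\<And>m. degree (coeff P m) \<le> M"
  shows "ev3 P z \<sigma> s = (\<Sum>m\<le>M. \<Sum>i\<le>M. poly (coeff (coeff P m) i) z * \<sigma>^i * s^m)"
proof -
  have "degree (spec P z \<sigma>) \<le> M"
    unfolding spec_def using map_poly_degree_leq assms(1) order_trans by blast
  hence e: "ev3 P z \<sigma> s = (\<Sum>m\<le>M. poly (poly (coeff P m) [:\<sigma>:]) z * s^m)"
    by (simp add: poly_spec[symmetric] poly_bounded_sum coeff_spec)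
  have "poly (poly (coeff P m) [:\<sigma>:]) z = (\<Sum>i\<le>M. poly (coeff (coeff P m) i) z * \<sigma>^i)" for m
  proof -
    have "degree (spec2 (coeff P m) z) \<le> M"
      unfolding spec2_def using map_poly_degree_leq assms(2) order_trans by blast
    thus ?thesis by (simp add: poly_spec2[symmetric] poly_bounded_sum coeff_spec2)
  qed
  thus ?thesis by (simp add: e sum_distrib_right)
qed

text \<open>The two expansions are built in one induction because the congruence concerns the
  polynomials themselves and is not visible in their values.\<close>

lemma form_exp3_cong:
  assumes "form d f" "\<And>i. Z dvd V2 i - V2' i"
  shows "\<exists>P P'. (\<forall>z \<sigma> s. f (pv V0 z + \<sigma> *s pv V1 z + s *s pv V2 z) = ev3 P z \<sigma> s) \<and>
     (\<forall>z \<sigma> s. f (pv V0 z + \<sigma> *s pv V1 z + s *s pv V2' z) = ev3 P' z \<sigma> s) \<and> [:[:Z:]:] dvd P - P'"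
  using assms(1)
proof (induction rule: form.induct)
  case (form_zero d) show ?case by (rule exI[of _ 0], rule exI[of _ 0]) simp
next
  case (form_const c)
  show ?case by (rule exI[of _ "[:[:[:c:]:]:]"], rule exI[of _ "[:[:[:c:]:]:]"]) (simp add: ev3_def)
next
  case (form_add d f g)
  obtain P P' where P: "\<forall>z \<sigma> s. f (pv V0 z + \<sigma> *s pv V1 z + s *s pv V2 z) = ev3 P z \<sigma> s"
     "\<forall>z \<sigma> s. f (pv V0 z + \<sigma> *s pv V1 z + s *s pv V2' z) = ev3 P' z \<sigma> s" "[:[:Z:]:] dvd P - P'"
    using form_add.IH(1) by blast
  obtain R R' where R: "\<forall>z \<sigma> s. g (pv V0 z + \<sigma> *s pv V1 z + s *s pv V2 z) = ev3 R z \<sigma> s"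
     "\<forall>z \<sigma> s. g (pv V0 z + \<sigma> *s pv V1 z + s *s pv V2' z) = ev3 R' z \<sigma> s" "[:[:Z:]:] dvd R - R'"
    using form_add.IH(2) by blast
  have "P + R - (P' + R') = (P - P') + (R - R')" by simp
  hence "[:[:Z:]:] dvd P + R - (P' + R')" using P(3) R(3) dvd_add by metis
  thus ?case using P R by (intro exI[of _ "P + R"] exI[of _ "P' + R'"]) simp
next
  case (form_coord d f i)
  obtain P P' where P: "\<forall>z \<sigma> s. f (pv V0 z + \<sigma> *s pv V1 z + s *s pv V2 z) = ev3 P z \<sigma> s"
     "\<forall>z \<sigma> s. f (pv V0 z + \<sigma> *s pv V1 z + s *s pv V2' z) = ev3 P' z \<sigma> s" "[:[:Z:]:] dvd P - P'"
    using form_coord.IH by blast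
  let ?L = "[:[:V0 i, V1 i:], [:V2 i:]:]" and ?L' = "[:[:V0 i, V1 i:], [:V2' i:]:]"
  have e: "(pv V0 z + \<sigma> *s pv V1 z + s *s pv V2 z) $ i = ev3 ?L z \<sigma> s"
     "(pv V0 z + \<sigma> *s pv V1 z + s *s pv V2' z) $ i = ev3 ?L' z \<sigma> s" for z \<sigma> s
    by (simp_all add: ev3_def pv_def)
  obtain q where q: "V2 i - V2' i = Z * q" using assms(2) by blast
  have "?L - ?L' = [:[:Z:]:] * [:0, [:q:]:]" by (simp add: q)
  hence "[:[:Z:]:] dvd ?L - ?L'" by (metis dvd_triv_left)
  moreover have "?L * P - ?L' * P' = (?L - ?L') * P + ?L' * (P - P')" by (simp only: algebra_simps) 
  ultimately have "[:[:Z:]:] dvd ?L * P - ?L' * P'" using P(3) by (metis dvd_add dvd_mult dvd_mult2)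
  with P e show ?case
    by (intro exI[of _ "?L * P"] exI[of _ "?L' * P'"]) (simp only: ev3_simps simp_thms)
qed

text \<open>p(z + \<sigma>) as a polynomial in \<sigma> over k[z]; its coefficients are the Hasse
  derivatives of p.\<close>

definition tay :: "'k::comm_ring_1 poly \<Rightarrow> 'k poly poly" where
  "tay p = (\<Sum>n\<le>degree p. smult [:coeff p n:] ([:[:0, 1:], 1:] ^ n))"

lemma poly_tay: "poly (poly (tay p) [:\<sigma>:]) z = poly p (z + \<sigma>)"
  unfolding tay_def poly_sum poly_altdef[of p] by (simp add: poly_power add.commute)

lemma coeff_tay: "coeff (coeff (tay p) i) k = of_nat ((i + k) choose i) * coeff p (i + k)"
proof -
  have pw: "coeff ([:0, 1:] ^ n :: 'a poly) k = (if k = n then 1 else 0)" for n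
    by (simp add: monom_altdef[symmetric, where c = 1, simplified])
  have "coeff (coeff (tay p) i) k = (\<Sum>n\<le>degree p. coeff p n * (of_nat (n choose i) * (if k = n - i then 1 else 0)))"
    unfolding tay_def coeff_sum
  proof (intro sum.cong refl)
    fix n assume "n \<in> {..degree p}"
    have "coeff ([:[:0, 1:], 1:] ^ n) i = of_nat (n choose i) * ([:0, 1:] :: 'a poly) ^ (n - i)"
      using coeff_linear_poly_power[of i n "[:0,1:]" "1::'a poly"]
      by (cases "i \<le> n") (auto simp: coeff_linear_poly_power binomial_eq_0 coeff_eq_0 degree_linear_power)
    hence "coeff (smult [:coeff p n:] ([:[:0, 1:], 1:] ^ n)) i = smult (coeff p n * of_nat (n choose i)) ([:0, 1:] ^ (n - i))"
      by (simp add: of_nat_poly mult.commute)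
    thus "coeff (coeff (smult [:coeff p n:] ([:[:0, 1:], 1:] ^ n)) i) k =
         coeff p n * (of_nat (n choose i) * (if k = n - i then 1 else 0))"
      by (simp add: pw)
  qed
  also have "\<dots> = (\<Sum>n\<le>degree p. if n = i + k then of_nat ((i + k) choose i) * coeff p (i + k) else 0)"
  proof (intro sum.cong refl)
    fix n assume "n \<in> {..degree p}"
    show "coeff p n * (of_nat (n choose i) * (if k = n - i then 1 else 0)) =
       (if n = i + k then of_nat ((i + k) choose i) * coeff p (i + k) else 0)"
      by (cases "i \<le> n") (auto simp: binomial_eq_0 mult.commute)
  qed
  also have "\<dots> = of_nat ((i + k) choose i) * coeff p (i + k)"
    by (auto simp: coeff_eq_0)
  finally show ?thesis .
qed

lemma lp_two_param:
  fixes f :: "'k::field_char_0 ^ 4 \<Rightarrow> 'k"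
  assumes "form d f" "\<And>\<sigma> s. f (x + \<sigma> *s y + s *s w) = ev3 P z \<sigma> s"
  shows "coeff (lp f x (A *s y + B *s w)) k = (\<Sum>m\<le>k. B^m * A^(k-m) * poly (coeff (coeff P m) (k-m)) z)"
proof -
  obtain M where M: "degree P \<le> M" "\<And>m. degree (coeff P m) \<le> M" "k \<le> M"
  proof -
    let ?M = "k + degree P + (\<Sum>m\<le>degree P. degree (coeff P m))"
    have "degree (coeff P m) \<le> ?M" for m
    proof (cases "m \<le> degree P")
      case True
      hence "degree (coeff P m) \<le> (\<Sum>m\<le>degree P. degree (coeff P m))" by (intro member_le_sum) auto
      thus ?thesis by simp
    qed (simp add: coeff_eq_0)
    thus ?thesis using that[of ?M] by simp
  qed
  let ?T = "\<Sum>m\<le>M. \<Sum>i\<le>M. monom (poly (coeff (coeff P m) i) z * A^i * B^m) (m + i)"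
  have "lp f x (A *s y + B *s w) = ?T"
  proof (rule lp_unique)
    fix t
    have "f (x + t *s (A *s y + B *s w)) = f (x + (t * A) *s y + (t * B) *s w)"
      by (simp add: vec.scale_right_distrib add.assoc)
    also have "\<dots> = ev3 P z (t * A) (t * B)" by (rule assms(2))
    also have "\<dots> = poly ?T t"
      by (simp add: ev3_sum[OF M(1,2)] poly_sum poly_monom power_mult_distrib power_add algebra_simps)
    finally show "poly ?T t = f (x + t *s (A *s y + B *s w))" by simp
  qed
  hence "coeff (lp f x (A *s y + B *s w)) k =
      (\<Sum>m\<le>M. \<Sum>i\<le>M. if m + i = k then poly (coeff (coeff P m) i) z * A^i * B^m else 0)"
    by (simp add: coeff_sum coeff_monom)
  also have "\<dots> = (\<Sum>m\<le>M. if m \<le> k then B^m * A^(k-m) * poly (coeff (coeff P m) (k-m)) z else 0)"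
  proof (intro sum.cong refl)
    fix m assume "m \<in> {..M}"
    have "(\<Sum>i\<le>M. if m + i = k then poly (coeff (coeff P m) i) z * A^i * B^m else 0) =
       (\<Sum>i\<le>M. if i = k - m then (if m \<le> k then B^m * A^(k-m) * poly (coeff (coeff P m) (k-m)) z else 0) else 0)"
      by (intro sum.cong refl) auto
    moreover have "k - m \<le> M" using M(3) by simp
    ultimately show "(\<Sum>i\<le>M. if m + i = k then poly (coeff (coeff P m) i) z * A^i * B^m else 0) =
       (if m \<le> k then B^m * A^(k-m) * poly (coeff (coeff P m) (k-m)) z else 0)"
      by simp
  qed
  also have "\<dots> = (\<Sum>m\<le>k. B^m * A^(k-m) * poly (coeff (coeff P m) (k-m)) z)"
    using M(3) by (intro sum.mono_neutral_cong_right) auto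
  finally show ?thesis .
qed

section \<open>The contact polynomials of a line\<close>

text \<open>\<open>u, v\<close> span the line, with \<open>u\<close> the point at infinity of the
  coordinate z in \<open>pt z\<close>, and \<open>n1, n2\<close> complete a basis. The quartics
  \<open>a, b\<close> below describe the tangent plane at \<open>pt z\<close>, so a : b is the Gauss
  map of the line.\<close>

locale quintic_line =
  fixes F :: "'k::{alg_closed_field,field_char_0} ^ 4 \<Rightarrow> 'k" and u v n1 n2 :: "'k ^ 4"
  assumes formF: "form 5 F"
    and on_line: "\<And>\<alpha> \<beta>. F (\<alpha> *s u + \<beta> *s v) = 0"
    and spans: "\<And>x. \<exists>\<alpha> \<beta> \<gamma> \<delta>. x = \<alpha> *s u + \<beta> *s v + \<gamma> *s n1 + \<delta> *s n2"
    and indep: "\<And>\<alpha> \<beta> \<gamma> \<delta>. \<alpha> *s u + \<beta> *s v + \<gamma> *s n1 + \<delta> *s n2 = 0 \<Longrightarrow> \<alpha> = 0 \<and> \<beta> = 0 \<and> \<gamma> = 0 \<and> \<delta> = 0"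
    and smooth: "\<And>x. x \<noteq> 0 \<Longrightarrow> \<exists>w. D F x w \<noteq> 0"
begin

lemma coords_cancel:
  assumes "\<alpha> *s u + \<beta> *s v + \<gamma> *s n1 + \<delta> *s n2 = \<alpha>' *s u + \<beta>' *s v + \<gamma>' *s n1 + \<delta>' *s n2"
  shows "\<alpha> = \<alpha>' \<and> \<beta> = \<beta>' \<and> \<gamma> = \<gamma>' \<and> \<delta> = \<delta>'"
proof -
  have "(\<alpha> - \<alpha>') *s u + (\<beta> - \<beta>') *s v + (\<gamma> - \<gamma>') *s n1 + (\<delta> - \<delta>') *s n2
    = (\<alpha> *s u + \<beta> *s v + \<gamma> *s n1 + \<delta> *s n2) - (\<alpha>' *s u + \<beta>' *s v + \<gamma>' *s n1 + \<delta>' *s n2)"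
    by (simp add: vec_eq_iff algebra_simps)
  also have "\<dots> = 0" using assms by simp
  finally have "\<alpha> - \<alpha>' = 0 \<and> \<beta> - \<beta>' = 0 \<and> \<gamma> - \<gamma>' = 0 \<and> \<delta> - \<delta>' = 0" by (rule indep)
  thus ?thesis by simp
qed

definition pt :: "'k \<Rightarrow> 'k ^ 4" where "pt z = v + z *s u"
definition a :: "'k poly" where "a = lp (\<lambda>x. D F x n1) v u"
definition b :: "'k poly" where "b = lp (\<lambda>x. D F x n2) v u"
text \<open>Tangent to the surface at \<open>pt z\<close> and transversal to the line. Every other
  line through \<open>pt z\<close> in the tangent plane has a direction \<kappa> u + N z, up to
  scaling and multiples of \<open>pt z\<close>.\<close>

definition N :: "'k \<Rightarrow> 'k ^ 4" where "N z = (- poly b z) *s n1 + poly a z *s n2"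

lemma form4: "form 4 (\<lambda>x. D F x w)" using form_D[OF formF, of w] by simp

lemma poly_a: "poly a z = D F (pt z) n1" and poly_b: "poly b z = D F (pt z) n2"
  by (simp_all add: a_def b_def poly_lp[OF form4] pt_def)

lemma deg_a: "degree a \<le> 4" and deg_b: "degree b \<le> 4"
  by (simp_all add: a_def b_def degree_lp[OF form4])

lemma coeff_a4: "coeff a 4 = D F u n1" and coeff_b4: "coeff b 4 = D F u n2"
  by (simp_all add: a_def b_def coeff_lp_top[OF form4])

lemma pt_nz: "pt z \<noteq> 0"
  using indep[of z 1 0 0] by (auto simp: pt_def algebra_simps)

lemma D_on_line: "D F (\<alpha> *s u + \<beta> *s v) (\<gamma> *s u + \<delta> *s v) = 0"
proof (rule D_along_zero[OF formF])
  fix t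
  have "\<alpha> *s u + \<beta> *s v + t *s (\<gamma> *s u + \<delta> *s v) = (\<alpha> + t * \<gamma>) *s u + (\<beta> + t * \<delta>) *s v"
    by (simp add: vec.scale_right_distrib vec.scale_left_distrib)
  thus "F (\<alpha> *s u + \<beta> *s v + t *s (\<gamma> *s u + \<delta> *s v)) = 0" using on_line by simp
qed

lemma D_pt_line: "D F (pt z) (\<gamma> *s u + \<delta> *s v) = 0"
  using D_on_line[of z 1 \<gamma> \<delta>] by (simp add: pt_def add.commute[of "z *s u"])

lemma D_u: "D F (pt z) u = 0"
  using D_pt_line[of z 1 0] by simp

lemma D_pt: "D F (pt z) (\<alpha> *s u + \<beta> *s v + \<gamma> *s n1 + \<delta> *s n2) = \<gamma> * poly a z + \<delta> * poly b z"
  using D_pt_line[of z \<alpha> \<beta>]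
  by (simp add: D_plus[OF formF] D_scale[OF formF] poly_a poly_b)

lemma ab_nz: "poly a z \<noteq> 0 \<or> poly b z \<noteq> 0"
proof -
  obtain w where w: "D F (pt z) w \<noteq> 0" using smooth pt_nz by blast
  obtain \<alpha> \<beta> \<gamma> \<delta> where "w = \<alpha> *s u + \<beta> *s v + \<gamma> *s n1 + \<delta> *s n2" using spans by blast
  thus ?thesis using w D_pt by auto
qed

lemma N_tangent: "D F (pt z) (N z) = 0"
  using D_pt[of z 0 0 "- poly b z" "poly a z"] by (simp add: N_def)

definition V0 :: "4 \<Rightarrow> 'k poly" where "V0 i = [:v $ i, u $ i:]"
definition V1 :: "4 \<Rightarrow> 'k poly" where "V1 i = [:u $ i:]"
definition VN :: "4 \<Rightarrow> 'k poly" where "VN i = a * [:n2 $ i:] - b * [:n1 $ i:]"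

lemma pv_V: "pv V0 z = pt z" "pv V1 z = u" "pv VN z = N z"
  by (simp_all add: pv_def V0_def V1_def VN_def pt_def N_def vec_eq_iff)

definition P :: "'k poly poly poly" where
  "P = (SOME P. \<forall>z \<sigma> s. F (pt z + \<sigma> *s u + s *s N z) = ev3 P z \<sigma> s)"

lemma P: "F (pt z + \<sigma> *s u + s *s N z) = ev3 P z \<sigma> s"
proof -
  have "\<exists>P. \<forall>z \<sigma> s. F (pt z + \<sigma> *s u + s *s N z) = ev3 P z \<sigma> s"
    using form_exp3[OF formF, of V0 V1 VN] by (simp add: pv_V)
  hence "\<forall>z \<sigma> s. F (pt z + \<sigma> *s u + s *s N z) = ev3 P z \<sigma> s"
    unfolding P_def by (rule someI_ex)
  thus ?thesis by blast
qed

definition H :: "nat \<Rightarrow> nat \<Rightarrow> 'k poly" where "H m i = coeff (coeff P m) i"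
definition h :: "nat \<Rightarrow> nat \<Rightarrow> 'k poly" where "h m i = H (Suc m) i"

lemma coeff_lp_dir:
  "coeff (lp F (pt z) (A *s u + B *s N z)) k = (\<Sum>m\<le>k. B^m * A^(k-m) * poly (H m (k-m)) z)"
  unfolding H_def by (rule lp_two_param[OF formF P])

lemma H0: "H 0 i = 0"
proof -
  have "poly (poly (coeff P 0) [:\<sigma>:]) z = 0" for \<sigma> z
  proof -
    have "poly (poly (coeff P 0) [:\<sigma>:]) z = poly (spec P z \<sigma>) 0"
      by (simp add: poly_0_coeff_0 coeff_spec)
    also have "\<dots> = F (pt z + \<sigma> *s u + 0 *s N z)" by (simp only: P poly_spec)
    also have "pt z + \<sigma> *s u + 0 *s N z = (z + \<sigma>) *s u + 1 *s v"
      by (simp add: pt_def vec.scale_left_distrib algebra_simps)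
    finally show ?thesis by (simp only: on_line)
  qed
  hence "poly (spec2 (coeff P 0) z) \<sigma> = poly 0 \<sigma>" for z \<sigma> by (simp add: poly_spec2)
  hence "spec2 (coeff P 0) z = 0" for z by (intro poly_eq_by_values) 
  hence "poly (coeff (coeff P 0) i) z = 0" for z by (metis coeff_0 coeff_spec2)
  thus ?thesis unfolding H_def by (intro poly_eq_by_values) simp
qed

lemma H1_value: "poly (poly (coeff P 1) [:\<sigma>:]) z = poly a z * poly b (z + \<sigma>) - poly b z * poly a (z + \<sigma>)"
proof -
  have "lp F (pt z + \<sigma> *s u) (N z) = spec P z \<sigma>"
    by (rule lp_unique) (simp add: poly_spec P)
  hence "poly (poly (coeff P 1) [:\<sigma>:]) z = D F (pt z + \<sigma> *s u) (N z)"
    by (simp add: D_def coeff_spec)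
  also have "pt z + \<sigma> *s u = pt (z + \<sigma>)" by (simp add: pt_def vec.scale_left_distrib algebra_simps)
  finally show ?thesis
    using D_pt[of "z + \<sigma>" 0 0 "- poly b z" "poly a z"] by (simp add: N_def)
qed

lemma H1: "poly (H 1 i) z = poly a z * poly (coeff (tay b) i) z - poly b z * poly (coeff (tay a) i) z"
proof -
  let ?q = "[:[:poly a z:]:] * tay b - [:[:poly b z:]:] * tay a"
  have "spec2 (coeff P 1) z = spec2 ?q z"
    by (intro poly_eq_by_values) (simp only: poly_spec2 H1_value, simp add: poly_tay)
  hence "coeff (spec2 (coeff P 1) z) i = coeff (spec2 ?q z) i" by simp
  thus ?thesis by (simp add: coeff_spec2 H_def)
qed

text \<open>The Wronskian of the Gauss map; its zeros are the ramification points.\<close>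

definition W :: "'k poly" where "W = a * pderiv b - b * pderiv a"

lemma coeff_tay_1: "coeff (tay p) 1 = pderiv p"
  by (rule poly_eqI) (simp add: coeff_tay coeff_pderiv)

lemma coeff_tay_0: "coeff (tay p) 0 = p"
  by (rule poly_eqI) (simp add: coeff_tay)

lemma H10: "H 1 0 = 0"
  by (rule poly_eq_by_values) (simp only: H1 coeff_tay_0, simp)

lemma H11: "H 1 1 = W"
  by (rule poly_eq_by_values) (simp only: H1 coeff_tay_1 W_def, simp)

definition Q :: "'k poly" where "Q = H 2 0"
definition e2 where "e2 = h 0 2 * Q^2 - W * Q * h 1 1 + W^2 * h 2 0"
definition e3 where "e3 = h 0 3 * Q^3 - W * Q^2 * h 1 2 + W^2 * Q * h 2 1 - W^3 * h 3 0"
definition e4 where "e4 = h 0 4 * Q^4 - W * Q^3 * h 1 3 + W^2 * Q^2 * h 2 2 - W^3 * Q * h 3 1 + W^4 * h 4 0"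

text \<open>The direction \<kappa> u + N z of slope \<kappa> = - Q / W, multiplied by - W to remain
  polynomial at ramification points. Contact along it has order at least three by
  construction.\<close>

definition dir :: "'k \<Rightarrow> 'k ^ 4" where "dir z = poly Q z *s u + (- poly W z) *s N z"

lemma lp_dir: "lp F (pt z) (dir z) = [:0, 0, 0, - poly (W * e2) z, - poly (W * e3) z, - poly (W * e4) z:]"
proof -
  have c: "coeff (lp F (pt z) (dir z)) k = (\<Sum>m\<le>k. (- poly W z)^m * (poly Q z)^(k-m) * poly (H m (k-m)) z)" for k
    unfolding dir_def by (rule coeff_lp_dir)
  note hs = H0 H10[simplified] H11[simplified] Q_def eval_nat_numeral
  show ?thesis
  proof (rule poly_eqI)
    fix k :: nat
    consider "k = 0" | "k = 1" | "k = 2" | "k = 3" | "k = 4" | "k = 5" | "k > 5" by linarith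
    thus "coeff (lp F (pt z) (dir z)) k = coeff [:0, 0, 0, - poly (W * e2) z, - poly (W * e3) z, - poly (W * e4) z:] k"
    proof cases
      case 7
      thus ?thesis using degree_lp[OF formF, of "pt z" "dir z"]
        by (simp add: coeff_eq_0 coeff_pCons split: nat.split)
    qed (unfold e2_def e3_def e4_def h_def, simp_all add: c hs algebra_simps)
  qed
qed

end

section \<open>Behaviour of the contact data near one point of the line\<close>

lemma X_power_monom: "[:0, 1:] ^ k = monom (1::'a::comm_semiring_1) k"
  by (simp add: monom_altdef)

lemma X_power_dvd_iff: "[:0, 1:] ^ k dvd p \<longleftrightarrow> (\<forall>l<k. coeff p l = (0::'a::idom))"
  unfolding X_power_monom by (rule monom_1_dvd_iff')

lemma coeff_X_power_mult: "coeff ([:0, 1:] ^ k * p) k = coeff p (0::nat)" for p :: "'a::comm_semiring_1 poly"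
  unfolding X_power_monom by (simp add: coeff_monom_mult)

lemma poly_poly_eqI:
  fixes p q :: "'k::field_char_0 poly poly"
  assumes "\<And>z \<sigma>. poly (poly p [:\<sigma>:]) z = poly (poly q [:\<sigma>:]) z" shows "p = q"
proof (rule poly_eqI)
  fix i
  have "spec2 p z = spec2 q z" for z
    by (intro poly_eq_by_values) (simp add: poly_spec2 assms)
  hence "poly (coeff p i) z = poly (coeff q i) z" for z by (metis coeff_spec2)
  thus "coeff p i = coeff q i" by (rule poly_eq_by_values)
qed

context quintic_line
begin

text \<open>Since b(0) W = c b' - b c', and likewise with a, the order of W at 0 is one less than
  that of c, provided the chosen one of a(0), b(0) is nonzero. As c has degree at most 4 and order j
  + 1, this gives j \<le> 3.\<close>

lemma wronskian_order:
  assumes W: "W \<noteq> 0" and j: "j = order 0 W"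
  defines "c \<equiv> smult (poly b 0) a - smult (poly a 0) b"
  obtains c1 where "c = [:0,1:]^(Suc j) * c1" "poly c1 0 \<noteq> 0" "j \<le> 3"
proof -
  let ?a0 = "poly a 0" and ?b0 = "poly b 0"
  have idb: "smult ?b0 W = c * pderiv b - b * pderiv c" and ida: "smult ?a0 W = c * pderiv a - a * pderiv c"
    unfolding W_def c_def by (simp_all add: pderiv_diff pderiv_smult algebra_simps smult_diff_right)
  have cnz: "c \<noteq> 0"
  proof
    assume "c = 0"
    hence "smult ?a0 W = 0" "smult ?b0 W = 0" using ida idb by simp_all
    thus False using W ab_nz[of 0] by auto
  qed
  define k where "k = order 0 c"
  obtain c1 where c1: "c = [:0,1:]^k * c1" "\<not> [:0,1:] dvd c1"
    using order_decomp[OF cnz, of 0] unfolding k_def by auto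
  have c10: "poly c1 0 \<noteq> 0" using c1(2) poly_eq_0_iff_dvd[of c1 0] by simp
  have "poly c 0 = 0" unfolding c_def by simp
  hence kpos: "k > 0" using cnz unfolding k_def by (simp add: order_root)
  then obtain l where l: "k = Suc l" by (cases k) auto
  have main: "order 0 W = l" if p0: "poly p 0 \<noteq> 0" and e: "smult (poly p 0) W = c * pderiv p - p * pderiv c" for p
  proof -
    let ?r = "[:0,1:] * c1 * pderiv p - p * (smult (of_nat k) c1 + [:0,1:] * pderiv c1)"
    have dc: "pderiv c = [:0,1:]^l * (smult (of_nat k) c1 + [:0,1:] * pderiv c1)"
    proof -
      have "pderiv ([:0,1:]^Suc l :: 'k poly) = smult (of_nat (Suc l)) ([:0,1:]^l)"
        by (simp only: pderiv_power_Suc) (simp add: pderiv_pCons)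
      thus ?thesis
        unfolding c1(1) l pderiv_mult
        by (simp add: algebra_simps del: mult_pCons_left mult_pCons_right)
    qed
    have "smult (poly p 0) W = [:0,1:]^l * ?r"
      unfolding e dc by (subst c1(1)) (simp add: l algebra_simps del: mult_pCons_left mult_pCons_right)
    hence 1: "order 0 (smult (poly p 0) W) = order 0 ([:0,1:]^l * ?r)" by (rule arg_cong)
    have r0: "poly ?r 0 \<noteq> 0" using p0 c10 kpos by simp
    hence 2: "order 0 ?r = 0" by (rule order_0I)
    have "?r \<noteq> 0" using r0 by (metis poly_0)
    hence 3: "[:0,1:]^l * ?r \<noteq> 0" by (simp only: mult_eq_0_iff power_eq_0_iff) simp
    have "order 0 ([:0,1:]^l :: 'k poly) = l" using order_power_n_n[of 0 l] by simp
    hence "order 0 (smult (poly p 0) W) = l" by (simp only: 1 order_mult[OF 3] 2)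
    thus ?thesis using p0 by (simp add: order_smult)
  qed
  have "order 0 W = l" using main[of a] main[of b] ida idb ab_nz[of 0] by blast
  hence kj: "k = Suc j" using l j by simp
  have "degree c \<le> 4" unfolding c_def
    using deg_a deg_b by (intro degree_diff_le) (meson degree_smult_le order_trans)+
  moreover have "k \<le> degree c" unfolding k_def using cnz by (rule order_degree)
  ultimately have "j \<le> 3" using kj by simp
  thus ?thesis using that c1(1) c10 kj by blast
qed

text \<open>\<open>VN\<close> differs from a multiple of the constant vector \<open>N 0\<close> by a
  multiple of the polynomial c of the preceding lemma, and c vanishes to order j + 1: to this order
  the tangent plane does not move. U is b / b(0) or a / a(0).\<close>

lemma direction_congruence:
  assumes W: "W \<noteq> 0" and j: "j = order 0 W"
  obtains U where "poly U 0 = 1" "\<And>i. [:0,1:]^(Suc j) dvd VN i - U * [:N 0 $ i:]"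
proof -
  let ?a0 = "poly a 0" and ?b0 = "poly b 0"
  define c where "c = smult ?b0 a - smult ?a0 b"
  obtain c1 where c1: "c = [:0,1:]^(Suc j) * c1"
    using wronskian_order[OF W j] unfolding c_def by blast
  hence cd: "[:0,1:]^(Suc j) dvd c" by (metis dvd_triv_left)
  have N0: "N 0 $ i = ?a0 * n2 $ i - ?b0 * n1 $ i" for i by (simp add: N_def)
  show ?thesis
  proof (cases "?b0 = 0")
    case False
    have "VN i - smult (1 / ?b0) b * [:N 0 $ i:] = c * [:n2 $ i / ?b0:]" for i
      unfolding N0 VN_def c_def using False
      by (simp add: algebra_simps smult_diff_right smult_diff_left diff_divide_distrib smult_add_right)
    hence "[:0,1:]^(Suc j) dvd VN i - smult (1 / ?b0) b * [:N 0 $ i:]" for i using cd by (metis dvd_mult2)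
    thus ?thesis using that[of "smult (1 / ?b0) b"] False by simp
  next
    case True
    hence a0: "?a0 \<noteq> 0" using ab_nz[of 0] by simp
    have "VN i - smult (1 / ?a0) a * [:N 0 $ i:] = c * [:n1 $ i / ?a0:]" for i
      unfolding N0 VN_def c_def using a0
      by (simp add: algebra_simps smult_diff_right smult_diff_left diff_divide_distrib smult_add_right)
    hence "[:0,1:]^(Suc j) dvd VN i - smult (1 / ?a0) a * [:N 0 $ i:]" for i using cd by (metis dvd_mult2)
    thus ?thesis using that[of "smult (1 / ?a0) a"] a0 by simp
  qed
qed

text \<open>With the direction frozen as U N(0), moving the base point from 0 to z replaces \<sigma>
  by z + \<sigma> and rescales s by U. So \<open>H m i\<close> is U^m times a coefficient of the
  Taylor shift of its values at 0, modulo Z^(j+1).\<close>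

lemma lead:
  assumes W: "W \<noteq> 0" and j: "j = order 0 W" and k: "k \<le> j"
    and z: "\<And>l. i \<le> l \<Longrightarrow> l < i + k \<Longrightarrow> poly (h m l) 0 = 0"
  shows "\<exists>r. h m i = [:0,1:]^k * r \<and> poly r 0 = of_nat ((i + k) choose i) * poly (h m (i + k)) 0"
proof -
  let ?Z = "[:0,1:]^(Suc j) :: 'k poly"
  obtain U where U: "poly U 0 = 1" "\<And>i. ?Z dvd VN i - U * [:N 0 $ i:]"
    using direction_congruence[OF W j] by blast
  have pvU: "pv (\<lambda>i. U * [:N 0 $ i:]) z = poly U z *s N 0" for z
    by (simp add: pv_def vec_eq_iff)
  obtain P1 P' where P1: "\<And>z \<sigma> s. F (pt z + \<sigma> *s u + s *s N z) = ev3 P1 z \<sigma> s"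
    and P': "\<And>z \<sigma> s. F (pt z + \<sigma> *s u + s *s (poly U z *s N 0)) = ev3 P' z \<sigma> s"
    and dv: "[:[:?Z:]:] dvd P1 - P'"
    using form_exp3_cong[OF formF, of ?Z VN "\<lambda>i. U * [:N 0 $ i:]" V0 V1, OF U(2), unfolded pv_V pvU] by blast
  have "P1 = P" by (rule ev3_eqI) (simp add: P1[symmetric] P)
  hence dv: "[:[:?Z:]:] dvd P - P'" using dv by simp
  define \<gamma> where "\<gamma> = (\<lambda>m. spec2 (coeff P m) 0)"
  have c\<gamma>: "coeff (\<gamma> m) i = poly (H m i) 0" for m i by (simp add: \<gamma>_def coeff_spec2 H_def)
  have "coeff P' m = [:U^m:] * tay (\<gamma> m)" for m
  proof (rule poly_poly_eqI)
    fix z \<sigma>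
    have "spec P' z \<sigma> = pcompose (spec P 0 (z + \<sigma>)) [:0, poly U z:]"
    proof (rule poly_eq_by_values)
      fix s
      have "poly (spec P' z \<sigma>) s = F (pt z + \<sigma> *s u + s *s (poly U z *s N 0))" by (simp only: poly_spec P')
      also have "pt z + \<sigma> *s u + s *s (poly U z *s N 0) = pt 0 + (z + \<sigma>) *s u + (s * poly U z) *s N 0"
        by (simp add: pt_def vec.scale_left_distrib algebra_simps)
      also have "F \<dots> = poly (spec P 0 (z + \<sigma>)) (s * poly U z)" by (simp only: P poly_spec)
      finally show "poly (spec P' z \<sigma>) s = poly (pcompose (spec P 0 (z + \<sigma>)) [:0, poly U z:]) s"
        by (simp add: poly_pcompose mult.commute)
    qed
    hence "coeff (spec P' z \<sigma>) m = poly U z ^ m * coeff (spec P 0 (z + \<sigma>)) m"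
      by (simp add: coeff_pcompose_linear)
    thus "poly (poly (coeff P' m) [:\<sigma>:]) z = poly (poly ([:U^m:] * tay (\<gamma> m)) [:\<sigma>:]) z"
      by (simp add: coeff_spec poly_tay \<gamma>_def poly_spec2)
  qed
  hence H': "coeff (coeff P' m) i = U^m * coeff (tay (\<gamma> m)) i" for m i by simp
  obtain R where R: "P - P' = [:[:?Z:]:] * R" using dv by blast
  hence "coeff (coeff (P - P') m) i = ?Z * coeff (coeff R m) i" for m i by simp
  hence HH: "H m i = U^m * coeff (tay (\<gamma> m)) i + ?Z * coeff (coeff R m) i" for m i
    by (simp add: H_def H'[symmetric] diff_eq_eq add.commute)
  define t where "t = coeff (tay (\<gamma> (Suc m))) i"
  have ct: "coeff t l = of_nat ((i + l) choose i) * poly (h m (i + l)) 0" for l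
    by (simp add: t_def coeff_tay c\<gamma> h_def)
  have "[:0,1:]^k dvd t" unfolding X_power_dvd_iff using z by (simp add: ct)
  then obtain t1 where t1: "t = [:0,1:]^k * t1" by blast
  have t10: "poly t1 0 = of_nat ((i + k) choose i) * poly (h m (i + k)) 0"
    using ct[of k] unfolding t1 coeff_X_power_mult by (simp add: poly_0_coeff_0)
  have "?Z = [:0,1:]^k * [:0,1:]^(Suc j - k)" using k by (simp add: power_add[symmetric] del: power_Suc)
  hence "h m i = [:0,1:]^k * (U^(Suc m) * t1 + [:0,1:]^(Suc j - k) * coeff (coeff R (Suc m)) i)"
    unfolding h_def HH t_def[symmetric] t1 by (simp only: algebra_simps)
  moreover have "poly (U^(Suc m) * t1 + [:0,1:]^(Suc j - k) * coeff (coeff R (Suc m)) i) 0 =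
      of_nat ((i + k) choose i) * poly (h m (i + k)) 0"
    using k by (simp add: U t10 Suc_diff_le)
  ultimately show ?thesis by blast
qed

end

text \<open>Degree count in z: every factor \<tau> trades a vector of degree 1 for one of degree 1 +
  r.\<close>

lemma form_weight:
  assumes "form d f" "\<And>i. degree (A i) \<le> 1" "\<And>i. degree (B i) \<le> 1 + r"
  shows "\<exists>E. (\<forall>z \<tau>. f (pv A z + \<tau> *s pv B z) = poly (poly E [:\<tau>:]) z) \<and> (\<forall>k. degree (coeff E k) \<le> d + r * k)"
  using assms(1)
proof (induction rule: form.induct)
  case (form_zero d) show ?case by (rule exI[of _ 0]) simp
next
  case (form_const c) show ?case by (rule exI[of _ "[:[:c:]:]"]) (simp add: coeff_pCons split: nat.split)
next
  case (form_add d f g)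
  then obtain E1 E2 where "\<forall>z \<tau>. f (pv A z + \<tau> *s pv B z) = poly (poly E1 [:\<tau>:]) z" "\<forall>k. degree (coeff E1 k) \<le> d + r * k"
    "\<forall>z \<tau>. g (pv A z + \<tau> *s pv B z) = poly (poly E2 [:\<tau>:]) z" "\<forall>k. degree (coeff E2 k) \<le> d + r * k" by blast
  thus ?case by (intro exI[of _ "E1 + E2"]) (simp add: degree_add_le)
next
  case (form_coord d f i)
  then obtain E where E: "\<And>z \<tau>. f (pv A z + \<tau> *s pv B z) = poly (poly E [:\<tau>:]) z" "\<And>k. degree (coeff E k) \<le> d + r * k" by blast
  let ?E = "[:A i, B i:] * E"
  have d1: "degree (A i * coeff E k) \<le> Suc d + r * k" for k
    using degree_mult_le[of "A i" "coeff E k"] assms(2)[of i] E(2)[of k] by linarith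
  have "degree (coeff ?E k) \<le> Suc d + r * k" for k
  proof (cases k)
    case (Suc l)
    have "degree (B i * coeff E l) \<le> Suc d + r * k"
      using degree_mult_le[of "B i" "coeff E l"] assms(3)[of i] E(2)[of l] Suc by simp
    thus ?thesis using d1[of k] Suc by (simp add: degree_add_le)
  qed (use d1[of 0] in simp)
  moreover have "(pv A z + \<tau> *s pv B z) $ i * f (pv A z + \<tau> *s pv B z) = poly (poly ?E [:\<tau>:]) z" for z \<tau>
  proof -
    have "(pv A z + \<tau> *s pv B z) $ i = poly (A i) z + \<tau> * poly (B i) z" by (simp add: pv_def)
    thus ?thesis by (simp add: E algebra_simps)
  qed
  ultimately show ?case by blast
qed

text \<open>x + t (w - c x) = (1 - c t) x + t w, so homogeneity amounts to the substitution of t /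
  (1 - c t) for t. The line stays the same, and so does the lowest nonzero coefficient.\<close>

lemma lp_shift_direction:
  fixes F :: "'k::field_char_0 ^ 4 \<Rightarrow> 'k"
  assumes F: "form 5 F" and l: "lp F x w = [:0, 0, 0, f3, f4, f5:]"
  shows "lp F x (w - c *s x) = [:1, -c:]^2 * [:0, 0, 0, f3:] + [:1, -c:] * [:0, 0, 0, 0, f4:] + [:0, 0, 0, 0, 0, f5:]"
proof (rule lp_unique)
  fix t
  have e: "x + t *s (w - c *s x) = (1 - c * t) *s x + t *s w"
    by (simp add: vec_eq_iff algebra_simps)
  show "poly ([:1, -c:]^2 * [:0, 0, 0, f3:] + [:1, -c:] * [:0, 0, 0, 0, f4:] + [:0, 0, 0, 0, 0, f5:]) t = F (x + t *s (w - c *s x))"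
  proof (cases "1 - c * t = 0")
    \<comment> \<open>Where 1 - c t = 0 the substitution is undefined, but there the point is a
      multiple of w and only the top coefficient matters.\<close>
    case True
    have "F (x + t *s (w - c *s x)) = t^5 * F w" unfolding e True by (simp add: form_scale[OF F])
    moreover have "F w = f5" using coeff_lp_top[OF F, of x w] unfolding l by (simp add: eval_nat_numeral)
    moreover have z: "poly [:1, -c:] t = 0" using True by (simp add: mult.commute)
    ultimately show ?thesis unfolding poly_add poly_mult poly_power z by (simp add: eval_nat_numeral algebra_simps)
  next
    case False
    let ?s = "1 - c * t"
    have "?s *s x + t *s w = ?s *s (x + (t / ?s) *s w)" using False by (simp add: vec.scale_right_distrib)
    hence "F (x + t *s (w - c *s x)) = ?s^5 * poly (lp F x w) (t / ?s)"
      unfolding e by (simp add: form_scale[OF F] poly_lp[OF F])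
    also have "\<dots> = ?s^2 * (t^3 * f3) + ?s * (t^4 * f4) + t^5 * f5"
    proof -
      have "S^5 * poly [:0, 0, 0, f3, f4, f5:] (t / S) = S^2 * (t^3 * f3) + S * (t^4 * f4) + t^5 * f5" if "S \<noteq> 0" for S
        using that by (simp add: field_simps eval_nat_numeral)
      thus ?thesis unfolding l using False by blast
    qed
    finally show ?thesis by (simp add: eval_nat_numeral algebra_simps)
  qed
qed

lemma sum_multiplicities_le_degree:
  fixes p :: "'k::field poly"
  assumes "p \<noteq> 0" "finite S" "\<And>z. z \<in> S \<Longrightarrow> [:-z, 1:] ^ f z dvd p"
  shows "(\<Sum>z\<in>S. f z) \<le> degree p"
proof -
  have "(\<Sum>z\<in>S. f z) \<le> (\<Sum>z\<in>S. count (proots p) z)"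
    using assms by (intro sum_mono) (simp add: order_divides)
  also have "\<dots> \<le> (\<Sum>z\<in>S \<union> set_mset (proots p). count (proots p) z)"
    using assms(2) by (intro sum_mono2) auto
  also have "\<dots> = size (proots p)"
    unfolding size_multiset_overloaded_eq
    by (intro sum.mono_neutral_right) (auto simp: assms(2) count_eq_zero_iff)
  also have "\<dots> \<le> degree p" by (rule size_proots_le)
  finally show ?thesis .
qed

lemma sum_order_eq_degree:
  fixes p :: "'k::alg_closed_field poly"
  assumes "p \<noteq> 0"
  shows "(\<Sum>z\<in>{z. poly p z = 0}. order z p) = degree p"
proof -
  obtain A where A: "size A = degree p" "p = smult (lead_coeff p) (\<Prod>x\<in>#A. [:-x, 1:])"
    using alg_closed_imp_factorization[OF assms] by blast
  have pr: "proots (\<Prod>x\<in>#B. [:-x, 1:]) = B" for B :: "'k multiset"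
  proof (induction B)
    case (add x B)
    have "[:-x, 1:] \<noteq> 0" "(\<Prod>x\<in>#B. [:-x, 1:]) \<noteq> 0"
      by (simp_all only: prod_mset_zero_iff) auto
    hence "proots ([:-x, 1:] * (\<Prod>x\<in>#B. [:-x, 1:])) = proots [:-x, 1:] + proots (\<Prod>x\<in>#B. [:-x, 1:])"
      by (rule proots_mult)
    also have "\<dots> = add_mset x B" by (simp add: add)
    finally show ?case by (simp only: image_mset_add_mset prod_mset.add_mset)
  qed simp
  have "proots p = A" using A(2) pr[of A] assms by (metis leading_coeff_neq_0 proots_smult)
  hence "degree p = size (proots p)" using A(1) by simp
  also have "\<dots> = (\<Sum>z\<in>{z. poly p z = 0}. order z p)"
    unfolding size_multiset_overloaded_eq using assms by (simp add: set_count_proots)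
  finally show ?thesis by simp
qed

context quintic_line
begin

text \<open>The terms of degree seven cancel, both products having the coefficient 4 a_4 b_4
  there.\<close>

lemma deg_W: "degree W \<le> 6"
proof -
  define a1 where "a1 = a - monom (coeff a 4) 4"
  define b1 where "b1 = b - monom (coeff b 4) 4"
  have d: "degree (p - monom (coeff p 4) 4) \<le> 3" if p: "degree p \<le> 4" for p :: "'k poly"
  proof (rule degree_le, intro allI impI)
    fix k :: nat assume k: "k > 3"
    show "coeff (p - monom (coeff p 4) 4) k = 0"
    proof (cases "k = 4")
      case False
      hence "coeff p k = 0" using k p by (intro coeff_eq_0) simp
      thus ?thesis using False by (simp add: coeff_monom)
    qed (simp add: coeff_monom)
  qed
  have d1: "degree a1 \<le> 3" "degree b1 \<le> 3"
    unfolding a1_def b1_def using d deg_a deg_b by auto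
  have d2: "degree (pderiv a1) \<le> 2" "degree (pderiv b1) \<le> 2"
    using d1 by (simp_all add: degree_pderiv)
  have ab: "a = monom (coeff a 4) 4 + a1" "b = monom (coeff b 4) 4 + b1" by (simp_all add: a1_def b1_def)
  let ?m = "\<lambda>c. monom c 4 :: 'k poly" and ?m' = "\<lambda>c. monom (4 * c) 3 :: 'k poly"
  have e: "W = (?m (coeff a 4) * pderiv b1 + a1 * ?m' (coeff b 4) + a1 * pderiv b1)
     - (?m (coeff b 4) * pderiv a1 + b1 * ?m' (coeff a 4) + b1 * pderiv a1)"
    unfolding W_def by (subst (1 2) ab(1), subst (1 2) ab(2))
      (simp add: pderiv_add pderiv_monom mult_monom algebra_simps)
  have dm: "degree (p * q) \<le> 6" if "degree p + degree q \<le> 6" for p q :: "'k poly"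
    using degree_mult_le[of p q] that by linarith
  have m: "degree (?m c) \<le> 4" "degree (?m' c) \<le> 3" for c by (simp_all add: degree_monom_le)
  note m[of "coeff a 4"] m[of "coeff b 4"]
  thus ?thesis unfolding e
    using d1 d2 by (intro degree_diff_le degree_add_le dm) linarith+
qed

end

context quintic_line
begin

lemma h_W: "h 0 1 = W" and h_Q: "h 1 0 = Q"
  using H11 by (simp_all add: h_def Q_def eval_nat_numeral)

lemma deg_Q: "degree Q \<le> 11"
proof -
  have "degree (V0 i) \<le> 1" "degree (VN i) \<le> 1 + 3" for i
    unfolding V0_def VN_def using deg_a deg_b
    by (simp, intro degree_diff_le) (auto intro: order_trans[OF degree_mult_le] simp: mult.commute[of _ "[:_:]"] order_trans[OF degree_smult_le])
  then obtain E where E: "\<And>z \<tau>. F (pt z + \<tau> *s N z) = poly (poly E [:\<tau>:]) z" "\<And>k. degree (coeff E k) \<le> 5 + 3 * k"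
    using form_weight[OF formF, of V0 VN 3] by (auto simp: pv_V)
  have "poly (coeff E k) z = poly (H k 0) z" for k z
  proof -
    have "lp F (pt z) (N z) = spec2 E z" by (rule lp_unique) (simp add: poly_spec2 E)
    hence "poly (coeff E k) z = coeff (lp F (pt z) (0 *s u + 1 *s N z)) k" by (simp add: coeff_spec2)
    also have "\<dots> = (\<Sum>m\<le>k. if m = k then poly (H k 0) z else 0)"
      unfolding coeff_lp_dir by (intro sum.cong refl) (auto simp: power_0_left)
    finally show ?thesis by simp
  qed
  hence "coeff E 2 = Q" unfolding Q_def by (intro poly_eq_by_values)
  thus ?thesis using E(2)[of 2] by simp
qed

text \<open>In \<open>dir z\<close> the part along \<open>u\<close> has degree 11, the part along
  \<open>N z\<close> degree 10. Subtracting c(z) \<open>pt z\<close>, with c the top coefficient of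
  Q times z^10, lowers everything to degree 10 = 1 + 9 without changing the line.\<close>

lemma weights:
  "\<exists>c E. (\<forall>z. lp F (pt z) (dir z - poly c z *s pt z) = spec2 E z) \<and> (\<forall>k. degree (coeff E k) \<le> 5 + 9 * k)"
proof -
  define c where "c = monom (coeff Q 11) 10"
  define B where "B i = (Q - [:0,1:] * c) * [:u $ i:] - c * [:v $ i:] - W * VN i" for i
  have dW: "degree (VN i) \<le> 4" for i
    unfolding VN_def using deg_a deg_b
    by (intro degree_diff_le) (auto intro: order_trans[OF degree_mult_le] simp: mult.commute[of _ "[:_:]"] order_trans[OF degree_smult_le])
  have dc: "degree c \<le> 10" unfolding c_def by (rule degree_monom_le)
  have dQ: "degree (Q - [:0,1:] * c) \<le> 10"
  proof (rule degree_le, intro allI impI)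
    fix k :: nat assume k: "k > 10"
    then obtain l where l: "k = Suc l" by (cases k) auto
    show "coeff (Q - [:0,1:] * c) k = 0"
    proof (cases "k = 11")
      case False
      hence "coeff Q k = 0" using k deg_Q by (intro coeff_eq_0) simp
      thus ?thesis using False l by (simp add: c_def coeff_monom)
    qed (simp add: c_def l coeff_monom eval_nat_numeral)
  qed
  have "degree (W * VN i) \<le> 10" for i
    using degree_mult_le[of W "VN i"] deg_W dW[of i] by linarith
  moreover have "degree (p * [:x:]) \<le> 10" if "degree p \<le> 10" for p and x :: 'k
    using degree_mult_le[of p "[:x:]"] that by simp
  ultimately have "degree (B i) \<le> 1 + 9" for i
    unfolding B_def using dQ dc by (intro degree_diff_le) auto
  moreover have "degree (V0 i) \<le> 1" for i by (simp add: V0_def)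
  ultimately obtain E where E: "\<And>z \<tau>. F (pt z + \<tau> *s pv B z) = poly (poly E [:\<tau>:]) z" "\<And>k. degree (coeff E k) \<le> 5 + 9 * k"
    using form_weight[OF formF, of V0 B 9] by (auto simp: pv_V)
  have "pv B z = dir z - poly c z *s pt z" for z
  proof -
    have "N z $ i = poly (VN i) z" for i using pv_V(3)[of z] by (simp add: pv_def vec_eq_iff)
    thus ?thesis
      by (simp add: pv_def B_def dir_def pt_def vec_eq_iff algebra_simps)
  qed
  hence "lp F (pt z) (dir z - poly c z *s pt z) = spec2 E z" for z
    by (intro lp_unique) (simp add: poly_spec2 E(1)[symmetric])
  thus ?thesis using E(2) by blast
qed

text \<open>The bounds are 5 + 9 k for k = 3, 4, 5. Once the lower coefficients vanish, the shift of
  direction does not affect the next one. Cancelling W of degree six later leaves 26, 35,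
  44.\<close>

lemma deg_We:
  shows "degree (W * e2) \<le> 32" "e2 = 0 \<Longrightarrow> degree (W * e3) \<le> 41" "e2 = 0 \<Longrightarrow> e3 = 0 \<Longrightarrow> degree (W * e4) \<le> 50"
proof -
  obtain c E where E: "\<And>z. lp F (pt z) (dir z - poly c z *s pt z) = spec2 E z" "\<And>k. degree (coeff E k) \<le> 5 + 9 * k"
    using weights by blast
  have v: "poly (coeff E k) z = coeff ([:1, - poly c z:]^2 * [:0, 0, 0, - poly (W * e2) z:] +
     [:1, - poly c z:] * [:0, 0, 0, 0, - poly (W * e3) z:] + [:0, 0, 0, 0, 0, - poly (W * e4) z:]) k" for k z
    unfolding coeff_spec2[symmetric] E(1)[symmetric] by (subst lp_shift_direction[OF formF lp_dir]) (rule refl)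
  have "coeff E 3 = - (W * e2)"
    by (rule poly_eq_by_values) (subst v, simp add: eval_nat_numeral)
  thus "degree (W * e2) \<le> 32" using E(2)[of 3] by simp
  assume z2: "e2 = 0"
  have "coeff E 4 = - (W * e3)"
    by (rule poly_eq_by_values) (subst v, simp add: eval_nat_numeral z2)
  thus "degree (W * e3) \<le> 41" using E(2)[of 4] by simp
  assume z3: "e3 = 0"
  have "coeff E 5 = - (W * e4)"
    by (rule poly_eq_by_values) (subst v, simp add: eval_nat_numeral z2 z3)
  thus "degree (W * e4) \<le> 50" using E(2)[of 5] by simp
qed

definition line_at :: "'k \<Rightarrow> 'k \<Rightarrow> bool" where
  "line_at z \<kappa> \<longleftrightarrow> (\<forall>\<tau>. F (pt z + \<tau> *s (\<kappa> *s u + N z)) = 0)"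

lemma local_bounds_0:
  assumes W: "W \<noteq> 0" and j: "j = order 0 W" and K: "finite K" "\<And>\<kappa>. \<kappa> \<in> K \<Longrightarrow> line_at 0 \<kappa>"
  defines "n \<equiv> card K"
  shows "j \<le> 3" "[:0,1:]^n dvd e2" "e2 = 0 \<Longrightarrow> [:0,1:]^(j + n) dvd e3" "e2 = 0 \<Longrightarrow> e3 = 0 \<Longrightarrow> [:0,1:]^n dvd e4"
    "e2 = 0 \<Longrightarrow> 0 < j \<Longrightarrow> [:0,1:]^(j + n + 1) dvd e3 \<or> (j = 2 \<and> n \<le> 1)"
    "e2 = 0 \<Longrightarrow> e3 = 0 \<Longrightarrow> 0 < j \<Longrightarrow> [:0,1:]^(2 * j + n + 2) dvd e4"
    "j = 0 \<Longrightarrow> n \<le> 1"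
proof -
  obtain c1 where c1: "smult (poly b 0) a - smult (poly a 0) b = [:0,1:]^(Suc j) * c1" "poly c1 0 \<noteq> 0" and j3: "j \<le> 3"
    using wronskian_order[OF W j] by blast
  have g0: "poly (h 0 l) 0 = - coeff ([:0,1:]^(Suc j) * c1) l" for l
  proof -
    have "poly (h 0 l) 0 = poly a 0 * coeff b l - poly b 0 * coeff a l"
    proof -
      have "poly (H 1 l) 0 = poly a 0 * poly (coeff (tay b) l) 0 - poly b 0 * poly (coeff (tay a) l) 0" by (rule H1)
      thus ?thesis by (simp add: h_def poly_0_coeff_0 coeff_tay)
    qed
    thus ?thesis unfolding c1(1)[symmetric] by simp
  qed
  have C: "(\<Sum>m\<le>k. \<kappa>^(k-m) * poly (H m (k-m)) 0) = 0" if "\<kappa> \<in> K" for \<kappa> k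
  proof -
    have "lp F (pt 0) (\<kappa> *s u + 1 *s N 0) = 0"
      using K(2)[OF that] by (intro lp_unique) (simp add: line_at_def)
    thus ?thesis using coeff_lp_dir[of 0 \<kappa> 1 k] by simp
  qed
  interpret L: local_data h "\<lambda>m i. poly (h m i) 0" j "[:0,1:]" "h 0 1" "h 1 0"
    "h 0 2 * (h 1 0)^2 - h 0 1 * h 1 0 * h 1 1 + (h 0 1)^2 * h 2 0"
    "h 0 3 * (h 1 0)^3 - h 0 1 * (h 1 0)^2 * h 1 2 + (h 0 1)^2 * (h 1 0) * h 2 1 - (h 0 1)^3 * h 3 0"
    "h 0 4 * (h 1 0)^4 - h 0 1 * (h 1 0)^3 * h 1 3 + (h 0 1)^2 * (h 1 0)^2 * h 2 2 - (h 0 1)^3 * (h 1 0) * h 3 1 + (h 0 1)^4 * h 4 0"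
    K "card K"
  proof unfold_locales
    fix m i k assume "k \<le> j" "\<And>l. i \<le> l \<Longrightarrow> l < i + k \<Longrightarrow> poly (h m l) 0 = 0"
    thus "\<exists>r. h m i = [:0, 1:] ^ k * r \<and> poly r 0 = of_nat (i + k choose i) * poly (h m (i + k)) 0"
      by (rule lead[OF W j])
  next
    fix l assume "l \<le> j" thus "poly (h 0 l) 0 = 0"
      unfolding g0 using X_power_dvd_iff[of "Suc j" "[:0,1:]^(Suc j) * c1"] by (metis dvd_triv_left le_imp_less_Suc neg_0_equal_iff_equal)
  next
    show "poly (h 0 (Suc j)) 0 \<noteq> 0"
      unfolding g0 using coeff_X_power_mult[of "Suc j" c1] c1(2) by (simp add: poly_0_coeff_0 del: power_Suc)
  next
    show "finite K" by (rule K)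
  next
    fix \<kappa> assume \<kappa>: "\<kappa> \<in> K"
    note hs = H0 H10[simplified] h_def eval_nat_numeral algebra_simps
    show "poly (h 0 1) 0 * \<kappa> + poly (h 1 0) 0 = 0" using C[OF \<kappa>, of 2] by (simp add: hs)
    show "poly (h 0 2) 0 * \<kappa>^2 + poly (h 1 1) 0 * \<kappa> + poly (h 2 0) 0 = 0" using C[OF \<kappa>, of 3] by (simp add: hs)
    show "poly (h 0 3) 0 * \<kappa>^3 + poly (h 1 2) 0 * \<kappa>^2 + poly (h 2 1) 0 * \<kappa> + poly (h 3 0) 0 = 0" using C[OF \<kappa>, of 4] by (simp add: hs)
    show "poly (h 0 4) 0 * \<kappa>^4 + poly (h 1 3) 0 * \<kappa>^3 + poly (h 2 2) 0 * \<kappa>^2 + poly (h 3 1) 0 * \<kappa> + poly (h 4 0) 0 = 0"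
      using C[OF \<kappa>, of 5] by (simp add: hs)
  qed
  note e = h_W h_Q e2_def[symmetric] e3_def[symmetric] e4_def[symmetric] n_def[symmetric]
  note lb = L.local_bounds[OF j3, unfolded e]
  show "j \<le> 3" by (rule j3)
  show "[:0,1:]^n dvd e2" "e2 = 0 \<Longrightarrow> [:0,1:]^(j + n) dvd e3" "e2 = 0 \<Longrightarrow> e3 = 0 \<Longrightarrow> [:0,1:]^n dvd e4"
    "e2 = 0 \<Longrightarrow> 0 < j \<Longrightarrow> [:0,1:]^(j + n + 1) dvd e3 \<or> (j = 2 \<and> n \<le> 1)"
    "e2 = 0 \<Longrightarrow> e3 = 0 \<Longrightarrow> 0 < j \<Longrightarrow> [:0,1:]^(2 * j + n + 2) dvd e4"
    by (fact lb)+
  show "j = 0 \<Longrightarrow> n \<le> 1" using L.case_0(1) unfolding n_def by blast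
qed

end

lemma pcompose_power: "pcompose (p ^ n) q = pcompose p q ^ n" for p :: "'k::field poly"
  by (induction n) (simp_all add: pcompose_mult pcompose_1)

lemma shift_power_dvd_iff:
  fixes p :: "'k::field poly"
  shows "[:0,1:]^k dvd pcompose p [:c,1:] \<longleftrightarrow> [:-c,1:]^k dvd p"
proof
  assume "[:0,1:]^k dvd pcompose p [:c,1:]"
  then obtain q where q: "pcompose p [:c,1:] = [:0,1:]^k * q" by blast
  have "p = pcompose (pcompose p [:c,1:]) [:-c,1:]" by (simp add: pcompose_assoc[symmetric] pcompose_pCons)
  also have "\<dots> = [:-c,1:]^k * pcompose q [:-c,1:]" unfolding q by (simp add: pcompose_mult pcompose_power pcompose_pCons)
  finally show "[:-c,1:]^k dvd p" by (metis dvd_triv_left)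
next
  assume "[:-c,1:]^k dvd p"
  then obtain q where q: "p = [:-c,1:]^k * q" by blast
  have "pcompose p [:c,1:] = [:0,1:]^k * pcompose q [:c,1:]" unfolding q by (simp add: pcompose_mult pcompose_power pcompose_pCons)
  thus "[:0,1:]^k dvd pcompose p [:c,1:]" by (metis dvd_triv_left)
qed

context quintic_line
begin

lemma shifted: "quintic_line F u (v + z0 *s u) n1 n2"
proof
  show "form 5 F" by (rule formF)
  fix \<alpha> \<beta> \<gamma> \<delta>
  have e: "\<alpha> *s u + \<beta> *s (v + z0 *s u) = (\<alpha> + \<beta> * z0) *s u + \<beta> *s v" for \<alpha> \<beta>
    by (simp add: vec_eq_iff algebra_simps)
  show "F (\<alpha> *s u + \<beta> *s (v + z0 *s u)) = 0" unfolding e by (rule on_line)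
  show "\<alpha> = 0 \<and> \<beta> = 0 \<and> \<gamma> = 0 \<and> \<delta> = 0" if "\<alpha> *s u + \<beta> *s (v + z0 *s u) + \<gamma> *s n1 + \<delta> *s n2 = 0"
    using indep that unfolding e by fastforce
  fix x
  obtain \<alpha> \<beta> \<gamma> \<delta> where x: "x = \<alpha> *s u + \<beta> *s v + \<gamma> *s n1 + \<delta> *s n2" using spans by blast
  have "x = (\<alpha> - \<beta> * z0) *s u + \<beta> *s (v + z0 *s u) + \<gamma> *s n1 + \<delta> *s n2" unfolding x e by simp
  thus "\<exists>\<alpha> \<beta> \<gamma> \<delta>. x = \<alpha> *s u + \<beta> *s (v + z0 *s u) + \<gamma> *s n1 + \<delta> *s n2" by blast
  show "\<exists>w. D F x w \<noteq> 0" if "x \<noteq> 0" using smooth that by blast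
qed

lemma W_roots_finite: "W \<noteq> 0 \<Longrightarrow> finite {z. poly W z = 0}" by (rule poly_roots_finite)

text \<open>Replacing \<open>v\<close> by v + z0 u moves the point z0 to 0 and translates all
  polynomials.\<close>

lemma local_bounds_at:
  assumes W: "W \<noteq> 0" and j: "j = order z0 W" and K: "finite K" "\<And>\<kappa>. \<kappa> \<in> K \<Longrightarrow> line_at z0 \<kappa>"
  defines "n \<equiv> card K"
  shows "j \<le> 3" "[:-z0,1:]^n dvd e2" "e2 = 0 \<Longrightarrow> [:-z0,1:]^(j + n) dvd e3" "e2 = 0 \<Longrightarrow> e3 = 0 \<Longrightarrow> [:-z0,1:]^n dvd e4"
    "e2 = 0 \<Longrightarrow> 0 < j \<Longrightarrow> [:-z0,1:]^(j + n + 1) dvd e3 \<or> (j = 2 \<and> n \<le> 1)"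
    "e2 = 0 \<Longrightarrow> e3 = 0 \<Longrightarrow> 0 < j \<Longrightarrow> [:-z0,1:]^(2 * j + n + 2) dvd e4"
    "j = 0 \<Longrightarrow> n \<le> 1"
proof -
  interpret S: quintic_line F u "v + z0 *s u" n1 n2 by (rule shifted)
  have pt: "S.pt z = pt (z0 + z)" for z
    by (simp add: S.pt_def pt_def vec.scale_left_distrib add.assoc)
  have ab: "poly S.a z = poly a (z0 + z)" "poly S.b z = poly b (z0 + z)" for z
    by (simp_all add: S.poly_a S.poly_b poly_a poly_b pt)
  have N: "S.N z = N (z0 + z)" for z by (simp add: S.N_def N_def ab)
  have H: "poly (S.H m i) z = poly (H m i) (z0 + z)" for m i z
  proof -
    have "spec S.P z \<sigma> = spec P (z0 + z) \<sigma>" for \<sigma>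
      by (intro poly_eq_by_values) (simp add: poly_spec S.P[symmetric] P[symmetric] pt N)
    hence "poly (spec2 (coeff S.P m) z) \<sigma> = poly (spec2 (coeff P m) (z0 + z)) \<sigma>" for \<sigma>
      by (metis coeff_spec poly_spec2)
    hence "spec2 (coeff S.P m) z = spec2 (coeff P m) (z0 + z)" by (intro poly_eq_by_values)
    thus ?thesis unfolding S.H_def H_def by (metis coeff_spec2)
  qed
  have h: "poly (S.h m i) z = poly (h m i) (z0 + z)" for m i z by (simp add: S.h_def h_def H)
  have tr: "S.W = pcompose W [:z0,1:]" "S.e2 = pcompose e2 [:z0,1:]" "S.e3 = pcompose e3 [:z0,1:]" "S.e4 = pcompose e4 [:z0,1:]"
    by (rule poly_eq_by_values,
      simp add: poly_pcompose S.h_W[symmetric] h_W[symmetric] S.h_Q[symmetric] h_Q[symmetric] h S.e2_def e2_def S.e3_def e3_def S.e4_def e4_def)+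
  have la: "S.line_at 0 \<kappa> \<longleftrightarrow> line_at z0 \<kappa>" for \<kappa>
    by (simp add: S.line_at_def line_at_def pt N)
  have pc: "pcompose p [:z0,1:] = 0 \<longleftrightarrow> p = 0" for p :: "'k poly"
  proof
    assume z: "pcompose p [:z0,1:] = 0"
    have "poly p x = poly 0 x" for x
    proof -
      have "poly (pcompose p [:z0,1:]) (x - z0) = 0" unfolding z by simp
      thus ?thesis by (simp add: poly_pcompose)
    qed
    thus "p = 0" by (intro poly_eq_by_values)
  qed simp
  have SW: "S.W \<noteq> 0" using W unfolding tr pc .
  have zero: "S.e2 = 0 \<longleftrightarrow> e2 = 0" "S.e3 = 0 \<longleftrightarrow> e3 = 0"
    unfolding tr pc by simp_all
  have ord: "order 0 S.W = order z0 W"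
  proof -
    have "k \<le> order 0 S.W \<longleftrightarrow> k \<le> order z0 W" for k
      using shift_power_dvd_iff[of k W z0] order_divides[of 0 k S.W] order_divides[of z0 k W] SW W unfolding tr by simp
    thus ?thesis by (meson eq_iff)
  qed
  have KL: "S.line_at 0 \<kappa>" if "\<kappa> \<in> K" for \<kappa> using K(2)[OF that] unfolding la .
  have jS: "j = order 0 S.W" unfolding j ord ..
  note B = S.local_bounds_0[OF SW jS K(1) KL]
  have B': "j \<le> 3" "[:0,1:]^n dvd S.e2" "S.e2 = 0 \<Longrightarrow> [:0,1:]^(j + n) dvd S.e3" "S.e2 = 0 \<Longrightarrow> S.e3 = 0 \<Longrightarrow> [:0,1:]^n dvd S.e4"
    "S.e2 = 0 \<Longrightarrow> 0 < j \<Longrightarrow> [:0,1:]^(j + n + 1) dvd S.e3 \<or> (j = 2 \<and> n \<le> 1)"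
    "S.e2 = 0 \<Longrightarrow> S.e3 = 0 \<Longrightarrow> 0 < j \<Longrightarrow> [:0,1:]^(2 * j + n + 2) dvd S.e4"
    "j = 0 \<Longrightarrow> n \<le> 1"
    unfolding n_def by -(rule B; assumption)+
  note B' = B'[unfolded zero, unfolded tr shift_power_dvd_iff]
  show "j \<le> 3" "[:-z0,1:]^n dvd e2" "e2 = 0 \<Longrightarrow> [:-z0,1:]^(j + n) dvd e3" "e2 = 0 \<Longrightarrow> e3 = 0 \<Longrightarrow> [:-z0,1:]^n dvd e4"
    "e2 = 0 \<Longrightarrow> 0 < j \<Longrightarrow> [:-z0,1:]^(j + n + 1) dvd e3 \<or> (j = 2 \<and> n \<le> 1)"
    "e2 = 0 \<Longrightarrow> e3 = 0 \<Longrightarrow> 0 < j \<Longrightarrow> [:-z0,1:]^(2 * j + n + 2) dvd e4"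
    "j = 0 \<Longrightarrow> n \<le> 1"
    by -(fact B')+
qed

end

section \<open>Valency bounds by counting zeros\<close>

context quintic_line
begin

definition fibre :: "('k \<times> 'k) set \<Rightarrow> 'k \<Rightarrow> 'k set" where
  "fibre \<Lambda> z = {\<kappa>. (z, \<kappa>) \<in> \<Lambda>}"

lemma card_fibres:
  assumes "finite \<Lambda>" "finite Z" "fst ` \<Lambda> \<subseteq> Z"
  shows "card \<Lambda> = (\<Sum>z\<in>Z. card (fibre \<Lambda> z))"
proof -
  have "\<Lambda> = (SIGMA z:Z. fibre \<Lambda> z)" using assms(3) by (auto simp: fibre_def)
  moreover have "finite (fibre \<Lambda> z)" for z
    using finite_imageI[OF assms(1), of snd] by (rule finite_subset[rotated]) (force simp: fibre_def)
  ultimately show ?thesis using card_SigmaI[of Z "fibre \<Lambda>"] assms(2) by simp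
qed

text \<open>Each order is at most 3, and they sum to 6.\<close>

lemma ramified_at_least_two:
  assumes "degree W = 6"
  shows "2 \<le> card {z. poly W z = 0}"
proof -
  have W: "W \<noteq> 0" using assms by auto
  have "6 = (\<Sum>z\<in>{z. poly W z = 0}. order z W)" using sum_order_eq_degree[OF W] assms by simp
  also have "\<dots> \<le> (\<Sum>z\<in>{z. poly W z = 0}. 3)"
    using local_bounds_at(1)[OF W refl, of "{}"] by (intro sum_mono) auto
  finally show ?thesis by simp
qed

context
  fixes \<Lambda> :: "('k \<times> 'k) set"
  assumes fin: "finite \<Lambda>" and lines: "\<And>z \<kappa>. (z, \<kappa>) \<in> \<Lambda> \<Longrightarrow> line_at z \<kappa>" and dW: "degree W = 6"
begin

lemma W_nz: "W \<noteq> 0" using dW by auto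

lemma finite_fibre: "finite (fibre \<Lambda> z)"
  using finite_imageI[OF fin, of snd] by (rule finite_subset[rotated]) (force simp: fibre_def)

lemma bounds:
  "order z W \<le> 3" "[:-z,1:]^card (fibre \<Lambda> z) dvd e2"
  "e2 = 0 \<Longrightarrow> [:-z,1:]^(order z W + card (fibre \<Lambda> z)) dvd e3"
  "e2 = 0 \<Longrightarrow> e3 = 0 \<Longrightarrow> [:-z,1:]^card (fibre \<Lambda> z) dvd e4"
  "e2 = 0 \<Longrightarrow> 0 < order z W \<Longrightarrow>
    [:-z,1:]^(order z W + card (fibre \<Lambda> z) + 1) dvd e3 \<or> (order z W = 2 \<and> card (fibre \<Lambda> z) \<le> 1)"
  "e2 = 0 \<Longrightarrow> e3 = 0 \<Longrightarrow> 0 < order z W \<Longrightarrow> [:-z,1:]^(2 * order z W + card (fibre \<Lambda> z) + 2) dvd e4"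
  "order z W = 0 \<Longrightarrow> card (fibre \<Lambda> z) \<le> 1"
proof -
  have l: "line_at z \<kappa>" if "\<kappa> \<in> fibre \<Lambda> z" for \<kappa> using that lines by (simp add: fibre_def)
  note B = local_bounds_at[OF W_nz refl finite_fibre l]
  show "order z W \<le> 3" "[:-z,1:]^card (fibre \<Lambda> z) dvd e2"
    "e2 = 0 \<Longrightarrow> [:-z,1:]^(order z W + card (fibre \<Lambda> z)) dvd e3"
    "e2 = 0 \<Longrightarrow> e3 = 0 \<Longrightarrow> [:-z,1:]^card (fibre \<Lambda> z) dvd e4"
    "e2 = 0 \<Longrightarrow> 0 < order z W \<Longrightarrow>
      [:-z,1:]^(order z W + card (fibre \<Lambda> z) + 1) dvd e3 \<or> (order z W = 2 \<and> card (fibre \<Lambda> z) \<le> 1)"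
    "e2 = 0 \<Longrightarrow> e3 = 0 \<Longrightarrow> 0 < order z W \<Longrightarrow> [:-z,1:]^(2 * order z W + card (fibre \<Lambda> z) + 2) dvd e4"
    "order z W = 0 \<Longrightarrow> card (fibre \<Lambda> z) \<le> 1"
    by - (rule B; assumption)+
qed

lemma degs: "degree e2 \<le> 26" "e2 = 0 \<Longrightarrow> degree e3 \<le> 35" "e2 = 0 \<Longrightarrow> e3 = 0 \<Longrightarrow> degree e4 \<le> 44"
proof -
  have *: "degree e \<le> d" if "degree (W * e) \<le> 6 + d" for e d
    using that degree_mult_eq[of W e] W_nz dW by (cases "e = 0") auto
  show "degree e2 \<le> 26" "e2 = 0 \<Longrightarrow> degree e3 \<le> 35" "e2 = 0 \<Longrightarrow> e3 = 0 \<Longrightarrow> degree e4 \<le> 44"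
    using *[of e2 26] *[of e3 35] *[of e4 44] deg_We by auto
qed

definition base :: "'k set" where "base = fst ` \<Lambda> \<union> {z. poly W z = 0}"

lemma finite_base: "finite base" using fin W_roots_finite[OF W_nz] by (simp add: base_def)

lemma card_eq: "card \<Lambda> = (\<Sum>z\<in>base. card (fibre \<Lambda> z))"
  by (rule card_fibres[OF fin finite_base]) (auto simp: base_def)

lemma sum_orders: "(\<Sum>z\<in>base. order z W) = 6"
proof -
  have "(\<Sum>z\<in>base. order z W) = (\<Sum>z\<in>{z. poly W z = 0}. order z W)"
    using finite_base by (intro sum.mono_neutral_right) (auto simp: base_def order_root W_nz)
  thus ?thesis using sum_order_eq_degree[OF W_nz] dW by simp
qed

lemma valency_first_kind: "e2 \<noteq> 0 \<Longrightarrow> card \<Lambda> \<le> 26"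
  using sum_multiplicities_le_degree[OF _ finite_base, of e2 "\<lambda>z. card (fibre \<Lambda> z)"] bounds(2) degs(1)
  unfolding card_eq by (meson order_trans)

text \<open>The multiplicities of \<open>e3\<close> add up to at least 6 +
  \<open>card \<Lambda>\<close>, against degree 35. At equality no ramification point can have a
  surplus, so each is of the exceptional type in \<open>bounds\<close>.\<close>

lemma valency_second_kind:
  assumes "e2 = 0" "e3 \<noteq> 0"
  shows "card \<Lambda> \<le> 29"
    "card \<Lambda> = 29 \<Longrightarrow> poly W z = 0 \<Longrightarrow> order z W = 2 \<and> card (fibre \<Lambda> z) \<le> 1"
proof -
  have "(\<Sum>z\<in>base. order z W + card (fibre \<Lambda> z)) \<le> degree e3"
    by (rule sum_multiplicities_le_degree[OF assms(2) finite_base]) (rule bounds(3)[OF assms(1)])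
  thus "card \<Lambda> \<le> 29" unfolding sum.distrib sum_orders card_eq[symmetric] using degs(2)[OF assms(1)] by simp
  assume c: "card \<Lambda> = 29" and z: "poly W z = 0"
  show "order z W = 2 \<and> card (fibre \<Lambda> z) \<le> 1"
  proof (rule ccontr)
    assume n: "\<not> ?thesis"
    have zb: "z \<in> base" using z by (simp add: base_def)
    have "0 < order z W" using z by (simp add: order_root W_nz)
    hence d: "[:-z,1:]^(order z W + card (fibre \<Lambda> z) + 1) dvd e3" using bounds(5)[OF assms(1), of z] n by blast
    have "(\<Sum>y\<in>base. order y W + card (fibre \<Lambda> y) + (if y = z then 1 else 0)) \<le> degree e3"
    proof (rule sum_multiplicities_le_degree[OF assms(2) finite_base])
      fix y show "[:-y,1:]^(order y W + card (fibre \<Lambda> y) + (if y = z then 1 else 0)) dvd e3"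
        using d bounds(3)[OF assms(1), of y] by (cases "y = z") auto
    qed
    thus False unfolding sum.distrib sum_orders card_eq[symmetric] c
      using degs(2)[OF assms(1)] zb finite_base by simp
  qed
qed

text \<open>Weights 2 j + n, with 2 more at each of at least two ramification points: 12 + 4 +
  \<open>card \<Lambda>\<close> is at most 44.\<close>

lemma valency_third_kind:
  assumes "e2 = 0" "e3 = 0" "e4 \<noteq> 0"
  shows "card \<Lambda> \<le> 28"
proof -
  let ?R = "{z. poly W z = 0}"
  have R: "?R \<subseteq> base" by (auto simp: base_def)
  have "(\<Sum>z\<in>base. 2 * order z W + card (fibre \<Lambda> z) + (if z \<in> ?R then 2 else 0)) \<le> degree e4"
  proof (rule sum_multiplicities_le_degree[OF assms(3) finite_base])
    fix z
    show "[:-z,1:]^(2 * order z W + card (fibre \<Lambda> z) + (if z \<in> ?R then 2 else 0)) dvd e4"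
    proof (cases "poly W z = 0")
      case True
      hence "0 < order z W" by (simp add: order_root W_nz)
      thus ?thesis using True bounds(6)[OF assms(1,2), of z] by simp
    next
      case False
      hence "order z W = 0" by (simp add: order_root)
      thus ?thesis using False bounds(4)[OF assms(1,2), of z] by simp
    qed
  qed
  also have "(\<Sum>z\<in>base. 2 * order z W + card (fibre \<Lambda> z) + (if z \<in> ?R then 2 else 0)) = 2 * 6 + card \<Lambda> + 2 * card ?R"
    unfolding sum.distrib sum_distrib_left[symmetric] sum_orders card_eq[symmetric]
    using finite_base R by (simp add: sum.If_cases Int_absorb1 inf.absorb2)
  finally show ?thesis using ramified_at_least_two[OF dW] degs(3)[OF assms(1,2)] by simp
qed

end

text \<open>The source of the infinite family of lines that the rank bound later excludes.\<close>

lemma line_at_of_flat: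
  assumes "e2 = 0" "e3 = 0" "e4 = 0" "poly W z \<noteq> 0"
  shows "line_at z (- poly Q z / poly W z)"
  unfolding line_at_def
proof
  fix \<tau>
  have "lp F (pt z) (dir z) = 0" unfolding lp_dir assms by simp
  hence "F (pt z + t *s dir z) = 0" for t using poly_lp[OF formF, of "pt z" "dir z" t] by simp
  moreover have "(- \<tau> / poly W z) *s dir z = \<tau> *s ((- poly Q z / poly W z) *s u + N z)"
    using assms(4) by (simp add: dir_def vec_eq_iff field_simps)
  ultimately show "F (pt z + \<tau> *s ((- poly Q z / poly W z) *s u + N z)) = 0" by metis
qed

end

section \<open>The Schwarzian of a line\<close>

lemma D_form_0:
  fixes f :: "'k::field_char_0 ^ 4 \<Rightarrow> 'k"
  assumes "form 0 f" shows "D f x w = 0"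
  using degree_lp[OF assms, of x w] by (simp add: D_def coeff_eq_0)

lemma D_commute:
  fixes f :: "'k::field_char_0 ^ 4 \<Rightarrow> 'k"
  assumes "form d f"
  shows "D (\<lambda>x. D f x y) p w = D (\<lambda>x. D f x w) p y"
  using assms
proof (induction rule: form.induct)
  case (form_add d f g)
  thus ?case
    using D_add[OF form_D[OF form_add.hyps(1)] form_D[OF form_add.hyps(2)]]
    by (simp only: D_add[OF form_add.hyps] form_add.IH)
next
  case (form_coord d f i)
  note fd = form_D[OF form_coord.hyps]
  have *: "D (\<lambda>x. D (\<lambda>x. x $ i * f x) x y) p w = p $ i * D (\<lambda>x. D f x y) p w + w $ i * D f p y + y $ i * D f p w" for y w
  proof (cases d)
    case 0
    hence z: "D f x w = 0" for x w using D_form_0 form_coord.hyps by blast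
    show ?thesis unfolding D_coord[OF form_coord.hyps] z by (simp add: D_cmult[OF form_coord.hyps] z)
  next
    case (Suc d')
    have f1: "form d (\<lambda>x. x $ i * D f x y)" using form.form_coord[OF form_D[OF form_coord.hyps, of y], of i] Suc by simp
    show ?thesis
      unfolding D_coord[OF form_coord.hyps] using Suc
      by (simp add: D_add[OF f1 form_cmult[OF form_coord.hyps]] D_coord[OF fd] D_cmult[OF form_coord.hyps])
  qed
  show ?case unfolding * using form_coord.IH by (simp add: algebra_simps)
qed simp_all

lemma form_chain_rule:
  fixes f :: "'k::field_char_0 ^ 4 \<Rightarrow> 'k"
  assumes "form d f"
  shows "\<exists>P. (\<forall>z. poly P z = f (pv C z)) \<and> (\<forall>z. poly (pderiv P) z = D f (pv C z) (pv (\<lambda>i. pderiv (C i)) z))"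
  using assms
proof (induction rule: form.induct)
  case (form_zero d) show ?case by (rule exI[of _ 0]) simp
next
  case (form_const c) show ?case by (rule exI[of _ "[:c:]"]) (simp add: pderiv_pCons)
next
  case (form_add d f g)
  then obtain P Q where "\<forall>z. poly P z = f (pv C z)" "\<forall>z. poly (pderiv P) z = D f (pv C z) (pv (\<lambda>i. pderiv (C i)) z)"
    "\<forall>z. poly Q z = g (pv C z)" "\<forall>z. poly (pderiv Q) z = D g (pv C z) (pv (\<lambda>i. pderiv (C i)) z)" by blast
  thus ?case by (intro exI[of _ "P + Q"]) (simp add: D_add[OF form_add.hyps] pderiv_add)
next
  case (form_coord d f i)
  then obtain P where "\<forall>z. poly P z = f (pv C z)" "\<forall>z. poly (pderiv P) z = D f (pv C z) (pv (\<lambda>i. pderiv (C i)) z)" by blast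
  thus ?case by (intro exI[of _ "C i * P"]) (simp only: D_coord[OF form_coord.hyps] pderiv_mult poly_add poly_mult, simp add: pv_def)
qed

context quintic_line
begin

lemma W_value: "poly W z = poly a z * poly (pderiv b) z - poly b z * poly (pderiv a) z"
  by (simp add: W_def)

text \<open>2 W^2 times the Schwarzian derivative of b / a, written without denominators.\<close>

definition Schw :: "'k poly" where
  "Schw = 2 * W * pderiv (pderiv W) - 3 * (pderiv W)^2 + 4 * W * (pderiv a * pderiv (pderiv b) - pderiv (pderiv a) * pderiv b)"

lemma taylor3:
  fixes p :: "'k poly"
  shows "\<exists>r. \<forall>s. poly p (z + s) = poly p z + poly (pderiv p) z * s + poly (pderiv (pderiv p)) z / 2 * s^2
     + poly (pderiv (pderiv (pderiv p))) z / 6 * s^3 + s^4 * poly r s"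
proof -
  define q where "q = pcompose p [:z, 1:]"
  have q: "poly q s = poly p (z + s)" for s by (simp add: q_def poly_pcompose algebra_simps)
  have pq: "pcompose (pderiv p) [:z, 1:] = pderiv (pcompose p [:z, 1:])" for p :: "'k poly"
    by (simp add: pderiv_pcompose pderiv_pCons)
  have d: "poly p z = poly (pcompose p [:z,1:]) 0" for p :: "'k poly" by (simp add: poly_pcompose)
  have c: "poly p z = coeff q 0" "poly (pderiv p) z = coeff q 1" "poly (pderiv (pderiv p)) z / 2 = coeff q 2"
    "poly (pderiv (pderiv (pderiv p))) z / 6 = coeff q 3"
    unfolding d[of p] d[of "pderiv p"] d[of "pderiv (pderiv p)"] d[of "pderiv (pderiv (pderiv p))"] pq q_def[symmetric]
    by (simp_all add: poly_0_coeff_0 coeff_pderiv eval_nat_numeral)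
  define r where "r = poly_shift 4 q"
  have "q = [:coeff q 0, coeff q 1, coeff q 2, coeff q 3:] + monom 1 4 * r"
    by (rule poly_eqI) (auto simp: coeff_monom_mult r_def coeff_poly_shift coeff_pCons eval_nat_numeral split: nat.split)
  hence "poly q s = poly ([:coeff q 0, coeff q 1, coeff q 2, coeff q 3:] + monom 1 4 * r) s" for s by simp
  thus ?thesis unfolding q[symmetric] c
    by (intro exI[of _ r] allI) (simp add: poly_monom eval_nat_numeral algebra_simps)
qed

text \<open>In Taylor coefficients the Schwarzian is the obstruction to killing a, b to order four
  by a pair of factors that are linear in the parameter.\<close>

lemma Schw_eq_det:
  fixes z defines "a1 \<equiv> poly (pderiv a) z" and "a2 \<equiv> poly (pderiv (pderiv a)) z / 2" and "a3 \<equiv> poly (pderiv (pderiv (pderiv a))) z / 6"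
    and "b1 \<equiv> poly (pderiv b) z" and "b2 \<equiv> poly (pderiv (pderiv b)) z / 2" and "b3 \<equiv> poly (pderiv (pderiv (pderiv b))) z / 6"
    and "a0 \<equiv> poly a z" and "b0 \<equiv> poly b z"
  shows "poly Schw z = 12 * ((a0*b1 - b0*a1) * (a1*b2 - b1*a2) + (a0*b1-b0*a1) * (a0*b3 - b0*a3) - (a0*b2-b0*a2)^2)"
proof -
  have e: "poly (pderiv (pderiv a)) z = 2 * a2" "poly (pderiv (pderiv b)) z = 2 * b2"
    "poly (pderiv (pderiv (pderiv a))) z = 6 * a3" "poly (pderiv (pderiv (pderiv b))) z = 6 * b3"
    by (simp_all add: a2_def b2_def a3_def b3_def)
  show ?thesis
    unfolding Schw_def W_def
    by (simp add: pderiv_diff pderiv_mult e flip: a0_def b0_def a1_def b1_def) (simp add: algebra_simps power2_eq_square)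
qed

text \<open>The hypothesis gives linear \<gamma> + s \<gamma>', \<delta> + s \<delta>' with
  (\<gamma> + s \<gamma>') a + (\<delta> + s \<delta>') b = O(s^4): to third order b / a is a,
  possibly degenerate, Moebius transformation.\<close>

lemma Schw_zero:
  assumes y: "y = \<alpha> *s u + \<beta> *s v + \<gamma> *s n1 + \<delta> *s n2" "(\<gamma>, \<delta>) \<noteq> (0, 0)"
    and r: "\<And>s. D F (pt (z + s)) (y + s *s y') = s^4 * poly r s"
  shows "poly Schw z = 0"
proof -
  obtain \<alpha>' \<beta>' \<gamma>' \<delta>' where y': "y' = \<alpha>' *s u + \<beta>' *s v + \<gamma>' *s n1 + \<delta>' *s n2" using spans by blast
  obtain ra where ra: "\<forall>s. poly a (z + s) = poly a z + poly (pderiv a) z * s + poly (pderiv (pderiv a)) z / 2 * s^2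
     + poly (pderiv (pderiv (pderiv a))) z / 6 * s^3 + s^4 * poly ra s" using taylor3 by blast
  obtain rb where rb: "\<forall>s. poly b (z + s) = poly b z + poly (pderiv b) z * s + poly (pderiv (pderiv b)) z / 2 * s^2
     + poly (pderiv (pderiv (pderiv b))) z / 6 * s^3 + s^4 * poly rb s" using taylor3 by blast
  define a0 a1 a2 a3 where a: "a0 = poly a z" "a1 = poly (pderiv a) z" "a2 = poly (pderiv (pderiv a)) z / 2" "a3 = poly (pderiv (pderiv (pderiv a))) z / 6"
  define b0 b1 b2 b3 where b: "b0 = poly b z" "b1 = poly (pderiv b) z" "b2 = poly (pderiv (pderiv b)) z / 2" "b3 = poly (pderiv (pderiv (pderiv b))) z / 6"
  let ?p = "[:\<gamma>, \<gamma>':] * ([:a0, a1, a2, a3:] + monom 1 4 * ra) + [:\<delta>, \<delta>':] * ([:b0, b1, b2, b3:] + monom 1 4 * rb)"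
  have "?p = monom 1 4 * r"
  proof (rule poly_eq_by_values)
    fix s
    have "D F (pt (z + s)) (y + s *s y') = (\<gamma> + s * \<gamma>') * poly a (z + s) + (\<delta> + s * \<delta>') * poly b (z + s)"
      unfolding D_plus[OF formF] D_scale[OF formF] unfolding y(1) y' D_pt by (simp add: algebra_simps)
    thus "poly ?p s = poly (monom 1 4 * r) s"
      unfolding r ra[rule_format] rb[rule_format] a[symmetric] b[symmetric]
      by (simp add: poly_monom eval_nat_numeral algebra_simps)
  qed
  hence c: "coeff ?p k = 0" if "k < 4" for k using that by (simp add: coeff_monom_mult)
  have e0: "\<gamma> * a0 + \<delta> * b0 = 0" and e1: "\<gamma> * a1 + \<delta> * b1 + \<gamma>' * a0 + \<delta>' * b0 = 0"
    and e2: "\<gamma> * a2 + \<delta> * b2 + \<gamma>' * a1 + \<delta>' * b1 = 0"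
    and e3: "\<gamma> * a3 + \<delta> * b3 + \<gamma>' * a2 + \<delta>' * b2 = 0"
    using c[of 0] c[of 1] c[of 2] c[of 3]
    by (simp_all add: coeff_mult coeff_monom_mult coeff_pCons eval_nat_numeral atMost_Suc algebra_simps)
  have "a0 \<noteq> 0 \<or> b0 \<noteq> 0" using ab_nz[of z] by (simp add: a b)
  then obtain c where c: "\<gamma> = - c * b0" "\<delta> = c * a0"
  proof cases
    assume "a0 \<noteq> 0"
    thus ?thesis using e0 by (intro that[of "\<delta> / a0"]) (simp_all add: field_simps add_eq_0_iff2)
  next
    assume "\<not> a0 \<noteq> 0"
    moreover hence "b0 \<noteq> 0" using \<open>a0 \<noteq> 0 \<or> b0 \<noteq> 0\<close> by blast
    ultimately show ?thesis using e0 by (intro that[of "- \<gamma> / b0"]) simp_all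
  qed
  have "c \<noteq> 0" using c y(2) by auto
  \<comment> \<open>The relation e0 gave (\<gamma>, \<delta>) = c (- b0, a0); this combination of
    the other three relations eliminates \<gamma>' and \<delta>'.\<close>
  have "c * ((a0*b1 - b0*a1) * (a1*b2 - b1*a2) + (a0*b1-b0*a1) * (a0*b3 - b0*a3) - (a0*b2-b0*a2)^2) =
     (a1*b2-b1*a2) * (\<gamma> * a1 + \<delta> * b1 + \<gamma>' * a0 + \<delta>' * b0)
     - (a0*b2-b0*a2) * (\<gamma> * a2 + \<delta> * b2 + \<gamma>' * a1 + \<delta>' * b1)
     + (a0*b1-b0*a1) * (\<gamma> * a3 + \<delta> * b3 + \<gamma>' * a2 + \<delta>' * b2)"
    unfolding c by (simp add: algebra_simps power2_eq_square)
  also have "\<dots> = 0" unfolding e1 e2 e3 by simp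
  finally show ?thesis unfolding Schw_eq_det a[symmetric] b[symmetric] using \<open>c \<noteq> 0\<close> by simp
qed

text \<open>W^2 times a quadratic differential on the projective line should have degree 12 - 4 = 8.
  The crude bound is 10; the coefficients in degrees 9 and 10 cancel because the top coefficients of
  V are fixed multiples of those of W.\<close>

lemma degree_Schw: "degree Schw \<le> 8"
proof -
  define V where "V = pderiv a * pderiv (pderiv b) - pderiv (pderiv a) * pderiv b"
  have hi: "coeff a k = 0" "coeff b k = 0" if "4 < k" for k
    using that deg_a deg_b by (simp_all add: coeff_eq_0)
  have W0: "coeff W k = 0" if "6 < k" for k using that deg_W by (simp add: coeff_eq_0)
  have dV: "degree (pderiv p * pderiv (pderiv q)) \<le> 5" if "degree p \<le> 4" "degree q \<le> 4" for p q :: "'k poly"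
    using that degree_mult_le[of "pderiv p" "pderiv (pderiv q)"] by (simp add: degree_pderiv)
  have "degree V \<le> 5" unfolding V_def
    using dV[OF deg_a deg_b] dV[OF deg_b deg_a] by (intro degree_diff_le) (simp_all add: mult.commute)
  moreover have "coeff V 5 = 0" unfolding V_def by (simp add: coeff_mult coeff_pderiv hi eval_nat_numeral atMost_Suc algebra_simps)
  ultimately have V0: "coeff V k = 0" if "4 < k" for k using that by (cases "k = 5") (simp_all add: coeff_eq_0)
  have V4: "coeff V 4 = 12 * coeff W 6" "coeff V 3 = 8 * coeff W 5"
    unfolding V_def W_def by (simp_all add: coeff_mult coeff_pderiv hi eval_nat_numeral atMost_Suc algebra_simps)
  have V4': "coeff V (Suc (Suc (Suc (Suc 0)))) = 12 * coeff W (Suc (Suc (Suc (Suc (Suc (Suc 0))))))"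
    "coeff V (Suc (Suc (Suc 0))) = 8 * coeff W (Suc (Suc (Suc (Suc (Suc 0)))))"
    using V4 by (simp_all add: eval_nat_numeral)
  have S: "Schw = 2 * (W * pderiv (pderiv W)) - 3 * (pderiv W * pderiv W) + 4 * (W * V)"
    unfolding Schw_def V_def by (simp add: power2_eq_square mult.assoc)
  have sc: "coeff (numeral n * p) k = numeral n * coeff p k" for n k and p :: "'k poly"
    by (simp add: numeral_poly)
  have "coeff Schw k = 0" if k8: "8 < k" for k
  proof (cases "k \<le> 10")
    case True
    then consider "k = 9" | "k = 10" using k8 by linarith
    thus ?thesis
      unfolding S by cases (simp_all add: sc, simp_all add: coeff_mult coeff_pderiv W0 V0 eval_nat_numeral atMost_Suc V4' algebra_simps)
  next
    case False
    have "degree (W * pderiv (pderiv W)) \<le> 10" "degree (pderiv W * pderiv W) \<le> 10" "degree (W * V) \<le> 10"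
      using degree_mult_le[of W "pderiv (pderiv W)"] degree_mult_le[of "pderiv W" "pderiv W"] degree_mult_le[of W V]
        deg_W degree_le[of 4 V] V0 by (auto simp: degree_pderiv)
    thus ?thesis using False unfolding S by (simp add: sc coeff_eq_0)
  qed
  thus ?thesis by (intro degree_le) auto
qed

text \<open>For W = X^2 c the lowest term of the first two summands is (4 - 12) c^2 X^2. The third
  has order at least three, since the factor V also vanishes at z.\<close>

lemma Schw_at_ramified:
  assumes W: "W \<noteq> 0" and o: "order z W = 2"
  shows "[:-z, 1:]^2 dvd Schw" "Schw \<noteq> 0"
proof -
  have "[:-z,1:]^2 dvd W" using o by (simp add: order_divides)
  then obtain c where c: "W = [:-z,1:]^2 * c" by blast
  have c0: "poly c z \<noteq> 0"
  proof
    assume "poly c z = 0"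
    hence "[:-z,1:] dvd c" by (simp add: poly_eq_0_iff_dvd)
    hence "[:-z,1:]^2 * [:-z,1:] dvd W" unfolding c by (rule mult_dvd_mono[OF dvd_refl])
    hence "[:-z,1:]^3 dvd W" by (simp only: power_Suc2[symmetric] eval_nat_numeral)
    thus False using o W by (simp add: order_divides)
  qed
  define X1 where "X1 = [:-z,1::'k:]"
  define V where "V = pderiv a * pderiv (pderiv b) - pderiv (pderiv a) * pderiv b"
  have dX: "pderiv X1 = 1" "poly X1 z = 0" by (simp_all add: X1_def pderiv_pCons)
  have d1: "pderiv W = 2 * X1 * c + X1^2 * pderiv c"
    unfolding c X1_def[symmetric] by (simp add: pderiv_mult pderiv_power power2_eq_square dX algebra_simps)
  have d2: "pderiv (pderiv W) = 2 * c + 4 * X1 * pderiv c + X1^2 * pderiv (pderiv c)"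
    unfolding d1 by (simp add: pderiv_mult pderiv_add dX power2_eq_square algebra_simps)
  have "poly V z = 0"
  proof -
    have W0: "poly W z = 0" "poly (pderiv W) z = 0" unfolding d1 by (simp_all add: c dX X1_def[symmetric])
    have e: "poly a z * poly (pderiv b) z = poly b z * poly (pderiv a) z"
      "poly a z * poly (pderiv (pderiv b)) z = poly b z * poly (pderiv (pderiv a)) z"
      using W0 by (simp_all add: W_def pderiv_diff pderiv_mult algebra_simps)
    have "poly a z * poly V z = poly (pderiv a) z * (poly a z * poly (pderiv (pderiv b)) z) - poly (pderiv (pderiv a)) z * (poly a z * poly (pderiv b) z)"
      by (simp add: V_def algebra_simps)
    also have "\<dots> = 0" unfolding e by (simp add: algebra_simps)
    finally have 1: "poly a z * poly V z = 0" .
    have "poly b z * poly V z = (poly b z * poly (pderiv a) z) * poly (pderiv (pderiv b)) z - (poly b z * poly (pderiv (pderiv a)) z) * poly (pderiv b) z"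
      by (simp add: V_def algebra_simps)
    also have "\<dots> = 0" unfolding e[symmetric] by (simp add: algebra_simps)
    finally have "poly b z * poly V z = 0" .
    note this 1
    thus ?thesis using ab_nz[of z] by auto
  qed
  hence "X1 dvd V" by (simp add: poly_eq_0_iff_dvd X1_def)
  then obtain e where e: "V = X1 * e" by blast
  have cX: "W = X1^2 * c" unfolding X1_def by (rule c)
  have S: "Schw = X1^2 * (2 * c * (2 * c + 4 * X1 * pderiv c + X1^2 * pderiv (pderiv c)) - 3 * (2 * c + X1 * pderiv c)^2 + 4 * c * X1 * e)"
    unfolding Schw_def V_def[symmetric] d2 unfolding d1 e
    unfolding cX by (simp add: algebra_simps power2_eq_square)
  thus "[:-z, 1:]^2 dvd Schw" by (simp add: X1_def)
  have "poly (2 * c * (2 * c + 4 * X1 * pderiv c + X1^2 * pderiv (pderiv c)) - 3 * (2 * c + X1 * pderiv c)^2 + 4 * c * X1 * e) z = - 8 * (poly c z)^2"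
    by (simp add: dX power2_eq_square)
  hence "2 * c * (2 * c + 4 * X1 * pderiv c + X1^2 * pderiv (pderiv c)) - 3 * (2 * c + X1 * pderiv c)^2 + 4 * c * X1 * e \<noteq> 0"
    using c0 by (metis mult_eq_0_iff neg_equal_0_iff_equal poly_0 power_eq_0_iff zero_neq_numeral)
  thus "Schw \<noteq> 0" unfolding S by (simp add: X1_def)
qed

text \<open>W has three double zeros, and these take six of the at most eight zeros of
  \<open>Schw\<close>.\<close>

lemma Schw_zeros:
  assumes dW: "degree W = 6" and o: "\<And>z. poly W z = 0 \<Longrightarrow> order z W = 2"
    and Z: "finite Z" "\<And>z. z \<in> Z \<Longrightarrow> poly W z \<noteq> 0 \<and> poly Schw z = 0"
  shows "card Z \<le> 2"
proof -
  let ?R = "{z. poly W z = 0}"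
  have W: "W \<noteq> 0" using dW by auto
  have fR: "finite ?R" by (rule W_roots_finite[OF W])
  have "6 = (\<Sum>z\<in>?R. order z W)" using sum_order_eq_degree[OF W] dW by simp
  also have "\<dots> = (\<Sum>z\<in>?R. 2)" using o by (intro sum.cong) auto
  finally have c: "card ?R = 3" by simp
  then obtain z0 where "poly W z0 = 0" by fastforce
  hence S: "Schw \<noteq> 0" using Schw_at_ramified(2)[OF W o] by blast
  have "(\<Sum>z\<in>?R \<union> Z. if z \<in> ?R then 2 else 1) \<le> degree Schw"
  proof (rule sum_multiplicities_le_degree[OF S])
    show "finite (?R \<union> Z)" using fR Z(1) by blast
    fix z assume "z \<in> ?R \<union> Z"
    thus "[:-z,1:]^(if z \<in> ?R then 2 else 1) dvd Schw"
      using Schw_at_ramified(1)[OF W o, of z] Z(2)[of z] by (auto simp: poly_eq_0_iff_dvd)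
  qed
  moreover have "(\<Sum>z\<in>?R \<union> Z. if z \<in> ?R then 2 else 1) = 2 * card ?R + card Z"
  proof -
    have "(\<Sum>z\<in>?R \<union> Z. if z \<in> ?R then 2 else 1) = (\<Sum>z\<in>?R. if z \<in> ?R then 2 else 1) + (\<Sum>z\<in>Z. if z \<in> ?R then 2 else (1::nat))"
      using fR Z by (intro sum.union_disjoint) auto
    also have "(\<Sum>z\<in>?R. if z \<in> ?R then 2 else (1::nat)) = (\<Sum>z\<in>?R. 2)" by (intro sum.cong) auto
    also have "(\<Sum>z\<in>Z. if z \<in> ?R then 2 else (1::nat)) = (\<Sum>z\<in>Z. 1)" using Z(2) by (intro sum.cong) auto
    finally show ?thesis by simp
  qed
  ultimately show ?thesis using degree_Schw c by linarith
qed

text \<open>Differentiating the contact condition along the family of lines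
  spanned by \<open>pt z\<close> and \<open>dir z\<close>.\<close>

lemma second_kind_deformation:
  assumes "e2 = 0"
  shows "\<exists>y' r. \<forall>\<tau>. D F (pt z + \<tau> *s (dir z + e *s pt z)) (u + \<tau> *s y') = \<tau>^4 * poly r \<tau>"
proof -
  define A where "A i = Q * [:u $ i:] - W * VN i + smult e (V0 i)" for i
  have A: "pv A x = dir x + e *s pt x" for x
  proof -
    have "N x $ i = poly (VN i) x" for i using pv_V(3)[of x] by (simp add: pv_def vec_eq_iff)
    thus ?thesis by (simp add: pv_def A_def dir_def pt_def V0_def vec_eq_iff algebra_simps)
  qed
  obtain P where P: "\<And>x \<sigma> s. F (pv V0 x + \<sigma> *s pv A x + s *s pv V1 x) = ev3 P x \<sigma> s"
    using form_exp3[OF formF, of V0 A V1] by blast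
  have "\<exists>E. \<forall>x \<tau>. F (pt x + \<tau> *s (dir x + e *s pt x)) = poly (poly E [:\<tau>:]) x"
  proof (intro exI allI)
    fix x \<tau>
    show "F (pt x + \<tau> *s (dir x + e *s pt x)) = poly (poly (poly P 0) [:\<tau>:]) x"
      using P[of x \<tau> 0] by (simp add: A pv_V ev3_def)
  qed
  then obtain E where E: "\<And>x \<tau>. F (pt x + \<tau> *s (dir x + e *s pt x)) = poly (poly E [:\<tau>:]) x" by blast
  have "\<exists>G. E = [:0,1:]^4 * G"
  proof -
    have "coeff E k = 0" if "k < 4" for k
    proof (rule poly_eq_by_values)
      fix x
      have "spec2 E x = lp F (pt x) (dir x - (- e) *s pt x)"
        by (rule lp_unique[symmetric]) (simp add: poly_spec2 E[symmetric])
      also have "\<dots> = [:1, e:]^2 * [:0,0,0,0:] + [:1, e:] * [:0, 0, 0, 0, - poly (W * e3) x:] + [:0, 0, 0, 0, 0, - poly (W * e4) x:]"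
        by (subst lp_shift_direction[OF formF lp_dir]) (simp add: assms)
      finally have "coeff (spec2 E x) k = 0" using that
        by (auto simp: coeff_pCons split: nat.split)
      thus "poly (coeff E k) x = poly 0 x" by (simp add: coeff_spec2)
    qed
    hence "[:0,1:]^4 dvd E" by (simp add: X_power_dvd_iff)
    thus ?thesis by (rule dvdE) blast
  qed
  then obtain G where G: "E = [:0,1:]^4 * G" by blast
  \<comment> \<open>Differentiating in x, along which \<open>pt x\<close> moves by \<open>u\<close>,
    does not touch the factor \<tau>^4, because the divisibility holds for all x at once.\<close>
  have e: "D F (pt z + \<tau> *s (dir z + e *s pt z)) (u + \<tau> *s pv (\<lambda>i. pderiv (A i)) z) = \<tau>^4 * poly (poly (map_poly pderiv G) [:\<tau>:]) z" for \<tau>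
  proof -
    define C where "C i = V0 i + smult \<tau> (A i)" for i
    have C: "pv C x = pt x + \<tau> *s (dir x + e *s pt x)" for x
    proof -
      have "pv C x = pv V0 x + \<tau> *s pv A x" unfolding C_def pv_def by (simp add: vec_eq_iff)
      thus ?thesis by (simp only: A pv_V)
    qed
    obtain R where R: "\<And>x. poly R x = F (pv C x)" "\<And>x. poly (pderiv R) x = D F (pv C x) (pv (\<lambda>i. pderiv (C i)) x)"
      using form_chain_rule[OF formF, of C] by blast
    have "R = smult (\<tau>^4) (poly G [:\<tau>:])"
      by (rule poly_eq_by_values) (simp add: R(1) C E G poly_power del: mult_pCons_left mult_pCons_right)
    moreover have "pderiv (poly G [:\<tau>:]) = poly (map_poly pderiv G) [:\<tau>:]"
      by (induction G) (simp_all add: map_poly_pCons pderiv_add pderiv_smult pderiv_mult pderiv_pCons)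
    moreover have "pv (\<lambda>i. pderiv (C i)) z = u + \<tau> *s pv (\<lambda>i. pderiv (A i)) z"
      by (simp add: pv_def C_def V0_def pderiv_add pderiv_smult pderiv_pCons vec_eq_iff)
    ultimately show ?thesis using R(2)[of z] by (simp add: C pderiv_smult)
  qed
  show ?thesis
    by (rule exI[of _ "pv (\<lambda>i. pderiv (A i)) z"], rule exI[of _ "spec2 (map_poly pderiv G) z"]) (simp add: e poly_spec2)
qed

end

section \<open>Linear algebra of lines and planes in four-space\<close>

lemma mem_span1: "x \<in> vec.span {u} \<longleftrightarrow> (\<exists>\<alpha>. x = \<alpha> *s u)" for u :: "'k::field ^ 4"
  by (auto simp: vec.span_breakdown_eq)

lemma mem_span2: "x \<in> vec.span {u, v} \<longleftrightarrow> (\<exists>\<alpha> \<beta>. x = \<alpha> *s u + \<beta> *s v)" for u :: "'k::field ^ 4"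
  by (auto simp: vec.span_breakdown_eq algebra_simps)

lemma mem_span3: "x \<in> vec.span {u, v, w} \<longleftrightarrow> (\<exists>\<alpha> \<beta> \<gamma>. x = \<alpha> *s u + \<beta> *s v + \<gamma> *s w)" for u :: "'k::field ^ 4"
proof -
  have "x \<in> vec.span {u, v, w} \<longleftrightarrow> (\<exists>k. x - k *s u \<in> vec.span {v, w})" by (rule vec.span_breakdown_eq)
  also have "\<dots> \<longleftrightarrow> (\<exists>\<alpha> \<beta> \<gamma>. x - \<alpha> *s u = \<beta> *s v + \<gamma> *s w)" by (simp add: mem_span2)
  finally show ?thesis by (simp add: diff_eq_eq add_ac)
qed

lemma mem_span4: "x \<in> vec.span {u, v, w, y} \<longleftrightarrow> (\<exists>\<alpha> \<beta> \<gamma> \<delta>. x = \<alpha> *s u + \<beta> *s v + \<gamma> *s w + \<delta> *s y)" for u :: "'k::field ^ 4"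
proof -
  have "x \<in> vec.span {u, v, w, y} \<longleftrightarrow> (\<exists>k. x - k *s u \<in> vec.span {v, w, y})" by (rule vec.span_breakdown_eq)
  also have "\<dots> \<longleftrightarrow> (\<exists>\<alpha> \<beta> \<gamma> \<delta>. x - \<alpha> *s u = \<beta> *s v + \<gamma> *s w + \<delta> *s y)" by (simp add: mem_span3)
  finally show ?thesis by (simp add: diff_eq_eq add_ac)
qed

lemma dim_UNIV4: "vec.dim (UNIV :: ('k::field ^ 4) set) = 4"
  by (simp add: card_cart_basis)

lemma scale_in_span: "a \<notin> vec.span S \<Longrightarrow> c *s a \<in> vec.span S \<Longrightarrow> c = 0" for a :: "'k::field ^ 4"
  using vec.span_scale[of "c *s a" S "inverse c"] by (cases "c = 0") auto

lemma basis4: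
  fixes u v w y :: "'k::field ^ 4"
  assumes "vec.dim {u, v, w, y} = 4"
  shows "\<exists>\<alpha> \<beta> \<gamma> \<delta>. x = \<alpha> *s u + \<beta> *s v + \<gamma> *s w + \<delta> *s y"
    "\<alpha> *s u + \<beta> *s v + \<gamma> *s w + \<delta> *s y = 0 \<Longrightarrow> \<alpha> = 0 \<and> \<beta> = 0 \<and> \<gamma> = 0 \<and> \<delta> = 0"
proof -
  have "vec.span {u, v, w, y} = UNIV"
    by (rule vec.subspace_dim_equal) (simp_all add: assms card_cart_basis vec.subspace_span)
  hence "x \<in> vec.span {u, v, w, y}" by simp
  thus "\<exists>\<alpha> \<beta> \<gamma> \<delta>. x = \<alpha> *s u + \<beta> *s v + \<gamma> *s w + \<delta> *s y" unfolding mem_span4 .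
  assume e: "\<alpha> *s u + \<beta> *s v + \<gamma> *s w + \<delta> *s y = 0"
  note D = vec.dim_insert
  have n: "u \<notin> vec.span {v, w, y}" "v \<notin> vec.span {w, y}" "w \<notin> vec.span {y}" "y \<noteq> 0"
    using assms by (auto simp: D split: if_splits)
  have "\<alpha> *s u = (- \<beta>) *s v + (- \<gamma>) *s w + (- \<delta>) *s y" using e by (simp add: algebra_simps eq_neg_iff_add_eq_0)
  hence "\<alpha> *s u \<in> vec.span {v, w, y}" unfolding mem_span3 by blast
  hence a: "\<alpha> = 0" by (rule scale_in_span[OF n(1)])
  have "\<beta> *s v = (- \<gamma>) *s w + (- \<delta>) *s y" using e by (simp add: a algebra_simps eq_neg_iff_add_eq_0)
  hence "\<beta> *s v \<in> vec.span {w, y}" unfolding mem_span2 by blast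
  hence b: "\<beta> = 0" by (rule scale_in_span[OF n(2)])
  have "\<gamma> *s w = (- \<delta>) *s y" using e by (simp add: a b eq_neg_iff_add_eq_0)
  hence "\<gamma> *s w \<in> vec.span {y}" unfolding mem_span1 by blast
  hence c: "\<gamma> = 0" by (rule scale_in_span[OF n(3)])
  thus "\<alpha> = 0 \<and> \<beta> = 0 \<and> \<gamma> = 0 \<and> \<delta> = 0" using a b n(4) e by simp
qed

lemma dim_extend:
  fixes S :: "('k::field ^ 4) set"
  assumes "vec.dim S < 4" shows "\<exists>x. vec.dim (insert x S) = Suc (vec.dim S)"
proof -
  have "vec.span S \<noteq> UNIV" using assms vec.dim_span[of S] by (metis dim_UNIV4 less_irrefl)
  then obtain x where "x \<notin> vec.span S" by blast
  thus ?thesis by (auto simp: vec.dim_insert)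
qed

lemma is_lineE:
  assumes "is_line L"
  shows "\<exists>u v. L = vec.span {u, v} \<and> vec.dim {u, v} = 2"
proof -
  have L: "vec.subspace L" "vec.dim L = 2" using assms by (auto simp: is_line_def)
  obtain u where u: "u \<in> L" "u \<noteq> 0" using L(2) vec.dim_eq_0[of L] by fastforce
  have d: "vec.dim {u} = 1" using u by simp
  have "\<not> L \<subseteq> vec.span {u}" using vec.dim_mono[of L "{u}"] L(2) d by fastforce
  then obtain v where v: "v \<in> L" "v \<notin> vec.span {u}" by blast
  hence d2: "vec.dim {v, u} = 2" by (simp add: vec.dim_insert u)
  have "vec.span {v, u} \<subseteq> L" using u v L by (intro vec.span_minimal) auto
  hence "vec.span {v, u} = L" by (intro vec.subspace_dim_equal) (use L d2 in \<open>auto simp: vec.subspace_span\<close>)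
  thus ?thesis using d2 by blast
qed

lemma is_line_span2: "vec.dim {u, v} = 2 \<Longrightarrow> is_line (vec.span {u, v})"
  by (simp add: is_line_def vec.subspace_span)

lemma line_eqI:
  assumes "is_line L" "is_line M" "L \<subseteq> M" shows "L = M"
  using assms by (intro vec.subspace_dim_equal) (auto simp: is_line_def)

lemma span2_subset_line: "is_line L \<Longrightarrow> x \<in> L \<Longrightarrow> y \<in> L \<Longrightarrow> vec.span {x, y} \<subseteq> L"
  by (rule vec.span_minimal) (auto simp: is_line_def)

lemma lineI2: "is_line L \<Longrightarrow> x \<in> L \<Longrightarrow> y \<in> L \<Longrightarrow> vec.dim {x, y} = 2 \<Longrightarrow> L = vec.span {x, y}"
  using line_eqI[OF is_line_span2 _ span2_subset_line] by metis

lemma two_points: "x \<noteq> 0 \<Longrightarrow> y \<notin> vec.span {x} \<Longrightarrow> vec.dim {x, y} = 2" for x :: "'k::field ^ 4"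
  by (subst insert_commute) (simp add: vec.dim_insert)

lemma line_second_point:
  assumes "is_line L" "p \<in> L" "p \<noteq> 0" shows "\<exists>q\<in>L. q \<notin> vec.span {p} \<and> L = vec.span {p, q}"
proof -
  have "\<not> L \<subseteq> vec.span {p}" using vec.dim_mono[of L "{p}"] assms(1,3) by (auto simp: is_line_def)
  thus ?thesis using lineI2[OF assms(1,2)] two_points[OF assms(3)] by blast
qed

lemma dim_hyperplane_le:
  fixes P :: "('k::field ^ 4) set"
  assumes "vec.subspace P" "P \<noteq> UNIV" shows "vec.dim P \<le> 3"
proof -
  have "vec.dim P \<noteq> 4"
  proof
    assume "vec.dim P = 4"
    hence "P = UNIV" by (intro vec.subspace_dim_equal[OF assms(1)]) (auto simp: card_cart_basis vec.subspace_UNIV)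
    thus False using assms(2) by blast
  qed
  moreover have "vec.dim P \<le> 4" using vec.dim_subset[of P UNIV] by (simp add: card_cart_basis)
  ultimately show ?thesis by linarith
qed

lemma dim_insert_line: "is_line L \<Longrightarrow> x \<notin> L \<Longrightarrow> vec.dim (insert x L) = 3"
  unfolding vec.dim_insert by (simp add: is_line_def vec.span_eq_iff[THEN iffD2])

lemma two_pointsD: "vec.dim {x, y} = 2 \<Longrightarrow> \<alpha> *s x + \<beta> *s y = 0 \<Longrightarrow> \<alpha> = 0 \<and> \<beta> = 0" for x :: "'k::field ^ 4"
proof -
  assume d: "vec.dim {x, y} = 2" and e: "\<alpha> *s x + \<beta> *s y = 0"
  have n: "x \<notin> vec.span {y}" "y \<noteq> 0" using d by (auto simp: vec.dim_insert split: if_splits)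
  have "\<alpha> *s x = (- \<beta>) *s y" using e by (simp add: eq_neg_iff_add_eq_0)
  hence "\<alpha> = 0" using scale_in_span[OF n(1)] mem_span1 by blast
  thus ?thesis using e n by simp
qed

section \<open>Lines on a smooth quintic\<close>

locale quintic =
  fixes F :: "'k::{alg_closed_field,field_char_0} ^ 4 \<Rightarrow> 'k"
  assumes formF: "form 5 F" and smooth: "\<And>x. x \<noteq> 0 \<Longrightarrow> \<exists>w. D F x w \<noteq> 0"
begin

definition XL :: "('k ^ 4) set set" where "XL = {L. is_line L \<and> (\<forall>x\<in>L. F x = 0)}"

lemma XL_D: "L \<in> XL \<Longrightarrow> is_line L" "L \<in> XL \<Longrightarrow> x \<in> L \<Longrightarrow> F x = 0" "L \<in> XL \<Longrightarrow> vec.subspace L"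
  by (auto simp: XL_def is_line_def)

lemma XL_tangent: "L \<in> XL \<Longrightarrow> x \<in> L \<Longrightarrow> w \<in> L \<Longrightarrow> D F x w = 0"
  by (rule D_along_zero[OF formF]) (auto intro!: XL_D(2) vec.subspace_add vec.subspace_scale dest: XL_D(3))

lemma quintic_line_exists:
  assumes "vec.span {u, v} \<in> XL" "vec.dim {u, v} = 2"
  shows "\<exists>n1 n2. quintic_line F u v n1 n2"
proof -
  obtain n1 where n1: "vec.dim {n1, u, v} = 3" using dim_extend[of "{u,v}"] assms(2) by auto
  obtain n2 where "vec.dim {n2, n1, u, v} = 4" using dim_extend[of "{n1,u,v}"] n1 by auto
  hence d: "vec.dim {u, v, n1, n2} = 4" by (simp add: insert_commute)
  have "quintic_line F u v n1 n2"
  proof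
    fix \<alpha> \<beta>
    have "\<alpha> *s u + \<beta> *s v \<in> vec.span {u, v}" unfolding mem_span2 by blast
    thus "F (\<alpha> *s u + \<beta> *s v) = 0" using XL_D(2)[OF assms(1)] by blast
  qed (use basis4[OF d] smooth formF in auto)
  thus ?thesis by blast
qed

text \<open>Degree 6 says that the point at infinity \<open>u\<close> is unramified. The last clause
  says that no other line of \<open>S\<close> lies in the tangent plane at \<open>u\<close>; in
  particular none passes through \<open>u\<close>.\<close>

definition adapted where
  "adapted S L u v n1 n2 \<longleftrightarrow> quintic_line F u v n1 n2 \<and> L = vec.span {u, v} \<and> degree (quintic_line.W F u v n1 n2) = 6
     \<and> (\<forall>M\<in>S. M \<noteq> L \<longrightarrow> (\<exists>w\<in>M. D F u w \<noteq> 0))"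

end

context quintic_line
begin

lemma swapped: "quintic_line F v u n1 n2"
proof
  show "form 5 F" by (rule formF)
  show "F (\<alpha> *s v + \<beta> *s u) = 0" for \<alpha> \<beta> using on_line[of \<beta> \<alpha>] by (simp add: add.commute)
  show "\<exists>\<alpha> \<beta> \<gamma> \<delta>. x = \<alpha> *s v + \<beta> *s u + \<gamma> *s n1 + \<delta> *s n2" for x
  proof -
    obtain \<alpha> \<beta> \<gamma> \<delta> where "x = \<alpha> *s u + \<beta> *s v + \<gamma> *s n1 + \<delta> *s n2" using spans by blast
    hence "x = \<beta> *s v + \<alpha> *s u + \<gamma> *s n1 + \<delta> *s n2" by (simp add: add.commute)
    thus ?thesis by blast
  qed
  show "\<alpha> = 0 \<and> \<beta> = 0 \<and> \<gamma> = 0 \<and> \<delta> = 0" if "\<alpha> *s v + \<beta> *s u + \<gamma> *s n1 + \<delta> *s n2 = 0" for \<alpha> \<beta> \<gamma> \<delta>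
    using indep[of \<beta> \<alpha> \<gamma> \<delta>] that by (simp add: add.commute)
  show "\<exists>w. D F x w \<noteq> 0" if "x \<noteq> 0" for x using smooth that by blast
qed

text \<open>The coordinate change from z to 1/z reverses the coefficients of a binary form.\<close>

lemma line_poly_swap: "form d f \<Longrightarrow> k \<le> d \<Longrightarrow> coeff (lp f u v) k = coeff (lp f v u) (d - k)"
proof (induction arbitrary: k rule: form.induct)
  case (form_zero d) thus ?case by (simp add: lp_zero)
next
  case (form_const c) thus ?case by (simp add: lp_const)
next
  case (form_add d f g) thus ?case by (simp add: lp_add)
next
  case (form_coord d f i)
  have l: "lp (\<lambda>x. x $ i * f x) x w = [:x $ i, w $ i:] * lp f x w" for x w
    using lp_mult[OF form_nth form_coord.hyps, of i x w] by (simp add: lp_nth)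
  have hi: "coeff (lp f x w) k = 0" if "d < k" for x w k
    using degree_lp[OF form_coord.hyps, of x w] that by (simp add: coeff_eq_0)
  show ?case
  proof (cases k)
    case 0
    thus ?thesis using form_coord.IH[of 0] hi[of "Suc d"] by (simp add: l)
  next
    case (Suc k')
    show ?thesis
    proof (cases "k' = d")
      case True
      thus ?thesis using Suc form_coord.IH[of d] hi[of "Suc d"] by (simp add: l)
    next
      case False
      then obtain e where "d - k' = Suc e" using form_coord.prems Suc by (cases "d - k'") auto
      hence e: "d - k' = Suc e" "d - Suc k' = e" "Suc d - k = Suc e" "k = Suc k'" "k' \<le> d" "Suc k' \<le> d" using Suc form_coord.prems by auto
      thus ?thesis using form_coord.IH[of k'] form_coord.IH[of "Suc k'"] by (simp add: l)
    qed
  qed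
qed

text \<open>At a zero of a smoothness makes b nonzero, so b a' has smaller order there than a b'.
  Hence W = 0 forces a and b to be constant; their coefficients in degree four then vanish, against
  smoothness at \<open>u\<close>.\<close>

lemma W_nonzero: "W \<noteq> 0"
proof
  assume W0: "W = 0"
  have e: "a * pderiv b = b * pderiv a" using W0 by (simp add: W_def)
  have root: "\<exists>z. poly p z = 0" if "degree p > 0" for p :: "'k poly"
    using alg_closed_imp_poly_has_root[OF that] .
  have "degree a = 0 \<and> degree b = 0"
  proof (cases "a = 0")
    case True
    hence "poly b z \<noteq> 0" for z using ab_nz[of z] by simp
    hence "degree b = 0" using root[of b] by blast
    thus ?thesis using True by simp
  next
    case False
    have a0: "degree a = 0"
    proof (rule ccontr)
      assume d: "degree a \<noteq> 0"
      then obtain z where z: "poly a z = 0" using root[of a] by blast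
      hence b: "poly b z \<noteq> 0" using ab_nz[of z] by blast
      have a': "pderiv a \<noteq> 0" using d by (simp add: pderiv_eq_0_iff)
      have "b * pderiv a \<noteq> 0" using a' b by auto
      hence "order z (b * pderiv a) = order z b + order z (pderiv a)" by (rule order_mult)
      also have "order z b = 0" using b by (simp add: order_root)
      finally have o: "order z (b * pderiv a) = order z (pderiv a)" by simp
      have "order z (a * pderiv b) = order z a + order z (pderiv b)"
        using \<open>b * pderiv a \<noteq> 0\<close> e by (intro order_mult) simp
      hence "order z a \<le> order z (pderiv a)" using o e by simp
      moreover have "order z a = Suc (order z (pderiv a))" using z False a' by (intro order_pderiv) (simp_all add: order_root)
      ultimately show False by simp
    qed
    then obtain c where c: "a = [:c:]" by (auto elim: degree_eq_zeroE)
    hence "a * pderiv b = 0" using e by (simp add: pderiv_pCons)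
    hence "degree b = 0" using False by (simp add: pderiv_eq_0_iff)
    thus ?thesis using a0 by simp
  qed
  hence "coeff a 4 = 0" "coeff b 4 = 0" by (simp_all add: coeff_eq_0)
  moreover interpret T: quintic_line F v u n1 n2 by (rule swapped)
  have "coeff a 4 = D F u n1" "coeff b 4 = D F u n2" by (rule coeff_a4 coeff_b4)+
  ultimately show False using T.ab_nz[of 0] by (simp add: T.poly_a T.poly_b T.pt_def)
qed

lemma degree_W_swapped:
  assumes "poly W 0 \<noteq> 0" shows "degree (quintic_line.W F v u n1 n2) = 6"
proof -
  interpret T: quintic_line F v u n1 n2 by (rule swapped)
  have c: "coeff T.a k = coeff a (4 - k)" "coeff T.b k = coeff b (4 - k)" if "k \<le> 4" for k
    unfolding T.a_def a_def T.b_def b_def using line_poly_swap[OF form4 that] by blast+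
  have hi: "coeff T.a k = 0" "coeff T.b k = 0" if "4 < k" for k
    using that T.deg_a T.deg_b by (simp_all add: coeff_eq_0)
  have "coeff T.W 6 = - poly W 0"
    unfolding T.W_def W_def
    by (simp add: coeff_mult coeff_pderiv hi eval_nat_numeral atMost_Suc c[unfolded eval_nat_numeral] poly_0_coeff_0 algebra_simps)
  hence "6 \<le> degree T.W" using assms by (intro le_degree) simp
  thus ?thesis using T.deg_W by simp
qed

end

text \<open>All but finitely many c work: the ramification points are excluded and, for each other
  line of \<open>S\<close>, the points whose tangent plane contains it. Swapping the basis puts v +
  c u at infinity.\<close>

lemma (in quintic) adapted_exists:
  assumes S: "finite S" "S \<subseteq> XL" and L: "L \<in> XL"
  shows "\<exists>u v n1 n2. adapted S L u v n1 n2"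
proof -
  obtain u v where uv: "L = vec.span {u, v}" "vec.dim {u, v} = 2" using is_lineE[OF XL_D(1)[OF L]] by blast
  obtain n1 n2 where q: "quintic_line F u v n1 n2" using quintic_line_exists uv L by blast
  interpret Q: quintic_line F u v n1 n2 by (rule q)
  define bad where "bad M = {c. \<forall>w\<in>M. D F (Q.pt c) w = 0}" for M
  have fin: "finite (bad M)" if M: "M \<in> S" "M \<noteq> L" for M
  proof -
    have "M \<in> XL" using M S by blast
    hence "\<not> M \<subseteq> L" using line_eqI[of M L] M(2) XL_D(1) L by blast
    then obtain w where w: "w \<in> M" "w \<notin> L" by blast
    obtain \<alpha> \<beta> \<gamma> \<delta> where e: "w = \<alpha> *s u + \<beta> *s v + \<gamma> *s n1 + \<delta> *s n2" using Q.spans by blast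
    have g: "\<gamma> \<noteq> 0 \<or> \<delta> \<noteq> 0" 
    proof (rule ccontr)
      assume "\<not> ?thesis"
      hence "w = \<alpha> *s u + \<beta> *s v" unfolding e by simp
      thus False using w(2) unfolding uv(1) mem_span2 by blast
    qed
    have v: "poly (smult \<gamma> Q.a + smult \<delta> Q.b) c = D F (Q.pt c) w" for c
      unfolding e Q.D_pt by simp
    have "smult \<gamma> Q.a + smult \<delta> Q.b \<noteq> 0"
    proof
      assume z: "smult \<gamma> Q.a + smult \<delta> Q.b = 0"
      hence z': "smult \<gamma> (pderiv Q.a) + smult \<delta> (pderiv Q.b) = 0" by (simp flip: pderiv_smult pderiv_add)
      have "smult \<gamma> Q.W = pderiv Q.b * (smult \<gamma> Q.a + smult \<delta> Q.b) - Q.b * (smult \<gamma> (pderiv Q.a) + smult \<delta> (pderiv Q.b))"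
        "smult \<delta> Q.W = Q.a * (smult \<gamma> (pderiv Q.a) + smult \<delta> (pderiv Q.b)) - pderiv Q.a * (smult \<gamma> Q.a + smult \<delta> Q.b)"
        by (simp_all add: Q.W_def algebra_simps smult_diff_right)
      hence "smult \<gamma> Q.W = 0" "smult \<delta> Q.W = 0" unfolding z z' by simp_all
      thus False using g Q.W_nonzero by simp
    qed
    hence "finite {c. poly (smult \<gamma> Q.a + smult \<delta> Q.b) c = 0}" by (rule poly_roots_finite)
    moreover have "bad M \<subseteq> {c. poly (smult \<gamma> Q.a + smult \<delta> Q.b) c = 0}"
      unfolding bad_def v using w(1) by blast
    ultimately show ?thesis by (rule finite_subset[rotated])
  qed
  have "finite ({c. poly Q.W c = 0} \<union> (\<Union>M\<in>S - {L}. bad M))"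
    using fin S(1) poly_roots_finite[OF Q.W_nonzero] by auto
  then obtain c where c: "c \<notin> {c. poly Q.W c = 0} \<union> (\<Union>M\<in>S - {L}. bad M)"
    using ex_new_if_finite[OF infinite_UNIV_char_0] by blast
  interpret R: quintic_line F u "v + c *s u" n1 n2 by (rule Q.shifted)
  have "poly R.W 0 = poly Q.W c"
  proof -
    have p: "R.pt z = Q.pt (c + z)" for z
      by (simp add: R.pt_def Q.pt_def vec.scale_left_distrib add.assoc)
    have "R.a = pcompose Q.a [:c, 1:]" "R.b = pcompose Q.b [:c, 1:]"
      by (rule poly_eq_by_values, simp add: poly_pcompose R.poly_a R.poly_b Q.poly_a Q.poly_b p)+
    thus ?thesis
      by (simp add: R.W_def Q.W_def pderiv_pcompose poly_pcompose pderiv_pCons)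
  qed
  hence W0: "poly R.W 0 \<noteq> 0" using c by simp
  have sp: "L = vec.span {v + c *s u, u}"
  proof -
    have "x \<in> vec.span {v + c *s u, u} \<longleftrightarrow> x \<in> vec.span {u, v}" for x
      unfolding mem_span2
    proof
      assume "\<exists>\<alpha> \<beta>. x = \<alpha> *s (v + c *s u) + \<beta> *s u"
      then obtain \<alpha> \<beta> where "x = \<alpha> *s (v + c *s u) + \<beta> *s u" by blast
      hence "x = (\<alpha> * c + \<beta>) *s u + \<alpha> *s v" by (simp add: vec_eq_iff algebra_simps)
      thus "\<exists>\<alpha> \<beta>. x = \<alpha> *s u + \<beta> *s v" by blast
    next
      assume "\<exists>\<alpha> \<beta>. x = \<alpha> *s u + \<beta> *s v"
      then obtain \<alpha> \<beta> where "x = \<alpha> *s u + \<beta> *s v" by blast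
      hence "x = \<beta> *s (v + c *s u) + (\<alpha> - \<beta> * c) *s u" by (simp add: vec_eq_iff algebra_simps)
      thus "\<exists>\<alpha> \<beta>. x = \<alpha> *s (v + c *s u) + \<beta> *s u" by blast
    qed
    thus ?thesis unfolding uv(1) by blast
  qed
  have "adapted S L (v + c *s u) u n1 n2"
    unfolding adapted_def
  proof (intro conjI ballI impI)
    show "quintic_line F (v + c *s u) u n1 n2" by (rule R.swapped)
    show "L = vec.span {v + c *s u, u}" by (rule sp)
    show "degree (quintic_line.W F (v + c *s u) u n1 n2) = 6" by (rule R.degree_W_swapped[OF W0])
    fix M assume "M \<in> S" "M \<noteq> L"
    hence "c \<notin> bad M" using c by blast
    thus "\<exists>w\<in>M. D F (v + c *s u) w \<noteq> 0" by (auto simp: bad_def Q.pt_def)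
  qed
  thus ?thesis by blast
qed

text \<open>Each line carries a basis for which the coordinate \<open>z = \<infinity>\<close> is unramified and
  meets no other line of \<open>S\<close>.\<close>

locale quintic_lines = quintic F for F :: "'k::{alg_closed_field,field_char_0} ^ 4 \<Rightarrow> 'k" +
  fixes S :: "('k ^ 4) set set" and U V N1 N2 :: "('k ^ 4) set \<Rightarrow> 'k ^ 4"
  assumes S: "finite S" "S \<subseteq> XL" and adapted: "\<And>L. L \<in> S \<Longrightarrow> adapted S L (U L) (V L) (N1 L) (N2 L)"

lemma (in quintic) quintic_lines_exists:
  assumes "finite S" "S \<subseteq> XL"
  shows "\<exists>U V N1 N2. quintic_lines F S U V N1 N2"
proof -
  have "\<forall>L\<in>S. \<exists>b. adapted S L (fst b) (fst (snd b)) (fst (snd (snd b))) (snd (snd (snd b)))"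
    using adapted_exists[OF assms] assms(2) by (metis (no_types, lifting) fst_conv snd_conv subsetD)
  then obtain b where "\<forall>L\<in>S. adapted S L (fst (b L)) (fst (snd (b L))) (fst (snd (snd (b L)))) (snd (snd (snd (b L))))"
    by (rule bchoice[THEN exE])
  hence "quintic_lines F S (\<lambda>L. fst (b L)) (\<lambda>L. fst (snd (b L))) (\<lambda>L. fst (snd (snd (b L)))) (\<lambda>L. snd (snd (snd (b L))))"
    using assms by unfold_locales auto
  thus ?thesis by blast
qed

section \<open>Coordinates of the lines that meet a given line\<close>

context quintic_line
begin

lemma in_line_iff: "x \<in> vec.span {u, v} \<longleftrightarrow> (\<exists>\<alpha> \<beta>. x = \<alpha> *s u + \<beta> *s v)"
  by (rule mem_span2)

lemma pt_in_line: "pt z \<in> vec.span {u, v}"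
  unfolding in_line_iff pt_def by (rule exI[of _ z], rule exI[of _ 1]) (simp add: add.commute)

lemma dim_uv: "vec.dim {u, v} = 2"
proof (rule two_points)
  show "u \<noteq> 0" using indep[of 1 0 0 0] by auto
  show "v \<notin> vec.span {u}"
  proof
    assume "v \<in> vec.span {u}"
    then obtain c where "v = c *s u" using mem_span1 by blast
    thus False using indep[of "- c" 1 0 0] by (auto simp: algebra_simps)
  qed
qed

lemma uv_XL: "quintic F" "vec.span {u, v} \<in> quintic.XL F"
proof -
  show q: "quintic F" by unfold_locales (use formF smooth in auto)
  show "vec.span {u, v} \<in> quintic.XL F"
    unfolding quintic.XL_def[OF q] using is_line_span2[OF dim_uv] on_line by (auto simp: in_line_iff)
qed

lemma tangent_direction:
  assumes "D F (pt z) w = 0"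
  shows "\<exists>c \<alpha> \<beta>. w = \<alpha> *s u + \<beta> *s pt z + c *s N z"
proof -
  obtain \<alpha> \<beta> \<gamma> \<delta> where w: "w = \<alpha> *s u + \<beta> *s v + \<gamma> *s n1 + \<delta> *s n2" using spans by blast
  have e: "\<gamma> * poly a z + \<delta> * poly b z = 0" using assms unfolding w D_pt .
  obtain c where c: "\<gamma> = - c * poly b z" "\<delta> = c * poly a z"
  proof (cases "poly a z = 0")
    case True
    hence b: "poly b z \<noteq> 0" using ab_nz[of z] by blast
    thus ?thesis using e True by (intro that[of "- \<gamma> / poly b z"]) simp_all
  next
    case False
    thus ?thesis using e by (intro that[of "\<delta> / poly a z"]) (simp_all add: field_simps eq_neg_iff_add_eq_0)
  qed
  have "w = (\<alpha> - \<beta> * z) *s u + \<beta> *s pt z + c *s N z"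
    unfolding w c by (simp add: N_def pt_def vec_eq_iff algebra_simps)
  thus ?thesis by blast
qed

lemma u_pt_N_indep: "\<alpha> *s u + \<beta> *s pt z + c *s N z = 0 \<Longrightarrow> \<alpha> = 0 \<and> \<beta> = 0 \<and> c = 0"
proof -
  assume e: "\<alpha> *s u + \<beta> *s pt z + c *s N z = 0"
  have "(\<alpha> + \<beta> * z) *s u + \<beta> *s v + (- (c * poly b z)) *s n1 + (c * poly a z) *s n2 = 0"
    using e by (simp add: N_def pt_def vec_eq_iff algebra_simps)
  hence "\<alpha> + \<beta> * z = 0 \<and> \<beta> = 0 \<and> - (c * poly b z) = 0 \<and> c * poly a z = 0" by (rule indep)
  thus ?thesis using ab_nz[of z] by auto
qed

definition ln :: "'k \<Rightarrow> 'k \<Rightarrow> ('k ^ 4) set" where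
  "ln z \<kappa> = vec.span {pt z, \<kappa> *s u + N z}"

lemma dim_ln: "vec.dim {pt z, \<kappa> *s u + N z} = 2"
proof (rule two_points)
  show "pt z \<noteq> 0" by (rule pt_nz)
  show "\<kappa> *s u + N z \<notin> vec.span {pt z}"
  proof
    assume "\<kappa> *s u + N z \<in> vec.span {pt z}"
    then obtain c where "\<kappa> *s u + N z = c *s pt z" using mem_span1 by blast
    hence "\<kappa> *s u + (- c) *s pt z + 1 *s N z = 0" by (simp add: algebra_simps)
    thus False using u_pt_N_indep[of \<kappa> "- c" z 1] by simp
  qed
qed

lemma ln_XL: assumes "line_at z \<kappa>" shows "ln z \<kappa> \<in> quintic.XL F"
proof -
  have q: "quintic F" by (rule uv_XL)
  have l0: "lp F (pt z) (\<kappa> *s u + N z) = 0"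
    using assms by (intro lp_unique) (simp add: line_at_def)
  have "F (\<alpha> *s pt z + \<beta> *s (\<kappa> *s u + N z)) = 0" for \<alpha> \<beta>
  proof (cases "\<alpha> = 0")
    case True
    have "coeff (lp F (pt z) (\<kappa> *s u + N z)) 5 = 0" using l0 by simp
    hence "F (\<kappa> *s u + N z) = 0" using coeff_lp_top[OF formF] by metis
    thus ?thesis using True form_scale[OF formF, of \<beta>] by simp
  next
    case False
    have "\<alpha> *s pt z + \<beta> *s (\<kappa> *s u + N z) = \<alpha> *s (pt z + (\<beta> / \<alpha>) *s (\<kappa> *s u + N z))"
      using False by (simp add: vec.scale_right_distrib)
    thus ?thesis using form_scale[OF formF, of \<alpha>] assms by (simp add: line_at_def)
  qed
  hence "F x = 0" if xln: "x \<in> ln z \<kappa>" for x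
  proof -
    obtain \<alpha> \<beta> where "x = \<alpha> *s pt z + \<beta> *s (\<kappa> *s u + N z)" using xln unfolding ln_def mem_span2 by blast
    thus ?thesis using \<open>\<And>\<alpha> \<beta>. F (\<alpha> *s pt z + \<beta> *s (\<kappa> *s u + N z)) = 0\<close> by simp
  qed
  thus ?thesis unfolding quintic.XL_def[OF q] using is_line_span2[OF dim_ln] unfolding ln_def by blast
qed

lemma meet_coords:
  assumes M: "M \<in> quintic.XL F" "w \<in> M" "D F u w \<noteq> 0" and ne: "M \<noteq> vec.span {u, v}"
    and p: "p \<in> M" "p \<in> vec.span {u, v}" "p \<noteq> 0"
  shows "\<exists>z \<kappa>. M = ln z \<kappa> \<and> line_at z \<kappa>"
proof -
  interpret q: quintic F by (rule uv_XL)
  obtain \<alpha> \<beta> where pe: "p = \<alpha> *s u + \<beta> *s v" using p(2) in_line_iff by blast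
  have sM: "vec.subspace M" "is_line M" using q.XL_D M by auto
  \<comment> \<open>The meeting point is not \<open>u\<close>: otherwise M would lie in the tangent
    plane at \<open>u\<close>, against the choice of w.\<close>
  have b: "\<beta> \<noteq> 0"
  proof
    assume "\<beta> = 0"
    hence "p = \<alpha> *s u" "\<alpha> \<noteq> 0" using pe p(3) by auto
    hence "u = inverse \<alpha> *s p" by simp
    hence "u \<in> M" using vec.subspace_scale[OF sM(1) p(1)] by metis
    thus False using q.XL_tangent[OF M(1) _ M(2)] M(3) by blast
  qed
  define z where "z = \<alpha> / \<beta>"
  have "pt z = inverse \<beta> *s p" unfolding pe pt_def z_def using b
    by (simp add: vec.scale_right_distrib field_simps)
  hence ptM: "pt z \<in> M" using vec.subspace_scale[OF sM(1) p(1)] by metis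
  have "\<not> M \<subseteq> vec.span {u, v}" using line_eqI[OF sM(2) is_line_span2[OF dim_uv]] ne by blast
  then obtain y where y: "y \<in> M" "y \<notin> vec.span {u, v}" by blast
  obtain c \<alpha>' \<beta>' where ye: "y = \<alpha>' *s u + \<beta>' *s pt z + c *s N z"
    using tangent_direction[of z y] q.XL_tangent[OF M(1) ptM y(1)] by blast
  have c: "c \<noteq> 0"
  proof
    assume "c = 0"
    hence "y = (\<alpha>' + \<beta>' * z) *s u + \<beta>' *s v" unfolding ye pt_def by (simp add: vec_eq_iff algebra_simps)
    thus False using y(2) in_line_iff by blast
  qed
  define \<kappa> where "\<kappa> = \<alpha>' / c"
  have "\<kappa> *s u + N z = inverse c *s y - (\<beta>' / c) *s pt z"
    unfolding ye \<kappa>_def using c by (simp add: vec_eq_iff field_simps)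
  hence kM: "\<kappa> *s u + N z \<in> M"
    using vec.subspace_diff[OF sM(1) vec.subspace_scale[OF sM(1) y(1)] vec.subspace_scale[OF sM(1) ptM]] by metis
  have "M = ln z \<kappa>" unfolding ln_def by (rule lineI2[OF sM(2) ptM kM dim_ln])
  moreover have "line_at z \<kappa>"
    unfolding line_at_def using q.XL_D(2)[OF M(1)] vec.subspace_add[OF sM(1) ptM vec.subspace_scale[OF sM(1) kM]] by blast
  ultimately show ?thesis by blast
qed

lemma pt_in_ln: "pt z \<in> ln z \<kappa>"
  unfolding ln_def by (rule vec.span_base) simp

lemma pt_in_ln_unique: "pt z' \<in> ln z \<kappa> \<Longrightarrow> z' = z"
proof -
  assume "pt z' \<in> ln z \<kappa>"
  then obtain \<alpha> \<beta> where e: "pt z' = \<alpha> *s pt z + \<beta> *s (\<kappa> *s u + N z)" unfolding ln_def mem_span2 by blast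
  have "pt z' = pt z + (z' - z) *s u" by (simp add: pt_def vec_eq_iff algebra_simps)
  hence "(\<beta> * \<kappa> - (z' - z)) *s u + (\<alpha> - 1) *s pt z + \<beta> *s N z = 0"
    using e by (simp add: vec_eq_iff algebra_simps)
  hence "\<beta> * \<kappa> - (z' - z) = 0 \<and> \<alpha> - 1 = 0 \<and> \<beta> = 0" by (rule u_pt_N_indep)
  thus ?thesis by auto
qed

end

context quintic_lines
begin

definition nb where "nb L = {M \<in> S. M \<noteq> L \<and> L \<inter> M \<noteq> {0}}"

abbreviation "ql L \<equiv> quintic_line F (U L) (V L) (N1 L) (N2 L)"
abbreviation "ptL L \<equiv> quintic_line.pt (U L) (V L)"
abbreviation "WL L \<equiv> quintic_line.W F (U L) (V L) (N1 L) (N2 L)"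

lemma ql: assumes "L \<in> S"
  shows "ql L" "L = vec.span {U L, V L}" "degree (WL L) = 6" "M \<in> S \<Longrightarrow> M \<noteq> L \<Longrightarrow> \<exists>w\<in>M. D F (U L) w \<noteq> 0"
  using adapted[OF assms] by (auto simp: adapted_def)

definition lcoords where
  "lcoords L M = (SOME c. M = quintic_line.ln F (U L) (V L) (N1 L) (N2 L) (fst c) (snd c)
     \<and> quintic_line.line_at F (U L) (V L) (N1 L) (N2 L) (fst c) (snd c))"
definition pos where "pos L M = fst (lcoords L M)"
definition slope where "slope L M = snd (lcoords L M)"

lemma finite_nb: "finite (nb L)" using S(1) by (simp add: nb_def)

lemma nb_point:
  assumes "L \<in> S" "M \<in> nb L" shows "\<exists>p. p \<in> L \<and> p \<in> M \<and> p \<noteq> 0"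
proof -
  have "vec.subspace L" "vec.subspace M" using assms S XL_D by (auto simp: nb_def)
  hence "0 \<in> L \<inter> M" by (simp add: vec.subspace_0)
  thus ?thesis using assms(2) by (auto simp: nb_def)
qed

lemma lcoords:
  assumes "L \<in> S" "M \<in> nb L"
  shows "M = quintic_line.ln F (U L) (V L) (N1 L) (N2 L) (pos L M) (slope L M)"
    "quintic_line.line_at F (U L) (V L) (N1 L) (N2 L) (pos L M) (slope L M)"
proof -
  interpret Q: quintic_line F "U L" "V L" "N1 L" "N2 L" by (rule ql(1)[OF assms(1)])
  have M: "M \<in> S" "M \<noteq> L" using assms(2) by (auto simp: nb_def)
  obtain p where p: "p \<in> L" "p \<in> M" "p \<noteq> 0" using nb_point[OF assms] by blast
  obtain w where w: "w \<in> M" "D F (U L) w \<noteq> 0" using ql(4)[OF assms(1) M] by blast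
  have "\<exists>z \<kappa>. M = Q.ln z \<kappa> \<and> Q.line_at z \<kappa>"
    using Q.meet_coords[OF _ w _ p(2) _ p(3)] M S(2) p(1) ql(2)[OF assms(1)] by blast
  hence "\<exists>c. M = Q.ln (fst c) (snd c) \<and> Q.line_at (fst c) (snd c)" by auto
  from someI_ex[OF this] show "M = Q.ln (pos L M) (slope L M)" "Q.line_at (pos L M) (slope L M)"
    unfolding pos_def slope_def lcoords_def by blast+
qed

lemma pt_pos_in: "L \<in> S \<Longrightarrow> M \<in> nb L \<Longrightarrow> ptL L (pos L M) \<in> M"
  using quintic_line.pt_in_ln[OF ql(1)] lcoords(1) by metis

lemma pos_unique: "L \<in> S \<Longrightarrow> M \<in> nb L \<Longrightarrow> ptL L z \<in> M \<Longrightarrow> z = pos L M"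
  using quintic_line.pt_in_ln_unique[OF ql(1)] lcoords(1) by metis

text \<open>\<open>sk L\<close> says that \<open>L\<close> is a line of the second kind in the sense of Segre.\<close>

definition sk where "sk L \<longleftrightarrow> quintic_line.e2 F (U L) (V L) (N1 L) (N2 L) = 0"
definition flat where "flat L \<longleftrightarrow> sk L \<and> quintic_line.e3 F (U L) (V L) (N1 L) (N2 L) = 0
   \<and> quintic_line.e4 F (U L) (V L) (N1 L) (N2 L) = 0"

lemma valency:
  assumes L: "L \<in> S"
  shows "\<not> sk L \<Longrightarrow> card (nb L) \<le> 26" "\<not> flat L \<Longrightarrow> card (nb L) \<le> 29"
    "\<not> flat L \<Longrightarrow> card (nb L) = 29 \<Longrightarrow> poly (WL L) z = 0 \<Longrightarrow> order z (WL L) = 2 \<and> card {M \<in> nb L. pos L M = z} \<le> 1"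
    "poly (WL L) z \<noteq> 0 \<Longrightarrow> card {M \<in> nb L. pos L M = z} \<le> 1"
proof -
  interpret Q: quintic_line F "U L" "V L" "N1 L" "N2 L" by (rule ql(1)[OF L])
  define \<Lambda> where "\<Lambda> = (\<lambda>M. (pos L M, slope L M)) ` nb L"
  have fin: "finite \<Lambda>" unfolding \<Lambda>_def using finite_nb by blast
  have inj: "inj_on (\<lambda>M. (pos L M, slope L M)) (nb L)"
  proof (rule inj_onI)
    fix M M' assume "M \<in> nb L" "M' \<in> nb L" "(pos L M, slope L M) = (pos L M', slope L M')"
    thus "M = M'" using lcoords(1)[OF L] by (metis prod.inject)
  qed
  have c: "card \<Lambda> = card (nb L)" unfolding \<Lambda>_def by (rule card_image[OF inj])
  have la: "Q.line_at z \<kappa>" if "(z, \<kappa>) \<in> \<Lambda>" for z \<kappa> using that lcoords(2)[OF L] by (auto simp: \<Lambda>_def)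
  have cf: "card (Q.fibre \<Lambda> z) = card {M \<in> nb L. pos L M = z}" for z
  proof -
    have "Q.fibre \<Lambda> z = slope L ` {M \<in> nb L. pos L M = z}" by (auto simp: Q.fibre_def \<Lambda>_def)
    moreover have "inj_on (slope L) {M \<in> nb L. pos L M = z}"
      using inj by (auto simp: inj_on_def)
    ultimately show ?thesis by (simp add: card_image)
  qed
  have dW: "degree Q.W = 6" by (rule ql(3)[OF L])
  note T = Q.valency_first_kind[OF fin la dW] Q.valency_second_kind[OF fin la dW] Q.valency_third_kind[OF fin la dW]
  show "\<not> sk L \<Longrightarrow> card (nb L) \<le> 26" using T(1) unfolding sk_def c by blast
  show "card (nb L) \<le> 29" if f: "\<not> flat L"
  proof -
    consider "Q.e2 \<noteq> 0" | "Q.e2 = 0" "Q.e3 \<noteq> 0" | "Q.e2 = 0" "Q.e3 = 0" "Q.e4 \<noteq> 0" using f unfolding flat_def sk_def by blast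
    thus ?thesis using T(1,2,4) unfolding c by cases fastforce+
  qed
  show "order z Q.W = 2 \<and> card {M \<in> nb L. pos L M = z} \<le> 1" if f: "\<not> flat L" "card (nb L) = 29" "poly Q.W z = 0"
  proof -
    have "Q.e2 = 0" using T(1) f unfolding c by fastforce
    moreover have "Q.e3 \<noteq> 0" using T(4) f \<open>Q.e2 = 0\<close> unfolding c flat_def sk_def by fastforce
    ultimately show ?thesis using T(3)[of z] f unfolding c cf by blast
  qed
  show "card {M \<in> nb L. pos L M = z} \<le> 1" if "poly Q.W z \<noteq> 0"
    using Q.bounds(7)[OF fin la dW, of z] that unfolding cf by (simp add: order_root)
qed

end

lemma lines_in_hyperplane_meet:
  fixes P :: "('k::field ^ 4) set"
  assumes "vec.subspace P" "P \<noteq> UNIV" "is_line L" "is_line M" "L \<subseteq> P" "M \<subseteq> P"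
  shows "\<exists>x. x \<in> L \<and> x \<in> M \<and> x \<noteq> 0"
proof -
  have sub: "vec.subspace L" "vec.subspace M" using assms by (auto simp: is_line_def)
  have "{x + y |x y. x \<in> L \<and> y \<in> M} \<subseteq> P" using assms vec.subspace_add[OF assms(1)] by blast
  hence "vec.dim {x + y |x y. x \<in> L \<and> y \<in> M} \<le> vec.dim P" by (rule vec.dim_subset)
  moreover have "vec.dim P \<noteq> 4"
  proof
    assume "vec.dim P = 4"
    hence "vec.dim P = vec.dimension TYPE('k) TYPE(4)" by (simp add: card_cart_basis vec.dimension_def)
    hence "vec.span P = UNIV" using vec.dim_eq_full by blast
    moreover have "vec.span P = P" using assms(1) by (simp add: vec.span_eq_iff)
    ultimately show False using assms(2) by simp
  qed
  moreover have "vec.dim P \<le> 4" using vec.dim_subset[of P UNIV] by (simp add: card_cart_basis)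
  ultimately have "vec.dim (L \<inter> M) \<noteq> 0"
    using vec.dim_sums_Int[OF sub] assms(3,4) unfolding is_line_def by linarith
  thus ?thesis unfolding vec.dim_eq_0 by auto
qed

context quintic_line
begin

text \<open>Being a second derivative of F, it is symmetric; this carries the property of being
  unramified from one of two meeting lines to the other.\<close>

lemma mixed_derivative:
  assumes "y = \<alpha> *s u + \<beta> *s pt z + c *s N z"
  shows "D (\<lambda>q. D F q y) (pt z) u = c * poly W z"
proof -
  define p where "p = smult (- c * poly b z) a + smult (c * poly a z) b"
  have y: "y = (\<alpha> + \<beta> * z) *s u + \<beta> *s v + (- c * poly b z) *s n1 + (c * poly a z) *s n2"
    unfolding assms by (simp add: N_def pt_def vec_eq_iff algebra_simps)
  have "lp (\<lambda>q. D F q y) (pt z) u = pcompose p [:z, 1:]"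
  proof (rule lp_unique)
    fix t
    have "pt z + t *s u = pt (z + t)" by (simp add: pt_def vec.scale_left_distrib add.assoc)
    hence "D F (pt z + t *s u) y = (- c * poly b z) * poly a (z + t) + (c * poly a z) * poly b (z + t)"
      unfolding y by (simp only: D_pt)
    thus "poly (pcompose p [:z, 1:]) t = D F (pt z + t *s u) y" by (simp add: poly_pcompose p_def)
  qed
  hence "D (\<lambda>q. D F q y) (pt z) u = poly (pderiv (pcompose p [:z, 1:])) 0"
    unfolding D_def by (simp add: coeff_1_eq_pderiv[symmetric])
  thus ?thesis
    by (simp add: pderiv_pcompose poly_pcompose pderiv_pCons p_def W_def pderiv_add pderiv_diff pderiv_smult algebra_simps)
qed

lemma dir_of_line_at:
  assumes "line_at z \<kappa>" shows "dir z = (- poly W z) *s (\<kappa> *s u + N z)"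
proof -
  have "lp F (pt z) (\<kappa> *s u + 1 *s N z) = 0"
    using assms by (intro lp_unique) (simp add: line_at_def)
  hence "(\<Sum>m\<le>2. 1^m * \<kappa>^(2-m) * poly (H m (2-m)) z) = 0" using coeff_lp_dir[of z \<kappa> 1 2] by simp
  hence "\<kappa> * poly W z + poly Q z = 0"
    using H0[of 2] H11 by (simp add: eval_nat_numeral Q_def)
  hence "poly Q z = - (\<kappa> * poly W z)" by (simp add: eq_neg_iff_add_eq_0 add.commute)
  thus ?thesis by (simp add: dir_def vec_eq_iff algebra_simps)
qed

end

context quintic_lines
begin

lemma nb_sym: "L \<in> S \<Longrightarrow> M \<in> nb L \<Longrightarrow> L \<in> nb M \<and> M \<in> S"
  by (auto simp: nb_def Int_commute)

lemma intersection_unique: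
  assumes "L \<in> S" "M \<in> S" "L \<noteq> M" "p \<in> L" "p \<in> M" "q \<in> L" "q \<in> M" "p \<noteq> 0" "q \<noteq> 0"
  shows "\<exists>c. c \<noteq> 0 \<and> q = c *s p"
proof -
  have "q \<in> vec.span {p}"
  proof (rule ccontr)
    assume "q \<notin> vec.span {p}"
    hence "vec.dim {p, q} = 2" using two_points assms(8) by blast
    hence "L = M" using lineI2[of L p q] lineI2[of M p q] assms S(2) XL_D(1) by blast
    thus False using assms(3) by blast
  qed
  then obtain c where "q = c *s p" using mem_span1 by blast
  thus ?thesis using assms(9) by auto
qed

lemma U_notin: "L \<in> S \<Longrightarrow> M \<in> S \<Longrightarrow> L \<noteq> M \<Longrightarrow> U L \<notin> M"
  using ql(4)[of L M] XL_tangent[of M "U L"] S(2) by blast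

lemma U_in: "L \<in> S \<Longrightarrow> U L \<in> L"
  using ql(2)[of L] vec.span_base[of "U L" "{U L, V L}"] by auto

lemma pt_in: "L \<in> S \<Longrightarrow> ptL L z \<in> L"
  using quintic_line.pt_in_line[OF ql(1), of L z] ql(2)[of L] by simp

lemma pt_nonzero: "L \<in> S \<Longrightarrow> ptL L z \<noteq> 0"
  using quintic_line.pt_nz[OF ql(1)] by blast

text \<open>As M is of the second kind, the lines spanned by \<open>pt x\<close> and
  \<open>dir x\<close> along M all have contact of order four, and at the common point this line is
  L. Differentiating the family gives vectors y + s y' along L that lie in the tangent planes up to
  order s^4, as \<open>Schw_zero\<close> requires.\<close>

lemma Schw_second_kind:
  assumes L: "L \<in> S" and M: "M \<in> nb L" and sk: "sk M" and W: "poly (WL L) (pos L M) \<noteq> 0"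
  shows "poly (quintic_line.Schw F (U L) (V L) (N1 L) (N2 L)) (pos L M) = 0"
proof -
  have MS: "M \<in> S" "L \<in> nb M" "L \<noteq> M" using nb_sym[OF L M] M by (auto simp: nb_def)
  interpret Q: quintic_line F "U L" "V L" "N1 L" "N2 L" by (rule ql(1)[OF L])
  interpret R: quintic_line F "U M" "V M" "N1 M" "N2 M" by (rule ql(1)[OF MS(1)])
  define z where "z = pos L M"
  define z' where "z' = pos M L"
  have p: "Q.pt z \<in> L" "Q.pt z \<in> M" "R.pt z' \<in> M" "R.pt z' \<in> L"
    unfolding z_def z'_def using pt_in pt_pos_in L M MS by blast+
  obtain \<beta> where \<beta>: "\<beta> \<noteq> 0" "R.pt z' = \<beta> *s Q.pt z"
    using intersection_unique[OF L MS(1) MS(3) p(1,2,4,3) Q.pt_nz R.pt_nz] by blast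
  have LX: "L \<in> XL" "M \<in> XL" using S(2) L MS by auto
  have sL: "vec.subspace L" by (rule XL_D(3)[OF LX(1)])
  obtain c \<alpha>1 \<beta>1 where uM: "U M = \<alpha>1 *s U L + \<beta>1 *s Q.pt z + c *s Q.N z"
    using Q.tangent_direction[OF XL_tangent[OF LX(2) p(2) U_in[OF MS(1)]]] by blast
  have "c \<noteq> 0"
  proof
    assume "c = 0"
    hence "U M \<in> L" unfolding uM using vec.subspace_add[OF sL] vec.subspace_scale[OF sL] U_in[OF L] p(1) by simp
    thus False using U_notin[OF MS(1) L] MS(3) by blast
  qed
  obtain c' \<alpha>2 \<beta>2 where uL: "U L = \<alpha>2 *s U M + \<beta>2 *s R.pt z' + c' *s R.N z'"
    using R.tangent_direction[OF XL_tangent[OF LX(1) p(4) U_in[OF L]]] by blast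
  \<comment> \<open>Read with L as the base line this is a nonzero multiple of its Wronskian; by
    symmetry M is unramified at the common point too.\<close>
  have "D (\<lambda>q. D F q (U M)) (Q.pt z) (U L) \<noteq> 0"
    unfolding Q.mixed_derivative[OF uM] using \<open>c \<noteq> 0\<close> W by (simp add: z_def)
  moreover have "D (\<lambda>q. D F q (U L)) (R.pt z') (U M) = \<beta>^3 * D (\<lambda>q. D F q (U L)) (Q.pt z) (U M)"
    unfolding \<beta>(2) using form_scale[OF form_D[OF Q.form4, of "U L" "U M"], of \<beta> "Q.pt z"] by simp
  ultimately have "D (\<lambda>q. D F q (U L)) (R.pt z') (U M) \<noteq> 0"
    using D_commute[OF formF, of "U M" "Q.pt z" "U L"] \<beta>(1) by simp
  hence W': "poly R.W z' \<noteq> 0" unfolding R.mixed_derivative[OF uL] by simp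
  define \<kappa> where "\<kappa> = slope M L"
  have la: "R.line_at z' \<kappa>" "L = R.ln z' \<kappa>" unfolding z'_def \<kappa>_def using lcoords[OF MS(1,2)] by blast+
  have d: "R.dir z' = (- poly R.W z') *s (\<kappa> *s U M + R.N z')" by (rule R.dir_of_line_at[OF la(1)])
  have "U L \<in> vec.span {R.pt z', \<kappa> *s U M + R.N z'}" using U_in[OF L] la(2) by (simp add: R.ln_def)
  then obtain s1 s2 where s: "U L = s1 *s R.pt z' + s2 *s (\<kappa> *s U M + R.N z')" unfolding mem_span2 by blast
  have "s2 \<noteq> 0"
  proof
    assume "s2 = 0"
    hence "U L = s1 *s R.pt z'" using s by simp
    hence "U L \<in> M" using vec.subspace_scale[OF XL_D(3)[OF LX(2)] p(3)] by simp
    thus False using U_notin[OF L MS(1)] MS(3) by blast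
  qed
  \<comment> \<open>c1 and e are chosen so that dir z' + e pt z' becomes c1 \<open>U L\<close>: the
    parameter \<tau> of the family then runs along L.\<close>
  define c1 where "c1 = - poly R.W z' / s2"
  define e where "e = poly R.W z' * (- s1) / s2"
  have c1: "c1 \<noteq> 0" using W' \<open>s2 \<noteq> 0\<close> by (simp add: c1_def)
  have de: "R.dir z' + e *s R.pt z' = c1 *s U L"
    unfolding d s c1_def e_def using \<open>s2 \<noteq> 0\<close> by (simp add: vec_eq_iff field_simps)
  obtain y' r where r: "\<And>\<tau>. D F (R.pt z' + \<tau> *s (R.dir z' + e *s R.pt z')) (U M + \<tau> *s y') = \<tau>^4 * poly r \<tau>"
    using R.second_kind_deformation[of z' e] sk unfolding sk_def by blast
  have r': "D F (Q.pt (z + s)) (U M + s *s ((\<beta> / c1) *s y')) = s^4 * poly (smult (1 / c1^4) (pcompose r [:0, \<beta> / c1:])) s" for s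
  proof -
    have pp: "R.pt z' + (s * \<beta> / c1) *s (c1 *s U L) = \<beta> *s Q.pt (z + s)"
      using c1 by (simp add: \<beta>(2) Q.pt_def vec_eq_iff field_simps)
    have "D F (\<beta> *s Q.pt (z + s)) (U M + (s * \<beta> / c1) *s y') = (s * \<beta> / c1)^4 * poly r (s * \<beta> / c1)"
      using r[of "s * \<beta> / c1"] unfolding de pp .
    moreover have "D F (\<beta> *s x) w = \<beta>^4 * D F x w" for x w by (rule form_scale[OF Q.form4])
    ultimately have "\<beta>^4 * D F (Q.pt (z + s)) (U M + (s * \<beta> / c1) *s y') = (s * \<beta> / c1)^4 * poly r (s * \<beta> / c1)" by simp
    hence "D F (Q.pt (z + s)) (U M + (s * \<beta> / c1) *s y') = s^4 / c1^4 * poly r (s * \<beta> / c1)"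
      using \<beta>(1) c1 by (simp add: field_simps power_mult_distrib power_divide)
    thus ?thesis by (simp add: poly_pcompose field_simps)
  qed
  have ue: "U M = (\<alpha>1 + \<beta>1 * z) *s U L + \<beta>1 *s V L + (- c * poly Q.b z) *s N1 L + (c * poly Q.a z) *s N2 L"
    by (subst uM) (simp add: Q.N_def Q.pt_def vec_eq_iff algebra_simps)
  have "(- c * poly Q.b z, c * poly Q.a z) \<noteq> (0, 0)" using Q.ab_nz[of z] \<open>c \<noteq> 0\<close> by auto
  thus ?thesis using Q.Schw_zero[OF ue _ r'] unfolding z_def by blast
qed

end

section \<open>Triangles and completely split planes\<close>

definition tangent_plane :: "('k::comm_ring_1 ^ 4 \<Rightarrow> 'k) \<Rightarrow> 'k ^ 4 \<Rightarrow> ('k ^ 4) set" where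
  "tangent_plane F p = {w. D F p w = 0}"

context quintic
begin

text \<open>Four distinct lines suffice, because the residual factor of the quintic on the plane is
  linear; the fifth line may coincide with one of the four.\<close>

definition split_plane :: "('k ^ 4) set \<Rightarrow> bool" where
  "split_plane P \<longleftrightarrow> vec.subspace P \<and> P \<noteq> UNIV \<and> (\<exists>T. T \<subseteq> XL \<and> card T = 4 \<and> (\<forall>L\<in>T. L \<subseteq> P))"

lemma tangent_plane:
  assumes "p \<noteq> 0" shows "vec.subspace (tangent_plane F p)" "tangent_plane F p \<noteq> UNIV"
proof -
  have "D F p 0 = 0" using D_scale[OF formF, of p 0 0] by simp
  thus "vec.subspace (tangent_plane F p)"
    by (auto simp: tangent_plane_def vec.subspace_def D_plus[OF formF] D_scale[OF formF])
  show "tangent_plane F p \<noteq> UNIV" using smooth[OF assms] by (auto simp: tangent_plane_def)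
qed

lemma XL_in_tangent_plane: "L \<in> XL \<Longrightarrow> p \<in> L \<Longrightarrow> L \<subseteq> tangent_plane F p"
  using XL_tangent by (auto simp: tangent_plane_def)

end

context quintic_lines
begin

text \<open>The plane of the triangle is tangent at the zeros of a quartic g on L. If all are
  unramified they are four distinct points, so there is one off M1 and M2. Through it runs a line R
  of the plane with contact of order four, on which F has at most one other zero. Meeting M1 and M2
  forces F to vanish on R, and R is a fourth line in the plane.\<close>

lemma triangle_ramified:
  assumes ns: "\<And>P. \<not> split_plane P" and L: "L \<in> S" "sk L"
    and M: "M1 \<in> nb L" "M2 \<in> nb L" "M1 \<noteq> M2" "M1 \<inter> M2 \<noteq> {0}"
  shows "\<exists>z. poly (WL L) z = 0 \<and> M1 \<subseteq> tangent_plane F (ptL L z) \<and> M2 \<subseteq> tangent_plane F (ptL L z)"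
proof (rule ccontr)
  assume no: "\<not> ?thesis"
  interpret Q: quintic_line F "U L" "V L" "N1 L" "N2 L" by (rule ql(1)[OF L(1)])
  have MS: "M1 \<in> S" "M2 \<in> S" "M1 \<noteq> L" "M2 \<noteq> L" using M by (auto simp: nb_def)
  have X: "L \<in> XL" "M1 \<in> XL" "M2 \<in> XL" using S(2) L MS by auto
  have "M2 \<in> nb M1" using M MS by (auto simp: nb_def)
  then obtain q where q: "q \<in> M1" "q \<in> M2" "q \<noteq> 0" using nb_point[OF MS(1)] by blast
  let ?T = "\<lambda>z. tangent_plane F (Q.pt z)"
  define z1 where "z1 = pos L M1"
  define z2 where "z2 = pos L M2"
  have p: "Q.pt z1 \<in> M1" "Q.pt z2 \<in> M2" unfolding z1_def z2_def using pt_pos_in L M by blast+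
  have pL: "Q.pt z \<in> L" for z by (rule pt_in[OF L(1)])
  have T: "vec.subspace (?T z)" "?T z \<noteq> UNIV" for z
    by (rule tangent_plane[OF Q.pt_nz])+
  have TL: "L \<subseteq> ?T z" for z by (rule XL_in_tangent_plane[OF X(1) pL])
  have span_in: "M \<subseteq> ?T z"
    if M: "M \<in> XL" "x \<in> M" "x \<noteq> 0" "y \<in> M" "y \<notin> vec.span {x}" "x \<in> ?T z" "y \<in> ?T z" for M x y z
  proof -
    have "M = vec.span {x, y}" using lineI2[OF XL_D(1)[OF M(1)] M(2,4) two_points[OF M(3,5)]] .
    thus ?thesis using vec.span_minimal[of "{x,y}", OF _ T(1)] M(6,7) by simp
  qed
  obtain w where w: "w \<in> M1" "D F (U L) w \<noteq> 0" using ql(4)[OF L(1) MS(1,3)] by blast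
  obtain \<alpha> \<beta> \<gamma> \<delta> where we: "w = \<alpha> *s U L + \<beta> *s V L + \<gamma> *s N1 L + \<delta> *s N2 L" using Q.spans by blast
  define g where "g = smult \<gamma> Q.a + smult \<delta> Q.b"
  have g: "poly g z = D F (Q.pt z) w" for z unfolding we Q.D_pt by (simp add: g_def)
  have "coeff g 4 = D F (U L) w"
  proof -
    have "D F (U L) (\<alpha> *s U L + \<beta> *s V L) = 0" using Q.D_on_line[of 1 0 \<alpha> \<beta>] by simp
    thus ?thesis unfolding we g_def by (simp add: Q.coeff_a4 Q.coeff_b4 D_plus[OF formF] D_scale[OF formF])
  qed
  hence "4 \<le> degree g" "g \<noteq> 0" using w by (auto intro: le_degree)
  moreover have "degree g \<le> 4" unfolding g_def using Q.deg_a Q.deg_b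
    by (intro degree_add_le) (auto intro: order_trans[OF degree_smult_le])
  ultimately have dg: "degree g = 4" "g \<noteq> 0" by simp_all
  have gT: "M1 \<subseteq> ?T z" if z: "poly g z = 0" for z
  proof (rule span_in[OF X(2) p(1) Q.pt_nz w(1)])
    show "Q.pt z1 \<in> ?T z" using TL pL by blast
    show "w \<in> ?T z" using z g by (simp add: tangent_plane_def)
    show "w \<notin> vec.span {Q.pt z1}"
    proof
      assume "w \<in> vec.span {Q.pt z1}"
      hence "w \<in> L" using pL[of z1] vec.span_minimal[of "{Q.pt z1}" L] XL_D(3)[OF X(1)] by auto
      thus False using w(2) XL_tangent[OF X(1) U_in[OF L(1)]] by blast
    qed
  qed
  have c1: "card {M \<in> nb L. pos L M = z} \<le> 1" if "poly Q.W z \<noteq> 0" for z using valency(4)[OF L(1) that] .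
  have g1: "poly g z1 = 0" using XL_tangent[OF X(2) p(1) w(1)] g by simp
  have tz: "z1 \<noteq> z2"
  proof
    assume e: "z1 = z2"
    have "M1 \<subseteq> ?T z1" "M2 \<subseteq> ?T z1"
      using XL_in_tangent_plane X p e by auto
    hence "poly Q.W z1 \<noteq> 0" using no by blast
    hence "card {M \<in> nb L. pos L M = z1} \<le> 1" by (rule c1)
    moreover have "{M1, M2} \<subseteq> {M \<in> nb L. pos L M = z1}" using M e by (auto simp: z1_def z2_def)
    ultimately have "card {M1, M2} \<le> 1" using card_mono[of "{M \<in> nb L. pos L M = z1}" "{M1,M2}"] finite_nb by simp
    thus False using M(3) by simp
  qed
  have qL: "q \<notin> L"
  proof
    assume "q \<in> L"
    then obtain c c' where "c \<noteq> 0" "q = c *s Q.pt z1" "c' \<noteq> 0" "q = c' *s Q.pt z2"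
      using intersection_unique[OF L(1) MS(1) MS(3)[symmetric] pL p(1) _ q(1) Q.pt_nz q(3)]
        intersection_unique[OF L(1) MS(2) MS(4)[symmetric] pL p(2) _ q(2) Q.pt_nz q(3)] by blast
    hence "Q.pt z1 = (c' / c) *s Q.pt z2" by (simp add: vec_eq_iff field_simps)
    hence "Q.pt z1 \<in> M2" using p(2) vec.subspace_scale[OF XL_D(3)[OF X(3)]] by simp
    thus False using pos_unique[OF L(1) M(2)] tz by (simp add: z2_def)
  qed
  have qspan: "q \<notin> vec.span {Q.pt z}" for z
    using qL pL[of z] vec.span_minimal[of "{Q.pt z}" L] XL_D(3)[OF X(1)] by auto
  have M2T: "M2 \<subseteq> ?T z" if "M1 \<subseteq> ?T z" for z
    by (rule span_in[OF X(3) p(2) Q.pt_nz q(2) qspan]) (use TL pL q(1) that in blast)+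
  have g2: "poly g z2 = 0"
  proof -
    have "M1 \<subseteq> ?T z2"
    proof (rule span_in[OF X(2) p(1) Q.pt_nz q(1) qspan])
      show "Q.pt z1 \<in> ?T z2" using TL pL by blast
      show "q \<in> ?T z2" using XL_in_tangent_plane[OF X(3) p(2)] q(2) by blast
    qed
    thus ?thesis using w(1) g by (auto simp: tangent_plane_def)
  qed
  have W: "poly Q.W z \<noteq> 0" if "poly g z = 0" for z using no gT[OF that] M2T by blast
  \<comment> \<open>A multiple zero of a member of the pencil spanned by a and b is a zero of the
    Wronskian.\<close>
  have o: "order z g = 1" if z: "poly g z = 0" for z
  proof -
    have gd: "(\<gamma>, \<delta>) \<noteq> (0, 0)" using dg by (auto simp: g_def)
    have "poly (pderiv g) z \<noteq> 0"
    proof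
      assume d: "poly (pderiv g) z = 0"
      have "\<gamma> * poly Q.W z = poly (pderiv Q.b) z * poly g z - poly Q.b z * poly (pderiv g) z"
        "\<delta> * poly Q.W z = poly Q.a z * poly (pderiv g) z - poly (pderiv Q.a) z * poly g z"
        by (simp_all add: g_def Q.W_def pderiv_add pderiv_smult algebra_simps)
      thus False using d z W[OF z] gd by auto
    qed
    hence "order z (pderiv g) = 0" by (simp add: order_root)
    moreover have "pderiv g \<noteq> 0" using \<open>poly (pderiv g) z \<noteq> 0\<close> by auto
    ultimately show ?thesis using order_pderiv[OF dg(2) z] by simp
  qed
  have "card {z. poly g z = 0} = 4"
  proof -
    have "(\<Sum>z\<in>{z. poly g z = 0}. order z g) = (\<Sum>z\<in>{z. poly g z = 0}. 1)" using o by (intro sum.cong) auto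
    thus ?thesis using sum_order_eq_degree[OF dg(2)] dg(1) by simp
  qed
  have "\<not> {z. poly g z = 0} \<subseteq> {z1, z2}"
  proof
    assume "{z. poly g z = 0} \<subseteq> {z1, z2}"
    hence "card {z. poly g z = 0} \<le> card {z1, z2}" by (intro card_mono) auto
    thus False using \<open>card {z. poly g z = 0} = 4\<close> card_insert_le_m1[of 2 "{z2}" z1] by simp
  qed
  then obtain z3 where z3: "poly g z3 = 0" "z3 \<noteq> z1" "z3 \<noteq> z2" by blast
  let ?P = "?T z3"
  have W3: "poly Q.W z3 \<noteq> 0" by (rule W[OF z3(1)])
  have P: "L \<subseteq> ?P" "M1 \<subseteq> ?P" "M2 \<subseteq> ?P" using TL gT[OF z3(1)] M2T by blast+
  define d where "d = Q.dir z3"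
  have dP: "d \<in> ?P"
    unfolding d_def Q.dir_def tangent_plane_def mem_Collect_eq D_linear[OF formF] Q.D_u Q.N_tangent by simp
  have dsp: "d \<notin> vec.span {U L, V L}"
  proof
    assume "d \<in> vec.span {U L, V L}"
    then obtain \<alpha> \<beta> where "d = \<alpha> *s U L + \<beta> *s V L" unfolding mem_span2 by blast
    hence "(\<alpha> - \<beta> * z3 - poly Q.Q z3) *s U L + \<beta> *s Q.pt z3 + poly Q.W z3 *s Q.N z3 = 0"
      unfolding d_def Q.dir_def Q.pt_def by (simp add: vec_eq_iff algebra_simps)
    hence "poly Q.W z3 = 0" using Q.u_pt_N_indep by blast
    thus False using W3 by simp
  qed
  hence dL: "d \<notin> L" using ql(2)[OF L(1)] by simp
  have p3: "Q.pt z3 \<notin> M1" "Q.pt z3 \<notin> M2"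
    using pos_unique[OF L(1) M(1), of z3] pos_unique[OF L(1) M(2), of z3] z3 by (auto simp: z1_def z2_def)
  define R where "R = vec.span {Q.pt z3, d}"
  have dR: "vec.dim {Q.pt z3, d} = 2"
  proof (rule two_points[OF Q.pt_nz])
    show "d \<notin> vec.span {Q.pt z3}" using dL pL[of z3] vec.span_minimal[of "{Q.pt z3}" L] XL_D(3)[OF X(1)] by auto
  qed
  have Rl: "is_line R" unfolding R_def by (rule is_line_span2[OF dR])
  have RP: "R \<subseteq> ?P" unfolding R_def using dP TL pL by (intro vec.span_minimal[OF _ T(1)]) auto
  define k4 where "k4 = - poly (Q.W * Q.e3) z3"
  define k5 where "k5 = - poly (Q.W * Q.e4) z3"
  have l: "lp F (Q.pt z3) d = [:0, 0, 0, 0, k4, k5:]"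
    using Q.lp_dir[of z3] L(2) unfolding sk_def d_def k4_def k5_def by simp
  have FR: "F (\<alpha> *s Q.pt z3 + \<beta> *s d) = \<beta>^4 * (\<alpha> * k4 + \<beta> * k5)" for \<alpha> \<beta>
  proof (cases "\<alpha> = 0")
    case True
    have "F d = k5" using coeff_lp_top[OF formF, of "Q.pt z3" d] unfolding l by (simp add: eval_nat_numeral)
    thus ?thesis using True form_scale[OF formF, of \<beta> d] by (simp add: eval_nat_numeral)
  next
    case False
    have "\<alpha> *s Q.pt z3 + \<beta> *s d = \<alpha> *s (Q.pt z3 + (\<beta> / \<alpha>) *s d)"
      using False by (simp add: vec.scale_right_distrib)
    hence "F (\<alpha> *s Q.pt z3 + \<beta> *s d) = \<alpha>^5 * poly (lp F (Q.pt z3) d) (\<beta> / \<alpha>)"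
      by (simp add: form_scale[OF formF] poly_lp[OF formF])
    also have "\<alpha>^5 * poly (lp F (Q.pt z3) d) (\<beta> / \<alpha>) = \<beta>^4 * (\<alpha> * k4 + \<beta> * k5)"
      using False unfolding l by (simp add: field_simps eval_nat_numeral)
    finally show ?thesis .
  qed
  have r: "\<exists>\<alpha> \<beta>. \<beta> \<noteq> 0 \<and> \<alpha> *s Q.pt z3 + \<beta> *s d \<in> M \<and> \<alpha> * k4 + \<beta> * k5 = 0"
    if M: "M \<in> XL" "M \<subseteq> ?P" "Q.pt z3 \<notin> M" for M
  proof -
    obtain x where x: "x \<in> R" "x \<in> M" "x \<noteq> 0"
      using lines_in_hyperplane_meet[OF T Rl XL_D(1)[OF M(1)] RP M(2)] by blast
    obtain \<alpha> \<beta> where xe: "x = \<alpha> *s Q.pt z3 + \<beta> *s d" using x(1) unfolding R_def mem_span2 by blast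
    have b: "\<beta> \<noteq> 0"
    proof
      assume "\<beta> = 0"
      hence "\<alpha> \<noteq> 0" "Q.pt z3 = inverse \<alpha> *s x" using xe x(3) by auto
      thus False using M(3) vec.subspace_scale[OF XL_D(3)[OF M(1)] x(2), of "inverse \<alpha>"] by simp
    qed
    have "F x = 0" by (rule XL_D(2)[OF M(1) x(2)])
    thus ?thesis using b x(2) unfolding xe FR by auto
  qed
  obtain \<alpha>1 \<beta>1 where r1: "\<beta>1 \<noteq> 0" "\<alpha>1 *s Q.pt z3 + \<beta>1 *s d \<in> M1" "\<alpha>1 * k4 + \<beta>1 * k5 = 0" using r[OF X(2) P(2) p3(1)] by blast
  obtain \<alpha>2 \<beta>2 where r2: "\<beta>2 \<noteq> 0" "\<alpha>2 *s Q.pt z3 + \<beta>2 *s d \<in> M2" "\<alpha>2 * k4 + \<beta>2 * k5 = 0" using r[OF X(3) P(3) p3(2)] by blast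
  have k4: "k4 = 0"
  proof (cases "\<alpha>1 * \<beta>2 = \<alpha>2 * \<beta>1")
    case False
    have "(\<alpha>1 * \<beta>2 - \<alpha>2 * \<beta>1) * k4 = \<beta>2 * (\<alpha>1 * k4 + \<beta>1 * k5) - \<beta>1 * (\<alpha>2 * k4 + \<beta>2 * k5)" by (simp add: algebra_simps)
    thus ?thesis using False r1(3) r2(3) by simp
  next
    \<comment> \<open>M1 and M2 cross R in the same point x. The tangent plane at x contains M1 and
      M2, hence \<open>pt z3\<close>, so the derivative of F at x towards \<open>pt z3\<close>
      vanishes; it equals \<beta>1^4 k4.\<close>
    case True
    define x where "x = \<alpha>1 *s Q.pt z3 + \<beta>1 *s d"
    have "x = (\<beta>1 / \<beta>2) *s (\<alpha>2 *s Q.pt z3 + \<beta>2 *s d)"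
      using True r2(1) by (simp add: x_def vec_eq_iff field_simps)
    hence x: "x \<in> M1" "x \<in> M2" using r1(2) vec.subspace_scale[OF XL_D(3)[OF X(3)] r2(2)] by (simp_all add: x_def)
    have "Q.pt z3 \<in> vec.span {Q.pt z1, Q.pt z2}"
    proof -
      define s where "s = (z3 - z2) / (z1 - z2)"
      have s: "s * z1 + (1 - s) * z2 = z3"
      proof -
        have "s * (z1 - z2) = z3 - z2" using tz by (simp add: s_def)
        thus ?thesis by (simp add: algebra_simps)
      qed
      have "Q.pt z3 = s *s Q.pt z1 + (1 - s) *s Q.pt z2"
        unfolding s[symmetric] by (simp add: Q.pt_def vec_eq_iff algebra_simps)
      thus ?thesis unfolding mem_span2 by blast
    qed
    then obtain s t where "Q.pt z3 = s *s Q.pt z1 + t *s Q.pt z2" unfolding mem_span2 by blast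
    hence "D F x (Q.pt z3) = 0"
      using XL_tangent[OF X(2) x(1) p(1)] XL_tangent[OF X(3) x(2) p(2)] by (simp add: D_linear[OF formF])
    moreover have "lp F x (Q.pt z3) = [:\<beta>1^4 * (\<alpha>1 * k4 + \<beta>1 * k5), \<beta>1^4 * k4:]"
    proof (rule lp_unique)
      fix t
      have "x + t *s Q.pt z3 = (\<alpha>1 + t) *s Q.pt z3 + \<beta>1 *s d" by (simp add: x_def vec.scale_left_distrib)
      thus "poly [:\<beta>1^4 * (\<alpha>1 * k4 + \<beta>1 * k5), \<beta>1^4 * k4:] t = F (x + t *s Q.pt z3)"
        by (simp only: FR) (simp add: algebra_simps)
    qed
    ultimately show ?thesis using r1(1) by (simp add: D_def)
  qed
  hence k5: "k5 = 0" using r1(1,3) by simp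
  have RX: "R \<in> XL" unfolding XL_def using Rl by (auto simp: R_def mem_span2 FR k4 k5)
  have RR: "Q.pt z3 \<in> R" "d \<in> R" unfolding R_def by (auto intro: vec.span_base)
  have ne: "R \<noteq> L" "R \<noteq> M1" "R \<noteq> M2" using RR dL p3 by auto
  have "card {L, M1, M2, R} = 4" using ne MS(3,4) M(3) by auto
  moreover have "{L, M1, M2, R} \<subseteq> XL" "\<forall>M\<in>{L, M1, M2, R}. M \<subseteq> ?P" using X RX P RP by auto
  ultimately have "split_plane ?P"
    unfolding split_plane_def by (intro conjI exI[of _ "{L, M1, M2, R}"] T)
  thus False using ns by blast
qed

definition triangles where
  "triangles L = {(M1, M2). M1 \<in> nb L \<and> M2 \<in> nb L \<and> M1 \<noteq> M2 \<and> M1 \<inter> M2 \<noteq> {0}}"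

lemma finite_triangles: "finite (triangles L)"
  by (rule finite_subset[OF _ finite_cartesian_product[OF finite_nb finite_nb]]) (auto simp: triangles_def)

lemma at_most_three:
  assumes ns: "\<And>P. \<not> split_plane P" and P: "vec.subspace P" "P \<noteq> UNIV"
    and L: "L \<in> XL" "L \<subseteq> P" "L1 \<in> XL" "L1 \<subseteq> P" "L2 \<in> XL" "L2 \<subseteq> P" "L3 \<in> XL" "L3 \<subseteq> P"
    and d: "L1 \<noteq> L" "L2 \<noteq> L" "L3 \<noteq> L" "L1 \<noteq> L2" "L3 \<noteq> L1"
  shows "L3 = L2"
proof (rule ccontr)
  assume "L3 \<noteq> L2"
  hence c: "card {L, L1, L2, L3} = 4" using d by auto
  have "split_plane P"
    unfolding split_plane_def
  proof (intro conjI exI[of _ "{L, L1, L2, L3}"] P c)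
    show "{L, L1, L2, L3} \<subseteq> XL" "\<forall>K\<in>{L, L1, L2, L3}. K \<subseteq> P" using L by auto
  qed
  thus False using ns by blast
qed

text \<open>The tangent plane at a ramification point holds at most two lines besides L, that is,
  two ordered pairs.\<close>

lemma card_triangles_ramified:
  assumes ns: "\<And>P. \<not> split_plane P" and L: "L \<in> S" "sk L"
  shows "card (triangles L) \<le> 2 * card {z. poly (WL L) z = 0}"
proof -
  define R where "R = {z. poly (WL L) z = 0}"
  have "WL L \<noteq> 0" using ql(3)[OF L(1)] by auto
  hence fR: "finite R" unfolding R_def by (rule poly_roots_finite)
  define T where "T z = {(M1, M2). (M1, M2) \<in> triangles L \<and> M1 \<subseteq> tangent_plane F (ptL L z) \<and> M2 \<subseteq> tangent_plane F (ptL L z)}" for z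
  have fT: "finite (T z)" for z by (rule finite_subset[OF _ finite_triangles[of L]]) (auto simp: T_def)
  have "triangles L \<subseteq> (\<Union>z\<in>R. T z)"
  proof
    fix x assume x: "x \<in> triangles L"
    then obtain M1 M2 where xe: "x = (M1, M2)" and M: "M1 \<in> nb L" "M2 \<in> nb L" "M1 \<noteq> M2" "M1 \<inter> M2 \<noteq> {0}"
      by (auto simp: triangles_def)
    obtain z where "poly (WL L) z = 0" "M1 \<subseteq> tangent_plane F (ptL L z)" "M2 \<subseteq> tangent_plane F (ptL L z)"
      using triangle_ramified[OF ns L M] by blast
    thus "x \<in> (\<Union>z\<in>R. T z)" using x unfolding xe by (auto simp: R_def T_def)
  qed
  hence "card (triangles L) \<le> card (\<Union>z\<in>R. T z)" using fR fT by (intro card_mono) auto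
  also have "\<dots> \<le> (\<Sum>z\<in>R. card (T z))" by (rule card_UN_le[OF fR])
  also have "\<dots> \<le> (\<Sum>z\<in>R. 2)"
  proof (rule sum_mono)
    fix z
    let ?P = "tangent_plane F (ptL L z)"
    have P: "vec.subspace ?P" "?P \<noteq> UNIV" by (rule tangent_plane[OF pt_nonzero[OF L(1)]])+
    have LX: "L \<in> XL" "L \<subseteq> ?P" using L(1) S(2) XL_in_tangent_plane pt_in[OF L(1)] by auto
    show "card (T z) \<le> 2"
    proof (cases "T z = {}")
      case False
      then obtain A B where AB: "(A, B) \<in> T z" by auto
      have "T z \<subseteq> {(A, B), (B, A)}"
      proof
        fix x assume x: "x \<in> T z"
        obtain C D' where xe: "x = (C, D')" by (cases x)
        have t: "C \<in> nb L \<and> C \<subseteq> ?P \<and> D' \<in> nb L \<and> D' \<subseteq> ?P \<and> C \<noteq> D'" if "(C, D') \<in> T z" for C D'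
          using that by (simp add: T_def triangles_def)
        have n: "C \<in> XL" "C \<noteq> L" if "C \<in> nb L" for C using that S(2) unfolding nb_def by blast+
        note t1 = t[OF AB] and t2 = t[OF x[unfolded xe]]
        have i: "A \<in> XL" "A \<subseteq> ?P" "B \<in> XL" "B \<subseteq> ?P" "C \<in> XL" "C \<subseteq> ?P" "D' \<in> XL" "D' \<subseteq> ?P"
          "A \<noteq> L" "B \<noteq> L" "C \<noteq> L" "D' \<noteq> L" "A \<noteq> B" "C \<noteq> D'"
          using t1 t2 n by simp_all
        have "C \<in> {A, B}" using at_most_three[OF ns P LX i(1-6) i(9-11) i(13)] by blast
        moreover have "D' \<in> {A, B}" using at_most_three[OF ns P LX i(1-4) i(7,8) i(9,10) i(12,13)] by blast
        ultimately show "x \<in> {(A, B), (B, A)}" using i(14) unfolding xe by blast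
      qed
      hence "card (T z) \<le> card {(A, B), (B, A)}" by (intro card_mono) auto
      also have "\<dots> \<le> 2" by (rule card_insert_le_m1) simp_all
      finally show ?thesis .
    qed simp
  qed
  finally show ?thesis by (simp add: R_def)
qed

text \<open>A neighbour A spans with L the tangent plane at their common point. A third line meeting
  both lies in this plane, whether or not it passes through that point, and without split planes
  there is only one.\<close>

lemma card_triangles_nb:
  assumes ns: "\<And>P. \<not> split_plane P" and L: "L \<in> S"
  shows "card (triangles L) \<le> card (nb L)"
proof (rule card_inj_on_le[of fst])
  show "fst ` triangles L \<subseteq> nb L" by (auto simp: triangles_def)
  show "finite (nb L)" by (rule finite_nb)
  show "inj_on fst (triangles L)"
  proof (rule inj_onI)
    fix x y assume xy: "x \<in> triangles L" "y \<in> triangles L" "fst x = fst y"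
    obtain A B C where e: "x = (A, B)" "y = (A, C)" using xy(3) by (cases x, cases y) auto
    have i: "A \<in> nb L" "B \<in> nb L" "C \<in> nb L" "A \<noteq> B" "A \<noteq> C" "A \<inter> B \<noteq> {0}" "A \<inter> C \<noteq> {0}"
      using xy unfolding e by (auto simp: triangles_def)
    have AS: "A \<in> S" "L \<noteq> A" using i by (auto simp: nb_def)
    let ?P = "vec.span (L \<union> A)"
    have X: "L \<in> XL" "A \<in> XL" using L AS S(2) by auto
    obtain p where p: "p \<in> L" "p \<in> A" "p \<noteq> 0" using nb_point[OF L i(1)] by blast
    have sP: "vec.subspace ?P" by (rule vec.subspace_span)
    have LP: "L \<subseteq> ?P" "A \<subseteq> ?P" using vec.span_superset[of "L \<union> A"] by auto
    have *: "K \<subseteq> tangent_plane F p \<or> K \<subseteq> ?P" if K: "K \<in> nb L" "A \<noteq> K" "A \<inter> K \<noteq> {0}" for K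
    proof -
      have KS: "K \<in> S" "K \<noteq> L" using K by (auto simp: nb_def)
      have KX: "K \<in> XL" using KS S(2) by auto
      obtain x where x: "x \<in> L" "x \<in> K" "x \<noteq> 0" using nb_point[OF L K(1)] by blast
      have "K \<in> nb A" using K KS by (auto simp: nb_def)
      then obtain y where y: "y \<in> A" "y \<in> K" "y \<noteq> 0" using nb_point[OF AS(1)] by blast
      show ?thesis
      proof (cases "y \<in> vec.span {x}")
        case False
        hence "K = vec.span {x, y}" using lineI2[OF XL_D(1)[OF KX] x(2) y(2) two_points[OF x(3)]] by blast
        hence "K \<subseteq> ?P" using x y LP by (auto intro!: vec.span_minimal[OF _ sP])
        thus ?thesis by blast
      next
        case True
        hence "y \<in> L" using x(1) vec.span_minimal[of "{x}" L] XL_D(3)[OF X(1)] by auto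
        then obtain c where c: "c \<noteq> 0" "y = c *s p" using intersection_unique[OF L AS(1) AS(2) p(1,2) _ y(1) p(3) y(3)] by blast
        hence "p = inverse c *s y" by simp
        hence "p \<in> K" using vec.subspace_scale[OF XL_D(3)[OF KX] y(2)] by metis
        thus ?thesis using XL_in_tangent_plane[OF KX] by blast
      qed
    qed
    have eq: "?P = tangent_plane F p"
    proof (rule vec.subspace_dim_equal[OF sP tangent_plane(1)[OF p(3)]])
      show "?P \<subseteq> tangent_plane F p"
        using XL_in_tangent_plane X p by (intro vec.span_minimal[OF _ tangent_plane(1)[OF p(3)]]) blast
      obtain y where y: "y \<in> A" "y \<notin> L" using line_eqI[OF XL_D(1)[OF X(2)] XL_D(1)[OF X(1)]] AS(2) by blast
      have "vec.dim (insert y L) \<le> vec.dim (L \<union> A)" using y by (intro vec.dim_subset) auto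
      thus "vec.dim (tangent_plane F p) \<le> vec.dim ?P"
        using dim_hyperplane_le[OF tangent_plane[OF p(3)]] dim_insert_line[OF XL_D(1)[OF X(1)] y(2)] by simp
    qed
    have PU: "?P \<noteq> UNIV" unfolding eq by (rule tangent_plane(2)[OF p(3)])
    have BC: "B \<subseteq> ?P" "C \<subseteq> ?P" using *[OF i(2,4,6)] *[OF i(3,5,7)] eq by auto
    have "C = B"
    proof (rule at_most_three[OF ns sP PU X(1) LP(1) X(2) LP(2)])
      show "B \<in> XL" "C \<in> XL" "B \<noteq> L" "C \<noteq> L" using i(2,3) S(2) unfolding nb_def by blast+
      show "B \<subseteq> ?P" "C \<subseteq> ?P" by (rule BC)+
      show "A \<noteq> L" "A \<noteq> B" "C \<noteq> A" using AS(2) i(4,5) by simp_all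
    qed
    thus "x = y" unfolding e by simp
  qed
qed

end

text \<open>Division with remainder by the linear form l. When l w = 1, the map x - l(x) w projects
  to the plane l = 0, so the remainder vanishes if f vanishes there.\<close>

lemma form_divide:
  fixes f :: "'k::comm_ring_1 ^ 4 \<Rightarrow> 'k"
  assumes "form d f" "form 1 l"
  shows "\<exists>g. form (d - 1) g \<and> (\<forall>x. f x = f (x - l x *s w) + l x * g x)"
  using assms(1)
proof (induction rule: form.induct)
  case (form_zero d) show ?case by (rule exI[of _ "\<lambda>x. 0"]) (simp add: form.form_zero)
next
  case (form_const c) show ?case by (rule exI[of _ "\<lambda>x. 0"]) (simp add: form.form_zero)
next
  case (form_add d f g)
  then obtain f' g' where "form (d - 1) f'" "\<forall>x. f x = f (x - l x *s w) + l x * f' x"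
    "form (d - 1) g'" "\<forall>x. g x = g (x - l x *s w) + l x * g' x" by blast
  note h = this
  show ?case
  proof (intro exI conjI allI)
    show "form (d - 1) (\<lambda>x. f' x + g' x)" using h form.form_add by blast
    show "f x + g x = f (x - l x *s w) + g (x - l x *s w) + l x * (f' x + g' x)" for x
      using h(2,4) by (metis (no_types, lifting) add.assoc add.left_commute distrib_left)
  qed
next
  case (form_coord d f i)
  then obtain f' where h: "form (d - 1) f'" "\<forall>x. f x = f (x - l x *s w) + l x * f' x" by blast
  have lw: "form 1 (\<lambda>x. (x - l x *s w) $ i)" for i
    using form_diff[OF form_nth[of i] form_cmult[OF assms(2), of "w $ i"]] by (simp add: mult.commute)
  have fp: "form d (\<lambda>x. f (x - l x *s w))" by (rule form_comp[OF form_coord.hyps lw])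
  show ?case
  proof (cases "d = 0")
    case True
    have c: "f x = f y" for x y using form_scale[OF form_coord.hyps[unfolded True], of 0] by (metis power_0 mult_1 vector_smult_lzero)
    show ?thesis
    proof (intro exI conjI allI)
      show "form (Suc d - 1) (\<lambda>x. w $ i * f x)" using form_cmult[OF form_coord.hyps] by simp
      show "x $ i * f x = (x - l x *s w) $ i * f (x - l x *s w) + l x * (w $ i * f x)" for x
        using c[of "x - l x *s w" x] by (simp add: algebra_simps)
    qed
  next
    case False
    hence "form d (\<lambda>x. x $ i * f' x)" using form.form_coord[OF h(1), of i] by simp
    show ?thesis
    proof (intro exI conjI allI)
      show "form (Suc d - 1) (\<lambda>x. w $ i * f (x - l x *s w) + x $ i * f' x)"
        using form.form_add[OF form_cmult[OF fp, of "w $ i"] \<open>form d (\<lambda>x. x $ i * f' x)\<close>] by simp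
      show "x $ i * f x = (x - l x *s w) $ i * f (x - l x *s w) + l x * (w $ i * f (x - l x *s w) + x $ i * f' x)" for x
        using h(2)[rule_format, of x] by (simp add: algebra_simps)
    qed
  qed
qed

lemma form_1_linear:
  assumes "form 1 g"
  shows "g (x + y) = g x + (g y :: 'k::comm_ring_1)" "g (c *s x) = c * g x"
proof -
  have "(d = 0 \<longrightarrow> (\<exists>c. \<forall>x. f x = c)) \<and> (d = 1 \<longrightarrow> (\<forall>x y. f (x + y) = f x + f y))" if "form d f" for d and f :: "'k ^ 4 \<Rightarrow> 'k"
    using that
  proof (induction rule: form.induct)
    case (form_add d f g)
    thus ?case by (auto simp: algebra_simps) 
  next
    case (form_coord d f i)
    thus ?case by (auto simp: algebra_simps)
  qed auto
  thus "g (x + y) = g x + g y" using assms by blast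
  show "g (c *s x) = c * g x" using form_scale[OF assms, of c x] by simp
qed

text \<open>Forms restricted to a line have no zero divisors.\<close>

lemma form_mult_zero_on_line:
  fixes f g :: "'k::field_char_0 ^ 4 \<Rightarrow> 'k"
  assumes "form d f" "form e g" "vec.subspace L" "\<And>x. x \<in> L \<Longrightarrow> f x * g x = 0" "x \<in> L" "f x \<noteq> 0" "y \<in> L"
  shows "g y = 0"
proof -
  have in_L: "x + t *s (y - x) \<in> L" for t
    using assms by (intro vec.subspace_add vec.subspace_scale vec.subspace_diff) auto
  have "lp f x (y - x) * lp g x (y - x) = 0"
    by (rule poly_eq_by_values) (simp add: poly_lp[OF assms(1)] poly_lp[OF assms(2)] assms(4)[OF in_L])
  moreover have "lp f x (y - x) \<noteq> 0"
    using coeff_lp_0[OF assms(1), of x "y - x"] assms(6) by auto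
  ultimately have "lp g x (y - x) = 0" by simp
  hence "poly (lp g x (y - x)) 1 = 0" by simp
  thus ?thesis by (simp add: poly_lp[OF assms(2)])
qed

context quintic_line
begin

lemma tangent_pencil_nonconstant:
  assumes "(\<gamma>, \<delta>) \<noteq> (0, 0)" shows "smult \<gamma> a + smult \<delta> b \<noteq> 0"
proof
  assume z: "smult \<gamma> a + smult \<delta> b = 0"
  hence z': "smult \<gamma> (pderiv a) + smult \<delta> (pderiv b) = 0" by (simp flip: pderiv_smult pderiv_add)
  have "smult \<gamma> W = pderiv b * (smult \<gamma> a + smult \<delta> b) - b * (smult \<gamma> (pderiv a) + smult \<delta> (pderiv b))"
    "smult \<delta> W = a * (smult \<gamma> (pderiv a) + smult \<delta> (pderiv b)) - pderiv a * (smult \<gamma> a + smult \<delta> b)"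
    by (simp_all add: W_def algebra_simps smult_diff_right)
  hence "smult \<gamma> W = 0" "smult \<delta> W = 0" unfolding z z' by simp_all
  thus False using assms W_nonzero by simp
qed

text \<open>The zeros of g are the points whose tangent plane contains y. At a common zero with W,
  both a g' and b g' vanish, hence g' does.\<close>

lemma D_off_line:
  assumes "y \<notin> vec.span {u, v}"
  shows "\<exists>g. g \<noteq> 0 \<and> degree g \<le> 4 \<and> (\<forall>z. poly g z = D F (pt z) y) \<and> (\<forall>z. poly g z = 0 \<longrightarrow> poly W z = 0 \<longrightarrow> [:-z,1:]^2 dvd g)"
proof -
  obtain \<alpha> \<beta> \<gamma> \<delta> where y: "y = \<alpha> *s u + \<beta> *s v + \<gamma> *s n1 + \<delta> *s n2" using spans by blast
  have "(\<gamma>, \<delta>) \<noteq> (0, 0)"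
  proof
    assume "(\<gamma>, \<delta>) = (0, 0)"
    hence "y = \<alpha> *s u + \<beta> *s v" unfolding y by simp
    thus False using assms unfolding mem_span2 by blast
  qed
  define g where "g = smult \<gamma> a + smult \<delta> b"
  have g0: "g \<noteq> 0" unfolding g_def by (rule tangent_pencil_nonconstant) fact
  have dg: "degree g \<le> 4" unfolding g_def using deg_a deg_b
    by (intro degree_add_le) (auto intro: order_trans[OF degree_smult_le])
  have v: "poly g z = D F (pt z) y" for z unfolding y D_pt by (simp add: g_def)
  have "[:-z,1:]^2 dvd g" if z: "poly g z = 0" "poly W z = 0" for z
  proof -
    have "poly a z * poly (pderiv g) z = \<delta> * poly W z + poly (pderiv a) z * poly g z"
      "poly b z * poly (pderiv g) z = - \<gamma> * poly W z + poly (pderiv b) z * poly g z"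
      by (simp_all add: g_def W_def pderiv_add pderiv_smult algebra_simps)
    hence "poly (pderiv g) z = 0" using z ab_nz[of z] by auto
    moreover obtain g1 where g1: "g = [:-z,1:] * g1" using z(1) by (auto simp: poly_eq_0_iff_dvd)
    ultimately have "poly g1 z = 0" unfolding g1 pderiv_mult by (simp add: pderiv_pCons)
    hence "[:-z,1:] dvd g1" by (simp add: poly_eq_0_iff_dvd)
    thus ?thesis unfolding g1 power2_eq_square by (rule mult_dvd_mono[OF dvd_refl])
  qed
  thus ?thesis using g0 dg v by blast
qed

text \<open>Each tangent plane along L is attained at finitely many points only, so unramified
  points with pairwise different tangent planes can be added one by one.\<close>

lemma flat_transversal_set:
  "\<exists>Z. finite Z \<and> card Z = n \<and> (\<forall>z\<in>Z. poly W z \<noteq> 0) \<and> (\<forall>z\<in>Z. \<forall>z'\<in>Z. z \<noteq> z' \<longrightarrow> poly a z * poly b z' \<noteq> poly b z * poly a z')"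
proof (induction n)
  case 0 thus ?case by (intro exI[of _ "{}"]) simp
next
  case (Suc n)
  then obtain Z where Z: "finite Z" "card Z = n" "\<forall>z\<in>Z. poly W z \<noteq> 0"
    "\<forall>z\<in>Z. \<forall>z'\<in>Z. z \<noteq> z' \<longrightarrow> poly a z * poly b z' \<noteq> poly b z * poly a z'" by blast
  define g where "g z = smult (- poly b z) a + smult (poly a z) b" for z
  have "g z \<noteq> 0" for z unfolding g_def using ab_nz[of z] by (intro tangent_pencil_nonconstant) auto
  hence "finite ({z. poly W z = 0} \<union> (\<Union>z\<in>Z. {x. poly (g z) x = 0}))"
    using poly_roots_finite[OF W_nonzero] poly_roots_finite Z(1) by blast
  then obtain x where x: "x \<notin> {z. poly W z = 0} \<union> (\<Union>z\<in>Z. {x. poly (g z) x = 0})"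
    using ex_new_if_finite[OF infinite_UNIV_char_0] by blast
  have xg: "poly a z * poly b x \<noteq> poly b z * poly a x" if "z \<in> Z" for z
  proof -
    have "poly (g z) x \<noteq> 0" using x that by blast
    thus ?thesis by (simp add: g_def)
  qed
  hence "x \<notin> Z" by (metis mult.commute)
  show ?case
  proof (intro exI[of _ "insert x Z"] conjI ballI impI)
    show "finite (insert x Z)" "card (insert x Z) = Suc n" using Z(1,2) \<open>x \<notin> Z\<close> by simp_all
    show "poly W z \<noteq> 0" if "z \<in> insert x Z" for z using that Z(3) x by blast
    fix z z' assume zz: "z \<in> insert x Z" "z' \<in> insert x Z" "z \<noteq> z'"
    then consider "z \<in> Z" "z' \<in> Z" | "z \<in> Z" "z' = x" | "z = x" "z' \<in> Z" by blast
    thus "poly a z * poly b z' \<noteq> poly b z * poly a z'"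
    proof cases
      case 1 thus ?thesis using Z(4) zz(3) by blast
    next
      case 2 thus ?thesis using xg by simp
    next
      case 3 thus ?thesis using xg[of z'] by (simp add: mult.commute) 
    qed
  qed
qed

text \<open>A common point of two of these lines lies in two different tangent planes that contain
  L, hence on L; but each line meets L only at its own base point.\<close>

lemma flat_skew_lines:
  assumes "e2 = 0" "e3 = 0" "e4 = 0"
  shows "\<exists>T. T \<subseteq> quintic.XL F \<and> finite T \<and> card T = n \<and> (\<forall>A\<in>T. \<forall>B\<in>T. A \<noteq> B \<longrightarrow> A \<inter> B = {0})"
proof -
  interpret q: quintic F by (rule uv_XL)
  obtain Z where Z: "finite Z" "card Z = n" "\<And>z. z \<in> Z \<Longrightarrow> poly W z \<noteq> 0"
    "\<And>z z'. z \<in> Z \<Longrightarrow> z' \<in> Z \<Longrightarrow> z \<noteq> z' \<Longrightarrow> poly a z * poly b z' \<noteq> poly b z * poly a z'"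
    using flat_transversal_set[of n] by blast
  define l where "l z = ln z (- poly Q z / poly W z)" for z
  have X: "l z \<in> q.XL" if "z \<in> Z" for z unfolding l_def by (rule ln_XL[OF line_at_of_flat[OF assms Z(3)[OF that]]])
  have pl: "pt z \<in> l z" for z unfolding l_def by (rule pt_in_ln)
  have inj: "inj_on l Z"
  proof (rule inj_onI)
    fix z z' assume "l z = l z'"
    hence "pt z \<in> l z'" using pl[of z] by simp
    thus "z = z'" unfolding l_def by (rule pt_in_ln_unique)
  qed
  have skew: "l z \<inter> l z' = {0}" if z: "z \<in> Z" "z' \<in> Z" "z \<noteq> z'" for z z'
  proof -
    have "q = 0" if q: "q \<in> l z" "q \<in> l z'" for q
    proof (rule ccontr)
      assume "q \<noteq> 0"
      have t: "D F (pt z) q = 0" "D F (pt z') q = 0" using q.XL_tangent[OF X pl] z q by blast+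
      obtain \<alpha> \<beta> \<gamma> \<delta> where qe: "q = \<alpha> *s u + \<beta> *s v + \<gamma> *s n1 + \<delta> *s n2" using spans by blast
      have g: "\<gamma> * poly a z + \<delta> * poly b z = 0" "\<gamma> * poly a z' + \<delta> * poly b z' = 0" using t unfolding qe D_pt by blast+
      let ?d = "poly a z * poly b z' - poly b z * poly a z'"
      have "\<gamma> * ?d = poly b z' * (\<gamma> * poly a z + \<delta> * poly b z) - poly b z * (\<gamma> * poly a z' + \<delta> * poly b z')"
        "\<delta> * ?d = poly a z * (\<gamma> * poly a z' + \<delta> * poly b z') - poly a z' * (\<gamma> * poly a z + \<delta> * poly b z)"
        by (simp_all add: algebra_simps)
      hence "\<gamma> * ?d = 0" "\<delta> * ?d = 0" unfolding g by simp_all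
      moreover have "?d \<noteq> 0" using Z(4)[OF z] by simp
      ultimately have gd: "\<gamma> = 0" "\<delta> = 0" by simp_all
      obtain s t where qs: "q = s *s pt z + t *s ((- poly Q z / poly W z) *s u + N z)" using q(1) unfolding l_def ln_def mem_span2 by blast
      have "(t * (- poly Q z / poly W z) + s * z - \<alpha>) *s u + (s - \<beta>) *s v + (- (t * poly b z)) *s n1 + (t * poly a z) *s n2 = 0"
      proof -
        have "s *s pt z + t *s ((- poly Q z / poly W z) *s u + N z) - (\<alpha> *s u + \<beta> *s v) = 0" using qs qe gd by simp
        thus ?thesis by (simp add: pt_def N_def vec_eq_iff algebra_simps)
      qed
      hence "- (t * poly b z) = 0 \<and> t * poly a z = 0" using indep by blast
      hence "t = 0" using ab_nz[of z] by auto
      hence "q = s *s pt z" "s \<noteq> 0" using qs \<open>q \<noteq> 0\<close> by auto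
      hence "pt z = inverse s *s q" by simp
      hence "pt z \<in> l z'" using vec.subspace_scale[OF q.XL_D(3)[OF X[OF z(2)]] q(2)] by simp
      thus False using pt_in_ln_unique z(3) unfolding l_def by blast
    qed
    moreover have "0 \<in> l z \<inter> l z'" using vec.subspace_0 q.XL_D(3)[OF X] z by blast
    ultimately show ?thesis by blast
  qed
  show ?thesis
  proof (intro exI[of _ "l ` Z"] conjI ballI impI)
    show "l ` Z \<subseteq> q.XL" using X by blast
    show "finite (l ` Z)" "card (l ` Z) = n" using Z(1,2) inj by (simp_all add: card_image)
    fix A B assume "A \<in> l ` Z" "B \<in> l ` Z" "A \<noteq> B"
    then obtain z z' where "z \<in> Z" "z' \<in> Z" "A = l z" "B = l z'" "z \<noteq> z'" by blast
    thus "A \<inter> B = {0}" using skew by blast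
  qed
qed

end

lemma line_meets_hyperplane:
  fixes P :: "('k::field ^ 4) set"
  assumes "vec.subspace P" "3 \<le> vec.dim P" "is_line M" shows "\<exists>x. x \<in> M \<and> x \<in> P \<and> x \<noteq> 0"
proof -
  have M: "vec.subspace M" "vec.dim M = 2" using assms by (auto simp: is_line_def)
  have "vec.dim {x + y |x y. x \<in> M \<and> y \<in> P} \<le> 4"
    using vec.dim_subset[of "{x + y |x y. x \<in> M \<and> y \<in> P}" UNIV] by (simp add: card_cart_basis)
  hence "vec.dim (M \<inter> P) \<noteq> 0" using vec.dim_sums_Int[OF M(1) assms(1)] assms(2) M(2) by linarith
  thus ?thesis unfolding vec.dim_eq_0 by auto
qed

lemma form_of_linear:
  fixes l :: "'k::field ^ 4 \<Rightarrow> 'k"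
  assumes "\<And>x y. l (x + y) = l x + l y" "\<And>c x. l (c *s x) = c * l x"
  shows "form 1 l"
proof -
  have eq: "l = (\<lambda>x. \<Sum>i\<in>UNIV. x $ i * l (axis i 1))"
  proof
    fix x
    have "l x = l (\<Sum>i\<in>UNIV. x $ i *s axis i 1)" by (simp only: basis_expansion)
    thus "l x = (\<Sum>i\<in>UNIV. x $ i * l (axis i 1))" by (simp add: sum_4 assms)
  qed
  have "form 1 (\<lambda>x. \<Sum>i\<in>UNIV. x $ i * l (axis i 1))"
    by (rule form_sum) (auto intro: form_mult[OF form_nth form_const, simplified])
  thus ?thesis by (rule ssubst[OF eq, of "form 1"])
qed

context quintic
begin

lemma D_off_XL:
  assumes "L \<in> XL" "y \<notin> L" shows "\<exists>p\<in>L. D F p y \<noteq> 0"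
proof -
  obtain u v where uv: "L = vec.span {u, v}" "vec.dim {u, v} = 2" using is_lineE[OF XL_D(1)[OF assms(1)]] by blast
  obtain n1 n2 where q: "quintic_line F u v n1 n2" using quintic_line_exists uv assms by blast
  interpret Q: quintic_line F u v n1 n2 by (rule q)
  obtain g where g: "g \<noteq> 0" "\<And>z. poly g z = D F (Q.pt z) y" using Q.D_off_line assms(2) unfolding uv(1) by blast
  have "\<exists>z. poly g z \<noteq> 0" using g(1) poly_eq_by_values[of g 0] by auto
  thus ?thesis using g(2) Q.pt_in_line unfolding uv(1) by metis
qed

text \<open>Choose a point p of L at which P is not tangent: the tangent plane at p then cuts P
  exactly in L, so its equation \<open>D F p\<close> can serve as l.\<close>

lemma plane_form:
  assumes P: "vec.subspace P" "P \<noteq> UNIV" and L: "L \<in> XL" "L \<subseteq> P" "P \<noteq> L"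
  shows "\<exists>l. form 1 l \<and> (\<forall>x\<in>P. l x = 0 \<longleftrightarrow> x \<in> L) \<and>
    (\<forall>d f. form (Suc d) f \<longrightarrow> (\<forall>x\<in>L. f x = 0) \<longrightarrow> (\<exists>g. form d g \<and> (\<forall>x\<in>P. f x = l x * g x)))"
proof -
  obtain y where y: "y \<in> P" "y \<notin> L" using L by blast
  obtain p where p: "p \<in> L" "D F p y \<noteq> 0" using D_off_XL[OF L(1) y(2)] by blast
  define l where "l = D F p"
  have lin: "l (x + y) = l x + l y" "l (c *s x) = c * l x" for x y c unfolding l_def by (rule D_plus[OF formF], rule D_scale[OF formF])
  have l1: "form 1 l" by (rule form_of_linear) (rule lin)+
  define w where "w = (1 / l y) *s y"
  have w: "w \<in> P" "l w = 1" using y p(2) vec.subspace_scale[OF P(1)] by (simp_all add: w_def lin l_def[symmetric])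
  have z: "l x = 0 \<longleftrightarrow> x \<in> L" if x: "x \<in> P" for x
  proof
    assume "x \<in> L" thus "l x = 0" unfolding l_def using XL_tangent[OF L(1) p(1)] by blast
  next
    assume lx: "l x = 0"
    show "x \<in> L"
    proof (rule ccontr)
      assume "x \<notin> L"
      have K: "vec.subspace {x \<in> P. l x = 0}"
        unfolding vec.subspace_def using P(1) lin lin(2)[of 0 0] by (auto simp: vec.subspace_def)
      have "insert x L \<subseteq> {x \<in> P. l x = 0}" using x lx L(2) XL_tangent[OF L(1) p(1)] by (auto simp: l_def)
      hence "vec.dim (insert x L) \<le> vec.dim {x \<in> P. l x = 0}" by (rule vec.dim_subset)
      hence "vec.dim P \<le> vec.dim {x \<in> P. l x = 0}"
        using dim_insert_line[OF XL_D(1)[OF L(1)] \<open>x \<notin> L\<close>] dim_hyperplane_le[OF P] by linarith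
      hence e: "{x \<in> P. l x = 0} = P" by (intro vec.subspace_dim_equal[OF K P(1)]) auto
      have "w \<in> {x \<in> P. l x = 0}" by (subst e) (rule w(1))
      thus False using w(2) by simp
    qed
  qed
  have "\<exists>g. form d g \<and> (\<forall>x\<in>P. f x = l x * g x)" if f: "form (Suc d) f" "\<forall>x\<in>L. f x = 0" for d f
  proof -
    obtain g where g: "form d g" "\<forall>x. f x = f (x - l x *s w) + l x * g x"
      using form_divide[OF f(1) l1, of w] by auto
    have "f x = l x * g x" if x: "x \<in> P" for x
    proof -
      have xp: "x - l x *s w \<in> P" using x w(1) P(1) by (intro vec.subspace_diff vec.subspace_scale)
      have "l (x - l x *s w) = l x + (- l x) * l w" using lin(1)[of x "(- l x) *s w"] lin(2)[of "- l x" w] by simp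
      hence "l (x - l x *s w) = 0" using w by simp
      hence "x - l x *s w \<in> L" using z[OF xp] by simp
      thus ?thesis using g(2) f(2) by (metis add_0)
    qed
    thus ?thesis using g(1) by blast
  qed
  thus ?thesis using l1 z by blast
qed

text \<open>Four divisions of F on P leave a linear form, whose zero set is the fifth line. It is
  not identically zero, since P would otherwise lie in the surface and be tangent at every point of
  a line.\<close>

lemma split_plane_factor:
  assumes "split_plane P"
  shows "\<exists>T m. T \<subseteq> XL \<and> card T = 4 \<and> m \<in> XL \<and> vec.subspace P \<and> vec.dim P = 3 \<and> P \<noteq> UNIV \<and> (\<forall>L\<in>insert m T. L \<subseteq> P)
    \<and> (\<forall>x\<in>P. F x = 0 \<longrightarrow> (\<exists>L\<in>insert m T. x \<in> L))"
proof -
  obtain T where P: "vec.subspace P" "P \<noteq> UNIV" and T: "T \<subseteq> XL" "card T = 4" "\<forall>L\<in>T. L \<subseteq> P"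
    using assms unfolding split_plane_def by blast
  obtain L1 T1 where T1: "T = insert L1 T1" "L1 \<notin> T1" "card T1 = 3" using T(2) card_eq_SucD[of T 3] by auto
  obtain L2 T2 where T2: "T1 = insert L2 T2" "L2 \<notin> T2" "card T2 = 2" using T1(3) card_eq_SucD[of T1 2] by auto
  obtain L3 L4 where T3: "T2 = {L3, L4}" "L3 \<noteq> L4" using T2(3) unfolding card_2_iff by blast
  have Te: "T = {L1, L2, L3, L4}" using T1(1) T2(1) T3(1) by simp
  have d: "L1 \<noteq> L2" "L1 \<noteq> L3" "L1 \<noteq> L4" "L2 \<noteq> L3" "L2 \<noteq> L4" "L3 \<noteq> L4"
    using T1(2) T2(2) T3 unfolding T2(1) T3(1) by simp_all
  have X: "L1 \<in> XL" "L2 \<in> XL" "L3 \<in> XL" "L4 \<in> XL" using T(1) unfolding Te by auto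
  have LP: "L1 \<subseteq> P" "L2 \<subseteq> P" "L3 \<subseteq> P" "L4 \<subseteq> P" using T(3) unfolding Te by auto
  have nsub: "\<exists>x\<in>A. x \<notin> B" if "A \<in> XL" "B \<in> XL" "A \<noteq> B" for A B
    using line_eqI[OF XL_D(1)[OF that(1)] XL_D(1)[OF that(2)]] that(3) by blast
  have neP: "P \<noteq> L1" "P \<noteq> L2" "P \<noteq> L3" "P \<noteq> L4"
    using nsub[of L2 L1] nsub[of L1 L2] nsub[of L1 L3] nsub[of L1 L4] X d LP by blast+
  obtain l1 where l1: "form 1 l1" "\<forall>x\<in>P. l1 x = 0 \<longleftrightarrow> x \<in> L1"
    "\<And>d f. form (Suc d) f \<Longrightarrow> \<forall>x\<in>L1. f x = 0 \<Longrightarrow> \<exists>g. form d g \<and> (\<forall>x\<in>P. f x = l1 x * g x)"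
    using plane_form[OF P X(1) LP(1) neP(1)] by blast
  obtain l2 where l2: "form 1 l2" "\<forall>x\<in>P. l2 x = 0 \<longleftrightarrow> x \<in> L2"
    "\<And>d f. form (Suc d) f \<Longrightarrow> \<forall>x\<in>L2. f x = 0 \<Longrightarrow> \<exists>g. form d g \<and> (\<forall>x\<in>P. f x = l2 x * g x)"
    using plane_form[OF P X(2) LP(2) neP(2)] by blast
  obtain l3 where l3: "form 1 l3" "\<forall>x\<in>P. l3 x = 0 \<longleftrightarrow> x \<in> L3"
    "\<And>d f. form (Suc d) f \<Longrightarrow> \<forall>x\<in>L3. f x = 0 \<Longrightarrow> \<exists>g. form d g \<and> (\<forall>x\<in>P. f x = l3 x * g x)"
    using plane_form[OF P X(3) LP(3) neP(3)] by blast
  obtain l4 where l4: "form 1 l4" "\<forall>x\<in>P. l4 x = 0 \<longleftrightarrow> x \<in> L4"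
    "\<And>d f. form (Suc d) f \<Longrightarrow> \<forall>x\<in>L4. f x = 0 \<Longrightarrow> \<exists>g. form d g \<and> (\<forall>x\<in>P. f x = l4 x * g x)"
    using plane_form[OF P X(4) LP(4) neP(4)] by blast
  have cancel: "\<forall>x\<in>B. g x = 0"
    if A: "A \<in> XL" "B \<in> XL" "A \<noteq> B" "B \<subseteq> P" and l: "form 1 l" "\<forall>x\<in>P. l x = 0 \<longleftrightarrow> x \<in> A"
      and fg: "form d g" "\<forall>x\<in>P. f x = l x * g x" "\<forall>x\<in>B. f x = 0" for A B l d f g
  proof
    fix y assume y: "y \<in> B"
    obtain x where x: "x \<in> B" "x \<notin> A" using nsub[OF A(2,1)] A(3) by blast
    have "l x \<noteq> 0" using l(2) A(4) x by blast
    moreover have "l x * g x = 0" if "x \<in> B" for x using fg A(4) that by (metis subsetD)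
    ultimately show "g y = 0" using form_mult_zero_on_line[OF l(1) fg(1) XL_D(3)[OF A(2)] _ x(1) _ y] by blast
  qed
  obtain g1 where g1: "form 4 g1" "\<forall>x\<in>P. F x = l1 x * g1 x" using l1(3)[of 4 F] formF XL_D(2)[OF X(1)] by auto
  have "\<forall>x\<in>L2. g1 x = 0" by (rule cancel[OF X(1,2) d(1) LP(2) l1(1,2) g1]) (use XL_D(2)[OF X(2)] in blast)
  then obtain g2 where g2: "form 3 g2" "\<forall>x\<in>P. g1 x = l2 x * g2 x" using l2(3)[of 3 g1] g1 by auto
  have "\<forall>x\<in>L3. g1 x = 0" by (rule cancel[OF X(1,3) d(2) LP(3) l1(1,2) g1]) (use XL_D(2)[OF X(3)] in blast)
  hence "\<forall>x\<in>L3. g2 x = 0" by (rule cancel[OF X(2,3) d(4) LP(3) l2(1,2) g2])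
  then obtain g3 where g3: "form 2 g3" "\<forall>x\<in>P. g2 x = l3 x * g3 x" using l3(3)[of 2 g2] g2 by (auto simp: numeral_2_eq_2 numeral_3_eq_3)
  have "\<forall>x\<in>L4. g1 x = 0" by (rule cancel[OF X(1,4) d(3) LP(4) l1(1,2) g1]) (use XL_D(2)[OF X(4)] in blast)
  hence "\<forall>x\<in>L4. g2 x = 0" by (rule cancel[OF X(2,4) d(5) LP(4) l2(1,2) g2])
  hence "\<forall>x\<in>L4. g3 x = 0" by (rule cancel[OF X(3,4) d(6) LP(4) l3(1,2) g3])
  then obtain g4 where g4: "form 1 g4" "\<forall>x\<in>P. g3 x = l4 x * g4 x" using l4(3)[of 1 g3] g3 by (auto simp: numeral_2_eq_2)
  have Fe: "F x = l1 x * (l2 x * (l3 x * (l4 x * g4 x)))" if "x \<in> P" for x using g1(2) g2(2) g3(2) g4(2) that by simp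
  note lin = form_1_linear[OF g4(1)]
  define m where "m = {x \<in> P. g4 x = 0}"
  have g40: "g4 0 = 0" using lin(2)[of 0 0] by simp
  have sm: "vec.subspace m" unfolding m_def vec.subspace_def using P(1) lin g40 by (auto simp: vec.subspace_def)
  have "\<exists>w\<in>P. g4 w \<noteq> 0"
  proof (rule ccontr)
    assume "\<not> (\<exists>w\<in>P. g4 w \<noteq> 0)"
    hence F0: "F x = 0" if "x \<in> P" for x using Fe[OF that] that by auto
    obtain y where y: "y \<in> L2" "y \<notin> L1" using nsub X d by blast
    then obtain p where p: "p \<in> L1" "D F p y \<noteq> 0" using D_off_XL[OF X(1)] by blast
    have "D F p y = 0"
      by (rule D_along_zero[OF formF], rule F0) (use p(1) y(1) LP P(1) in \<open>auto intro!: vec.subspace_add vec.subspace_scale\<close>)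
    thus False using p(2) by blast
  qed
  then obtain w where w: "w \<in> P" "g4 w \<noteq> 0" by blast
  have dP: "vec.dim P = 3"
  proof -
    obtain y where y: "y \<in> L2" "y \<notin> L1" using nsub X d by blast
    have "vec.dim (insert y L1) \<le> vec.dim P" using y LP by (intro vec.dim_subset) auto
    thus ?thesis using dim_insert_line[OF XL_D(1)[OF X(1)] y(2)] dim_hyperplane_le[OF P] by linarith
  qed
  have "vec.dim m = 2"
  proof -
    have "P \<subseteq> vec.span (insert w m)"
    proof
      fix x assume x: "x \<in> P"
      have "g4 (x + (- (g4 x / g4 w)) *s w) = 0" unfolding lin(1) lin(2) using w(2) by simp
      moreover have "x + (- (g4 x / g4 w)) *s w \<in> P" by (intro vec.subspace_add[OF P(1)] vec.subspace_scale[OF P(1)] x w(1))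
      ultimately have "x + (- (g4 x / g4 w)) *s w \<in> m" unfolding m_def by blast
      hence "x + (- (g4 x / g4 w)) *s w \<in> vec.span m" by (rule vec.span_base)
      hence "x - (g4 x / g4 w) *s w \<in> vec.span m" by simp
      thus "x \<in> vec.span (insert w m)" unfolding vec.span_breakdown_eq by blast
    qed
    hence "vec.dim P \<le> vec.dim (insert w m)" by (rule vec.dim_mono)
    also have "\<dots> \<le> vec.dim m + 1" by (simp add: vec.dim_insert)
    finally have "2 \<le> vec.dim m" using dP by simp
    moreover have "vec.dim m \<noteq> 3"
    proof
      assume "vec.dim m = 3"
      hence "m = P" using dP by (intro vec.subspace_dim_equal[OF sm P(1)]) (auto simp: m_def)
      thus False using w by (auto simp: m_def)
    qed
    moreover have "vec.dim m \<le> 3" using vec.dim_subset[of m P] dP by (auto simp: m_def)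
    ultimately show ?thesis by linarith
  qed
  hence mX: "m \<in> XL" using sm Fe by (auto simp: XL_def is_line_def m_def)
  have cov: "\<exists>L\<in>insert m T. x \<in> L" if x: "x \<in> P" "F x = 0" for x
  proof -
    have "l1 x = 0 \<or> l2 x = 0 \<or> l3 x = 0 \<or> l4 x = 0 \<or> g4 x = 0" using Fe[OF x(1)] x(2) by simp
    thus ?thesis using x(1) l1(2) l2(2) l3(2) l4(2) unfolding Te m_def by auto
  qed
  show ?thesis
    by (intro exI[of _ T] exI[of _ m] conjI T(1,2) mX P dP) (use T(3) cov in \<open>auto simp: m_def\<close>)
qed

end

context quintic_lines
begin

text \<open>45 is one more than the rank bound 44. The hypothesis is later supplied by
  \<open>no_45_skew_lines\<close>, which rests on the residue functionals.\<close>

lemma not_flat: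
  assumes sb: "\<And>T. T \<subseteq> XL \<Longrightarrow> finite T \<Longrightarrow> card T = 45 \<Longrightarrow> \<exists>A\<in>T. \<exists>B\<in>T. A \<noteq> B \<and> A \<inter> B \<noteq> {0}" and L: "L \<in> S"
  shows "\<not> flat L"
proof
  assume f: "flat L"
  interpret Q: quintic_line F "U L" "V L" "N1 L" "N2 L" by (rule ql(1)[OF L])
  have "Q.e2 = 0" "Q.e3 = 0" "Q.e4 = 0" using f by (auto simp: flat_def sk_def)
  then obtain T where T: "T \<subseteq> XL" "finite T" "card T = 45" "\<forall>A\<in>T. \<forall>B\<in>T. A \<noteq> B \<longrightarrow> A \<inter> B = {0}"
    using Q.flat_skew_lines[of 45] by blast
  thus False using sb[OF T(1-3)] by blast
qed

text \<open>The remaining lines of a completely split plane meet \<open>L\<close> in four different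
  points with the same tangent plane. All four are unramified, so the Schwarzian bounds how many of
  those lines can be of the second kind.\<close>

lemma split_plane_second_kind:
  assumes nf: "\<not> flat L" and L: "L \<in> S" "card (nb L) = 29"
    and P: "vec.subspace P" "vec.dim P = 3" "L \<subseteq> P"
    and T: "T \<subseteq> S - {L}" "\<And>M. M \<in> T \<Longrightarrow> M \<subseteq> P" "card T = 4"
  shows "card {M \<in> T. sk M} \<le> 2"
proof -
  interpret Q: quintic_line F "U L" "V L" "N1 L" "N2 L" by (rule ql(1)[OF L(1)])
  have PU: "P \<noteq> UNIV" using P(2) by (auto simp: card_cart_basis)
  have LX: "L \<in> XL" using L S by blast
  have TX: "M \<in> XL" if "M \<in> T" for M using T(1) S(2) that by blast
  have fT: "finite T" using T(3) by (simp add: card_ge_0_finite)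
  have Tnb: "M \<in> nb L" if M: "M \<in> T" for M
  proof -
    obtain x where "x \<in> L" "x \<in> M" "x \<noteq> 0"
      using lines_in_hyperplane_meet[OF P(1) PU XL_D(1)[OF LX] XL_D(1)[OF TX[OF M]] P(3) T(2)[OF M]] by blast
    thus ?thesis using T(1) M by (auto simp: nb_def)
  qed
  \<comment> \<open>Valency 29 leaves at most one other line through each point of L, ramified or
    not; hence the four lines meet L in different points.\<close>
  have one: "card {M \<in> nb L. pos L M = z} \<le> 1" for z
    using valency(3)[OF L(1) nf L(2), of z] valency(4)[OF L(1), of z] by blast
  have inj: "inj_on (pos L) T"
  proof (rule inj_onI)
    fix M M' assume M: "M \<in> T" "M' \<in> T" "pos L M = pos L M'"
    show "M = M'"
    proof (rule ccontr)
      assume "M \<noteq> M'"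
      hence "card {M, M'} = 2" by simp
      moreover have "card {M, M'} \<le> card {K \<in> nb L. pos L K = pos L M}"
        using M Tnb finite_nb[of L] by (intro card_mono) auto
      ultimately show False using one[of "pos L M"] by linarith
    qed
  qed
  obtain M0 where M0: "M0 \<in> T" using T(3) by fastforce
  have "\<not> M0 \<subseteq> L" using line_eqI[OF XL_D(1)[OF TX[OF M0]] XL_D(1)[OF LX]] T(1) M0 by blast
  then obtain y where y: "y \<in> M0" "y \<notin> L" by blast
  have yP: "y \<in> P" using y T(2)[OF M0] by blast
  obtain g where g: "g \<noteq> 0" "degree g \<le> 4" "\<And>z. poly g z = D F (Q.pt z) y"
    "\<And>z. poly g z = 0 \<Longrightarrow> poly Q.W z = 0 \<Longrightarrow> [:-z,1:]^2 dvd g"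
    using Q.D_off_line[of y] y(2) ql(2)[OF L(1)] by blast
  have root: "poly g (pos L M) = 0" if M: "M \<in> T" for M
  proof -
    let ?T = "tangent_plane F (Q.pt (pos L M))"
    have t: "vec.subspace ?T" "?T \<noteq> UNIV" by (rule tangent_plane[OF Q.pt_nz])+
    have "L \<subseteq> ?T" by (rule XL_in_tangent_plane[OF LX pt_in[OF L(1)]])
    moreover have "M \<subseteq> ?T" by (rule XL_in_tangent_plane[OF TX[OF M] pt_pos_in[OF L(1) Tnb[OF M]]])
    moreover have "\<not> M \<subseteq> L" using line_eqI[OF XL_D(1)[OF TX[OF M]] XL_D(1)[OF LX]] T(1) M by blast
    then obtain x where x: "x \<in> M" "x \<notin> L" by blast
    have i: "vec.dim (insert x L) = 3" by (rule dim_insert_line[OF XL_D(1)[OF LX] x(2)])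
    have "vec.span (insert x L) = P"
    proof (rule vec.subspace_dim_equal[OF vec.subspace_span P(1)])
      show "vec.span (insert x L) \<subseteq> P" using x(1) T(2)[OF M] P(3) by (intro vec.span_minimal[OF _ P(1)]) auto
      show "vec.dim P \<le> vec.dim (vec.span (insert x L))" using i P(2) by simp
    qed
    moreover have "vec.span (insert x L) \<subseteq> ?T" using calculation x(1) by (intro vec.span_minimal[OF _ t(1)]) auto
    ultimately have "y \<in> ?T" using yP by blast
    thus ?thesis unfolding g(3) by (simp add: tangent_plane_def)
  qed
  \<comment> \<open>All four positions are zeros of g, which has degree at most four; a ramified one
    would be a double zero.\<close>
  have unram: "poly Q.W (pos L M) \<noteq> 0" if M: "M \<in> T" for M
  proof
    assume "poly Q.W (pos L M) = 0"
    hence d: "[:- pos L M, 1:]^2 dvd g" using g(4) root[OF M] by blast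
    have "(\<Sum>z\<in>pos L ` T. if z = pos L M then 2 else 1) \<le> degree g"
    proof (rule sum_multiplicities_le_degree[OF g(1)])
      show "finite (pos L ` T)" using fT by blast
      fix z assume "z \<in> pos L ` T"
      hence "poly g z = 0" using root by auto
      thus "[:-z,1:]^(if z = pos L M then 2 else 1) dvd g" using d by (simp add: poly_eq_0_iff_dvd)
    qed
    moreover have "(\<Sum>z\<in>pos L ` T. if z = pos L M then 2 else 1) = (\<Sum>z\<in>pos L ` T. 1 + (if z = pos L M then 1 else (0::nat)))"
      by (intro sum.cong) auto
    moreover have "\<dots> = card (pos L ` T) + 1" using fT M unfolding sum.distrib by simp
    ultimately show False using g(2) card_image[OF inj] T(3) by simp
  qed
  have "card (pos L ` {M \<in> T. sk M}) \<le> 2"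
  proof (rule Q.Schw_zeros[OF ql(3)[OF L(1)]])
    show "order z Q.W = 2" if "poly Q.W z = 0" for z using valency(3)[OF L(1) nf L(2) that] by blast
    show "finite (pos L ` {M \<in> T. sk M})" using fT by simp
    fix z assume "z \<in> pos L ` {M \<in> T. sk M}"
    then obtain M where M: "M \<in> T" "sk M" "z = pos L M" by blast
    show "poly Q.W z \<noteq> 0 \<and> poly Q.Schw z = 0"
      unfolding M(3) using unram[OF M(1)] Schw_second_kind[OF L(1) Tnb[OF M(1)] M(2) unram[OF M(1)]] by blast
  qed
  moreover have "inj_on (pos L) {M \<in> T. sk M}" using inj by (rule inj_on_subset) auto
  ultimately show ?thesis by (simp add: card_image)
qed

end

text \<open>Every line meets the plane, and therefore one of its lines. With a repeated line the
  count is 4 + 4 * 26. With five different lines it is 5 + 5 * 24 if none has valency 29, and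
  otherwise 5 + 25 + 2 * 25 + 2 * 22, as at most two of the remaining four are of the second
  kind.\<close>

lemma (in quintic) split_bound:
  assumes sb: "\<And>T. T \<subseteq> XL \<Longrightarrow> finite T \<Longrightarrow> card T = 45 \<Longrightarrow> \<exists>A\<in>T. \<exists>B\<in>T. A \<noteq> B \<and> A \<inter> B \<noteq> {0}"
    and sp: "split_plane P" and S: "finite S" "S \<subseteq> XL"
  shows "card S \<le> 127"
proof -
  obtain T0 m where T0: "T0 \<subseteq> XL" "card T0 = 4" and m: "m \<in> XL" and P: "vec.subspace P" "vec.dim P = 3" "P \<noteq> UNIV"
    and TP: "\<forall>L\<in>insert m T0. L \<subseteq> P" and cov: "\<forall>x\<in>P. F x = 0 \<longrightarrow> (\<exists>L\<in>insert m T0. x \<in> L)"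
    using split_plane_factor[OF sp] by blast
  define T where "T = insert m T0"
  have fT: "finite T" "finite T0" using T0(2) by (auto simp: T_def card_ge_0_finite)
  define S' where "S' = S \<union> T"
  have S': "finite S'" "S' \<subseteq> XL" using S fT T0 m by (auto simp: S'_def T_def)
  obtain U V N1 N2 where "quintic_lines F S' U V N1 N2" using quintic_lines_exists[OF S'] by blast
  then interpret Q: quintic_lines F S' U V N1 N2 .
  have TS: "T \<subseteq> S'" by (simp add: S'_def)
  have TX: "T \<subseteq> XL" using TS S'(2) by blast
  have TT: "M \<in> Q.nb L" if LM: "L \<in> T" "M \<in> T" "L \<noteq> M" for L M
  proof -
    have l: "is_line L" "is_line M" "L \<subseteq> P" "M \<subseteq> P" using LM(1,2) XL_D(1) TX TP unfolding T_def by blast+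
    obtain x where "x \<in> L" "x \<in> M" "x \<noteq> 0"
      using lines_in_hyperplane_meet[OF P(1,3) l] by blast
    thus ?thesis using LM TS by (auto simp: Q.nb_def)
  qed
  have cover: "S' \<subseteq> T \<union> (\<Union>L\<in>T. Q.nb L - T)"
  proof
    fix M assume M: "M \<in> S'"
    hence MX: "M \<in> XL" using S' by blast
    obtain x where x: "x \<in> M" "x \<in> P" "x \<noteq> 0" using line_meets_hyperplane[OF P(1) _ XL_D(1)[OF MX]] P(2) by auto
    have "F x = 0" by (rule XL_D(2)[OF MX x(1)])
    then obtain L where L: "L \<in> T" "x \<in> L" using cov x(2) unfolding T_def by blast
    show "M \<in> T \<union> (\<Union>L\<in>T. Q.nb L - T)"
    proof (cases "M \<in> T")
      case False
      hence "M \<in> Q.nb L" using M L x by (auto simp: Q.nb_def)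
      thus ?thesis using False L by blast
    qed simp
  qed
  have nf: "\<not> Q.flat L" if "L \<in> T" for L by (rule Q.not_flat[OF sb]) (use that TS in auto)
  have v29: "card (Q.nb L) \<le> 29" if "L \<in> T" for L using Q.valency(2) TS nf that by blast
  have cT: "card (Q.nb L - T) = card (Q.nb L) - (card T - 1)" "card T - 1 \<le> card (Q.nb L)" if L: "L \<in> T" for L
  proof -
    have e: "Q.nb L - T = Q.nb L - (T - {L})" by (auto simp: Q.nb_def)
    have s: "T - {L} \<subseteq> Q.nb L" using TT L by blast
    show "card (Q.nb L - T) = card (Q.nb L) - (card T - 1)"
      unfolding e using card_Diff_subset[OF _ s] fT L by simp
    show "card T - 1 \<le> card (Q.nb L)" using card_mono[OF Q.finite_nb s] fT L by simp
  qed
  have "card S \<le> card S'" using S' by (intro card_mono) (auto simp: S'_def)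
  also have "\<dots> \<le> card (T \<union> (\<Union>L\<in>T. Q.nb L - T))" using cover fT Q.finite_nb by (intro card_mono) auto
  also have "\<dots> \<le> card T + card (\<Union>L\<in>T. Q.nb L - T)" by (rule card_Un_le)
  also have "\<dots> \<le> card T + (\<Sum>L\<in>T. card (Q.nb L - T))" by (intro add_left_mono card_UN_le fT(1))
  also have "(\<Sum>L\<in>T. card (Q.nb L - T)) = (\<Sum>L\<in>T. card (Q.nb L) - (card T - 1))" using cT(1) by (intro sum.cong) auto
  finally have le: "card S \<le> card T + (\<Sum>L\<in>T. card (Q.nb L) - (card T - 1))" .
  show ?thesis
  proof (cases "m \<in> T0")
    case True
    hence c: "card T = 4" using T0(2) by (simp add: T_def insert_absorb)
    have "(\<Sum>L\<in>T. card (Q.nb L) - (card T - 1)) \<le> (\<Sum>L\<in>T. 26)"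
      using v29 c by (intro sum_mono) fastforce
    thus ?thesis using le c by simp
  next
    case False
    hence c: "card T = 5" using T0(2) fT by (simp add: T_def)
    show ?thesis
    proof (cases "\<exists>L\<in>T. card (Q.nb L) = 29")
      case False
      have "(\<Sum>L\<in>T. card (Q.nb L) - (card T - 1)) \<le> (\<Sum>L\<in>T. 24)"
      proof (rule sum_mono)
        fix L assume "L \<in> T"
        thus "card (Q.nb L) - (card T - 1) \<le> 24" using v29[of L] False c by fastforce
      qed
      thus ?thesis using le c by simp
    next
      case True
      then obtain L where L: "L \<in> T" "card (Q.nb L) = 29" by blast
      define K where "K = T - {L}"
      have K: "finite K" "card K = 4" "T = insert L K" "L \<notin> K" using fT c L by (auto simp: K_def)
      have s2: "card {M \<in> K. Q.sk M} \<le> 2"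
      proof (rule Q.split_plane_second_kind[OF nf[OF L(1)] _ L(2) P(1,2)])
        show "L \<in> S'" "K \<subseteq> S' - {L}" using L TS by (auto simp: K_def)
        show "L \<subseteq> P" "\<And>M. M \<in> K \<Longrightarrow> M \<subseteq> P" using TP L unfolding K_def T_def by blast+
        show "card K = 4" by fact
      qed
      have "(\<Sum>M\<in>K. card (Q.nb M) - 4) \<le> (\<Sum>M\<in>K. if Q.sk M then 25 else 22)"
      proof (rule sum_mono)
        fix M assume "M \<in> K"
        hence M: "M \<in> T" "M \<in> S'" using TS by (auto simp: K_def)
        show "card (Q.nb M) - 4 \<le> (if Q.sk M then 25 else 22)"
          using v29[OF M(1)] Q.valency(1)[OF M(2)] by (cases "Q.sk M") auto
      qed
      also have "\<dots> = 25 * card {M \<in> K. Q.sk M} + 22 * card {M \<in> K. \<not> Q.sk M}"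
        using K(1) by (simp add: sum.If_cases Int_def Compl_eq)
      also have "card {M \<in> K. \<not> Q.sk M} = 4 - card {M \<in> K. Q.sk M}"
      proof -
        have "{M \<in> K. \<not> Q.sk M} = K - {M \<in> K. Q.sk M}" by blast
        thus ?thesis using card_Diff_subset[of "{M \<in> K. Q.sk M}" K] K by simp
      qed
      finally have "(\<Sum>M\<in>K. card (Q.nb M) - 4) \<le> 94" using s2 by simp
      hence "(\<Sum>M\<in>T. card (Q.nb M) - 4) \<le> 119" unfolding K(3) using K(1,4) L(2) by simp
      thus ?thesis using le c by simp
    qed
  qed
qed

section \<open>Trace inequality and rank\<close>

lemma norm_matrix_mult_le:
  fixes A B :: "real ^ 'n ^ 'n"
  shows "norm (A ** B) \<le> norm A * norm B"
proof -
  have c: "norm (column j B)^2 = (\<Sum>k\<in>UNIV. (B $ k $ j)^2)" for j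
    by (simp add: norm_vec_def L2_set_def column_def sum_nonneg)
  have "(norm (A ** B))^2 = (\<Sum>i\<in>UNIV. \<Sum>j\<in>UNIV. ((A ** B) $ i $ j)^2)"
    by (simp add: norm_vec_def L2_set_def sum_nonneg)
  also have "\<dots> \<le> (\<Sum>i\<in>UNIV. \<Sum>j\<in>UNIV. (norm (A $ i))^2 * (norm (column j B))^2)"
  proof (intro sum_mono)
    fix i j
    have "(A ** B) $ i $ j = A $ i \<bullet> column j B" by (simp add: matrix_matrix_mult_def inner_vec_def column_def)
    hence "\<bar>(A ** B) $ i $ j\<bar> \<le> norm (A $ i) * norm (column j B)" by (simp add: Cauchy_Schwarz_ineq2)
    hence "\<bar>(A ** B) $ i $ j\<bar>^2 \<le> (norm (A $ i) * norm (column j B))^2" by (intro power_mono) auto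
    thus "((A ** B) $ i $ j)^2 \<le> (norm (A $ i))^2 * (norm (column j B))^2" by (simp add: power_mult_distrib)
  qed
  also have "\<dots> = (\<Sum>i\<in>UNIV. (norm (A $ i))^2) * (\<Sum>j\<in>UNIV. (norm (column j B))^2)"
    by (simp add: sum_product)
  also have "(\<Sum>i\<in>UNIV. (norm (A $ i))^2) = (norm A)^2" by (simp add: norm_vec_def L2_set_def sum_nonneg)
  also have "(\<Sum>j\<in>UNIV. (norm (column j B))^2) = (norm B)^2"
    unfolding c by (subst sum.swap) (simp add: norm_vec_def L2_set_def sum_nonneg)
  finally have "(norm (A ** B))^2 \<le> (norm A * norm B)^2" by (simp add: power_mult_distrib)
  thus ?thesis by (rule power2_le_imp_le) simp
qed

text \<open>In terms of eigenvalues: the sum of cubes is at most the 3/2 power of the sum of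
  squares. The Frobenius norm avoids diagonalisation.\<close>

lemma trace_symmetric_cube_le:
  fixes A :: "real ^ 'n ^ 'n"
  assumes "transpose A = A" shows "trace (A ** A ** A) \<le> norm A ^ 3"
proof -
  have s: "A $ i $ j = A $ j $ i" for i j
    using assms by (metis transpose_def vec_lambda_beta)
  have "trace (A ** A ** A) = (A ** A) \<bullet> A"
    unfolding trace_def matrix_matrix_mult_def inner_vec_def by (simp add: s)
  also have "\<dots> \<le> norm (A ** A) * norm A" by (rule norm_cauchy_schwarz)
  also have "\<dots> \<le> norm A * norm A * norm A" by (intro mult_right_mono norm_matrix_mult_le) simp
  finally show ?thesis by (simp add: power3_eq_cube)
qed

lemma trace_symmetric_square:
  fixes A :: "real ^ 'n ^ 'n"
  assumes "transpose A = A" shows "trace (A ** A) = norm A ^ 2"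
proof -
  have s: "A $ i $ j = A $ j $ i" for i j
    using assms by (metis transpose_def vec_lambda_beta)
  have "trace (A ** A) = A \<bullet> A"
    unfolding trace_def matrix_matrix_mult_def inner_vec_def by (simp add: s)
  thus ?thesis by (simp add: power2_norm_eq_inner)
qed

lemma row_space_projector:
  fixes A :: "real ^ 'n ^ 'n"
  assumes "dim (rows A) \<le> r"
  shows "\<exists>P. transpose P = P \<and> P ** P = P \<and> A ** P = A \<and> trace P \<le> real r"
proof -
  obtain B where B: "B \<subseteq> span (rows A)" "pairwise orthogonal B" "\<And>x. x \<in> B \<Longrightarrow> norm x = 1" "independent B"
    "card B = dim (span (rows A))" "span B = span (rows A)"
    using orthonormal_basis_subspace[OF subspace_span] by metis
  have fB: "finite B" using B(4) by (rule independent_imp_finite)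
  define P :: "real ^ 'n ^ 'n" where "P = (\<chi> i j. \<Sum>b\<in>B. b $ i * b $ j)"
  have bb: "b \<bullet> c = (if b = c then 1 else 0)" if "b \<in> B" "c \<in> B" for b c
    using that B(2,3) by (auto simp: pairwise_def orthogonal_def norm_eq_1)
  have mv: "P *v x = (\<Sum>b\<in>B. (b \<bullet> x) *\<^sub>R b)" for x
    by (simp add: P_def matrix_vector_mult_def vec_eq_iff inner_vec_def sum_distrib_left sum_distrib_right mult_ac)
       (simp add: sum.swap[of _ B])
  have fix_: "P *v x = x" if "x \<in> span B" for x
    using that
  proof (induction rule: span_induct_alt)
    case base thus ?case by simp
  next
    case (step c b y)
    have "P *v b = (\<Sum>a\<in>B. if a = b then b else 0)" unfolding mv using bb[OF _ step(1)] by (intro sum.cong) auto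
    hence "P *v b = b" using fB step(1) by simp
    thus ?case using step by (simp add: matrix_vector_right_distrib matrix_vector_mult_scaleR)
  qed
  have t: "transpose P = P" by (simp add: transpose_def P_def vec_eq_iff mult.commute)
  have "A ** P = A"
  proof -
    have "(A ** P) $ i = A $ i" for i
    proof -
      have "A $ i \<in> span B" unfolding B(6) by (rule span_base) (auto simp: rows_def row_def)
      hence "P *v (A $ i) = A $ i" by (rule fix_)
      moreover have "(A ** P) $ i = P *v (A $ i)"
        by (simp add: matrix_matrix_mult_def matrix_vector_mult_def vec_eq_iff P_def mult_ac)
      ultimately show ?thesis by simp
    qed
    thus ?thesis by (simp add: vec_eq_iff)
  qed
  moreover have "P ** P = P"
  proof -
    have "P *v (P *v x) = P *v x" for x
      unfolding mv[of x] by (rule fix_, intro span_sum span_scale span_base)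
    thus ?thesis by (simp add: matrix_eq matrix_vector_mul_assoc[symmetric])
  qed
  moreover have "trace P \<le> real r"
  proof -
    have "trace P = (\<Sum>b\<in>B. b \<bullet> b)" unfolding trace_def P_def inner_vec_def by (simp add: sum.swap[of _ B])
    also have "\<dots> = card B" using bb by simp
    finally show ?thesis using B(5) assms by simp
  qed
  ultimately show ?thesis using t by blast
qed

text \<open>Applied to Y = A - m P, with P the orthogonal projection to the row space: this
  subtracts the mean m from the at most r nonzero eigenvalues, and the cube estimate for Y compares
  third and second moments. The number s is any upper bound for a square root, which keeps the later
  arithmetic rational.\<close>

lemma trace_cube_inequality:
  fixes A :: "real ^ 'n ^ 'n"
  assumes A: "transpose A = A" and r: "dim (rows A) \<le> r" and m: "trace A = real r * m" "0 \<le> m"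
    and s: "trace (A ** A) - real r * m^2 \<le> s^2" "0 \<le> s"
  shows "0 \<le> trace (A ** A) - real r * m^2"
    "trace (A ** A ** A) - 3 * m * trace (A ** A) + 2 * real r * m^3 \<le> s * (trace (A ** A) - real r * m^2)"
proof -
  obtain P where P: "transpose P = P" "P ** P = P" "A ** P = A" "trace P \<le> real r"
    using row_space_projector[OF r] by blast
  have PA: "P ** A = A"
    using arg_cong[OF P(3), of transpose] by (simp add: matrix_transpose_mul A P(1))
  define Y where "Y = A - m *\<^sub>R P"
  have tY: "transpose Y = Y" using A P(1)
    by (simp add: Y_def transpose_def vec_eq_iff)
  have tr: "trace (B + C) = trace B + trace C" "trace (B - C) = trace B - trace C" "trace (c *\<^sub>R B) = c * trace B" for B C :: "real ^ 'n ^ 'n" and c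
    by (simp_all add: trace_def sum.distrib sum_subtractf sum_distrib_left)
  have sc: "(c *\<^sub>R B) ** C = c *\<^sub>R (B ** C)" "B ** (c *\<^sub>R C) = c *\<^sub>R (B ** C)" for B C :: "real ^ 'n ^ 'n" and c
    by (simp_all add: matrix_matrix_mult_def vec_eq_iff sum_distrib_left mult_ac)
  have ml: "(B + C) ** E = B ** E + C ** E" "(B - C) ** E = B ** E - C ** E" "B ** (C - E) = B ** C - B ** E" for B C E :: "real ^ 'n ^ 'n"
    by (simp_all add: matrix_matrix_mult_def vec_eq_iff sum_subtractf sum.distrib left_diff_distrib right_diff_distrib distrib_right)
  have Y2: "Y ** Y = A ** A - (2 * m) *\<^sub>R A + m^2 *\<^sub>R P"
    unfolding Y_def ml sc P PA by (simp add: vec_eq_iff algebra_simps power2_eq_square)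
  have AAP: "A ** A ** P = A ** A" using P(3) by (simp add: matrix_mul_assoc[symmetric])
  have Y3: "Y ** Y ** Y = A ** A ** A - (3 * m) *\<^sub>R (A ** A) + (3 * m^2) *\<^sub>R A - m^3 *\<^sub>R P"
  proof -
    have "Y ** Y ** Y = (A ** A - (2 * m) *\<^sub>R A) ** Y + m^2 *\<^sub>R (P ** Y)"
      unfolding Y2 by (simp add: ml sc)
    also have "\<dots> = A ** A ** A - m *\<^sub>R (A ** A) - (2 * m) *\<^sub>R (A ** A) + (2 * m * m) *\<^sub>R A + m^2 *\<^sub>R A - m^3 *\<^sub>R P"
      unfolding Y_def ml sc AAP P PA by (simp add: vec_eq_iff algebra_simps power2_eq_square power3_eq_cube)
    finally show ?thesis by (simp add: vec_eq_iff algebra_simps power2_eq_square)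
  qed
  have T: "trace P * m^2 \<le> r * m^2" "trace P * m^3 \<le> r * m^3"
    using P(4) m(2) by (intro mult_right_mono; simp)+
  define D where "D = trace (A ** A) - real r * m^2"
  have n2: "norm Y ^ 2 \<le> D"
    unfolding trace_symmetric_square[OF tY, symmetric] Y2 tr m(1) D_def using T(1) by (simp add: power2_eq_square algebra_simps)
  show "0 \<le> trace (A ** A) - real r * m^2" using n2 unfolding D_def by (meson order_trans zero_le_power2)
  have "norm Y \<le> s" using n2 s unfolding D_def[symmetric] by (intro power2_le_imp_le[OF _ s(2)]) linarith
  have "trace (A ** A ** A) - 3 * m * trace (A ** A) + 2 * real r * m^3 \<le> trace (Y ** Y ** Y)"
    unfolding Y3 tr m(1) using T(2) by (simp add: power2_eq_square power3_eq_cube algebra_simps)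
  also have "\<dots> \<le> norm Y ^ 3" by (rule trace_symmetric_cube_le[OF tY])
  also have "\<dots> = norm Y * norm Y ^ 2" by (simp add: power3_eq_cube power2_eq_square)
  also have "\<dots> \<le> s * D" using \<open>norm Y \<le> s\<close> n2 s(2) by (intro mult_mono) auto
  finally show "trace (A ** A ** A) - 3 * m * trace (A ** A) + 2 * real r * m^3 \<le> s * (trace (A ** A) - real r * m^2)"
    unfolding D_def .
qed

text \<open>The constants come from \<open>B = 3 I - A + J / 5\<close>: \<open>44 m\<close>, \<open>D + 44 m\<^sup>2\<close> and \<open>p3\<close> are the traces of
  \<open>B\<close>, \<open>B\<^sup>2\<close> and \<open>B\<^sup>3\<close>, and \<open>v i\<close>, \<open>t i\<close> are the numbers of neighbours and of ordered triangles at \<open>i\<close>.\<close>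

lemma valency_sum_contradiction:
  fixes v t :: "'n::finite \<Rightarrow> nat" and p3 D m :: real
  assumes N: "CARD('n) = 128"
    and v: "\<And>i. v i \<le> 29" and t: "\<And>i. t i \<le> v i" "\<And>i. 26 < v i \<Longrightarrow> t i \<le> 12" "\<And>i. v i = 29 \<Longrightarrow> t i \<le> 6"
    and m: "m = 512 / 55"
    and D: "D = 1960.96 + 0.6 * (\<Sum>i\<in>UNIV. real (v i)) - 44 * m^2"
    and p3: "p3 = (\<Sum>i\<in>UNIV. 27 + 9 * real (v i) - real (t i) + 0.6 * (3 - real (v i))^2 + 15.36 * (3 - real (v i))) + 16777.216"
    and ineq: "\<And>s. 0 \<le> s \<Longrightarrow> D \<le> s^2 \<Longrightarrow> p3 - 3 * m * (D + 44 * m^2) + 88 * m^3 \<le> s * D"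
  shows False
proof -
  define V where "V = (\<Sum>i\<in>UNIV. real (v i))"
  have D': "D = 1960.96 + 0.6 * V - 44 * (512/55)^2" unfolding D V_def m ..
  have e: "p3 - 3 * m * (D + 44 * m^2) + 88 * m^3 = p3 - 3 * (512/55) * (1960.96 + 0.6 * V) + 88 * (512/55)^3"
    unfolding D V_def[symmetric] m by simp
  have n128: "(\<Sum>i\<in>(UNIV :: 'n set). c) = 128 * c" for c :: real using N by simp
  have V29: "V \<le> 29 * 128"
  proof -
    have "V \<le> (\<Sum>i\<in>(UNIV :: 'n set). 29)" unfolding V_def using v by (intro sum_mono) simp
    also have "\<dots> = 128 * 29" by (rule n128)
    finally show ?thesis by simp
  qed
  have p3a: "p3 \<ge> 16777.216 + (27 * 128 + 9 * V - V + 0.6 * (9 * 128 - 6 * V + (\<Sum>i\<in>UNIV. (real (v i))^2)) + 15.36 * (3 * 128 - V))"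
  proof -
    have "(\<Sum>i\<in>UNIV. 27 + 9 * real (v i) - real (v i) + 0.6 * (9 - 6 * real (v i) + (real (v i))^2) + 15.36 * (3 - real (v i)))
      \<le> (\<Sum>i\<in>UNIV. 27 + 9 * real (v i) - real (t i) + 0.6 * (3 - real (v i))^2 + 15.36 * (3 - real (v i)))"
      using t(1) by (intro sum_mono) (simp add: power2_eq_square algebra_simps)
    moreover have "(\<Sum>i\<in>UNIV. 27 + 9 * real (v i) - real (v i) + 0.6 * (9 - 6 * real (v i) + (real (v i))^2) + 15.36 * (3 - real (v i)))
      = 27 * 128 + 9 * V - V + 0.6 * (9 * 128 - 6 * V + (\<Sum>i\<in>UNIV. (real (v i))^2)) + 15.36 * (3 * 128 - V)"
      unfolding sum.distrib sum_subtractf sum_distrib_left[symmetric] n128 V_def by simp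
    ultimately show ?thesis unfolding p3 by linarith
  qed
  have p3b: "p3 \<ge> 16777.216 + (27 * 128 + 9 * V + (291.4 * 128 + 35.5 * (V - 26 * 128)) + 15.36 * (3 * 128 - V))"
  proof -
    \<comment> \<open>A linear minorant, with equality at v = 26, t = 26 and almost so at v = 28, t
      = 12, where 363 stands against 362.4. Only the drop of t to 12, and to 6 at v = 29, makes a
      line of this slope possible.\<close>
    have psi: "291.4 + 35.5 * (real (v i) - 26) \<le> 0.6 * (3 - real (v i))^2 - real (t i)" for i
    proof (cases "v i \<le> 26")
      case True
      define x where "x = real (v i)"
      have "0 \<le> (26 - x) * (637/26 - 0.6 * x)" using True by (intro mult_nonneg_nonneg) (auto simp: x_def)
      also have "(26 - x) * (637/26 - 0.6 * x) = 637 - 40.1 * x + 0.6 * (x * x)" by (simp add: field_simps)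
      finally have 1: "0 \<le> 637 - 40.1 * x + 0.6 * (x * x)" .
      have 2: "(3 - x)^2 = 9 - 6 * x + x * x" by (simp add: power2_eq_square algebra_simps)
      have 3: "real (t i) \<le> x" using t(1) by (simp add: x_def)
      define q where "q = x * x"
      show ?thesis using 1 3 unfolding x_def[symmetric] 2 q_def[symmetric] by (simp add: field_simps)
    next
      case False
      then consider "v i = 27" | "v i = 28" | "v i = 29" using v[of i] by linarith
      thus ?thesis using t(2)[of i] t(3)[of i] by cases (auto simp: power2_eq_square)
    qed
    have "(\<Sum>i\<in>UNIV. 27 + 9 * real (v i) + (291.4 + 35.5 * (real (v i) - 26)) + 15.36 * (3 - real (v i)))
      \<le> (\<Sum>i\<in>UNIV. 27 + 9 * real (v i) - real (t i) + 0.6 * (3 - real (v i))^2 + 15.36 * (3 - real (v i)))"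
    proof (rule sum_mono)
      fix i
      show "27 + 9 * real (v i) + (291.4 + 35.5 * (real (v i) - 26)) + 15.36 * (3 - real (v i))
        \<le> 27 + 9 * real (v i) - real (t i) + 0.6 * (3 - real (v i))^2 + 15.36 * (3 - real (v i))"
        using psi[of i] by linarith
    qed
    moreover have "(\<Sum>i\<in>UNIV. 27 + 9 * real (v i) + (291.4 + 35.5 * (real (v i) - 26)) + 15.36 * (3 - real (v i)))
      = 27 * 128 + 9 * V + (291.4 * 128 + 35.5 * (V - 26 * 128)) + 15.36 * (3 * 128 - V)"
      unfolding sum.distrib sum_subtractf sum_distrib_left[symmetric] n128 V_def by simp
    ultimately show ?thesis unfolding p3 by linarith
  qed
  \<comment> \<open>The tangent of the square function at c, where c remains free for each range of
    V.\<close>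
  have Q: "(\<Sum>i\<in>UNIV. (real (v i))^2) \<ge> 2 * c * V - 128 * c^2" for c
  proof -
    have "0 \<le> (\<Sum>i\<in>UNIV. (real (v i) - c)^2)" by (intro sum_nonneg) simp
    also have "\<dots> = (\<Sum>i\<in>UNIV. (real (v i))^2 - 2 * c * real (v i) + c^2)" by (simp add: power2_diff algebra_simps)
    also have "\<dots> = (\<Sum>i\<in>UNIV. (real (v i))^2) - 2 * c * V + 128 * c^2"
      unfolding sum.distrib sum_subtractf sum_distrib_left[symmetric] n128 V_def by simp
    finally show ?thesis by simp
  qed
  define q where "q = (\<Sum>i\<in>UNIV. (real (v i))^2)"
  have ineq': "p3 - 3 * (512/55) * (1960.96 + 0.6 * V) + 88 * (512/55)^3 \<le> s * (1960.96 + 0.6 * V - 44 * (512/55)^2)"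
    if "0 \<le> s" "1960.96 + 0.6 * V - 44 * (512/55)^2 \<le> s^2" for s
    using ineq[of s] that unfolding e unfolding D' by blast
  \<comment> \<open>The cuts are the mean valencies 26.1, 26.5 and 27.5. Each s used below is
    slightly more than the square root of D at the upper end of its range. The lower two ranges need
    only t \<le> v; the upper two need the minorant.\<close>
  consider "V \<le> 3340.8" | "3340.8 \<le> V" "V \<le> 3392" | "3392 \<le> V" "V \<le> 3520" | "3520 \<le> V" by linarith
  thus False
  proof cases
    case 1
    thus False using ineq'[of "12.35"] p3a Q[of "23.1"] unfolding q_def[symmetric] by (simp add: power2_eq_square power3_eq_cube field_simps)
  next
    case 2
    thus False using ineq'[of "13.54"] p3a Q[of "26.3"] unfolding q_def[symmetric] by (simp add: power2_eq_square power3_eq_cube field_simps)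
  next
    case 3
    thus False using ineq'[of "16.13"] p3b by (simp add: power2_eq_square power3_eq_cube field_simps)
  next
    case 4
    thus False using ineq'[of "19.37"] V29 p3b by (simp add: power2_eq_square power3_eq_cube field_simps)
  qed
qed

definition gram :: "('n::finite \<Rightarrow> 'n \<Rightarrow> bool) \<Rightarrow> 'n \<Rightarrow> 'n \<Rightarrow> int" where
  "gram adj i j = (if i = j then 16 else if adj i j then -4 else 1)"

lemma gram_rank_contradiction:
  fixes adj :: "'n::finite \<Rightarrow> 'n \<Rightarrow> bool"
  assumes N: "CARD('n) = 128" and sym: "\<And>i j. adj i j \<Longrightarrow> adj j i" and irr: "\<And>i. \<not> adj i i"
    and v: "\<And>i. card {j. adj i j} \<le> 29"
    and t: "\<And>i. card {(j, k). adj i j \<and> adj i k \<and> adj j k} \<le> card {j. adj i j}"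
      "\<And>i. 26 < card {j. adj i j} \<Longrightarrow> card {(j, k). adj i j \<and> adj i k \<and> adj j k} \<le> 12"
      "\<And>i. card {j. adj i j} = 29 \<Longrightarrow> card {(j, k). adj i j \<and> adj i k \<and> adj j k} \<le> 6"
    and rk: "dim (range (\<lambda>i. \<chi> j. real_of_int (gram adj i j))) \<le> 44"
  shows False
proof -
  define A :: "real ^ 'n ^ 'n" where "A = (\<chi> i j. of_bool (adj i j))"
  define J :: "real ^ 'n ^ 'n" where "J = (\<chi> i j. 1)"
  define B :: "real ^ 'n ^ 'n" where "B = 3 *\<^sub>R mat 1 - A + (1/5) *\<^sub>R J"
  have As: "A $ i $ j = A $ j $ i" for i j using sym by (auto simp: A_def)
  have Aij: "A $ i $ j = of_bool (adj i j)" and Jij: "J $ i $ j = 1" for i j by (simp_all add: A_def J_def)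
  define d where "d i = card {j. adj i j}" for i
  define \<tau> where "\<tau> i = card {(j, k). adj i j \<and> adj i k \<and> adj j k}" for i
  have row: "(\<Sum>j\<in>UNIV. A $ i $ j) = real (d i)" for i
    by (simp add: Aij d_def)
  have col: "(\<Sum>j\<in>UNIV. A $ j $ i) = real (d i)" for i using row[of i] As by simp
  define V where "V = (\<Sum>i\<in>UNIV. real (d i))"
  have BG: "B $ i $ j = real_of_int (gram adj i j) / 5" for i j
    using irr by (simp add: B_def A_def J_def mat_def gram_def)
  have tB: "transpose B = B" using sym
    by (auto simp: transpose_def vec_eq_iff BG gram_def)
  have "dim (rows B) \<le> dim (range (\<lambda>i. \<chi> j. real_of_int (gram adj i j)))"
  proof (rule dim_mono, rule subsetI)
    fix x assume "x \<in> rows B"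
    then obtain i where "x = B $ i" by (auto simp: rows_def row_def)
    hence "x = (1/5) *\<^sub>R (\<chi> j. real_of_int (gram adj i j))" by (simp add: vec_eq_iff BG)
    thus "x \<in> span (range (\<lambda>i. \<chi> j. real_of_int (gram adj i j)))" by (simp add: span_base span_scale)
  qed
  hence rB: "dim (rows B) \<le> 44" using rk by simp
  have tr: "trace (B + C) = trace B + trace C" "trace (B - C) = trace B - trace C" "trace (c *\<^sub>R B) = c * trace B" for B C :: "real ^ 'n ^ 'n" and c
    by (simp_all add: trace_def sum.distrib sum_subtractf sum_distrib_left)
  have sc: "(c *\<^sub>R B) ** C = c *\<^sub>R (B ** C)" "B ** (c *\<^sub>R C) = c *\<^sub>R (B ** C)" for B C :: "real ^ 'n ^ 'n" and c
    by (simp_all add: matrix_matrix_mult_def vec_eq_iff sum_distrib_left mult_ac)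
  have ml: "(B + C) ** E = B ** E + C ** E" "B ** (C + E) = B ** C + B ** E"
    "(B - C) ** E = B ** E - C ** E" "B ** (C - E) = B ** C - B ** E" for B C E :: "real ^ 'n ^ 'n"
    by (simp_all add: matrix_matrix_mult_def vec_eq_iff sum_subtractf sum.distrib left_diff_distrib right_diff_distrib distrib_right distrib_left)
  have AJ: "(A ** J) $ i $ j = real (d i)" "(J ** A) $ i $ j = real (d j)" "(J ** J) $ i $ j = 128" for i j
    using row col N by (simp_all add: matrix_matrix_mult_def Jij)
  have t1: "trace A = 0" "trace J = 128" "trace (mat 1 :: real ^ 'n ^ 'n) = 128"
  proof -
    have "trace J = (\<Sum>i\<in>(UNIV :: 'n set). 1)" unfolding trace_def Jij ..
    also have "\<dots> = 128" using N by simp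
    finally show "trace J = 128" .
    show "trace A = 0" unfolding trace_def Aij using irr by simp
    show "trace (mat 1 :: real ^ 'n ^ 'n) = 128" using N by (simp add: trace_def mat_def)
  qed
  have t2: "trace (A ** J) = V" "trace (J ** A) = V" "trace (J ** J) = 128 * 128"
    unfolding trace_def AJ V_def using N by simp_all
  have t2': "trace (A ** A) = V"
    unfolding trace_def V_def row[symmetric] using As by (simp add: matrix_matrix_mult_def Aij of_bool_conj[symmetric] sym cong: conj_cong)
  have sq: "(\<Sum>i\<in>UNIV. \<Sum>k\<in>UNIV. real (d i) * A $ k $ i) = (\<Sum>i\<in>UNIV. (real (d i))^2)"
    "(\<Sum>i\<in>UNIV. \<Sum>k\<in>UNIV. real (d i) * A $ i $ k) = (\<Sum>i\<in>UNIV. (real (d i))^2)"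
    by (simp_all add: sum_distrib_left[symmetric] row col power2_eq_square)
  have t3: "trace (A ** A ** J) = (\<Sum>i\<in>UNIV. (real (d i))^2)" "trace (A ** J ** A) = (\<Sum>i\<in>UNIV. (real (d i))^2)"
    "trace (J ** A ** A) = (\<Sum>i\<in>UNIV. (real (d i))^2)"
  proof -
    have 1: "trace (J ** A ** A) = (\<Sum>i\<in>UNIV. \<Sum>k\<in>UNIV. real (d k) * A $ k $ i)"
      unfolding trace_def by (subst matrix_matrix_mult_def) (simp add: AJ)
    show "trace (J ** A ** A) = (\<Sum>i\<in>UNIV. (real (d i))^2)" unfolding 1 by (subst sum.swap) (rule sq)
    thus "trace (A ** J ** A) = (\<Sum>i\<in>UNIV. (real (d i))^2)" "trace (A ** A ** J) = (\<Sum>i\<in>UNIV. (real (d i))^2)"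
      using trace_mul_sym[of "A ** J" A] trace_mul_sym[of "A ** A" J] trace_mul_sym[of A "J ** A"] by (simp_all add: matrix_mul_assoc)
  qed
  have t4: "trace (A ** J ** J) = 128 * V" "trace (J ** A ** J) = 128 * V" "trace (J ** J ** A) = 128 * V" "trace (J ** J ** J) = 128 * 128 * 128"
  proof -
    have JJ: "J ** J = 128 *\<^sub>R J" by (simp add: vec_eq_iff AJ Jij)
    show "trace (J ** J ** A) = 128 * V" "trace (J ** J ** J) = 128 * 128 * 128" unfolding JJ sc tr t2 t1 by simp_all
    show "trace (A ** J ** J) = 128 * V" unfolding matrix_mul_assoc[symmetric] JJ sc tr t2 by simp
    show "trace (J ** A ** J) = 128 * V" using trace_mul_sym[of "J ** A" J] unfolding matrix_mul_assoc JJ sc tr t2 by simp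
  qed
  have t5: "trace (A ** A ** A) = (\<Sum>i\<in>UNIV. real (\<tau> i))"
  proof -
    have "(A ** A ** A) $ i $ i = real (\<tau> i)" for i
    proof -
      have o: "A $ i $ j * A $ j $ k * A $ k $ i = of_bool ((k, j) \<in> {(k, j). adj i j \<and> adj j k \<and> adj k i})" for j k
        by (simp add: Aij)
      have "(A ** A ** A) $ i $ i = (\<Sum>k\<in>UNIV. \<Sum>j\<in>UNIV. A $ i $ j * A $ j $ k * A $ k $ i)"
        by (simp only: matrix_matrix_mult_def vec_lambda_beta sum_distrib_right)
      also have "\<dots> = (\<Sum>p\<in>UNIV. of_bool (p \<in> {(k, j). adj i j \<and> adj j k \<and> adj k i}))"
        unfolding o sum.cartesian_product by (simp add: case_prod_beta)
      also have "\<dots> = real (card {(k, j). adj i j \<and> adj j k \<and> adj k i})"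
        by (simp only: sum_of_bool_eq finite) simp
      also have "{(k, j). adj i j \<and> adj j k \<and> adj k i} = {(j, k). adj i j \<and> adj i k \<and> adj j k}" using sym by blast
      finally show ?thesis by (simp add: \<tau>_def)
    qed
    thus ?thesis by (simp add: trace_def)
  qed
  note tt = t1 t2 t2' t3 t4 t5
  \<comment> \<open>The 128 diagonal entries are 16/5, with sum 409.6; dividing by 44 gives the mean
    512/55.\<close>
  have T1: "trace B = 44 * (512/55)" unfolding B_def tr tt by simp
  have T2: "trace (B ** B) = 1960.96 + 0.6 * V"
    unfolding B_def ml sc tr matrix_mul_lid matrix_mul_rid tt by (simp add: field_simps)
  have T3: "trace (B ** B ** B) = (\<Sum>i\<in>UNIV. 27 + 9 * real (d i) - real (\<tau> i) + 0.6 * (3 - real (d i))^2 + 15.36 * (3 - real (d i))) + 16777.216"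
  proof -
    have "(\<Sum>i\<in>UNIV. 27 + 9 * real (d i) - real (\<tau> i) + 0.6 * (3 - real (d i))^2 + 15.36 * (3 - real (d i)))
      = (\<Sum>i\<in>UNIV. 27 + 9 * real (d i) - real (\<tau> i) + 0.6 * (9 - 6 * real (d i) + (real (d i))^2) + 15.36 * (3 - real (d i)))"
      by (simp add: power2_eq_square algebra_simps)
    also have "\<dots> = 27 * 128 + 9 * V - (\<Sum>i\<in>UNIV. real (\<tau> i)) + 0.6 * (9 * 128 - 6 * V + (\<Sum>i\<in>UNIV. (real (d i))^2)) + 15.36 * (3 * 128 - V)"
      unfolding sum.distrib sum_subtractf sum_distrib_left[symmetric] V_def using N by simp
    finally have e: "(\<Sum>i\<in>UNIV. 27 + 9 * real (d i) - real (\<tau> i) + 0.6 * (3 - real (d i))^2 + 15.36 * (3 - real (d i)))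
      = 27 * 128 + 9 * V - (\<Sum>i\<in>UNIV. real (\<tau> i)) + 0.6 * (9 * 128 - 6 * V + (\<Sum>i\<in>UNIV. (real (d i))^2)) + 15.36 * (3 * 128 - V)" .
    define q where "q = (\<Sum>i\<in>UNIV. (real (d i))^2)"
    define r where "r = (\<Sum>i\<in>UNIV. real (\<tau> i))"
    have "trace (B ** B ** B) = 27 * 128 + 9 * V - r + 0.6 * (9 * 128 - 6 * V + q) + 15.36 * (3 * 128 - V) + 16777.216"
      unfolding B_def ml sc tr matrix_mul_lid matrix_mul_rid tt q_def[symmetric] r_def[symmetric] by (simp add: field_simps)
    thus ?thesis unfolding e q_def r_def .
  qed
  note ineq = trace_cube_inequality[OF tB rB, of "512/55", unfolded T1 T2]
  show False
  proof (rule valency_sum_contradiction[OF N, of d \<tau> "512/55", OF _ _ _ _ refl refl refl])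
    show "d i \<le> 29" "\<tau> i \<le> d i" "26 < d i \<Longrightarrow> \<tau> i \<le> 12" "d i = 29 \<Longrightarrow> \<tau> i \<le> 6" for i
      unfolding d_def \<tau>_def using v t by blast+
    fix s :: real assume "0 \<le> s" "1960.96 + 0.6 * (\<Sum>i\<in>UNIV. real (d i)) - 44 * (512/55)^2 \<le> s^2"
    thus "(\<Sum>i\<in>UNIV. 27 + 9 * real (d i) - real (\<tau> i) + 0.6 * (3 - real (d i))^2 + 15.36 * (3 - real (d i))) + 16777.216
      - 3 * (512/55) * ((1960.96 + 0.6 * (\<Sum>i\<in>UNIV. real (d i)) - 44 * (512/55)^2) + 44 * (512/55)^2) + 88 * (512/55)^3
      \<le> s * (1960.96 + 0.6 * (\<Sum>i\<in>UNIV. real (d i)) - 44 * (512/55)^2)"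
      using ineq(2)[of s] unfolding T3 V_def by simp
  qed
qed

section \<open>From dependence over the field to the rank of a real matrix\<close>

lemma rational_functional:
  fixes a :: "'k::field_char_0"
  assumes "a \<noteq> 0"
  shows "\<exists>f :: 'k \<Rightarrow> rat. f a = 1 \<and> (\<forall>x y. f (x + y) = f x + f y) \<and> (\<forall>q x. f (of_rat q * x) = q * f x)"
proof -
  interpret K: vector_space "\<lambda>(q::rat) (x::'k). of_rat q * x"
    by unfold_locales (simp_all add: algebra_simps of_rat_add of_rat_mult)
  interpret Q: vector_space "\<lambda>(q::rat) (x::rat). q * x"
    by unfold_locales (simp_all add: algebra_simps)
  interpret vector_space_pair "\<lambda>(q::rat) (x::'k). of_rat q * x" "\<lambda>(q::rat) (x::rat). q * x" ..
  have "K.independent {a}" using assms by simp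
  then obtain f where "Vector_Spaces.linear (\<lambda>(q::rat) (x::'k). of_rat q * x) (\<lambda>(q::rat) (x::rat). q * x) f" "\<forall>x\<in>{a}. f x = 1"
    using linear_independent_extend[of "{a}" "\<lambda>x. 1"] by blast
  thus ?thesis
    by (intro exI[of _ f]) (simp add: linear_add linear_scale)
qed

text \<open>A relation with coefficients in the field is turned into a rational one by a functional
  that is 1 on a nonzero coefficient. It passes through the sums because the entries are
  integers.\<close>

lemma dim_range_le:
  fixes g :: "'n::finite \<Rightarrow> 'n \<Rightarrow> int"
  assumes dep: "\<And>I. card I = Suc r \<Longrightarrow> \<exists>c :: 'n \<Rightarrow> 'k::field_char_0. (\<exists>i\<in>I. c i \<noteq> 0) \<and> (\<forall>j. (\<Sum>i\<in>I. c i * of_int (g i j)) = 0)"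
  shows "dim (range (\<lambda>i. \<chi> j. real_of_int (g i j))) \<le> r"
proof (rule ccontr)
  let ?row = "\<lambda>i. \<chi> j. real_of_int (g i j)"
  assume "\<not> ?thesis"
  moreover obtain B where B: "B \<subseteq> range ?row" "independent B" "card B = dim (range ?row)"
    using basis_exists[of "range ?row"] by metis
  ultimately have "Suc r \<le> card B" by simp
  then obtain B' where B': "B' \<subseteq> B" "card B' = Suc r" "finite B'" by (rule obtain_subset_with_card_n)
  have "\<forall>b\<in>B'. \<exists>i. ?row i = b" using B(1) B'(1) by blast
  then obtain f where f: "\<forall>b\<in>B'. ?row (f b) = b" by (rule bchoice[THEN exE])
  have inj: "inj_on f B'" using f by (metis inj_onI)
  have "card (f ` B') = Suc r" using card_image[OF inj] B'(2) by simp
  then obtain c :: "'n \<Rightarrow> 'k" where c: "\<exists>i\<in>f ` B'. c i \<noteq> 0" "\<forall>j. (\<Sum>i\<in>f ` B'. c i * of_int (g i j)) = 0" using dep by blast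
  then obtain b0 where b0: "b0 \<in> B'" "c (f b0) \<noteq> 0" by blast
  obtain \<phi> :: "'k \<Rightarrow> rat" where \<phi>: "\<phi> (c (f b0)) = 1" "\<And>x y. \<phi> (x + y) = \<phi> x + \<phi> y" "\<And>q x. \<phi> (of_rat q * x) = q * \<phi> x"
    using rational_functional[OF b0(2)] by blast
  have \<phi>0: "\<phi> 0 = 0" using \<phi>(3)[of 0 0] by simp
  have \<phi>sum: "\<phi> (\<Sum>i\<in>S. h i) = (\<Sum>i\<in>S. \<phi> (h i))" if "finite S" for S :: "'z set" and h
    using that by (induction S rule: finite_induct) (simp_all add: \<phi>0 \<phi>(2))
  have e: "(\<Sum>b\<in>B'. real_of_rat (\<phi> (c (f b))) * real_of_int (g (f b) j)) = 0" for j
  proof -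
    have "0 = \<phi> (\<Sum>b\<in>B'. c (f b) * of_int (g (f b) j))"
      using c(2) \<phi>0 by (simp add: sum.reindex[OF inj])
    also have "\<dots> = (\<Sum>b\<in>B'. \<phi> (c (f b) * of_int (g (f b) j)))" by (rule \<phi>sum[OF B'(3)])
    also have "\<dots> = (\<Sum>b\<in>B'. of_int (g (f b) j) * \<phi> (c (f b)))"
    proof (intro sum.cong refl)
      fix b
      have "c (f b) * of_int (g (f b) j) = of_rat (of_int (g (f b) j)) * c (f b)" by (simp add: mult.commute)
      thus "\<phi> (c (f b) * of_int (g (f b) j)) = of_int (g (f b) j) * \<phi> (c (f b))" by (simp only: \<phi>(3))
    qed
    finally have "real_of_rat (\<Sum>b\<in>B'. of_int (g (f b) j) * \<phi> (c (f b))) = 0" by simp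
    thus ?thesis by (simp add: of_rat_sum of_rat_mult mult.commute)
  qed
  have "(\<Sum>b\<in>B'. real_of_rat (\<phi> (c (f b))) *\<^sub>R b) = 0"
  proof -
    have "(\<Sum>b\<in>B'. real_of_rat (\<phi> (c (f b))) *\<^sub>R b) = (\<Sum>b\<in>B'. real_of_rat (\<phi> (c (f b))) *\<^sub>R ?row (f b))"
      using f by (intro sum.cong) auto
    also have "\<dots> = 0" using e by (simp add: vec_eq_iff)
    finally show ?thesis .
  qed
  moreover have "independent B'" using B(2) B'(1) by (rule independent_mono)
  ultimately have "real_of_rat (\<phi> (c (f b0))) = 0" using independentD[of B' B' "\<lambda>b. real_of_rat (\<phi> (c (f b)))" b0] B'(3) b0(1) by simp
  thus False using \<phi>(1) by simp
qed

section \<open>The Jacobian ideal\<close>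

text \<open>Koszul acyclicity in degree one: the four elements \<open>g\<^sub>i\<close> form a regular sequence inside
  the ideal of the \<open>f\<^sub>i\<close>. A syzygy \<open>q\<close> is wedged with the coefficient vectors of
  \<open>g\<^sub>1, g\<^sub>2, g\<^sub>3\<close>, and each of the resulting chains is then seen to be a boundary.\<close>

lemma syzygy_in_ideal:
  fixes f1 f2 f3 f4 :: "'r::comm_ring_1"
  assumes g: "a1 * f1 + a2 * f2 + a3 * f3 + a4 * f4 = g1" "b1 * f1 + b2 * f2 + b3 * f3 + b4 * f4 = g2"
      "c1 * f1 + c2 * f2 + c3 * f3 + c4 * f4 = g3" "d1 * f1 + d2 * f2 + d3 * f3 + d4 * f4 = g4"
    and q: "q1 * f1 + q2 * f2 + q3 * f3 + q4 * f4 = 0"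
    and r4: "\<And>p x y z. g4 * p = g1 * x + g2 * y + g3 * z \<Longrightarrow> \<exists>x y z. p = g1 * x + g2 * y + g3 * z"
    and r3: "\<And>p x y. g3 * p = g1 * x + g2 * y \<Longrightarrow> \<exists>x y. p = g1 * x + g2 * y"
    and r2: "\<And>p x. g2 * p = g1 * x \<Longrightarrow> \<exists>x. p = g1 * x"
    and r1: "\<And>p x. g1 * p = g1 * x \<Longrightarrow> p = x"
  shows "\<exists>t1 t2 t3 t4. q4 = t1 * f1 + t2 * f2 + t3 * f3 + t4 * f4"
proof -
  \<comment> \<open>Coordinates of the exterior products of q with a, of that with b, and finally
    with c. Contraction with f sends q to 0 and a, b, c to g1, g2, g3.\<close>
  define Q12 Q13 Q14 Q23 Q24 Q34 where Q: "Q12 = a1 * q2 - a2 * q1" "Q13 = a1 * q3 - a3 * q1" "Q14 = a1 * q4 - a4 * q1"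
    "Q23 = a2 * q3 - a3 * q2" "Q24 = a2 * q4 - a4 * q2" "Q34 = a3 * q4 - a4 * q3"
  define R234 R134 R124 R123 where R: "R234 = b2 * Q34 - b3 * Q24 + b4 * Q23" "R134 = b1 * Q34 - b3 * Q14 + b4 * Q13"
    "R124 = b1 * Q24 - b2 * Q14 + b4 * Q12" "R123 = b1 * Q23 - b2 * Q13 + b3 * Q12"
  define \<rho> where "\<rho> = c1 * R234 - c2 * R134 + c3 * R124 - c4 * R123"
  let ?s = "q1 * f1 + q2 * f2 + q3 * f3 + q4 * f4"
  have dQ: "f2 * Q12 + f3 * Q13 + f4 * Q14 = a1 * ?s - g1 * q1" "f1 * Q12 - f3 * Q23 - f4 * Q24 = g1 * q2 - a2 * ?s"
    "f1 * Q13 + f2 * Q23 - f4 * Q34 = g1 * q3 - a3 * ?s" "f1 * Q14 + f2 * Q24 + f3 * Q34 = g1 * q4 - a4 * ?s"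
    unfolding Q g(1)[symmetric] by (simp_all add: algebra_simps)
  note dQ = dQ[unfolded q, simplified]
  have q1': "g1 * q1 = - (f2 * Q12 + f3 * Q13 + f4 * Q14)" using dQ(1) by simp
  have dR: "f1 * R134 + f2 * R234 = g2 * Q34 - b3 * (g1 * q4) + b4 * (g1 * q3)" "f1 * R124 - f3 * R234 = g2 * Q24 - b2 * (g1 * q4) + b4 * (g1 * q2)"
    "f1 * R123 + f4 * R234 = g2 * Q23 - b2 * (g1 * q3) + b3 * (g1 * q2)" "- f2 * R124 - f3 * R134 = g2 * Q14 - b1 * (g1 * q4) + b4 * (g1 * q1)"
    "- f2 * R123 + f4 * R134 = g2 * Q13 - b1 * (g1 * q3) + b3 * (g1 * q1)" "f3 * R123 + f4 * R124 = g2 * Q12 - b1 * (g1 * q2) + b2 * (g1 * q1)"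
    unfolding R g(2)[symmetric] q1' dQ(2-4)[symmetric] by (simp_all add: algebra_simps)
  have R2: "\<exists>x y. f1 * \<rho> = g3 * R234 + g1 * x + g2 * y" "\<exists>x y. f2 * \<rho> = - g3 * R134 + g1 * x + g2 * y"
    "\<exists>x y. f3 * \<rho> = g3 * R124 + g1 * x + g2 * y" "\<exists>x y. f4 * \<rho> = - g3 * R123 + g1 * x + g2 * y"
  proof -
    have F: "f1 * \<rho> = g3 * R234 - c2 * (f1 * R134 + f2 * R234) + c3 * (f1 * R124 - f3 * R234) - c4 * (f1 * R123 + f4 * R234)"
      "f2 * \<rho> = - g3 * R134 + c1 * (f1 * R134 + f2 * R234) + c3 * (f2 * R124 + f3 * R134) + c4 * (- f2 * R123 + f4 * R134)"
      "f3 * \<rho> = g3 * R124 - c1 * (f1 * R124 - f3 * R234) - c2 * (f2 * R124 + f3 * R134) - c4 * (f3 * R123 + f4 * R124)"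
      "f4 * \<rho> = - g3 * R123 + c1 * (f1 * R123 + f4 * R234) - c2 * (- f2 * R123 + f4 * R134) + c3 * (f3 * R123 + f4 * R124)"
      unfolding \<rho>_def g(3)[symmetric] by (simp_all add: algebra_simps)
    have h: "f2 * R124 + f3 * R134 = - (g2 * Q14 - b1 * (g1 * q4) + b4 * (g1 * q1))" using dR(4) by (simp add: algebra_simps)
    have "f1 * \<rho> = g3 * R234 + g1 * (c2 * b3 * q4 - c2 * b4 * q3 - c3 * b2 * q4 + c3 * b4 * q2 + c4 * b2 * q3 - c4 * b3 * q2) + g2 * (- c2 * Q34 + c3 * Q24 - c4 * Q23)"
      "f2 * \<rho> = - g3 * R134 + g1 * (- c1 * b3 * q4 + c1 * b4 * q3 + c3 * b1 * q4 - c3 * b4 * q1 - c4 * b1 * q3 + c4 * b3 * q1) + g2 * (c1 * Q34 - c3 * Q14 + c4 * Q13)"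
      "f3 * \<rho> = g3 * R124 + g1 * (c1 * b2 * q4 - c1 * b4 * q2 - c2 * b1 * q4 + c2 * b4 * q1 + c4 * b1 * q2 - c4 * b2 * q1) + g2 * (- c1 * Q24 + c2 * Q14 - c4 * Q12)"
      "f4 * \<rho> = - g3 * R123 + g1 * (- c1 * b2 * q3 + c1 * b3 * q2 + c2 * b1 * q3 - c2 * b3 * q1 - c3 * b1 * q2 + c3 * b2 * q1) + g2 * (c1 * Q23 - c2 * Q13 + c3 * Q12)"
      unfolding F dR h by (simp_all add: algebra_simps)
    thus "\<exists>x y. f1 * \<rho> = g3 * R234 + g1 * x + g2 * y" "\<exists>x y. f2 * \<rho> = - g3 * R134 + g1 * x + g2 * y"
      "\<exists>x y. f3 * \<rho> = g3 * R124 + g1 * x + g2 * y" "\<exists>x y. f4 * \<rho> = - g3 * R123 + g1 * x + g2 * y" by blast+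
  qed
  obtain x1 y1 x2 y2 x3 y3 x4 y4 where f\<rho>: "f1 * \<rho> = g3 * R234 + g1 * x1 + g2 * y1" "f2 * \<rho> = - g3 * R134 + g1 * x2 + g2 * y2"
    "f3 * \<rho> = g3 * R124 + g1 * x3 + g2 * y3" "f4 * \<rho> = - g3 * R123 + g1 * x4 + g2 * y4"
    using R2 by blast
  \<comment> \<open>Since g4 is the contraction of d, the multiple g4 \<rho> lies in (g1, g2, g3);
    by regularity \<rho> lies there itself, and the descent through R and Q can begin.\<close>
  have "g4 * \<rho> = d1 * (f1 * \<rho>) + d2 * (f2 * \<rho>) + d3 * (f3 * \<rho>) + d4 * (f4 * \<rho>)" unfolding g(4)[symmetric] by (simp add: algebra_simps)
  also have "\<dots> = g1 * (d1 * x1 + d2 * x2 + d3 * x3 + d4 * x4) + g2 * (d1 * y1 + d2 * y2 + d3 * y3 + d4 * y4) + g3 * (d1 * R234 - d2 * R134 + d3 * R124 - d4 * R123)"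
    unfolding f\<rho> by (simp add: algebra_simps)
  finally obtain x y u where \<rho>: "\<rho> = g1 * x + g2 * y + g3 * u" using r4 by blast
  have S: "\<exists>r s. e = f * u + g1 * r + g2 * s" if "f * \<rho> = g3 * e + g1 * w1 + g2 * w2" for e f w1 w2
  proof -
    have "g3 * (e - f * u) = g1 * (f * x - w1) + g2 * (f * y - w2)" using that unfolding \<rho> by (simp add: algebra_simps)
    then obtain r s where "e - f * u = g1 * r + g2 * s" using r3 by blast
    hence "e = f * u + g1 * r + g2 * s" by (simp add: algebra_simps)
    thus ?thesis by blast
  qed
  obtain p1 s1 where S1: "R234 = f1 * u + g1 * p1 + g2 * s1" using S[OF f\<rho>(1)] by blast
  obtain p2 s2 where "- R134 = f2 * u + g1 * p2 + g2 * s2" using S[of f2 "- R134" x2 y2] f\<rho>(2) by auto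
  hence S2: "R134 = - (f2 * u + g1 * p2 + g2 * s2)" by (metis minus_minus)
  obtain p3 s3 where S3: "R124 = f3 * u + g1 * p3 + g2 * s3" using S[OF f\<rho>(3)] by blast
  have T: "\<exists>t. Q = v + g1 * t" if "g2 * Q = g2 * v + g1 * w" for Q v w
  proof -
    have "g2 * (Q - v) = g1 * w" using that by (simp add: algebra_simps)
    then obtain t where "Q - v = g1 * t" using r2 by blast
    hence "Q = v + g1 * t" by (simp add: algebra_simps)
    thus ?thesis by blast
  qed
  have "g2 * Q34 = g2 * (- f1 * s2 + f2 * s1) + g1 * (- f1 * p2 + f2 * p1 + b3 * q4 - b4 * q3)" using dR(1) unfolding S1 S2 by (simp add: algebra_simps)
  then obtain t34 where t34: "Q34 = - f1 * s2 + f2 * s1 + g1 * t34" using T by blast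
  have "g2 * Q24 = g2 * (f1 * s3 - f3 * s1) + g1 * (f1 * p3 - f3 * p1 + b2 * q4 - b4 * q2)" using dR(2) unfolding S1 S3 by (simp add: algebra_simps)
  then obtain t24 where t24: "Q24 = f1 * s3 - f3 * s1 + g1 * t24" using T by blast
  have "g2 * Q14 = g2 * (- f2 * s3 + f3 * s2) + g1 * (- f2 * p3 + f3 * p2 + b1 * q4 - b4 * q1)" using dR(4) unfolding S2 S3 by (simp add: algebra_simps)
  then obtain t14 where t14: "Q14 = - f2 * s3 + f3 * s2 + g1 * t14" using T by blast
  \<comment> \<open>The contraction of Q is g1 q. The boundary terms in s1, s2, s3 cancel in it, so
    every remaining term carries g1.\<close>
  have "g1 * q4 = g1 * (f1 * t14 + f2 * t24 + f3 * t34)" unfolding dQ(4)[symmetric] t14 t24 t34 by (simp add: algebra_simps)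
  hence "q4 = f1 * t14 + f2 * t24 + f3 * t34" by (rule r1)
  hence "q4 = t14 * f1 + t24 * f2 + t34 * f3 + 0 * f4" by (simp add: algebra_simps)
  thus ?thesis by blast
qed

text \<open>Nakayama's lemma by hand. Modulo I the powers of Z below n generate over A, and the
  element with coefficients f, which reduces to 1 under \<open>ev\<close>, shows that the module
  equals its multiple by the kernel of \<open>ev\<close>. \<open>C k\<close> says that after
  multiplication by some c with value 1 the powers below k generate; \<open>C 0\<close> puts c into
  I.\<close>

lemma elimination:
  fixes I A :: "'r::comm_ring_1 set" and ev :: "'r \<Rightarrow> 'k::field"
  assumes I: "\<And>x y. x \<in> I \<Longrightarrow> y \<in> I \<Longrightarrow> x + y \<in> I" "\<And>r x. x \<in> I \<Longrightarrow> r * x \<in> I" "0 \<in> I"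
    and A: "\<And>x y. x \<in> A \<Longrightarrow> y \<in> A \<Longrightarrow> x + y \<in> A" "\<And>x y. x \<in> A \<Longrightarrow> y \<in> A \<Longrightarrow> x * y \<in> A" "0 \<in> A" "1 \<in> A" "\<And>x. x \<in> A \<Longrightarrow> - x \<in> A"
    and ev: "\<And>x y. x \<in> A \<Longrightarrow> y \<in> A \<Longrightarrow> ev (x + y) = ev x + ev y" "\<And>x y. x \<in> A \<Longrightarrow> y \<in> A \<Longrightarrow> ev (x * y) = ev x * ev y" "ev 1 = 1" "ev 0 = 0"
    and monic: "\<exists>c. (\<forall>j. c j \<in> A) \<and> Z ^ n - (\<Sum>j<n. c j * Z ^ j) \<in> I"
    and f: "\<And>j. f j \<in> A" "(\<Sum>j<d. f j * Z ^ j) \<in> I" "\<And>j. ev (f j) = (if j = 0 then 1 else 0)" "0 < d"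
  shows "\<exists>c. c \<in> A \<and> c \<in> I \<and> ev c = 1"
proof -
  have Im: "- x \<in> I" if "x \<in> I" for x using I(2)[OF that, of "- 1"] by simp
  have Isum: "sum h S \<in> I" if "\<And>i. i \<in> S \<Longrightarrow> h i \<in> I" for h and S :: "nat set"
    using that by (induction S rule: infinite_finite_induct) (auto intro: I)
  have Asum: "sum h S \<in> A" if "\<And>i. i \<in> S \<Longrightarrow> h i \<in> A" for h and S :: "nat set"
    using that by (induction S rule: infinite_finite_induct) (auto intro: A)
  have evsum: "ev (sum h S) = (\<Sum>i\<in>S. ev (h i))" if "\<And>i. i \<in> S \<Longrightarrow> h i \<in> A" for h and S :: "nat set"
    using that by (induction S rule: infinite_finite_induct) (auto simp: ev Asum)
  have evm: "ev (- x) = - ev x" if "x \<in> A" for x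
  proof -
    have "ev (- x) + ev x = ev (- x + x)" using ev(1)[OF A(5)[OF that] that] by simp
    thus ?thesis using ev(4) by (simp add: eq_neg_iff_add_eq_0)
  qed
  define C where "C k \<longleftrightarrow> (\<exists>c\<in>A. ev c = 1 \<and> (\<forall>N. \<exists>r. (\<forall>j. r j \<in> A) \<and> c * Z ^ N - (\<Sum>j<k. r j * Z ^ j) \<in> I))" for k
  have "C n"
  proof -
    obtain c where c: "\<And>j. c j \<in> A" "Z ^ n - (\<Sum>j<n. c j * Z ^ j) \<in> I" using monic by blast
    have "\<exists>r. (\<forall>j. r j \<in> A) \<and> Z ^ N - (\<Sum>j<n. r j * Z ^ j) \<in> I" for N
    proof (induction N)
      case 0
      show ?case
      proof (cases n)
        case 0 thus ?thesis using c(2) A(3) by (intro exI[of _ "\<lambda>j. 0"]) simp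
      next
        case (Suc n')
        have "(\<Sum>j<n. (if j = 0 then 1 else 0) * Z ^ j) = 1" unfolding Suc sum.lessThan_Suc_shift by simp
        thus ?thesis using A(3,4) I(3) by (intro exI[of _ "\<lambda>j. if j = 0 then 1 else 0"]) auto
      qed
    next
      case (Suc N)
      then obtain r where r: "\<And>j. r j \<in> A" "Z ^ N - (\<Sum>j<n. r j * Z ^ j) \<in> I" by blast
      show ?case
      proof (cases n)
        case 0
        hence "Z ^ Suc N \<in> I" using I(2)[of "Z ^ N" Z] r(2) by simp
        thus ?thesis using A(3) 0 by (intro exI[of _ "\<lambda>j. 0"]) simp
      next
        case (Suc m)
        define s where "s j = (if j = 0 then 0 else r (j - 1)) + r m * c j" for j
        have "Z * (Z ^ N - (\<Sum>j<n. r j * Z ^ j)) + r m * (Z ^ n - (\<Sum>j<n. c j * Z ^ j)) = Z ^ Suc N - (\<Sum>j<n. s j * Z ^ j)"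
        proof -
          have "Z * (\<Sum>j<n. r j * Z ^ j) = (\<Sum>j<m. r j * Z ^ Suc j) + r m * Z ^ n"
            unfolding Suc by (simp add: sum_distrib_left algebra_simps)
          moreover have "(\<Sum>j<n. (if j = 0 then 0 else r (j - 1)) * Z ^ j) = (\<Sum>j<m. r j * Z ^ Suc j)"
            unfolding Suc by (subst sum.lessThan_Suc_shift) simp
          moreover have "(\<Sum>j<n. s j * Z ^ j) = (\<Sum>j<n. (if j = 0 then 0 else r (j - 1)) * Z ^ j) + r m * (\<Sum>j<n. c j * Z ^ j)"
            by (simp add: s_def sum.distrib distrib_right sum_distrib_left mult.assoc)
          ultimately show ?thesis by (simp add: algebra_simps)
        qed
        moreover have "Z * (Z ^ N - (\<Sum>j<n. r j * Z ^ j)) + r m * (Z ^ n - (\<Sum>j<n. c j * Z ^ j)) \<in> I"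
          using r(2) c(2) I by blast
        moreover have "\<forall>j. s j \<in> A" using r(1) c(1) A by (auto simp: s_def)
        ultimately show ?thesis by metis
      qed
    qed
    thus ?thesis unfolding C_def using A(4) ev(3) by (intro bexI[of _ 1]) auto
  qed
  moreover have "C k" if Ck: "C (Suc k)" for k
  proof -
    obtain c where c: "c \<in> A" "ev c = 1" "\<forall>N. \<exists>r. (\<forall>j. r j \<in> A) \<and> c * Z ^ N - (\<Sum>j<Suc k. r j * Z ^ j) \<in> I"
      using Ck unfolding C_def by blast
    obtain r where r: "\<And>N j. r N j \<in> A" "\<And>N. c * Z ^ N - (\<Sum>j<Suc k. r N j * Z ^ j) \<in> I"
      using choice[OF c(3)] by blast
    define e where "e j = (if j = 0 then 1 - f 0 else - f j)" for j
    have eA: "e j \<in> A" for j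
      using A(1)[OF A(4) A(5)[OF f(1)[of 0]]] A(5)[OF f(1)[of j]] by (simp add: e_def)
    have eve: "ev (e j) = 0" for j
    proof (cases "j = 0")
      case True
      have "ev (1 + - f 0) = ev 1 + ev (- f 0)" by (rule ev(1)[OF A(4) A(5)[OF f(1)]])
      thus ?thesis using True evm[OF f(1)[of 0]] f(3)[of 0] ev(3) by (simp add: e_def)
    next
      case False
      thus ?thesis using evm[OF f(1)[of j]] f(3)[of j] by (simp add: e_def)
    qed
    define s where "s i = (\<Sum>j<d. e j * r (j + k) i)" for i
    have sA: "s i \<in> A" for i unfolding s_def by (intro Asum A eA r)
    have evs: "ev (s i) = 0" for i unfolding s_def by (subst evsum) (auto simp: A eA r ev(2) eve)
    have key: "c * Z ^ k - (\<Sum>i<Suc k. s i * Z ^ i) \<in> I"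
    proof -
      have 1: "(\<Sum>j<d. f j * Z ^ j) = 1 - (\<Sum>j<d. e j * Z ^ j)"
      proof -
        obtain d' where d: "d = Suc d'" using f(4) by (cases d) auto
        show ?thesis unfolding d sum.lessThan_Suc_shift by (simp add: e_def sum_negf)
      qed
      have 2: "c * Z ^ k * (\<Sum>j<d. f j * Z ^ j) \<in> I" by (rule I(2)[OF f(2)])
      have 3: "(\<Sum>j<d. e j * (c * Z ^ (j + k) - (\<Sum>i<Suc k. r (j + k) i * Z ^ i))) \<in> I"
        by (intro Isum I(2) r)
      have 4: "(\<Sum>i<Suc k. s i * Z ^ i) = (\<Sum>j<d. e j * (\<Sum>i<Suc k. r (j + k) i * Z ^ i))"
        unfolding s_def sum_distrib_right sum_distrib_left by (subst sum.swap) (simp add: mult.assoc)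
      have "c * Z ^ k - (\<Sum>i<Suc k. s i * Z ^ i)
        = c * Z ^ k * (\<Sum>j<d. f j * Z ^ j) + (\<Sum>j<d. e j * (c * Z ^ (j + k) - (\<Sum>i<Suc k. r (j + k) i * Z ^ i)))"
        unfolding 1 4 by (simp only: right_diff_distrib sum_subtractf sum_distrib_left mult_1_right power_add) (simp add: mult_ac)
      thus ?thesis using I(1)[OF 2 3] by simp
    qed
    \<comment> \<open>The coefficient of Z^k on the right has value 0 under \<open>ev\<close>, so it
      can be moved to the left without destroying the value 1.\<close>
    define c' where "c' = c - s k"
    have c'A: "c' \<in> A" "ev c' = 1"
    proof -
      have "c + - s k \<in> A" by (intro A c sA)
      thus "c' \<in> A" by (simp add: c'_def)
      have "ev (c + - s k) = ev c + ev (- s k)" by (intro ev A c sA)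
      thus "ev c' = 1" using evm[OF sA] evs c(2) by (simp add: c'_def)
    qed
    have key': "c' * Z ^ k - (\<Sum>i<k. s i * Z ^ i) \<in> I"
      using key by (simp add: c'_def algebra_simps)
    show "C k"
      unfolding C_def
    proof (intro bexI[of _ "c' * c"] conjI allI)
      show "c' * c \<in> A" "ev (c' * c) = 1" using c'A c A(2) ev(2) by simp_all
      fix N
      define t where "t i = c' * r N i + r N k * s i" for i
      have "c' * (c * Z ^ N - (\<Sum>j<Suc k. r N j * Z ^ j)) + r N k * (c' * Z ^ k - (\<Sum>i<k. s i * Z ^ i)) = c' * c * Z ^ N - (\<Sum>j<k. t j * Z ^ j)"
        by (simp add: t_def sum.distrib distrib_right sum_distrib_left algebra_simps)
      moreover have "c' * (c * Z ^ N - (\<Sum>j<Suc k. r N j * Z ^ j)) + r N k * (c' * Z ^ k - (\<Sum>i<k. s i * Z ^ i)) \<in> I"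
        by (intro I r key')
      moreover have "\<forall>j. t j \<in> A" unfolding t_def by (intro allI A(1,2) c'A(1) r(1) sA)
      ultimately show "\<exists>r. (\<forall>j. r j \<in> A) \<and> c' * c * Z ^ N - (\<Sum>j<k. r j * Z ^ j) \<in> I"
        by (intro exI[of _ t]) simp
    qed
  qed
  ultimately have "C 0" by (induction n) auto
  then obtain c where c: "c \<in> A" "ev c = 1" "\<forall>N. \<exists>r. (\<forall>j. r j \<in> A) \<and> c * Z ^ N - (\<Sum>j<0. r j * Z ^ j) \<in> I"
    unfolding C_def by blast
  have "c \<in> I" using spec[OF c(3), of 0] by simp
  thus ?thesis using c by blast
qed

section \<open>Polynomials in four variables: substitution, degree, and the variables
  involved\<close>

lemma poly4_sum_terms: "p = (\<Sum>m\<in>keys p. single m (lookup p m))" for p :: "'k::comm_monoid_add poly4"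
proof (rule poly_mapping_eqI)
  fix m
  have "(\<Sum>n\<in>keys p. lookup (single n (lookup p n)) m) = (\<Sum>n\<in>keys p. if n = m then lookup p m else 0)"
    by (intro sum.cong refl) (auto simp: lookup_single when_def)
  also have "\<dots> = lookup p m" by (simp add: in_keys_iff)
  finally show "lookup p m = lookup (\<Sum>m\<in>keys p. single m (lookup p m)) m"
    by (simp add: lookup_sum)
qed

lemma poly4_term_induct:
  fixes p :: "'k::comm_monoid_add poly4"
  assumes "P 0" "\<And>a b. P a \<Longrightarrow> P b \<Longrightarrow> P (a + b)" "\<And>m c. m \<in> keys p \<Longrightarrow> P (single m c)"
  shows "P p"
proof -
  have "P (\<Sum>m\<in>T. single m (lookup p m))" if "T \<subseteq> keys p" "finite T" for T
    using that(2,1) by (induction T rule: finite_induct) (auto intro: assms)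
  thus ?thesis using poly4_sum_terms[of p] by (metis finite_keys subset_refl)
qed

text \<open>Restriction of p to a parametrised curve. It is used on lines parallel to a coordinate
  axis, where Euclidean division is available.\<close>

definition psub :: "(4 \<Rightarrow> 'k::comm_ring_1 poly) \<Rightarrow> 'k poly4 \<Rightarrow> 'k poly" where
  "psub y p = (\<Sum>m\<in>keys p. [:lookup p m:] * (\<Prod>i\<in>UNIV. y i ^ lookup m i))"

lemma psub_alt:
  assumes "finite S" "keys p \<subseteq> S"
  shows "psub y p = (\<Sum>m\<in>S. [:lookup p m:] * (\<Prod>i\<in>UNIV. y i ^ lookup m i))"
  unfolding psub_def using assms by (intro sum.mono_neutral_left) (auto simp: in_keys_iff)

lemma psub_zero [simp]: "psub y 0 = 0" by (simp add: psub_def)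

lemma psub_add: "psub y (p + q) = psub y p + psub y q"
proof -
  let ?S = "keys p \<union> keys q"
  have "keys (p + q) \<subseteq> ?S" by (rule keys_add)
  hence "psub y (p + q) = (\<Sum>m\<in>?S. [:lookup (p + q) m:] * (\<Prod>i\<in>UNIV. y i ^ lookup m i))"
    by (intro psub_alt) auto
  also have "\<dots> = (\<Sum>m\<in>?S. [:lookup p m:] * (\<Prod>i\<in>UNIV. y i ^ lookup m i)
      + [:lookup q m:] * (\<Prod>i\<in>UNIV. y i ^ lookup m i))"
    unfolding lookup_add distrib_right[symmetric] by simp
  also have "\<dots> = psub y p + psub y q" unfolding sum.distrib by (simp add: psub_alt[of ?S])
  finally show ?thesis .
qed

lemma psub_sum: "psub y (\<Sum>i\<in>A. p i) = (\<Sum>i\<in>A. psub y (p i))"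
  by (induction A rule: infinite_finite_induct) (auto simp: psub_add)

lemma psub_single: "psub y (single m c) = [:c:] * (\<Prod>i\<in>UNIV. y i ^ lookup m i)"
  by (subst psub_alt[of "{m}"]) auto

lemma psub_mult: "psub y (p * q) = psub y p * psub y q"
proof (rule poly4_term_induct[of "\<lambda>p. psub y (p * q) = psub y p * psub y q"])
  fix m c
  show "psub y (single m c * q) = psub y (single m c) * psub y q"
  proof (rule poly4_term_induct[of "\<lambda>q. psub y (single m c * q) = psub y (single m c) * psub y q"])
    fix n d
    have "[:c * d:] = [:c:] * [:d:]" by simp
    thus "psub y (single m c * single n d) = psub y (single m c) * psub y (single n d)"
      by (simp add: mult_single psub_single lookup_add power_add prod.distrib mult_ac del: mult_pCons_left mult_pCons_right)
  qed (simp_all add: psub_add algebra_simps)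
qed (simp_all add: psub_add algebra_simps)

lemma poly_psub: "poly (psub y p) t = poly4_eval p (\<chi> i. poly (y i) t)"
  by (simp add: psub_def poly4_eval_def poly_sum poly_prod)

lemma poly4_eval_mult: "poly4_eval (p * q) x = poly4_eval p x * (poly4_eval q x :: 'k::comm_ring_1)"
  using psub_mult[of "\<lambda>i. [:x $ i:]" p q, THEN arg_cong[of _ _ "\<lambda>p. poly p 0"]] by (simp add: poly_psub)

lemma poly4_eval_one [simp]: "poly4_eval 1 x = (1 :: 'k::field)"
  using poly4_eval_single[of 0 1 x] by (simp add: single_one)

lemma psub_one [simp]: "psub y 1 = 1"
  using psub_single[of y 0 1] by (simp add: single_one flip: one_pCons)

abbreviation var :: "4 \<Rightarrow> 'k::comm_semiring_1 poly4" where "var i \<equiv> single (single i 1) 1"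

lemma var_power: "var i ^ n = single (single i n) (1 :: 'k::comm_semiring_1)"
proof (induction n)
  case 0 show ?case by (simp add: single_one)
next
  case (Suc n)
  have "single i 1 + single i n = single i (Suc n)"
    by (simp add: single_add[symmetric])
  thus ?case using Suc by (simp add: mult_single)
qed

lemma homogeneous_add: "homogeneous d p \<Longrightarrow> homogeneous d q \<Longrightarrow> homogeneous d (p + q)"
  using keys_add[of p q] by (auto simp: homogeneous_def)

lemma homogeneous_0: "homogeneous d 0" by (simp add: homogeneous_def)

lemma homogeneous_sum: "(\<And>i. i \<in> S \<Longrightarrow> homogeneous d (p i)) \<Longrightarrow> homogeneous d (\<Sum>i\<in>S. p i)"
  by (induction S rule: infinite_finite_induct) (simp_all add: homogeneous_add homogeneous_0)

lemma monomial_degree_add: "monomial_degree (m + n) = monomial_degree m + monomial_degree n"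
  by (simp add: monomial_degree_def lookup_add sum.distrib)

lemma homogeneous_mult: "homogeneous d p \<Longrightarrow> homogeneous e q \<Longrightarrow> homogeneous (d + e) (p * q)"
  using keys_mult[of p q] by (fastforce simp: homogeneous_def monomial_degree_add)

lemma monomial_degree_single: "monomial_degree (single i n) = n"
  by (simp add: monomial_degree_def lookup_single when_def)

lemma homogeneous_decomposition:
  fixes p :: "'k::comm_monoid_add poly4"
  shows "\<exists>C N. (\<forall>e. homogeneous e (C e)) \<and> (\<forall>M\<ge>N. p = (\<Sum>e\<le>M. C e))"
proof (rule poly4_term_induct[of "\<lambda>p. \<exists>C N. (\<forall>e. homogeneous e (C e)) \<and> (\<forall>M\<ge>N. p = (\<Sum>e\<le>M. C e))"])
  show "\<exists>C N. (\<forall>e. homogeneous e (C e)) \<and> (\<forall>M\<ge>N. 0 = (\<Sum>e\<le>M. C e :: 'k poly4))"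
    by (intro exI[of _ "\<lambda>e. 0"]) (simp add: homogeneous_def)
next
  fix a b :: "'k poly4"
  assume "\<exists>C N. (\<forall>e. homogeneous e (C e)) \<and> (\<forall>M\<ge>N. a = (\<Sum>e\<le>M. C e))" "\<exists>C N. (\<forall>e. homogeneous e (C e)) \<and> (\<forall>M\<ge>N. b = (\<Sum>e\<le>M. C e))"
  then obtain C N C' N' where h: "\<forall>e. homogeneous e (C e)" "\<forall>M\<ge>N. a = (\<Sum>e\<le>M. C e)" "\<forall>e. homogeneous e (C' e)" "\<forall>M\<ge>N'. b = (\<Sum>e\<le>M. C' e)" by blast
  show "\<exists>C N. (\<forall>e. homogeneous e (C e)) \<and> (\<forall>M\<ge>N. a + b = (\<Sum>e\<le>M. C e))"
  proof (intro exI conjI allI impI)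
    show "homogeneous e (C e + C' e)" for e using h by (intro homogeneous_add) auto
    fix M assume M: "max N N' \<le> M"
    hence "a = (\<Sum>e\<le>M. C e)" "b = (\<Sum>e\<le>M. C' e)" using h(2,4) by simp_all
    thus "a + b = (\<Sum>e\<le>M. C e + C' e)" by (simp add: sum.distrib)
  qed
next
  fix m and c :: 'k
  show "\<exists>C N. (\<forall>e. homogeneous e (C e)) \<and> (\<forall>M\<ge>N. single m c = (\<Sum>e\<le>M. C e))"
    by (intro exI[of _ "\<lambda>e. if e = monomial_degree m then single m c else 0"] exI[of _ "monomial_degree m"])
       (auto simp: homogeneous_def split: if_splits)
qed

text \<open>Components of different degrees cannot cancel; so a component of a polynomial involves
  no new variables.\<close>

lemma homogeneous_component_keys:
  assumes "finite S" "inj_on \<delta> S" "\<And>e. e \<in> S \<Longrightarrow> homogeneous (\<delta> e) (C e)" "p = (\<Sum>e\<in>S. C e)" "d \<in> S"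
  shows "keys (C d) \<subseteq> keys p"
proof
  fix m assume m: "m \<in> keys (C d)"
  have "lookup p m = (\<Sum>e\<in>S. if e = d then lookup (C d) m else 0)"
    unfolding assms(4) lookup_sum
  proof (intro sum.cong refl)
    fix e assume e: "e \<in> S"
    have "m \<notin> keys (C e)" if "e \<noteq> d"
    proof -
      have "\<delta> e \<noteq> \<delta> d" using assms(2,5) e that by (auto simp: inj_on_def)
      thus ?thesis using m assms(3)[OF e] assms(3)[OF assms(5)] unfolding homogeneous_def by auto
    qed
    thus "lookup (C e) m = (if e = d then lookup (C d) m else 0)"
      by (simp add: in_keys_iff)
  qed
  also have "\<dots> = lookup (C d) m" using assms(1,5) by simp
  finally show "m \<in> keys p" using m by (simp add: in_keys_iff)
qed

definition in_vars :: "4 set \<Rightarrow> 'k::zero poly4 \<Rightarrow> bool" where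
  "in_vars V p \<longleftrightarrow> (\<forall>m\<in>keys p. \<forall>i. i \<notin> V \<longrightarrow> lookup m i = 0)"

lemma in_vars_add: "in_vars V p \<Longrightarrow> in_vars V q \<Longrightarrow> in_vars V (p + q)"
  using keys_add[of p q] by (auto simp: in_vars_def)

lemma in_vars_mult: "in_vars V p \<Longrightarrow> in_vars V q \<Longrightarrow> in_vars V (p * q)"
  using keys_mult[of p q] by (fastforce simp: in_vars_def lookup_add)

lemma in_vars_0: "in_vars V 0" by (simp add: in_vars_def)
lemma in_vars_1: "in_vars V 1" unfolding single_one[symmetric] by (simp add: in_vars_def)
lemma in_vars_uminus: "in_vars V p \<Longrightarrow> in_vars V (- p)" for p :: "'k::ab_group_add poly4" by (simp add: in_vars_def)

lemma expand_in_var: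
  fixes p :: "'k::comm_ring_1 poly4"
  assumes "in_vars (insert i V) p" "i \<notin> V"
  shows "\<exists>f. (\<forall>j. in_vars V (f j)) \<and> (\<forall>d. (\<forall>m\<in>keys p. lookup m i < d) \<longrightarrow> p = (\<Sum>j<d. f j * var i ^ j))"
proof -
  define K where "K = keys p"
  define r where "r m = m - single i (lookup m i)" for m :: monomial4
  define f where "f j = (\<Sum>m\<in>{m\<in>K. lookup m i = j}. single (r m) (lookup p m))" for j
  have r: "r m + single i (lookup m i) = m" for m
    by (rule poly_mapping_eqI) (simp add: r_def lookup_add lookup_minus lookup_single when_def)
  have rl: "lookup (r m) l = (if l = i then 0 else lookup m l)" for m l
    by (simp add: r_def lookup_minus lookup_single when_def)
  have in_sum: "in_vars V (\<Sum>m\<in>S. g m)" if "\<And>m. m \<in> S \<Longrightarrow> in_vars V (g m)" for S and g :: "monomial4 \<Rightarrow> 'k poly4"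
    using that by (induction S rule: infinite_finite_induct) (auto intro: in_vars_add in_vars_0)
  have "in_vars V (f j)" for j
    unfolding f_def
  proof (rule in_sum)
    fix m assume "m \<in> {m\<in>K. lookup m i = j}"
    thus "in_vars V (single (r m) (lookup p m))"
      using assms(1) by (auto simp: in_vars_def K_def rl)
  qed
  moreover have "p = (\<Sum>j<d. f j * var i ^ j)" if d: "\<forall>m\<in>keys p. lookup m i < d" for d
  proof -
    have "(\<Sum>j<d. f j * var i ^ j) = (\<Sum>j<d. \<Sum>m\<in>{m\<in>K. lookup m i = j}. single m (lookup p m))"
      unfolding f_def sum_distrib_right var_power
    proof (intro sum.cong refl)
      fix j m assume "m \<in> {m\<in>K. lookup m i = j}"
      thus "single (r m) (lookup p m) * single (single i j) 1 = single m (lookup p m)"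
        using r[of m] by (auto simp: mult_single)
    qed
    also have "\<dots> = (\<Sum>m\<in>K. single m (lookup p m))"
      by (rule sum.group) (use d in \<open>auto simp: K_def\<close>)
    also have "\<dots> = p" unfolding K_def by (rule poly4_sum_terms[symmetric])
    finally show ?thesis by simp
  qed
  ultimately show ?thesis by blast
qed

abbreviation const4 :: "'k::zero \<Rightarrow> 'k poly4" where "const4 c \<equiv> single 0 c"

lemma poly4_eval_const [simp]: "poly4_eval (const4 c) x = c" by (simp add: poly4_eval_single)

lemma psub_const [simp]: "psub y (const4 c) = [:c:]"
  by (simp add: psub_single)

lemma psub_var [simp]: "psub y (var i) = y i"
proof -
  have "(\<Prod>j\<in>UNIV. y j ^ lookup (single i 1) j) = (\<Prod>j\<in>UNIV. if j = i then y i else 1)"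
    by (intro prod.cong refl) (simp add: lookup_single when_def)
  thus ?thesis by (simp add: psub_single)
qed

lemma psub_power: "psub y (p ^ n) = psub y p ^ n"
  by (induction n) (simp_all add: psub_mult)

lemma psub_in_vars:
  assumes "in_vars V p" "\<And>i. i \<in> V \<Longrightarrow> y i = [:a $ i:]" shows "psub y p = [:poly4_eval p a:]"
proof (rule poly_eqI)
  have "psub y p = (\<Sum>m\<in>keys p. [:lookup p m * (\<Prod>i\<in>UNIV. (a $ i) ^ lookup m i):])"
    unfolding psub_def
  proof (rule sum.cong[OF refl])
    fix m assume m: "m \<in> keys p"
    have pw: "[:c:] ^ n = [:c ^ n:]" for c :: 'a and n by (induction n) (simp_all flip: one_pCons)
    have "(\<Prod>i\<in>UNIV. y i ^ lookup m i) = (\<Prod>i\<in>UNIV. [:(a $ i) ^ lookup m i:])"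
    proof (intro prod.cong refl)
      fix i
      show "y i ^ lookup m i = [:(a $ i) ^ lookup m i:]"
      proof (cases "i \<in> V")
        case True thus ?thesis using assms(2) pw by simp
      next
        case False thus ?thesis using assms(1) m by (simp add: in_vars_def flip: one_pCons)
      qed
    qed
    also have "\<dots> = [:\<Prod>i\<in>UNIV. (a $ i) ^ lookup m i:]"
    proof -
      have "(\<Prod>i\<in>S. [:h i:]) = [:\<Prod>i\<in>S. h i:]" if "finite S" for S :: "4 set" and h :: "4 \<Rightarrow> 'a"
        using that by (induction S rule: finite_induct) (simp_all flip: one_pCons)
      thus ?thesis by simp
    qed
    finally show "[:lookup p m:] * (\<Prod>i\<in>UNIV. y i ^ lookup m i) = [:lookup p m * (\<Prod>i\<in>UNIV. (a $ i) ^ lookup m i):]"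
      by simp
  qed
  moreover have "(\<Sum>m\<in>S. [:h m:]) = [:\<Sum>m\<in>S. h m:]" if "finite S" for S :: "monomial4 set" and h :: "monomial4 \<Rightarrow> 'a"
    using that by (induction S rule: finite_induct) simp_all
  ultimately show "coeff (psub y p) n = coeff [:poly4_eval p a:] n" for n by (simp add: poly4_eval_def)
qed

lemma poly4_eval_uminus: "poly4_eval (- p) x = - poly4_eval p x" for p :: "'k::comm_ring_1 poly4"
  using poly4_eval_add[of "- p" p x] by (simp add: eq_neg_iff_add_eq_0)

lemma poly4_eval_var: "poly4_eval (var i) x = x $ i" for x :: "'k::comm_ring_1 ^ 4"
proof -
  have "(\<Prod>j\<in>UNIV. (x $ j) ^ lookup (single i 1) j) = (\<Prod>j\<in>UNIV. if j = i then x $ i else 1)"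
    by (intro prod.cong refl) (simp add: lookup_single when_def)
  thus ?thesis by (simp add: poly4_eval_single)
qed

lemma poly4_eval_power: "poly4_eval (p ^ n) x = poly4_eval p x ^ n" for x :: "'k::field ^ 4"
  by (induction n) (simp_all add: poly4_eval_mult)

lemma homogeneous_eq_single:
  assumes "monomial_degree m = n" "\<And>l. l \<noteq> i \<Longrightarrow> lookup m l = 0"
  shows "m = single i n"
proof -
  have "monomial_degree m = (\<Sum>l\<in>UNIV. if l = i then lookup m i else 0)"
    unfolding monomial_degree_def using assms(2) by (intro sum.cong) auto
  hence "lookup m i = n" using assms(1) by simp
  thus ?thesis using assms(2) by (intro poly_mapping_eqI) (auto simp: lookup_single when_def)
qed

lemma eval_axis_homogeneous:
  assumes "homogeneous n g"
  shows "poly4_eval g (axis i 1) = lookup g (single i n)"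
proof -
  have "poly4_eval g (axis i 1) = (\<Sum>m\<in>keys g. if m = single i n then lookup g m else 0)"
    unfolding poly4_eval_def
  proof (intro sum.cong refl)
    fix m assume m: "m \<in> keys g"
    have "(\<Prod>l\<in>UNIV. (axis i 1 $ l :: 'a) ^ lookup m l) = (if m = single i n then 1 else 0)"
    proof (cases "m = single i n")
      case True thus ?thesis by (auto simp: axis_def lookup_single when_def intro!: prod.neutral)
    next
      case False
      then obtain l where "l \<noteq> i" "lookup m l \<noteq> 0"
        using homogeneous_eq_single[of m n i] assms m unfolding homogeneous_def by blast
      hence "(axis i 1 $ l :: 'a) ^ lookup m l = 0" by (simp add: axis_def zero_power)
      thus ?thesis using False by (auto intro!: prod_zero)
    qed
    thus "lookup g m * (\<Prod>l\<in>UNIV. (axis i 1 $ l :: 'a) ^ lookup m l) = (if m = single i n then lookup g m else 0)"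
      by simp
  qed
  thus ?thesis by (simp add: in_keys_iff)
qed

section \<open>The ideal of four forms without a common zero\<close>

locale form_ideal =
  fixes f :: "4 \<Rightarrow> 'k::{alg_closed_field,field_char_0} poly4" and e :: nat
  assumes hom: "\<And>i. homogeneous e (f i)" and no_zero: "\<And>x. x \<noteq> 0 \<Longrightarrow> \<exists>i. poly4_eval (f i) x \<noteq> 0"
begin

definition I :: "'k poly4 set" where "I = {p. \<exists>r. p = (\<Sum>i\<in>UNIV. r i * f i)}"

lemma I_closed: "x \<in> I \<Longrightarrow> y \<in> I \<Longrightarrow> x + y \<in> I" "x \<in> I \<Longrightarrow> r * x \<in> I" "0 \<in> I" "f i \<in> I"
proof -
  assume "x \<in> I" "y \<in> I"
  then obtain s t where "x = (\<Sum>i\<in>UNIV. s i * f i)" "y = (\<Sum>i\<in>UNIV. t i * f i)" by (auto simp: I_def)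
  hence "x + y = (\<Sum>i\<in>UNIV. (s i + t i) * f i)" by (simp add: sum.distrib distrib_right)
  thus "x + y \<in> I" unfolding I_def by (intro CollectI exI)
next
  assume "x \<in> I"
  then obtain s where "x = (\<Sum>i\<in>UNIV. s i * f i)" by (auto simp: I_def)
  hence "r * x = (\<Sum>i\<in>UNIV. (r * s i) * f i)" by (simp add: sum_distrib_left mult.assoc)
  thus "r * x \<in> I" unfolding I_def by (intro CollectI exI)
next
  have "0 = (\<Sum>i\<in>UNIV. 0 * f i)" by simp
  thus "0 \<in> I" unfolding I_def by (intro CollectI exI)
next
  have "f i = (\<Sum>j\<in>UNIV. if j = i then f j else 0)" by simp
  also have "\<dots> = (\<Sum>j\<in>UNIV. (if j = i then 1 else 0) * f j)" by (intro sum.cong) auto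
  finally show "f i \<in> I" unfolding I_def by (intro CollectI exI)
qed

text \<open>The generators are forms, so the components of c lie in I as well, and one of them is
  nonzero at the point.\<close>

lemma I_homogeneous:
  assumes "c \<in> I" "in_vars V c" "poly4_eval c a \<noteq> 0"
  shows "\<exists>h d. h \<in> I \<and> homogeneous d h \<and> in_vars V h \<and> poly4_eval h a \<noteq> 0"
proof -
  obtain r where r: "c = (\<Sum>i\<in>UNIV. r i * f i)" using assms(1) by (auto simp: I_def)
  have "\<forall>i. \<exists>CN. (\<forall>t. homogeneous t (fst CN t)) \<and> (\<forall>M\<ge>snd CN. r i = (\<Sum>t\<le>M. fst CN t))"
    using homogeneous_decomposition by (metis fst_conv snd_conv)
  then obtain CN where CN: "\<And>i t. homogeneous t (fst (CN i) t)" "\<And>i M. snd (CN i) \<le> M \<Longrightarrow> r i = (\<Sum>t\<le>M. fst (CN i) t)"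
    using choice[of "\<lambda>i CN. (\<forall>t. homogeneous t (fst CN t)) \<and> (\<forall>M\<ge>snd CN. r i = (\<Sum>t\<le>M. fst CN t))"] by blast
  define M where "M = (\<Sum>i\<in>UNIV. snd (CN i))"
  have M: "snd (CN i) \<le> M" for i unfolding M_def by (rule member_le_sum) auto
  define E where "E t = (\<Sum>i\<in>UNIV. fst (CN i) t * f i)" for t
  have cE: "c = (\<Sum>t\<in>{..M}. E t)"
    unfolding r E_def by (subst sum.swap) (simp add: CN(2)[OF M] sum_distrib_right)
  have hE: "homogeneous (t + e) (E t)" for t
    unfolding E_def by (intro homogeneous_sum homogeneous_mult CN hom)
  have "poly4_eval c a = (\<Sum>t\<in>{..M}. poly4_eval (E t) a)" unfolding cE by (rule poly4_eval_sum)
  then obtain t where t: "t \<in> {..M}" "poly4_eval (E t) a \<noteq> 0" using assms(3) by (metis (no_types, lifting) sum.neutral)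
  have "keys (E t) \<subseteq> keys c"
    by (rule homogeneous_component_keys[OF _ _ hE cE t(1)]) auto
  hence "in_vars V (E t)" using assms(2) by (auto simp: in_vars_def)
  moreover have "E t \<in> I" unfolding I_def E_def by (intro CollectI exI, rule refl)
  ultimately show ?thesis using hE t(2) by blast
qed

text \<open>The elimination ideal of I in the variables V has only the origin as a zero in that
  coordinate subspace.\<close>

definition separates where
  "separates V \<longleftrightarrow> (\<forall>a. a \<noteq> 0 \<longrightarrow> (\<forall>i. i \<notin> V \<longrightarrow> a $ i = 0) \<longrightarrow>
     (\<exists>h d. h \<in> I \<and> homogeneous d h \<and> in_vars V h \<and> poly4_eval h a \<noteq> 0))"

lemma separates_UNIV: "separates UNIV"
  unfolding separates_def using no_zero hom I_closed(4) by (metis UNIV_I in_vars_def)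

text \<open>Projection from the i-th coordinate point. I has no zero at that point, so the variable
  is integral modulo I over the polynomials in V. I has no zero on the line over a, so its
  restriction to that line is the unit ideal. \<open>elimination\<close> combines the two.\<close>

lemma separates_remove:
  assumes sep: "separates (insert i V)" and iV: "i \<notin> V"
  shows "separates V"
  unfolding separates_def
proof (intro allI impI)
  fix a :: "'k ^ 4" assume a: "a \<noteq> 0" "\<forall>l. l \<notin> V \<longrightarrow> a $ l = 0"
  have ai: "a $ i = 0" using a(2) iV by blast
  have "axis i (1::'k) \<noteq> 0" by (simp add: axis_eq_0_iff)
  moreover have "\<forall>l. l \<notin> insert i V \<longrightarrow> axis i (1::'k) $ l = 0" by (simp add: axis_def)
  ultimately obtain g n where g: "g \<in> I" "homogeneous n g" "in_vars (insert i V) g" "poly4_eval g (axis i 1) \<noteq> 0"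
    using sep unfolding separates_def by blast
  define c0 where "c0 = lookup g (single i n)"
  have c0: "c0 \<noteq> 0" using g(4) eval_axis_homogeneous[OF g(2)] by (simp add: c0_def)
  define R where "R = const4 (1 / c0) * g + (- (var i ^ n))"
  have hR: "homogeneous n R"
  proof -
    have "homogeneous (0 + n) (const4 (1 / c0) * g)" by (intro homogeneous_mult g) (simp add: homogeneous_def monomial_degree_def)
    moreover have "homogeneous n (- (var i ^ n) :: 'k poly4)" by (simp add: var_power[simplified] homogeneous_def monomial_degree_single)
    ultimately show ?thesis unfolding R_def by (intro homogeneous_add) auto
  qed
  have vR: "in_vars (insert i V) R"
    unfolding R_def by (intro in_vars_add in_vars_mult in_vars_uminus g) (auto simp: in_vars_def var_power[simplified] lookup_single when_def)
  have "poly4_eval R (axis i 1) = 0"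
    unfolding R_def using c0 eval_axis_homogeneous[OF g(2), of i]
    unfolding poly4_eval_add poly4_eval_mult poly4_eval_uminus poly4_eval_power poly4_eval_var by (simp add: c0_def)
  hence R0: "lookup R (single i n) = 0" using eval_axis_homogeneous[OF hR] by simp
  have ltn: "lookup m i < n" if m: "m \<in> keys R" for m
  proof -
    have dm: "monomial_degree m = n" using hR m by (simp add: homogeneous_def)
    have "lookup m i + (\<Sum>l\<in>UNIV - {i}. lookup m l) = n"
      using dm unfolding monomial_degree_def by (simp add: sum.remove[of UNIV i])
    moreover have "(\<Sum>l\<in>UNIV - {i}. lookup m l) \<noteq> 0"
    proof
      assume "(\<Sum>l\<in>UNIV - {i}. lookup m l) = 0"
      hence "m = single i n" by (intro homogeneous_eq_single[OF dm]) auto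
      thus False using R0 m by (simp add: in_keys_iff)
    qed
    ultimately show ?thesis by linarith
  qed
  obtain c where c: "\<And>j. in_vars V (c j)" "R = (\<Sum>j<n. c j * var i ^ j)" using expand_in_var[OF vR iV] ltn by blast
  have monic: "\<exists>c. (\<forall>j. c j \<in> {p. in_vars V p}) \<and> var i ^ n - (\<Sum>j<n. c j * var i ^ j) \<in> I"
  proof (intro exI[of _ "\<lambda>j. - c j"] conjI allI)
    show "- c j \<in> {p. in_vars V p}" for j by (simp add: c(1) in_vars_uminus)
    have "var i ^ n - (\<Sum>j<n. - c j * var i ^ j) = var i ^ n + R" unfolding c(2) by (simp add: sum_negf)
    also have "\<dots> = const4 (1 / c0) * g" by (simp add: R_def)
    finally show "var i ^ n - (\<Sum>j<n. - c j * var i ^ j) \<in> I" using I_closed(2)[OF g(1)] by simp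
  qed
  define y where "y l = (if l = i then [:0, 1:] else [:a $ l:])" for l
  have yV: "y l = [:a $ l:]" if "l \<in> V" for l using that iV by (auto simp: y_def)
  define J where "J p \<longleftrightarrow> p \<in> I \<and> in_vars (insert i V) p" for p
  have point: "\<exists>h. J h \<and> poly (psub y h) T \<noteq> 0" for T
  proof -
    define x where "x = (\<chi> l. poly (y l) T)"
    obtain l where l: "a $ l \<noteq> 0" using a(1) by (auto simp: vec_eq_iff)
    hence "x $ l \<noteq> 0" using ai by (auto simp: x_def y_def)
    hence "x \<noteq> 0" by auto
    moreover have "\<forall>l. l \<notin> insert i V \<longrightarrow> x $ l = 0" using a(2) by (auto simp: x_def y_def)
    ultimately obtain h d where "h \<in> I" "in_vars (insert i V) h" "poly4_eval h x \<noteq> 0" using sep unfolding separates_def by blast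
    thus ?thesis unfolding J_def poly_psub x_def by blast
  qed
  have "\<exists>p. J p \<and> psub y p \<noteq> 0" using point[of 0] by auto
  then obtain p where p: "J p" "psub y p \<noteq> 0" "\<And>q. J q \<and> psub y q \<noteq> 0 \<Longrightarrow> degree (psub y p) \<le> degree (psub y q)"
    using ex_has_least_nat[of "\<lambda>p. J p \<and> psub y p \<noteq> 0" _ "\<lambda>p. degree (psub y p)"] by blast
  \<comment> \<open>By Euclidean division an element of least degree on the line divides all others,
    so a root of it would be a common zero.\<close>
  have "degree (psub y p) = 0"
  proof (rule ccontr)
    assume d: "degree (psub y p) \<noteq> 0"
    then obtain T where T: "poly (psub y p) T = 0" using alg_closed_imp_poly_has_root[of "psub y p"] by blast
    obtain h where h: "J h" "poly (psub y h) T \<noteq> 0" using point by blast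
    define q where "q = psub y h div psub y p"
    define s where "s = (\<Sum>k\<le>degree q. const4 (coeff q k) * var i ^ k)"
    have s: "psub y s = q"
    proof -
      have "psub y s = (\<Sum>k\<le>degree q. [:coeff q k:] * [:0, 1:] ^ k)"
        unfolding s_def psub_sum psub_mult psub_power psub_const psub_var by (simp add: y_def)
      also have "\<dots> = q"
      proof (rule poly_eq_by_values)
        fix z
        have "poly q z = (\<Sum>k\<le>degree q. coeff q k * z ^ k)" by (rule poly_altdef)
        thus "poly (\<Sum>k\<le>degree q. [:coeff q k:] * [:0, 1:] ^ k) z = poly q z"
          by (simp add: poly_sum poly_power del: mult_pCons_left)
      qed
      finally show ?thesis .
    qed
    have sv: "in_vars (insert i V) s"
    proof -
      have "in_vars (insert i V) (\<Sum>k\<in>S. const4 (coeff q k) * var i ^ k)" if "finite S" for S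
        using that by (induction S rule: finite_induct)
          (auto intro!: in_vars_add in_vars_0 in_vars_mult simp: var_power[simplified], auto simp: in_vars_def lookup_single when_def)
      thus ?thesis unfolding s_def by simp
    qed
    have "J (h + (- s) * p)"
      using h(1) p(1) sv unfolding J_def by (intro conjI I_closed(1,2) in_vars_add in_vars_mult in_vars_uminus) simp_all
    moreover have e: "psub y (h + (- s) * p) = psub y h mod psub y p"
    proof -
      have "psub y (- s) + psub y s = 0" unfolding psub_add[symmetric] by simp
      hence "psub y (- s) = - q" using s by (simp add: eq_neg_iff_add_eq_0)
      hence "psub y (h + (- s) * p) = psub y h + (- q) * psub y p" unfolding psub_add psub_mult by simp
      also have "\<dots> = psub y h mod psub y p" by (simp add: q_def minus_div_mult_eq_mod)
      finally show ?thesis .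
    qed
    ultimately have "psub y h mod psub y p = 0"
      using p(3)[of "h + (- s) * p"] degree_mod_less[OF p(2), of "psub y h"] by fastforce
    hence "psub y p dvd psub y h" by (simp add: mod_eq_0_iff_dvd)
    thus False using T h(2) by (auto elim!: dvdE)
  qed
  then obtain c1 where c1: "psub y p = [:c1:]" by (auto elim: degree_eq_zeroE)
  hence "c1 \<noteq> 0" using p(2) by auto
  define p' where "p' = const4 (1 / c1) * p"
  have p': "p' \<in> I" "in_vars (insert i V) p'" "psub y p' = 1"
  proof -
    show "p' \<in> I" "in_vars (insert i V) p'"
      using p(1) unfolding p'_def J_def by (intro I_closed(2) in_vars_mult; simp add: in_vars_def)+
    show "psub y p' = 1" using \<open>c1 \<noteq> 0\<close> by (simp add: p'_def psub_mult c1 flip: one_pCons)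
  qed
  obtain b where b: "\<And>j. in_vars V (b j)" "\<And>d. \<forall>m\<in>keys p'. lookup m i < d \<Longrightarrow> p' = (\<Sum>j<d. b j * var i ^ j)"
    using expand_in_var[OF p'(2) iV] by blast
  define d where "d = Suc (Max ((\<lambda>m. lookup m i) ` keys p'))"
  have "\<forall>m\<in>keys p'. lookup m i < d" unfolding d_def by (auto simp: less_Suc_eq_le)
  hence pb: "p' = (\<Sum>j<d. b j * var i ^ j)" by (rule b(2))
  define b' where "b' j = (if j < d then b j else 0)" for j
  have ev: "poly4_eval (b' j) a = (if j = 0 then 1 else 0)" for j
  proof -
    have "1 = (\<Sum>j<d. psub y (b j) * psub y (var i) ^ j)" using p'(3) unfolding pb psub_sum psub_mult psub_power by simp
    also have "\<dots> = (\<Sum>j<d. monom (poly4_eval (b j) a) j)"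
      by (intro sum.cong refl) (simp add: psub_in_vars[OF b(1) yV] psub_var[simplified] y_def monom_altdef)
    finally have "coeff 1 j = coeff (\<Sum>j<d. monom (poly4_eval (b j) a) j) j" by simp
    thus ?thesis by (cases "j < d") (auto simp: coeff_sum b'_def split: if_splits)
  qed
  have "\<exists>c. c \<in> {p. in_vars V p} \<and> c \<in> I \<and> poly4_eval c a = 1"
  proof (rule elimination[where I = I and A = "{p. in_vars V p}" and ev = "\<lambda>p. poly4_eval p a" and Z = "var i" and n = n and f = b' and d = d])
    show "\<exists>c. (\<forall>j. c j \<in> {p. in_vars V p}) \<and> var i ^ n - (\<Sum>j<n. c j * var i ^ j) \<in> I" by (rule monic)
    show "x + y \<in> I" if "x \<in> I" "y \<in> I" for x y using that by (rule I_closed(1))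
    show "r * x \<in> I" if "x \<in> I" for r x using that by (rule I_closed(2))
    show "0 \<in> I" by (rule I_closed(3))
    show "(\<Sum>j<d. b' j * var i ^ j) \<in> I"
    proof -
      have "(\<Sum>j<d. b' j * var i ^ j) = p'" unfolding pb by (intro sum.cong refl) (simp add: b'_def)
      thus ?thesis using p'(1) by simp
    qed
    show "b' j \<in> {p. in_vars V p}" for j by (simp add: b'_def b(1) in_vars_0)
    show "0 < d" by (simp add: d_def)
  qed (auto simp: in_vars_add in_vars_mult in_vars_0 in_vars_1 in_vars_uminus poly4_eval_add poly4_eval_mult ev)
  then obtain c where "c \<in> I" "in_vars V c" "poly4_eval c a = 1" by blast
  thus "\<exists>h d. h \<in> I \<and> homogeneous d h \<and> in_vars V h \<and> poly4_eval h a \<noteq> 0" using I_homogeneous[of c V a] by simp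
qed

text \<open>Removing the other three variables one by one leaves a nonzero form in a single
  variable, a multiple of one of its powers. This takes the place of the Nullstellensatz.\<close>

lemma var_power_in_I: "\<exists>k. var j ^ k \<in> I"
proof -
  have "separates V" if "finite (UNIV - V)" "j \<in> V" for V
  proof -
    have "\<forall>V. UNIV - V = W \<longrightarrow> separates V" if "finite W" for W :: "4 set"
      using that
    proof (induction W rule: finite_induct)
      case empty
      thus ?case using separates_UNIV by (metis Diff_eq_empty_iff top.extremum_uniqueI)
    next
      case (insert w W)
      show ?case
      proof (intro allI impI)
        fix V assume V: "UNIV - V = insert w W"
        hence "UNIV - insert w V = W" "w \<notin> V" using insert.hyps(2) by auto
        thus "separates V" using insert.IH separates_remove by blast
      qed
    qed
    thus ?thesis using that(1) by blast
  qed
  hence "separates {j}" by simp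
  moreover have "axis j (1::'k) \<noteq> 0" by (simp add: axis_eq_0_iff)
  moreover have "\<forall>i. i \<notin> {j} \<longrightarrow> axis j (1::'k) $ i = 0" by (simp add: axis_def)
  ultimately obtain h d where h: "h \<in> I" "homogeneous d h" "in_vars {j} h" "poly4_eval h (axis j 1) \<noteq> 0"
    unfolding separates_def by blast
  define c where "c = lookup h (single j d)"
  have c: "c \<noteq> 0" using h(4) eval_axis_homogeneous[OF h(2)] by (simp add: c_def)
  have k: "keys h \<subseteq> {single j d}"
  proof
    fix m assume m: "m \<in> keys h"
    have "m = single j d"
      by (rule homogeneous_eq_single) (use h(2,3) m in \<open>auto simp: homogeneous_def in_vars_def\<close>)
    thus "m \<in> {single j d}" by simp
  qed
  have "h = single (single j d) c"
  proof (rule poly_mapping_eqI)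
    fix m
    show "lookup h m = lookup (single (single j d) c) m"
    proof (cases "m = single j d")
      case False
      hence "m \<notin> keys h" using k by blast
      thus ?thesis using False by (simp add: in_keys_iff lookup_single when_def)
    qed (simp add: c_def)
  qed
  hence "const4 (1 / c) * h = var j ^ d" using c by (simp add: mult_single var_power[simplified])
  thus ?thesis using I_closed(2)[OF h(1)] by metis
qed

end

section \<open>Powers of the variables as a regular sequence\<close>

lemma lookup_monomial_mult:
  "lookup (single n 1 * p) (n + m) = lookup p m" for p :: "'k::comm_ring_1 poly4"
proof -
  have "\<forall>m. lookup (single n 1 * p) (n + m) = lookup p m"
    by (rule poly4_term_induct[of "\<lambda>p. \<forall>m. lookup (single n 1 * p) (n + m) = lookup p m"])
      (simp_all add: distrib_left lookup_add mult_single lookup_single when_def)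
  thus ?thesis by blast
qed

text \<open>Membership in the monomial ideal generated by the powers \<open>var i ^ k i\<close> for
  i in V, tested on exponents; this makes regularity a statement about single monomials.\<close>

definition in_mon :: "4 set \<Rightarrow> (4 \<Rightarrow> nat) \<Rightarrow> 'k::zero poly4 \<Rightarrow> bool" where
  "in_mon V k p \<longleftrightarrow> (\<forall>m\<in>keys p. \<exists>i\<in>V. k i \<le> lookup m i)"

lemma in_mon_sum:
  fixes r :: "4 \<Rightarrow> 'k::comm_ring_1 poly4"
  shows "in_mon V k (\<Sum>i\<in>V. var i ^ k i * r i)"
proof -
  have a: "in_mon V k (p + q)" if "in_mon V k p" "in_mon V k q" for p q :: "'k poly4"
    using that keys_add[of p q] unfolding in_mon_def by blast
  have v: "in_mon V k (var i ^ k i * q)" if i: "i \<in> V" for i and q :: "'k poly4"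
    unfolding in_mon_def
  proof
    fix m assume "m \<in> keys (var i ^ k i * q)"
    then obtain x y where "x \<in> keys (var i ^ k i :: 'k poly4)" "m = x + y"
      using keys_mult[of "var i ^ k i" q] by blast
    hence "m = single i (k i) + y" unfolding var_power by (auto split: if_splits)
    thus "\<exists>i\<in>V. k i \<le> lookup m i" using i by (intro bexI[of _ i]) (simp_all add: lookup_add)
  qed
  have "in_mon V k (\<Sum>i\<in>W. var i ^ k i * r i)" if "finite W" "W \<subseteq> V" for W
    using that
  proof (induction W rule: finite_induct)
    case (insert w W)
    hence "in_mon V k (\<Sum>i\<in>W. var i ^ k i * r i)" "w \<in> V" by auto
    thus ?case unfolding sum.insert[OF insert.hyps] by (intro a v)
  qed (simp add: in_mon_def)
  thus ?thesis by simp
qed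

lemma in_mon_expand:
  fixes p :: "'k::comm_ring_1 poly4"
  assumes "in_mon V k p"
  shows "\<exists>r. p = (\<Sum>i\<in>V. var i ^ k i * r i)"
proof (rule poly4_term_induct[of "\<lambda>p. \<exists>r. p = (\<Sum>i\<in>V. var i ^ k i * r i)"])
  show "\<exists>r. 0 = (\<Sum>i\<in>V. var i ^ k i * r i :: 'k poly4)" by (rule exI[of _ "\<lambda>i. 0"]) simp
next
  fix a b :: "'k poly4"
  assume "\<exists>r. a = (\<Sum>i\<in>V. var i ^ k i * r i)" "\<exists>r. b = (\<Sum>i\<in>V. var i ^ k i * r i)"
  then obtain r s where "a = (\<Sum>i\<in>V. var i ^ k i * r i)" "b = (\<Sum>i\<in>V. var i ^ k i * s i)" by blast
  hence "a + b = (\<Sum>i\<in>V. var i ^ k i * (r i + s i))" by (simp add: sum.distrib distrib_left)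
  thus "\<exists>r. a + b = (\<Sum>i\<in>V. var i ^ k i * r i)" by (rule exI[of _ "\<lambda>i. r i + s i"])
next
  fix m and c :: 'k assume "m \<in> keys p"
  then obtain i where i: "i \<in> V" "k i \<le> lookup m i" using assms unfolding in_mon_def by blast
  have "single i (k i) + (m - single i (k i)) = m"
    using i(2) by (intro poly_mapping_eqI) (auto simp: lookup_add lookup_minus lookup_single when_def)
  hence e: "var i ^ k i * single (m - single i (k i)) c = single m c"
    unfolding var_power by (simp add: mult_single)
  have "(\<Sum>j\<in>V. var j ^ k j * (if j = i then single (m - single i (k i)) c else 0))
    = (\<Sum>j\<in>V. if j = i then single m c else 0)"
    by (intro sum.cong refl) (use e in auto)
  hence "single m c = (\<Sum>j\<in>V. var j ^ k j * (if j = i then single (m - single i (k i)) c else 0))"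
    using i(1) by simp
  thus "\<exists>r. single m c = (\<Sum>i\<in>V. var i ^ k i * r i)"
    by (rule exI[of _ "\<lambda>j. if j = i then single (m - single i (k i)) c else 0"])
qed

lemma in_mon_cancel:
  fixes p :: "'k::comm_ring_1 poly4"
  assumes "in_mon V k (var l ^ n * p)" "l \<notin> V"
  shows "in_mon V k p"
  unfolding in_mon_def
proof
  fix m assume "m \<in> keys p"
  hence "single l n + m \<in> keys (var l ^ n * p)"
    unfolding var_power by (simp add: in_keys_iff lookup_monomial_mult)
  then obtain i where i: "i \<in> V" "k i \<le> lookup (single l n + m) i"
    using assms(1) unfolding in_mon_def by blast
  hence "k i \<le> lookup m i" using assms(2) by (auto simp: lookup_add lookup_single when_def split: if_splits)
  thus "\<exists>i\<in>V. k i \<le> lookup m i" using i(1) by blast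
qed

lemma regular_var_powers:
  fixes p :: "'k::comm_ring_1 poly4"
  assumes "var l ^ n * p = (\<Sum>i\<in>V. var i ^ k i * r i)" "l \<notin> V"
  shows "\<exists>r. p = (\<Sum>i\<in>V. var i ^ k i * r i)"
proof (rule in_mon_expand)
  have "in_mon V k (var l ^ n * p)" unfolding assms(1) by (rule in_mon_sum)
  thus "in_mon V k p" using assms(2) by (rule in_mon_cancel)
qed

lemma var_power_cancel: "var l ^ n * p = var l ^ n * q \<Longrightarrow> p = q" for p :: "'k::comm_ring_1 poly4"
  unfolding var_power by (rule poly_mapping_eqI) (metis lookup_monomial_mult)

context form_ideal
begin

text \<open>Powers of the variables form a regular sequence inside the ideal, so the coefficient
  \<open>q j\<close> of a syzygy lies in the ideal. The ideal has no nonzero elements of degree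
  below e.\<close>

lemma no_syzygy_aux:
  assumes q: "(\<Sum>i\<in>UNIV. q i * f i) = 0" and d: "homogeneous d (q j)" "d < e"
    and ijk: "UNIV = {i1, i2, i3, j}" "distinct [i1, i2, i3, j]"
  shows "q j = 0"
proof -
  have s: "(\<Sum>i\<in>UNIV. h i) = h i1 + h i2 + h i3 + h j" for h :: "4 \<Rightarrow> 'k poly4"
    unfolding ijk(1) using ijk(2) by (simp add: add.assoc)
  have "\<forall>i. \<exists>k. var i ^ k \<in> I" using var_power_in_I by blast
  then obtain k where k: "\<And>i. var i ^ k i \<in> I" using choice[of "\<lambda>i k. var i ^ k \<in> I"] by blast
  have "\<exists>r. r i1 * f i1 + r i2 * f i2 + r i3 * f i3 + r j * f j = var i ^ k i" for i
  proof -
    obtain r where "var i ^ k i = (\<Sum>i\<in>UNIV. r i * f i)" using k[of i] by (auto simp: I_def)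
    thus ?thesis unfolding s by (intro exI[of _ r]) simp
  qed
  then obtain r where r: "\<And>i. r i i1 * f i1 + r i i2 * f i2 + r i i3 * f i3 + r i j * f j = var i ^ k i"
    using choice[of "\<lambda>i r. r i1 * f i1 + r i2 * f i2 + r i3 * f i3 + r j * f j = var i ^ k i"] by blast
  have n: "(1::4) \<noteq> 2" "(1::4) \<noteq> 3" "(1::4) \<noteq> 4" "(2::4) \<noteq> 3" "(2::4) \<noteq> 4" "(3::4) \<noteq> 4" by simp_all
  have "\<exists>t1 t2 t3 t4. q j = t1 * f i1 + t2 * f i2 + t3 * f i3 + t4 * f j"
  proof (rule syzygy_in_ideal[OF r[of 1] r[of 2] r[of 3] r[of 4]])
    show "q i1 * f i1 + q i2 * f i2 + q i3 * f i3 + q j * f j = 0" using q unfolding s .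
    show "p = x" if "var 1 ^ k 1 * p = var 1 ^ k 1 * x" for p x :: "'k poly4" using var_power_cancel[OF that] .
    show "\<exists>x. p = var 1 ^ k 1 * x" if "var 2 ^ k 2 * p = var 1 ^ k 1 * x" for p x :: "'k poly4"
      using regular_var_powers[of 2 "k 2" p k "\<lambda>i. x" "{1}"] that n by auto
    show "\<exists>x y. p = var 1 ^ k 1 * x + var 2 ^ k 2 * y" if "var 3 ^ k 3 * p = var 1 ^ k 1 * x + var 2 ^ k 2 * y" for p x y :: "'k poly4"
      using regular_var_powers[of 3 "k 3" p k "\<lambda>i. if i = 1 then x else y" "{1, 2}"] that n by auto
    show "\<exists>x y z. p = var 1 ^ k 1 * x + var 2 ^ k 2 * y + var 3 ^ k 3 * z"
      if "var 4 ^ k 4 * p = var 1 ^ k 1 * x + var 2 ^ k 2 * y + var 3 ^ k 3 * z" for p x y z :: "'k poly4"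
      using regular_var_powers[of 4 "k 4" p k "\<lambda>i. if i = 1 then x else if i = 2 then y else z" "{1, 2, 3}"] that n
      by (auto simp: add.assoc)
  qed
  then obtain t1 t2 t3 t4 where t: "q j = t1 * f i1 + t2 * f i2 + t3 * f i3 + t4 * f j" by blast
  have lo: "e \<le> monomial_degree m" if "m \<in> keys (t * f i)" for m t i
  proof -
    obtain x y where "m = x + y" "y \<in> keys (f i)" using keys_mult[of t "f i"] \<open>m \<in> keys (t * f i)\<close> by blast
    thus ?thesis using hom[of i] by (simp add: homogeneous_def monomial_degree_add)
  qed
  have "keys (q j) = {}"
  proof (rule ccontr)
    assume "keys (q j) \<noteq> {}"
    then obtain m where m: "m \<in> keys (q j)" by blast
    have "m \<in> keys (t1 * f i1) \<union> keys (t2 * f i2) \<union> keys (t3 * f i3) \<union> keys (t4 * f j)"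
      using m keys_add[of "t1 * f i1 + t2 * f i2 + t3 * f i3" "t4 * f j"] keys_add[of "t1 * f i1 + t2 * f i2" "t3 * f i3"]
        keys_add[of "t1 * f i1" "t2 * f i2"] unfolding t by blast
    hence "e \<le> monomial_degree m" using lo by blast
    moreover have "monomial_degree m = d" using m d(1) by (simp add: homogeneous_def)
    ultimately show False using d(2) by simp
  qed
  thus ?thesis by simp
qed

lemma no_syzygy:
  assumes q: "(\<Sum>i\<in>UNIV. q i * f i) = 0" and d: "\<And>i. homogeneous d (q i)" "d < e"
  shows "q j = 0"
proof -
  note U = UNIV_4
  have "q 1 = 0" by (rule no_syzygy_aux[OF q d, of 2 3 4]) (use U in auto)
  moreover have "q 2 = 0" by (rule no_syzygy_aux[OF q d, of 1 3 4]) (use U in auto)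
  moreover have "q 3 = 0" by (rule no_syzygy_aux[OF q d, of 1 2 4]) (use U in auto)
  moreover have "q 4 = 0" by (rule no_syzygy_aux[OF q d, of 1 2 3]) (use U in auto)
  ultimately show ?thesis using exhaust_4[of j] by auto
qed

end

lemma homogeneous_partial: "homogeneous d F \<Longrightarrow> homogeneous (d - 1) (partial i F)"
  unfolding partial_def
proof (rule homogeneous_sum)
  fix m assume F: "homogeneous d F" and m: "m \<in> keys F"
  show "homogeneous (d - 1) (single (m - single i 1) (of_nat (lookup m i) * lookup F m))"
  proof (cases "lookup m i = 0")
    case False
    hence "single i 1 + (m - single i 1) = m"
      by (intro poly_mapping_eqI) (auto simp: lookup_add lookup_minus lookup_single when_def)
    hence "monomial_degree (single i 1) + monomial_degree (m - single i 1) = monomial_degree m"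
      by (simp only: monomial_degree_add[symmetric])
    hence "monomial_degree (m - single i 1) = d - 1"
      using F m by (simp add: monomial_degree_single homogeneous_def)
    thus ?thesis by (simp add: homogeneous_def)
  qed (simp add: homogeneous_def)
qed

section \<open>Linear algebra for the dimension count 84 - 40 = 44\<close>

lemma underdetermined_system:
  fixes \<phi> :: "'i \<Rightarrow> 'x \<Rightarrow> 'k::field"
  assumes "finite A" "finite B" "card A < card B"
  shows "\<exists>c. (\<exists>i\<in>B. c i \<noteq> 0) \<and> (\<forall>x\<in>A. (\<Sum>i\<in>B. c i * \<phi> i x) = 0)"
  using assms
proof (induction A arbitrary: B \<phi> rule: finite_induct)
  case empty
  then obtain i where "i \<in> B" by fastforce
  thus ?case by (intro exI[of _ "\<lambda>j. 1"]) auto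
next
  case (insert a A)
  show ?case
  proof (cases "\<forall>i\<in>B. \<phi> i a = 0")
    case True
    obtain c where c: "\<exists>i\<in>B. c i \<noteq> 0" "\<forall>x\<in>A. (\<Sum>i\<in>B. c i * \<phi> i x) = 0"
      using insert.IH[of B \<phi>] insert.prems insert.hyps by auto
    thus ?thesis using True by (intro exI[of _ c]) auto
  next
    case False
    then obtain i0 where i0: "i0 \<in> B" "\<phi> i0 a \<noteq> 0" by blast
    define B' where "B' = B - {i0}"
    have B': "finite B'" "card A < card B'" "i0 \<notin> B'" "B = insert i0 B'"
      using insert.prems insert.hyps i0 by (auto simp: B'_def)
    define \<psi> where "\<psi> i x = \<phi> i x - \<phi> i a / \<phi> i0 a * \<phi> i0 x" for i x
    obtain c where c: "\<exists>i\<in>B'. c i \<noteq> 0" "\<forall>x\<in>A. (\<Sum>i\<in>B'. c i * \<psi> i x) = 0"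
      using insert.IH[of B' \<psi>] B'(1,2) by blast
    define d where "d i = (if i = i0 then - (\<Sum>i\<in>B'. c i * (\<phi> i a / \<phi> i0 a)) else c i)" for i
    have s: "(\<Sum>i\<in>B. d i * \<phi> i x) = (\<Sum>i\<in>B'. c i * \<psi> i x)" for x
    proof -
      have "(\<Sum>i\<in>B'. d i * \<phi> i x) = (\<Sum>i\<in>B'. c i * \<phi> i x)" using B'(3) by (intro sum.cong) (auto simp: d_def)
      thus ?thesis unfolding B'(4) using B'(1,3)
        by (simp add: d_def \<psi>_def right_diff_distrib sum_subtractf sum_distrib_right mult.assoc)
    qed
    have "(\<Sum>i\<in>B. d i * \<phi> i a) = 0" unfolding s using i0(2) by (simp add: \<psi>_def)
    hence "\<forall>x\<in>insert a A. (\<Sum>i\<in>B. d i * \<phi> i x) = 0" using c(2) s by simp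
    moreover have "\<exists>i\<in>B. d i \<noteq> 0" using c(1) B'(3,4) unfolding d_def by auto
    ultimately show ?thesis by blast
  qed
qed

text \<open>Each new vector is nonzero at some coordinate after subtracting the combination that
  matches it on the old pivots; that coordinate is the new pivot.\<close>

lemma pivots:
  fixes \<phi> :: "'t \<Rightarrow> 'x \<Rightarrow> 'k::field"
  assumes "finite A" "finite T" "\<And>c. (\<forall>x\<in>A. (\<Sum>t\<in>T. c t * \<phi> t x) = 0) \<Longrightarrow> \<forall>t\<in>T. c t = 0"
  shows "\<exists>P\<subseteq>A. card P = card T \<and> (\<forall>f. \<exists>d. \<forall>x\<in>P. f x = (\<Sum>t\<in>T. d t * \<phi> t x))"
  using assms(2,3)
proof (induction T rule: finite_induct)
  case empty thus ?case by (intro exI[of _ "{}"]) simp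
next
  case (insert t T)
  have "\<forall>s\<in>T. c s = 0" if c: "\<forall>x\<in>A. (\<Sum>s\<in>T. c s * \<phi> s x) = 0" for c
  proof -
    have e: "(\<Sum>s\<in>insert t T. (if s = t then 0 else c s) * \<phi> s x) = (\<Sum>s\<in>T. c s * \<phi> s x)" for x
    proof -
      have "(\<Sum>s\<in>T. (if s = t then 0 else c s) * \<phi> s x) = (\<Sum>s\<in>T. c s * \<phi> s x)" using insert.hyps(2) by (intro sum.cong) auto
      thus ?thesis using insert.hyps by simp
    qed
    have "\<forall>s\<in>insert t T. (if s = t then 0 else c s) = 0" by (rule insert.prems) (use c e in simp)
    thus ?thesis using insert.hyps(2) by (metis insertI2)
  qed
  then obtain P where P: "P \<subseteq> A" "card P = card T" "\<forall>f. \<exists>d. \<forall>x\<in>P. f x = (\<Sum>t\<in>T. d t * \<phi> t x)" using insert.IH by blast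
  obtain d where d: "\<forall>x\<in>P. \<phi> t x = (\<Sum>s\<in>T. d s * \<phi> s x)" using spec[OF P(3), of "\<phi> t"] by blast
  define \<psi> where "\<psi> x = \<phi> t x - (\<Sum>s\<in>T. d s * \<phi> s x)" for x
  have "\<exists>x\<in>A. \<psi> x \<noteq> 0"
  proof (rule ccontr)
    assume "\<not> ?thesis"
    hence z: "\<psi> x = 0" if "x \<in> A" for x using that by blast
    have e: "(\<Sum>s\<in>insert t T. (if s = t then 1 else - d s) * \<phi> s x) = \<psi> x" for x
    proof -
      have "(\<Sum>s\<in>T. (if s = t then 1 else - d s) * \<phi> s x) = (\<Sum>s\<in>T. - (d s * \<phi> s x))" using insert.hyps(2) by (intro sum.cong) auto
      thus ?thesis using insert.hyps by (simp add: \<psi>_def sum_negf)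
    qed
    have "\<forall>s\<in>insert t T. (if s = t then 1 else - d s) = 0" by (rule insert.prems) (use z e in simp)
    thus False by auto
  qed
  then obtain m where m: "m \<in> A" "\<psi> m \<noteq> 0" by blast
  have \<psi>P: "\<psi> x = 0" if "x \<in> P" for x using d that by (simp add: \<psi>_def)
  have "m \<notin> P" using \<psi>P m(2) by blast
  have fP: "finite P" using P(1) assms(1) by (rule finite_subset)
  have "\<exists>b. \<forall>x\<in>insert m P. f x = (\<Sum>s\<in>insert t T. b s * \<phi> s x)" for f
  proof -
    obtain b where b: "\<forall>x\<in>P. f x = (\<Sum>s\<in>T. b s * \<phi> s x)" using spec[OF P(3), of f] by blast
    define \<alpha> where "\<alpha> = (f m - (\<Sum>s\<in>T. b s * \<phi> s m)) / \<psi> m"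
    define b' where "b' s = (if s = t then \<alpha> else b s - \<alpha> * d s)" for s
    have e: "(\<Sum>s\<in>insert t T. b' s * \<phi> s x) = (\<Sum>s\<in>T. b s * \<phi> s x) + \<alpha> * \<psi> x" for x
    proof -
      have "(\<Sum>s\<in>T. b' s * \<phi> s x) = (\<Sum>s\<in>T. b s * \<phi> s x - \<alpha> * (d s * \<phi> s x))" using insert.hyps(2) by (intro sum.cong) (auto simp: b'_def algebra_simps)
      thus ?thesis using insert.hyps by (simp add: b'_def \<psi>_def sum_subtractf sum_distrib_left right_diff_distrib)
    qed
    have "\<forall>x\<in>insert m P. f x = (\<Sum>s\<in>insert t T. b' s * \<phi> s x)"
      unfolding e using b \<psi>P m(2) by (auto simp: \<alpha>_def)
    thus ?thesis by blast
  qed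
  moreover have "insert m P \<subseteq> A" "card (insert m P) = card (insert t T)"
    using m(1) P(1,2) \<open>m \<notin> P\<close> fP insert.hyps by simp_all
  ultimately show ?case by blast
qed

text \<open>Functionals that kill a subspace of dimension \<open>card T\<close> are determined by
  their values off the pivots: a combination vanishing there is orthogonal to the subspace, and
  testing it against dual vectors gives zero on the pivots.\<close>

lemma annihilator_dependent:
  fixes \<phi> :: "'i \<Rightarrow> 'x \<Rightarrow> 'k::field" and j :: "'t \<Rightarrow> 'x \<Rightarrow> 'k"
  assumes fin: "finite A" "finite T" "finite B" and indep: "\<And>c. (\<forall>x\<in>A. (\<Sum>t\<in>T. c t * j t x) = 0) \<Longrightarrow> \<forall>t\<in>T. c t = 0"
    and orth: "\<And>i t. i \<in> B \<Longrightarrow> t \<in> T \<Longrightarrow> (\<Sum>x\<in>A. \<phi> i x * j t x) = 0" and card: "card A < card T + card B"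
  shows "\<exists>c. (\<exists>i\<in>B. c i \<noteq> 0) \<and> (\<forall>x\<in>A. (\<Sum>i\<in>B. c i * \<phi> i x) = 0)"
proof -
  obtain P where P: "P \<subseteq> A" "card P = card T" "\<forall>f. \<exists>d. \<forall>x\<in>P. f x = (\<Sum>t\<in>T. d t * j t x)"
    using pivots[OF fin(1,2) indep] by blast
  have fP: "finite P" using P(1) fin(1) by (rule finite_subset)
  have "card (A - P) < card B" using card_Diff_subset[OF fP P(1)] card_mono[OF fin(1) P(1)] card P(2) by linarith
  then obtain c where c: "\<exists>i\<in>B. c i \<noteq> 0" "\<forall>x\<in>A - P. (\<Sum>i\<in>B. c i * \<phi> i x) = 0"
    using underdetermined_system[of "A - P" B \<phi>] fin by auto
  define \<psi> where "\<psi> x = (\<Sum>i\<in>B. c i * \<phi> i x)" for x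
  have o: "(\<Sum>x\<in>A. \<psi> x * j t x) = 0" if t: "t \<in> T" for t
  proof -
    have "(\<Sum>x\<in>A. \<psi> x * j t x) = (\<Sum>i\<in>B. c i * (\<Sum>x\<in>A. \<phi> i x * j t x))"
      unfolding \<psi>_def sum_distrib_right sum_distrib_left by (subst sum.swap) (simp add: mult.assoc)
    also have "\<dots> = 0" using orth t by simp
    finally show ?thesis .
  qed
  have "\<psi> x0 = 0" if x0: "x0 \<in> P" for x0
  proof -
    obtain d where d: "\<forall>x\<in>P. (if x = x0 then 1 else 0) = (\<Sum>t\<in>T. d t * j t x)"
      using spec[OF P(3), of "\<lambda>x. if x = x0 then 1 else 0"] by blast
    have "0 = (\<Sum>t\<in>T. d t * (\<Sum>x\<in>A. \<psi> x * j t x))" using o by simp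
    also have "\<dots> = (\<Sum>x\<in>A. \<psi> x * (\<Sum>t\<in>T. d t * j t x))"
      unfolding sum_distrib_left by (subst sum.swap) (simp add: mult_ac)
    also have "\<dots> = (\<Sum>x\<in>P. \<psi> x * (\<Sum>t\<in>T. d t * j t x))"
      using fin(1) P(1) c(2) by (intro sum.mono_neutral_right) (auto simp: \<psi>_def)
    also have "\<dots> = (\<Sum>x\<in>P. if x = x0 then \<psi> x0 else 0)"
    proof (intro sum.cong refl)
      fix x assume "x \<in> P"
      hence "(\<Sum>t\<in>T. d t * j t x) = (if x = x0 then 1 else 0)" using d by simp
      thus "\<psi> x * (\<Sum>t\<in>T. d t * j t x) = (if x = x0 then \<psi> x0 else 0)" by simp
    qed
    also have "\<dots> = \<psi> x0" using fP x0 by simp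
    finally show ?thesis by simp
  qed
  hence "\<forall>x\<in>A. \<psi> x = 0" using c(2) unfolding \<psi>_def by blast
  thus ?thesis using c(1) unfolding \<psi>_def by blast
qed

definition exps :: "nat \<Rightarrow> (nat \<times> nat \<times> nat) set" where
  "exps d = (SIGMA i:{..d}. SIGMA j:{..d - i}. {..d - i - j})"

fun expo :: "nat \<Rightarrow> nat \<times> nat \<times> nat \<Rightarrow> monomial4" where
  "expo d (i, j, k) = single 1 i + single 2 j + single 3 k + single 4 (d - i - j - k)"

lemma finite_exps: "finite (exps d)" by (simp add: exps_def)

lemma card_exps: "card (exps 2) = 10" "card (exps 6) = 84"
  by (simp_all add: exps_def card_SigmaI eval_nat_numeral atMost_Suc)

lemma lookup_expo: "lookup (expo d (i, j, k)) 1 = i" "lookup (expo d (i, j, k)) 2 = j"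
  "lookup (expo d (i, j, k)) 3 = k" "lookup (expo d (i, j, k)) 4 = d - i - j - k"
  by (simp_all add: lookup_add lookup_single when_def)

lemma inj_expo: "inj (expo d)"
proof (rule injI)
  fix s t assume e: "expo d s = expo d t"
  obtain i j k i' j' k' where st: "s = (i, j, k)" "t = (i', j', k')" by (cases s, cases t) auto
  show "s = t" using lookup_expo[of d i j k] lookup_expo[of d i' j' k'] e unfolding st by simp
qed

lemma expo_degree: "t \<in> exps d \<Longrightarrow> monomial_degree (expo d t) = d"
  by (cases t) (auto simp: exps_def monomial_degree_add monomial_degree_single)

lemma expo_surj:
  assumes "monomial_degree m = d" shows "m \<in> expo d ` exps d"
proof -
  let ?l = "lookup m"
  have s: "?l 1 + ?l 2 + ?l 3 + ?l 4 = d" using assms by (simp add: monomial_degree_def sum_4)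
  have "expo d (?l 1, ?l 2, ?l 3) = m"
  proof (rule poly_mapping_eqI)
    fix i :: 4
    show "lookup (expo d (?l 1, ?l 2, ?l 3)) i = ?l i"
      using exhaust_4[of i] lookup_expo[of d "?l 1" "?l 2" "?l 3"] s by auto
  qed
  moreover have "(?l 1, ?l 2, ?l 3) \<in> exps d" using s by (auto simp: exps_def)
  ultimately show ?thesis by (metis image_eqI)
qed

lemma homogeneous_expand:
  fixes p :: "'k::comm_ring_1 poly4"
  assumes "homogeneous d p"
  shows "p = (\<Sum>t\<in>exps d. single (expo d t) (lookup p (expo d t)))"
proof (rule poly_mapping_eqI)
  fix m
  show "lookup p m = lookup (\<Sum>t\<in>exps d. single (expo d t) (lookup p (expo d t))) m"
  proof (cases "monomial_degree m = d")
    case True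
    then obtain s where s: "s \<in> exps d" "m = expo d s" using expo_surj by blast
    have "lookup (\<Sum>t\<in>exps d. single (expo d t) (lookup p (expo d t))) m
      = (\<Sum>t\<in>exps d. if t = s then lookup p m else 0)"
      unfolding lookup_sum s(2) by (intro sum.cong refl) (auto simp: lookup_single when_def dest: injD[OF inj_expo])
    also have "\<dots> = lookup p m" using s(1) finite_exps by simp
    finally show ?thesis by simp
  next
    case False
    hence "m \<notin> keys p" using assms by (auto simp: homogeneous_def)
    moreover have "(\<Sum>t\<in>exps d. lookup (single (expo d t) (lookup p (expo d t))) m) = 0"
      using False expo_degree by (intro sum.neutral) (auto simp: lookup_single when_def)
    ultimately show ?thesis by (simp add: lookup_sum in_keys_iff)
  qed
qed

lemma form_imp_poly4:
  fixes f :: "'k::field ^ 4 \<Rightarrow> 'k"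
  assumes "form d f" shows "\<exists>p. homogeneous d p \<and> f = poly4_eval p"
  using assms
proof (induction rule: form.induct)
  case (form_zero d) show ?case by (rule exI[of _ 0]) (auto simp: homogeneous_def)
next
  case (form_const c) show ?case by (rule exI[of _ "const4 c"]) (auto simp: homogeneous_def monomial_degree_def)
next
  case (form_add d f g)
  then obtain p q where "homogeneous d p" "f = poly4_eval p" "homogeneous d q" "g = poly4_eval q" by blast
  thus ?case by (intro exI[of _ "p + q"]) (auto simp: homogeneous_add poly4_eval_add)
next
  case (form_coord d f i)
  then obtain p where p: "homogeneous d p" "f = poly4_eval p" by blast
  have "homogeneous 1 (var i :: 'k poly4)" by (simp add: homogeneous_def monomial_degree_single[simplified])
  hence "homogeneous (1 + d) (var i * p)" using p(1) by (rule homogeneous_mult)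
  thus ?case using p(2) by (intro exI[of _ "var i * p"]) (auto simp: poly4_eval_mult poly4_eval_var[simplified])
qed

text \<open>Ten quadratic monomials times four quartics give 40 independent sextics, by
  \<open>no_syzygy\<close> in degree 2 < 4, among 84 monomials. Taking the functionals as weighted
  sums of point values makes their linearity immediate.\<close>

lemma (in form_ideal) sextic_functionals_dependent:
  fixes \<Phi> :: "'i \<Rightarrow> 'z set" and wt :: "'i \<Rightarrow> 'z \<Rightarrow> 'k" and pts :: "'i \<Rightarrow> 'z \<Rightarrow> 'k ^ 4"
  defines "\<phi> \<equiv> \<lambda>i g. \<Sum>x\<in>\<Phi> i. wt i x * g (pts i x)"
  assumes e: "e = 4" and B: "finite B" "card B = 45"
    and kill: "\<And>i q l. i \<in> B \<Longrightarrow> form 2 q \<Longrightarrow> \<phi> i (\<lambda>x. q x * poly4_eval (f l) x) = 0"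
  shows "\<exists>c. (\<exists>i\<in>B. c i \<noteq> 0) \<and> (\<forall>g. form 6 g \<longrightarrow> (\<Sum>i\<in>B. c i * \<phi> i g) = 0)"
proof -
  define m where "m t = (single (expo 6 t) 1 :: 'k poly4)" for t
  define v where "v i t = \<phi> i (poly4_eval (m t))" for i t
  define J where "J = (\<lambda>(l, s). single (expo 2 s) 1 * f l :: 'k poly4)"
  have hom2: "homogeneous 2 (single (expo 2 s) a)" if "s \<in> exps 2" for s and a :: 'k
    using expo_degree[OF that] by (simp add: homogeneous_def)
  have homJ: "homogeneous 6 (J t)" if t: "t \<in> UNIV \<times> exps 2" for t
    using homogeneous_mult[OF hom2 hom] t e by (auto simp: J_def)
  have val: "\<phi> i (poly4_eval p) = (\<Sum>t\<in>exps 6. v i t * lookup p (expo 6 t))" if p: "homogeneous 6 p" for i p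
  proof -
    have "poly4_eval p x = (\<Sum>t\<in>exps 6. lookup p (expo 6 t) * poly4_eval (m t) x)" for x
      by (subst homogeneous_expand[OF p]) (simp add: poly4_eval_sum poly4_eval_single m_def)
    thus ?thesis unfolding \<phi>_def v_def
      by (simp add: sum_distrib_left sum_distrib_right) (subst sum.swap, simp add: mult_ac)
  qed
  have "\<exists>c. (\<exists>i\<in>B. c i \<noteq> 0) \<and> (\<forall>t\<in>exps 6. (\<Sum>i\<in>B. c i * v i t) = 0)"
  proof (rule annihilator_dependent[where A = "exps 6" and T = "UNIV \<times> exps 2" and B = B and \<phi> = v
      and j = "\<lambda>t x. lookup (J t) (expo 6 x)"])
    show "finite (exps 6)" by (rule finite_exps)
    show "finite (UNIV \<times> exps 2 :: (4 \<times> _) set)" using finite_exps by simp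
    show "card (exps 6) < card (UNIV \<times> exps 2 :: (4 \<times> _) set) + card B" using B by (simp add: card_exps card_cartesian_product)
    fix i and t :: "4 \<times> nat \<times> nat \<times> nat" assume i: "i \<in> B" and t: "t \<in> UNIV \<times> exps 2"
    obtain l s where ls: "t = (l, s)" "s \<in> exps 2" using t by auto
    have "\<phi> i (poly4_eval (J t)) = 0"
      using kill[OF i form_poly4_eval[OF hom2[OF ls(2), of 1]], of l]
      by (simp add: J_def ls(1) poly4_eval_mult[abs_def])
    thus "(\<Sum>x\<in>exps 6. v i x * lookup (J t) (expo 6 x)) = 0" using val[OF homJ[OF t]] by simp
  next
    fix c :: "4 \<times> nat \<times> nat \<times> nat \<Rightarrow> 'k"
    assume c: "\<forall>x\<in>exps 6. (\<Sum>t\<in>UNIV \<times> exps 2. c t * lookup (J t) (expo 6 x)) = 0"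
    define q where "q l = (\<Sum>s\<in>exps 2. single (expo 2 s) (c (l, s)))" for l
    have hq: "homogeneous 2 (q l)" for l unfolding q_def by (intro homogeneous_sum hom2)
    define G where "G = (\<Sum>l\<in>UNIV. q l * f l)"
    have hG: "homogeneous 6 G" unfolding G_def using homogeneous_mult[OF hq hom] e by (intro homogeneous_sum) simp
    have "G = (\<Sum>l\<in>UNIV. \<Sum>s\<in>exps 2. const4 (c (l, s)) * J (l, s))"
      unfolding G_def q_def sum_distrib_right J_def by (simp add: mult.assoc[symmetric] mult_single)
    also have "\<dots> = (\<Sum>t\<in>UNIV \<times> exps 2. const4 (c t) * J t)" by (simp add: sum.cartesian_product)
    finally have GJ: "G = (\<Sum>t\<in>UNIV \<times> exps 2. const4 (c t) * J t)" .
    have lc: "lookup (const4 a * p) m = a * lookup p m" for a :: 'k and p m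
    proof -
      have "\<forall>m. lookup (const4 a * p) m = a * lookup p m"
        by (rule poly4_term_induct[of "\<lambda>p. \<forall>m. lookup (const4 a * p) m = a * lookup p m"])
          (simp_all add: distrib_left lookup_add mult_single lookup_single when_def)
      thus ?thesis by blast
    qed
    have "lookup G (expo 6 x) = 0" if "x \<in> exps 6" for x
      unfolding GJ lookup_sum lc using c that by simp
    hence "G = 0" by (subst homogeneous_expand[OF hG]) simp
    hence q0: "q l = 0" for l using no_syzygy[of q 2 l] hq e unfolding G_def by simp
    show "\<forall>t\<in>UNIV \<times> exps 2. c t = 0"
    proof
      fix t :: "4 \<times> nat \<times> nat \<times> nat" assume "t \<in> UNIV \<times> exps 2"
      then obtain l s where ls: "t = (l, s)" "s \<in> exps 2" by auto
      have "lookup (q l) (expo 2 s) = (\<Sum>s'\<in>exps 2. if s' = s then c (l, s) else 0)"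
        unfolding q_def lookup_sum by (intro sum.cong refl) (auto simp: lookup_single when_def dest: injD[OF inj_expo])
      also have "\<dots> = c (l, s)" using ls(2) finite_exps by simp
      finally show "c t = 0" using q0 ls(1) by simp
    qed
  qed (rule B(1))
  then obtain c where c: "\<exists>i\<in>B. c i \<noteq> 0" "\<forall>t\<in>exps 6. (\<Sum>i\<in>B. c i * v i t) = 0" by blast
  have "(\<Sum>i\<in>B. c i * \<phi> i g) = 0" if g: "form 6 g" for g
  proof -
    obtain p where p: "homogeneous 6 p" "g = poly4_eval p" using form_imp_poly4[OF g] by blast
    have "(\<Sum>i\<in>B. c i * \<phi> i g) = (\<Sum>t\<in>exps 6. (\<Sum>i\<in>B. c i * v i t) * lookup p (expo 6 t))"
      unfolding p(2) val[OF p(1)] sum_distrib_left sum_distrib_right by (subst sum.swap) (simp add: mult.assoc)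
    thus ?thesis using c(2) by simp
  qed
  thus ?thesis using c(1) by blast
qed

section \<open>Residue functionals\<close>

definition minor2 :: "4 \<Rightarrow> 4 \<Rightarrow> 'k::comm_ring_1 ^ 4 \<Rightarrow> 'k ^ 4 \<Rightarrow> 'k" where
  "minor2 i j x y = x $ i * y $ j - x $ j * y $ i"

text \<open>The determinant of four vectors, as its Laplace expansion along pairs of rows.\<close>

definition vol :: "'k::comm_ring_1 ^ 4 \<Rightarrow> 'k ^ 4 \<Rightarrow> 'k ^ 4 \<Rightarrow> 'k ^ 4 \<Rightarrow> 'k" where
  "vol u v w x = minor2 1 2 u v * minor2 3 4 w x - minor2 1 3 u v * minor2 2 4 w x + minor2 1 4 u v * minor2 2 3 w x
     + minor2 2 3 u v * minor2 1 4 w x - minor2 2 4 u v * minor2 1 3 w x + minor2 3 4 u v * minor2 1 2 w x"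

lemma minor2_linear:
  "minor2 i j (a *s x + b *s y) (c *s x + d *s y) = (a * d - b * c) * minor2 i j x y"
  by (simp add: minor2_def algebra_simps)

lemma vol_swap: "vol u v w x = vol w x u v"
  by (simp add: vol_def algebra_simps)

lemma vol_linear2: "vol (a *s x + b *s y) (c *s x + d *s y) w z = (a * d - b * c) * vol x y w z"
  unfolding vol_def minor2_linear by (simp add: algebra_simps)

lemma vol_exchange: "vol u v w x = - vol u w v x"
  by (simp add: vol_def minor2_def algebra_simps)

lemma vol_repeat: "vol u v u x = 0" "vol u v v x = 0" "vol u v x u = 0" "vol u v x v = 0" "vol u v x x = 0"
  by (simp_all add: vol_def minor2_def algebra_simps)

lemma vol_add: "vol u v (a *s w + b *s x) z = a * vol u v w z + b * vol u v x z"
  by (simp add: vol_def minor2_def algebra_simps)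

lemma vol_expand:
  assumes "w = \<alpha> *s u + \<beta> *s v + \<gamma> *s m + \<delta> *s n" "x = \<alpha>' *s u + \<beta>' *s v + \<gamma>' *s m + \<delta>' *s n"
  shows "vol u v w x = (\<gamma> * \<delta>' - \<delta> * \<gamma>') * vol u v m n"
proof -
  have 1: "vol u v (\<alpha> *s u + \<beta> *s v + \<gamma> *s m + \<delta> *s n) z = \<gamma> * vol u v m z + \<delta> * vol u v n z" for \<alpha> \<beta> \<gamma> \<delta> z
    using vol_add[of u v 1 "\<alpha> *s u + \<beta> *s v" 1 "\<gamma> *s m + \<delta> *s n" z] by (simp add: vol_add vol_repeat add.assoc)
  have a: "vol u v x z = - vol u v z x" for x z by (simp add: vol_def minor2_def algebra_simps)
  have "vol u v x m = \<gamma>' * vol u v m m + \<delta>' * vol u v n m" "vol u v x n = \<gamma>' * vol u v m n + \<delta>' * vol u v n n"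
    unfolding assms(2) by (rule 1)+
  hence "vol u v m x = \<delta>' * vol u v m n" "vol u v n x = - \<gamma>' * vol u v m n"
    using a[of m x] a[of n x] a[of n m] by (simp_all add: vol_repeat)
  moreover have "vol u v w x = \<gamma> * vol u v m x + \<delta> * vol u v n x" unfolding assms(1) by (rule 1)
  ultimately show ?thesis by (simp add: algebra_simps)
qed

lemma D_linear_form: "form 1 g \<Longrightarrow> D g x w = (g w :: 'k::field_char_0)"
proof -
  assume g: "form 1 g"
  have "lp g x w = [:g x, g w:]" by (rule lp_unique) (simp add: form_1_linear[OF g])
  thus ?thesis by (simp add: D_def)
qed

text \<open>The residue theorem for g / b on the projective line: the finite residues on the left,
  minus the residue at infinity on the right. The interpolation polynomial of g at the four roots
  has g itself as its value.\<close>

lemma lagrange_top_coefficient: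
  fixes b g :: "'k::field_char_0 poly"
  assumes b: "degree b \<le> 4" "card {z. poly b z = 0} = 4" and g: "degree g \<le> 3"
  shows "(\<Sum>z\<in>{z. poly b z = 0}. poly g z / poly (pderiv b) z) = coeff g 3 / coeff b 4" "coeff b 4 \<noteq> 0"
    "\<And>z. poly b z = 0 \<Longrightarrow> poly (pderiv b) z \<noteq> 0"
proof -
  define R where "R = {z. poly b z = 0}"
  have b0: "b \<noteq> 0" using b(2) by (auto simp: infinite_UNIV_char_0)
  have fR: "finite R" unfolding R_def by (rule poly_roots_finite[OF b0])
  have "\<forall>z\<in>R. \<exists>q. b = [:-z, 1:] * q" unfolding R_def poly_eq_0_iff_dvd dvd_def by blast
  then obtain q where q: "\<And>z. z \<in> R \<Longrightarrow> b = [:-z, 1:] * q z" using bchoice[of R "\<lambda>z q. b = [:-z, 1:] * q"] by blast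
  have mult: "degree b = 4"
  proof -
    have "(\<Sum>z\<in>R. 1) \<le> degree b"
      by (rule sum_multiplicities_le_degree[OF b0 fR]) (simp add: R_def poly_eq_0_iff_dvd)
    thus ?thesis using b unfolding R_def by simp
  qed
  thus b4: "coeff b 4 \<noteq> 0" using b0 leading_coeff_0_iff[of b] by simp
  have dq: "poly (pderiv b) z = poly (q z) z" if "z \<in> R" for z
  proof -
    have "pderiv b = [:-z, 1:] * pderiv (q z) + q z"
      by (subst q[OF that], subst pderiv_mult) (simp add: pderiv_pCons)
    thus ?thesis by simp
  qed
  have db: "poly (pderiv b) z \<noteq> 0" if z: "z \<in> R" for z
  proof
    assume "poly (pderiv b) z = 0"
    hence "[:-z, 1:] dvd q z" using dq[OF z] by (simp add: poly_eq_0_iff_dvd)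
    hence "[:-z, 1:] * [:-z, 1:] dvd b" by (subst q[OF z]) (rule mult_dvd_mono[OF dvd_refl])
    hence d2: "[:-z, 1:]^2 dvd b" by (simp only: power2_eq_square)
    have "(\<Sum>y\<in>R. if y = z then 2 else 1) \<le> degree b"
    proof (rule sum_multiplicities_le_degree[OF b0 fR])
      fix y assume "y \<in> R"
      thus "[:-y,1:]^(if y = z then 2 else 1) dvd b" using d2 by (simp add: R_def poly_eq_0_iff_dvd)
    qed
    moreover have "(\<Sum>y\<in>R. if y = z then 2 else 1) = (\<Sum>y\<in>R. 1 + (if y = z then 1 else (0::nat)))" by (intro sum.cong) auto
    moreover have "\<dots> = card R + 1" using fR z unfolding sum.distrib by simp
    ultimately show False using mult b(2) by (simp add: R_def)
  qed
  thus "\<And>z. poly b z = 0 \<Longrightarrow> poly (pderiv b) z \<noteq> 0" by (simp add: R_def)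
  have qz: "degree (q z) \<le> 3" "coeff (q z) 3 = coeff b 4" if z: "z \<in> R" for z
  proof -
    have q0: "q z \<noteq> 0" using q[OF z] b0 by auto
    have "degree b = degree [:-z, 1:] + degree (q z)"
      by (subst q[OF z], rule degree_mult_eq) (use q0 in auto)
    hence d: "degree (q z) = 3" using mult by simp
    thus "degree (q z) \<le> 3" by simp
    have "coeff b 4 = coeff ([:-z, 1:] * q z) 4" using q[OF z] by simp
    also have "\<dots> = coeff (q z) 3" using d by (simp add: coeff_eq_0 eval_nat_numeral)
    finally show "coeff (q z) 3 = coeff b 4" by simp
  qed
  define G where "G = (\<Sum>z\<in>R. smult (poly g z / poly (pderiv b) z) (q z))"
  have van: "poly (G - g) y = 0" if y: "y \<in> R" for y
  proof -
    have "poly G y = (\<Sum>z\<in>R. if z = y then poly g y else 0)"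
      unfolding G_def poly_sum
    proof (intro sum.cong refl)
      fix z assume z: "z \<in> R"
      show "poly (smult (poly g z / poly (pderiv b) z) (q z)) y = (if z = y then poly g y else 0)"
      proof (cases "z = y")
        case True thus ?thesis using db[OF z] dq[OF z] by simp
      next
        case False
        have "poly ([:-z, 1:] * q z) y = 0" using q[OF z] y by (simp add: R_def)
        thus ?thesis using False by simp
      qed
    qed
    thus ?thesis using fR y by simp
  qed
  have "degree (G - g) \<le> 3"
  proof -
    have "degree G \<le> 3" unfolding G_def using qz(1) fR by (intro degree_sum_le) (auto intro: order_trans[OF degree_smult_le])
    thus ?thesis using g by (intro degree_diff_le) auto
  qed
  have "G - g = 0"
  proof -
    have False if n: "G - g \<noteq> 0"
    proof -
      have "(\<Sum>z\<in>R. 1) \<le> degree (G - g)"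
        by (rule sum_multiplicities_le_degree[OF n fR]) (simp only: power_one_right poly_eq_0_iff_dvd[symmetric] van)
      thus False using \<open>degree (G - g) \<le> 3\<close> b(2) by (simp add: R_def)
    qed
    thus ?thesis by blast
  qed
  hence "coeff G 3 = coeff g 3" by simp
  moreover have "coeff G 3 = (\<Sum>z\<in>R. poly g z / poly (pderiv b) z) * coeff b 4"
    unfolding G_def coeff_sum by (simp add: qz(2) sum_distrib_right)
  ultimately show "(\<Sum>z\<in>{z. poly b z = 0}. poly g z / poly (pderiv b) z) = coeff g 3 / coeff b 4"
    using b4 by (simp add: R_def field_simps)
qed

section \<open>The residue functional of one line\<close>

context quintic_line
begin

lemma D_at_u: "D F u (\<alpha> *s u + \<beta> *s v + \<gamma> *s n1 + \<delta> *s n2) = \<gamma> * coeff a 4 + \<delta> * coeff b 4"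
proof -
  have "D F u (\<alpha> *s u + \<beta> *s v) = 0" using D_on_line[of 1 0 \<alpha> \<beta>] by simp
  thus ?thesis by (simp add: coeff_a4 coeff_b4 D_plus[OF formF] D_scale[OF formF])
qed

lemma vol_basis_nonzero: "vol u v n1 n2 \<noteq> 0"
proof
  assume z: "vol u v n1 n2 = 0"
  have zero: "vol u v x y = 0" for x y
  proof -
    obtain \<alpha> \<beta> \<gamma> \<delta> where x: "x = \<alpha> *s u + \<beta> *s v + \<gamma> *s n1 + \<delta> *s n2" using spans by blast
    obtain \<alpha>' \<beta>' \<gamma>' \<delta>' where y: "y = \<alpha>' *s u + \<beta>' *s v + \<gamma>' *s n1 + \<delta>' *s n2" using spans by blast
    show ?thesis using vol_expand[OF x y] z by simp
  qed
  have "minor2 1 2 u v = 0" "minor2 1 3 u v = 0" "minor2 1 4 u v = 0" "minor2 2 3 u v = 0" "minor2 2 4 u v = 0" "minor2 3 4 u v = 0"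
    using zero[of "axis 3 1" "axis 4 1"] zero[of "axis 2 1" "axis 4 1"] zero[of "axis 2 1" "axis 3 1"]
      zero[of "axis 1 1" "axis 4 1"] zero[of "axis 1 1" "axis 3 1"] zero[of "axis 1 1" "axis 2 1"]
    unfolding vol_def minor2_def[of _ _ "axis _ _"] by (simp_all add: axis_def)
  hence m: "u $ i * v $ j = u $ j * v $ i" for i j
    using exhaust_4[of i] exhaust_4[of j] by (auto simp: minor2_def)
  have "u \<noteq> 0" using indep[of 1 0 0 0] by auto
  then obtain i where i: "u $ i \<noteq> 0" by (auto simp: vec_eq_iff)
  have "(- (v $ i)) *s u + (u $ i) *s v + 0 *s n1 + 0 *s n2 = 0"
    using m by (simp add: vec_eq_iff mult.commute)
  thus False using indep i by blast
qed

lemma change_normal: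
  assumes "c \<noteq> 0" shows "quintic_line F u v (c *s n1) (n2 + t *s n1)"
proof
  show "form 5 F" by (rule formF)
  show "F (\<alpha> *s u + \<beta> *s v) = 0" for \<alpha> \<beta> by (rule on_line)
  have e: "\<alpha> *s u + \<beta> *s v + \<gamma> *s (c *s n1) + \<delta> *s (n2 + t *s n1) = \<alpha> *s u + \<beta> *s v + (\<gamma> * c + \<delta> * t) *s n1 + \<delta> *s n2" for \<alpha> \<beta> \<gamma> \<delta>
    by (simp add: vec_eq_iff algebra_simps)
  show "\<alpha> = 0 \<and> \<beta> = 0 \<and> \<gamma> = 0 \<and> \<delta> = 0" if "\<alpha> *s u + \<beta> *s v + \<gamma> *s (c *s n1) + \<delta> *s (n2 + t *s n1) = 0" for \<alpha> \<beta> \<gamma> \<delta>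
    using indep[of \<alpha> \<beta> "\<gamma> * c + \<delta> * t" \<delta>] that assms unfolding e by auto
  show "\<exists>\<alpha> \<beta> \<gamma> \<delta>. x = \<alpha> *s u + \<beta> *s v + \<gamma> *s (c *s n1) + \<delta> *s (n2 + t *s n1)" for x
  proof -
    obtain \<alpha> \<beta> \<gamma> \<delta> where x: "x = \<alpha> *s u + \<beta> *s v + \<gamma> *s n1 + \<delta> *s n2" using spans by blast
    have "x = \<alpha> *s u + \<beta> *s v + ((\<gamma> - \<delta> * t) / c) *s (c *s n1) + \<delta> *s (n2 + t *s n1)"
      unfolding e x using assms by simp
    thus ?thesis by blast
  qed
  show "\<exists>w. D F x w \<noteq> 0" if "x \<noteq> 0" for x using smooth that by blast
qed

text \<open>Replacing n2 by n2 + t n1 changes b to b + t a. A double root of this is a ramification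
  point, and a root at infinity means a zero coefficient in degree four; finitely many t are
  excluded. Rescaling n1 normalises the volume.\<close>

lemma separable_normal_exists:
  "\<exists>m1 m2. quintic_line F u v m1 m2 \<and> vol u v m1 m2 = 1 \<and> card {z. poly (quintic_line.b F u v m2) z = 0} = 4"
proof -
  let ?bad = "(\<lambda>z. - poly b z / poly a z) ` {z. poly W z = 0} \<union> {- coeff b 4 / coeff a 4}"
  have "finite ?bad" using poly_roots_finite[OF W_nonzero] by simp
  then obtain t where t: "t \<notin> ?bad" using ex_new_if_finite[OF infinite_UNIV_char_0] by blast
  define c where "c = 1 / vol u v n1 n2"
  have c: "c \<noteq> 0" using vol_basis_nonzero by (simp add: c_def)
  interpret T: quintic_line F u v "c *s n1" "n2 + t *s n1" by (rule change_normal[OF c])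
  have Tb: "T.b = b + smult t a"
    by (rule poly_eq_by_values) (simp add: T.poly_b poly_b poly_a D_plus[OF formF] D_scale[OF formF])
  have ab4: "coeff a 4 \<noteq> 0 \<or> coeff b 4 \<noteq> 0"
  proof -
    have "u \<noteq> 0" using indep[of 1 0 0 0] by auto
    then obtain w where w: "D F u w \<noteq> 0" using smooth by blast
    obtain \<alpha> \<beta> \<gamma> \<delta> where "w = \<alpha> *s u + \<beta> *s v + \<gamma> *s n1 + \<delta> *s n2" using spans by blast
    thus ?thesis using w D_at_u by auto
  qed
  have b4: "coeff T.b 4 \<noteq> 0"
  proof
    assume "coeff T.b 4 = 0"
    hence e: "coeff b 4 + t * coeff a 4 = 0" unfolding Tb by simp
    hence "coeff a 4 \<noteq> 0" using ab4 by auto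
    hence "t = - coeff b 4 / coeff a 4" using e by (simp add: field_simps eq_neg_iff_add_eq_0 add.commute)
    thus False using t by blast
  qed
  hence Tb0: "T.b \<noteq> 0" by auto
  have dTb: "degree T.b = 4" using T.deg_b le_degree[OF b4] by simp
  have sep: "order z T.b = 1" if z: "poly T.b z = 0" for z
  proof -
    have "poly (pderiv T.b) z \<noteq> 0"
    proof
      assume d: "poly (pderiv T.b) z = 0"
      have bz: "poly b z = - t * poly a z" using z unfolding Tb by (simp add: eq_neg_iff_add_eq_0)
      have bz': "poly (pderiv b) z = - t * poly (pderiv a) z" using d unfolding Tb by (simp add: pderiv_add pderiv_smult eq_neg_iff_add_eq_0)
      have "poly W z = 0" unfolding W_value bz bz' by simp
      moreover have "poly a z \<noteq> 0" using ab_nz[of z] bz by auto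
      hence "t = - poly b z / poly a z" using bz by simp
      ultimately show False using t by blast
    qed
    hence "order z (pderiv T.b) = 0" by (simp add: order_root)
    moreover have "pderiv T.b \<noteq> 0" using \<open>poly (pderiv T.b) z \<noteq> 0\<close> by auto
    ultimately show ?thesis using order_pderiv[OF Tb0 z] by simp
  qed
  have "(\<Sum>z\<in>{z. poly T.b z = 0}. order z T.b) = (\<Sum>z\<in>{z. poly T.b z = 0}. 1)" using sep by (intro sum.cong) auto
  hence "card {z. poly T.b z = 0} = 4" using sum_order_eq_degree[OF Tb0] dTb by simp
  moreover have "vol u v (c *s n1) (n2 + t *s n1) = 1"
  proof -
    have "vol u v (c *s n1) (n2 + t *s n1) = (c * 1 - 0 * t) * vol u v n1 n2"
      by (rule vol_expand[where \<alpha> = 0 and \<beta> = 0 and \<alpha>' = 0 and \<beta>' = 0]) (simp_all add: add.commute)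
    thus ?thesis using vol_basis_nonzero by (simp add: c_def)
  qed
  ultimately show ?thesis using T.quintic_line_axioms by blast
qed

text \<open>The sum of the residues of g / (a b) at the zeros of b, written with values because
  these zeros are simple in use.\<close>

definition \<phi> :: "('k ^ 4 \<Rightarrow> 'k) \<Rightarrow> 'k" where
  "\<phi> g = (\<Sum>z\<in>{z. poly b z = 0}. 1 / (poly a z * poly (pderiv b) z) * g (pt z))"

context
  assumes sep: "card {z. poly b z = 0} = 4"
begin

lemmas lagrange = lagrange_top_coefficient[OF deg_b sep]

text \<open>At a zero of b the derivative along w is a multiple of a, which cancels the denominator.
  What remains is the coefficient in degree 3 of a polynomial of degree at most 2.\<close>

lemma \<phi>_kills:
  assumes q: "form 2 q" shows "\<phi> (\<lambda>x. q x * D F x w) = 0"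
proof -
  obtain \<alpha> \<beta> \<gamma> \<delta> where w: "w = \<alpha> *s u + \<beta> *s v + \<gamma> *s n1 + \<delta> *s n2" using spans by blast
  have "\<phi> (\<lambda>x. q x * D F x w) = (\<Sum>z\<in>{z. poly b z = 0}. poly (smult \<gamma> (lp q v u)) z / poly (pderiv b) z)"
    unfolding \<phi>_def
  proof (intro sum.cong refl)
    fix z assume z: "z \<in> {z. poly b z = 0}"
    hence "poly a z \<noteq> 0" using ab_nz[of z] by auto
    thus "1 / (poly a z * poly (pderiv b) z) * (q (pt z) * D F (pt z) w) = poly (smult \<gamma> (lp q v u)) z / poly (pderiv b) z"
      using z unfolding w D_pt by (simp add: poly_lp[OF q] pt_def)
  qed
  also have "\<dots> = coeff (smult \<gamma> (lp q v u)) 3 / coeff b 4"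
    using degree_lp[OF q, of v u] by (intro lagrange(1)) (auto intro: order_trans[OF degree_smult_le])
  also have "coeff (smult \<gamma> (lp q v u)) 3 = 0" using degree_lp[OF q, of v u] by (simp add: coeff_eq_0)
  finally show ?thesis by simp
qed

lemma \<phi>_cong: "(\<And>z. g (pt z) = g' (pt z)) \<Longrightarrow> \<phi> g = \<phi> g'"
  by (simp add: \<phi>_def)

lemma \<phi>_cmult: "\<phi> (\<lambda>x. c * g x) = c * \<phi> g"
  by (simp add: \<phi>_def sum_distrib_left mult_ac)

text \<open>At the zeros of \<open>b\<close> the derivatives along \<open>w1\<close> and \<open>w2\<close> are proportional to \<open>a\<close>, which turns the sum
  into the Lagrange interpolation of a leading coefficient.\<close>

lemma \<phi>_det:
  assumes f: "form 1 y1" "form 1 y2" "form 3 M11" "form 3 M12" "form 3 M21" "form 3 M22"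
    and r1: "\<And>x. x \<in> vec.span {u, v} \<Longrightarrow> D F x w1 = M11 x * y1 x + M12 x * y2 x"
    and r2: "\<And>x. x \<in> vec.span {u, v} \<Longrightarrow> D F x w2 = M21 x * y1 x + M22 x * y2 x"
    and e: "y1 u * y2 v - y1 v * y2 u \<noteq> 0" and vol1: "vol u v n1 n2 = 1"
  shows "\<phi> (\<lambda>x. M11 x * M22 x - M12 x * M21 x) * (y1 u * y2 v - y1 v * y2 u) = - vol u v w1 w2"
proof -
  let ?e = "y1 u * y2 v - y1 v * y2 u"
  obtain \<alpha>1 \<beta>1 \<gamma>1 \<delta>1 where w1: "w1 = \<alpha>1 *s u + \<beta>1 *s v + \<gamma>1 *s n1 + \<delta>1 *s n2" using spans by blast
  obtain \<alpha>2 \<beta>2 \<gamma>2 \<delta>2 where w2: "w2 = \<alpha>2 *s u + \<beta>2 *s v + \<gamma>2 *s n1 + \<delta>2 *s n2" using spans by blast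
  \<comment> \<open>The form \<alpha> y1 + \<beta> y2 is 0 at \<open>u\<close> and 1 at
    \<open>v\<close>, hence 1 at every \<open>pt z\<close>. Cramer's rule then writes the
    determinant at a zero of b as a times the cubic G.\<close>
  define \<alpha> where "\<alpha> = - y2 u / ?e"
  define \<beta> where "\<beta> = y1 u / ?e"
  have gen: "(r * x + s * y) * t = (r * t) * x + (s * t) * y" for r s t x y :: 'k by (simp add: algebra_simps)
  have \<alpha>\<beta>: "\<alpha> * ?e = - y2 u" "\<beta> * ?e = y1 u" using e by (simp_all add: \<alpha>_def \<beta>_def)
  define G where "G x = \<alpha> * (\<gamma>1 * M22 x - \<gamma>2 * M12 x) + \<beta> * (\<gamma>2 * M11 x - \<gamma>1 * M21 x)" for x
  have fG: "form 3 G"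
    unfolding G_def[abs_def] by (intro form_add form_cmult form_diff f)
  have unit: "\<alpha> * y1 (pt z) + \<beta> * y2 (pt z) = 1" for z
  proof -
    have y: "y (pt z) = y v + z * y u" if "form 1 y" for y using form_1_linear[OF that] by (simp add: pt_def)
    have "(\<alpha> * y1 (pt z) + \<beta> * y2 (pt z)) * ?e = (\<alpha> * ?e) * y1 (pt z) + (\<beta> * ?e) * y2 (pt z)" by (rule gen)
    also have "\<dots> = - y2 u * (y1 v + z * y1 u) + y1 u * (y2 v + z * y2 u)"
      unfolding \<alpha>\<beta> y[OF f(1)] y[OF f(2)] ..
    also have "\<dots> = 1 * ?e" by (simp add: algebra_simps)
    finally show ?thesis using e by (simp only: mult_cancel_right) simp
  qed
  have val: "M11 (pt z) * M22 (pt z) - M12 (pt z) * M21 (pt z) = poly a z * G (pt z)" if z: "poly b z = 0" for z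
  proof -
    let ?x = "pt z"
    let ?d = "M11 ?x * M22 ?x - M12 ?x * M21 ?x"
    have 1: "\<gamma>1 * poly a z = M11 ?x * y1 ?x + M12 ?x * y2 ?x" using r1[OF pt_in_line, of z] z unfolding w1 D_pt by simp
    have 2: "\<gamma>2 * poly a z = M21 ?x * y1 ?x + M22 ?x * y2 ?x" using r2[OF pt_in_line, of z] z unfolding w2 D_pt by simp
    have "?d * y1 ?x = M22 ?x * (M11 ?x * y1 ?x + M12 ?x * y2 ?x) - M12 ?x * (M21 ?x * y1 ?x + M22 ?x * y2 ?x)"
      by (simp add: algebra_simps)
    hence d1: "?d * y1 ?x = poly a z * (\<gamma>1 * M22 ?x - \<gamma>2 * M12 ?x)" unfolding 1[symmetric] 2[symmetric] by (simp add: algebra_simps)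
    have "?d * y2 ?x = M11 ?x * (M21 ?x * y1 ?x + M22 ?x * y2 ?x) - M21 ?x * (M11 ?x * y1 ?x + M12 ?x * y2 ?x)"
      by (simp add: algebra_simps)
    hence d2: "?d * y2 ?x = poly a z * (\<gamma>2 * M11 ?x - \<gamma>1 * M21 ?x)" unfolding 1[symmetric] 2[symmetric] by (simp add: algebra_simps)
    have "?d = ?d * (\<alpha> * y1 ?x + \<beta> * y2 ?x)" unfolding unit by simp
    also have "\<dots> = \<alpha> * (?d * y1 ?x) + \<beta> * (?d * y2 ?x)" by (simp only: distrib_left mult.left_commute)
    also have "\<dots> = poly a z * G ?x" unfolding d1 d2 G_def by (simp add: algebra_simps)
    finally show ?thesis .
  qed
  have "\<phi> (\<lambda>x. M11 x * M22 x - M12 x * M21 x) = (\<Sum>z\<in>{z. poly b z = 0}. poly (lp G v u) z / poly (pderiv b) z)"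
    unfolding \<phi>_def
  proof (intro sum.cong refl)
    fix z assume z: "z \<in> {z. poly b z = 0}"
    hence "poly a z \<noteq> 0" using ab_nz[of z] by auto
    thus "1 / (poly a z * poly (pderiv b) z) * (M11 (pt z) * M22 (pt z) - M12 (pt z) * M21 (pt z)) = poly (lp G v u) z / poly (pderiv b) z"
      using z val[of z] by (simp add: poly_lp[OF fG] pt_def)
  qed
  also have "\<dots> = coeff (lp G v u) 3 / coeff b 4" by (rule lagrange(1)[OF degree_lp[OF fG]])
  also have "coeff (lp G v u) 3 = G u" by (rule coeff_lp_top[OF fG])
  finally have "\<phi> (\<lambda>x. M11 x * M22 x - M12 x * M21 x) * ?e = (G u * ?e) / coeff b 4" by simp
  also have "G u * ?e = \<gamma>2 * (M11 u * y1 u + M12 u * y2 u) - \<gamma>1 * (M21 u * y1 u + M22 u * y2 u)"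
  proof -
    have "G u * ?e = (\<alpha> * ?e) * (\<gamma>1 * M22 u - \<gamma>2 * M12 u) + (\<beta> * ?e) * (\<gamma>2 * M11 u - \<gamma>1 * M21 u)"
      unfolding G_def by (rule gen)
    thus ?thesis unfolding \<alpha>\<beta> by (simp add: algebra_simps)
  qed
  also have "\<dots> = \<gamma>2 * D F u w1 - \<gamma>1 * D F u w2"
    using r1[of u] r2[of u] vec.span_base[of u "{u, v}"] by simp
  also have "\<dots> = - (\<gamma>1 * \<delta>2 - \<delta>1 * \<gamma>2) * coeff b 4" unfolding w1 w2 D_at_u by (simp add: algebra_simps)
  finally show ?thesis using vol_expand[OF w1 w2] vol1 lagrange(2)[of 0] by simp
qed

end

end

text \<open>The decomposition F = cg A + cd B is not unique, so A and B belong to the data.\<close>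

locale normalized_line = quintic_line F u v n1 n2
  for F :: "'k::{alg_closed_field,field_char_0} ^ 4 \<Rightarrow> 'k" and u v n1 n2 +
  fixes cu cv cg cd A B :: "'k ^ 4 \<Rightarrow> 'k"
  assumes sep: "card {z. poly b z = 0} = 4" and vol1: "vol u v n1 n2 = 1"
    and coord_forms: "form 1 cu" "form 1 cv" "form 1 cg" "form 1 cd"
    and coords: "\<And>x. x = cu x *s u + cv x *s v + cg x *s n1 + cd x *s n2"
    and formAB: "form 4 A" "form 4 B" and split: "\<And>x. F x = cg x * A x + cd x * B x"
begin

lemma coords_unique:
  "cu (\<alpha> *s u + \<beta> *s v + \<gamma> *s n1 + \<delta> *s n2) = \<alpha>" "cv (\<alpha> *s u + \<beta> *s v + \<gamma> *s n1 + \<delta> *s n2) = \<beta>"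
  "cg (\<alpha> *s u + \<beta> *s v + \<gamma> *s n1 + \<delta> *s n2) = \<gamma>" "cd (\<alpha> *s u + \<beta> *s v + \<gamma> *s n1 + \<delta> *s n2) = \<delta>"
  using coords_cancel[OF coords[symmetric, of "\<alpha> *s u + \<beta> *s v + \<gamma> *s n1 + \<delta> *s n2"]] by simp_all

lemma coords_basis:
  "cu u = 1" "cv u = 0" "cg u = 0" "cd u = 0" "cu v = 0" "cv v = 1" "cg v = 0" "cd v = 0"
  "cg n1 = 1" "cd n1 = 0" "cg n2 = 0" "cd n2 = 1"
  using coords_unique[of 1 0 0 0] coords_unique[of 0 1 0 0] coords_unique[of 0 0 1 0] coords_unique[of 0 0 0 1] by simp_all

lemma on_line_iff: "x \<in> vec.span {u, v} \<longleftrightarrow> cg x = 0 \<and> cd x = 0"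
proof
  assume "x \<in> vec.span {u, v}"
  then obtain \<alpha> \<beta> where "x = \<alpha> *s u + \<beta> *s v" unfolding mem_span2 by blast
  thus "cg x = 0 \<and> cd x = 0" using coords_unique[of \<alpha> \<beta> 0 0] by simp
next
  assume "cg x = 0 \<and> cd x = 0"
  hence "x = cu x *s u + cv x *s v" using coords[of x] by simp
  thus "x \<in> vec.span {u, v}" unfolding mem_span2 by blast
qed

lemma vol_coords: "vol u v x y = cg x * cd y - cd x * cg y"
  using vol_expand[OF coords[of x] coords[of y]] vol1 by simp

lemma D_split: "D F x w = cg x * D A x w + cg w * A x + cd x * D B x w + cd w * B x"
proof -
  have "D F x w = D (\<lambda>x. cg x * A x + cd x * B x) x w" using split by presburger
  also have "\<dots> = D (\<lambda>x. cg x * A x) x w + D (\<lambda>x. cd x * B x) x w"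
    using form_mult[OF coord_forms(3) formAB(1)] form_mult[OF coord_forms(4) formAB(2)] by (rule D_add)
  finally show ?thesis
    by (simp add: D_mult[OF coord_forms(3) formAB(1)] D_mult[OF coord_forms(4) formAB(2)] D_linear_form[OF coord_forms(3)] D_linear_form[OF coord_forms(4)])
qed

text \<open>The Jacobian determinant of A and B in the directions of the line, with the sign for
  which the line takes the value +16 on itself.\<close>

definition P\<^sub>6 :: "'k ^ 4 \<Rightarrow> 'k" where "P\<^sub>6 x = D A x v * D B x u - D A x u * D B x v"

lemma formDA: "form 3 (\<lambda>x. D A x w)" and formDB: "form 3 (\<lambda>x. D B x w)"
  using form_D[OF formAB(1), of w] form_D[OF formAB(2), of w] by simp_all

lemma form_P6: "form 6 P\<^sub>6"
  using form_diff[OF form_mult[OF formDA formDB] form_mult[OF formDA formDB], of v u u v] by (simp add: P\<^sub>6_def[abs_def])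

text \<open>On the line the normal derivatives of F are A and B. Euler's relation expresses them
  through the coordinates cu, cv with a quarter of the Jacobian matrix, and the determinant collects
  1/16.\<close>

lemma gram_self: "\<phi> P\<^sub>6 = 16"
proof -
  have on: "cg x = 0" "cd x = 0" "x = cu x *s u + cv x *s v" if "x \<in> vec.span {u, v}" for x
    using that on_line_iff coords[of x] by auto
  have e: "G x = 1/4 * D G x u * cu x + 1/4 * D G x v * cv x" if "form 4 G" "x \<in> vec.span {u, v}" for G x
  proof -
    have "4 * G x = D G x x" using D_euler[OF that(1), of x] by simp
    also have "\<dots> = D G x (cu x *s u + cv x *s v)" using on(3)[OF that(2)] by simp
    also have "\<dots> = cu x * D G x u + cv x * D G x v" by (rule D_linear[OF that(1)])
    finally show ?thesis by (simp add: field_simps)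
  qed
  have "\<phi> (\<lambda>x. (1/4 * D A x u) * (1/4 * D B x v) - (1/4 * D A x v) * (1/4 * D B x u)) * (cu u * cv v - cu v * cv u) = - vol u v n1 n2"
  proof (rule \<phi>_det[OF sep coord_forms(1,2)])
    show "form 3 (\<lambda>x. 1/4 * D A x u)" "form 3 (\<lambda>x. 1/4 * D A x v)" "form 3 (\<lambda>x. 1/4 * D B x u)" "form 3 (\<lambda>x. 1/4 * D B x v)"
      by (intro form_cmult formDA formDB)+
    fix x assume x: "x \<in> vec.span {u, v}"
    show "D F x n1 = 1/4 * D A x u * cu x + 1/4 * D A x v * cv x"
      using e[OF formAB(1) x] D_split[of x n1] on[OF x] by (simp add: coords_basis)
    show "D F x n2 = 1/4 * D B x u * cu x + 1/4 * D B x v * cv x"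
      using e[OF formAB(2) x] D_split[of x n2] on[OF x] by (simp add: coords_basis)
  qed (simp_all add: coords_basis vol1)
  moreover have "(\<lambda>x. (1/4 * D A x u) * (1/4 * D B x v) - (1/4 * D A x v) * (1/4 * D B x u)) = (\<lambda>x. - (1/16) * P\<^sub>6 x)"
    by (rule ext) (simp add: P\<^sub>6_def algebra_simps)
  ultimately have "\<phi> (\<lambda>x. - (1/16) * P\<^sub>6 x) = - 1" by (simp add: coords_basis vol1)
  thus ?thesis unfolding \<phi>_cmult[OF sep] by (simp add: field_simps)
qed

end

text \<open>For a skew line M the equations cg', cd' of M are coordinates on L. The derivatives of F
  along u', v' are then given by the Jacobian matrix itself, without an Euler factor.\<close>

lemma gram_skew:
  assumes "normalized_line F u v n1 n2 cu cv cg cd A B" "normalized_line F u' v' n1' n2' cu' cv' cg' cd' A' B'"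
    and skew: "vec.span {u, v} \<inter> vec.span {u', v'} = {0}"
  shows "quintic_line.\<phi> F u v n1 n2 (normalized_line.P\<^sub>6 u' v' A' B') = 1"
proof -
  interpret L: normalized_line F u v n1 n2 cu cv cg cd A B by fact
  interpret M: normalized_line F u' v' n1' n2' cu' cv' cg' cd' A' B' by fact
  let ?e = "cg' u * cd' v - cg' v * cd' u"
  have ne: "?e \<noteq> 0"
  proof
    assume e: "?e = 0"
    have "\<exists>s t. (s, t) \<noteq> (0, 0) \<and> s * cg' u + t * cg' v = 0 \<and> s * cd' u + t * cd' v = 0"
    proof (cases "cg' u = 0 \<and> cg' v = 0")
      case True
      show ?thesis
      proof (cases "cd' u = 0 \<and> cd' v = 0")
        case True
        thus ?thesis using \<open>cg' u = 0 \<and> cg' v = 0\<close> by (intro exI[of _ 1]) auto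
      next
        case False
        thus ?thesis using True by (intro exI[of _ "cd' v"] exI[of _ "- cd' u"]) auto
      qed
    next
      case False
      thus ?thesis using e by (intro exI[of _ "cg' v"] exI[of _ "- cg' u"]) (auto simp: algebra_simps)
    qed
    then obtain s t where st: "(s, t) \<noteq> (0, 0)" "s * cg' u + t * cg' v = 0" "s * cd' u + t * cd' v = 0" by blast
    let ?x = "s *s u + t *s v"
    have "cg' ?x = 0" "cd' ?x = 0"
      using st form_1_linear[OF M.coord_forms(3)] form_1_linear[OF M.coord_forms(4)] by simp_all
    hence "?x \<in> vec.span {u', v'}" using M.on_line_iff by blast
    moreover have "?x \<in> vec.span {u, v}" unfolding mem_span2 by blast
    ultimately have "?x = 0" using skew by blast
    hence "s *s u + t *s v + 0 *s n1 + 0 *s n2 = 0" by simp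
    hence "s = 0 \<and> t = 0" using L.indep by blast
    thus False using st(1) by simp
  qed
  have "L.\<phi> (\<lambda>x. D A' x u' * D B' x v' - D B' x u' * D A' x v') * ?e = - vol u v u' v'"
  proof (rule L.\<phi>_det[OF L.sep M.coord_forms(3,4) M.formDA M.formDB M.formDA M.formDB])
    fix x
    show "D F x u' = D A' x u' * cg' x + D B' x u' * cd' x" using M.D_split[of x u'] by (simp add: M.coords_basis mult.commute)
    show "D F x v' = D A' x v' * cg' x + D B' x v' * cd' x" using M.D_split[of x v'] by (simp add: M.coords_basis mult.commute)
  qed (use ne L.vol1 in simp_all)
  moreover have "vol u v u' v' = ?e" unfolding vol_swap[of u v] M.vol_coords by (simp add: mult.commute)
  moreover have "(\<lambda>x. D A' x u' * D B' x v' - D B' x u' * D A' x v') = (\<lambda>x. - 1 * M.P\<^sub>6 x)"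
    by (rule ext) (simp add: M.P\<^sub>6_def algebra_simps)
  ultimately have "- (L.\<phi> M.P\<^sub>6 * ?e) = - ?e" using L.\<phi>_cmult[OF L.sep, of "- 1" M.P\<^sub>6] by simp
  hence "L.\<phi> M.P\<^sub>6 * ?e = 1 * ?e" unfolding neg_equal_iff_equal mult_1_left .
  thus ?thesis using ne by (metis mult_right_cancel)
qed

lemma two_points_det:
  fixes u v :: "'k::field ^ 4"
  assumes d: "vec.dim {s1 *s u + s2 *s v, t1 *s u + t2 *s v} = 2" shows "s1 * t2 - s2 * t1 \<noteq> 0"
proof
  let ?p = "s1 *s u + s2 *s v" and ?q = "t1 *s u + t2 *s v"
  assume 0: "s1 * t2 - s2 * t1 = 0"
  have "t2 *s ?p + (- s2) *s ?q = (s1 * t2 - s2 * t1) *s u" "(- t1) *s ?p + s1 *s ?q = (s1 * t2 - s2 * t1) *s v"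
    by (simp_all add: vec_eq_iff algebra_simps)
  hence "t2 *s ?p + (- s2) *s ?q = 0" "(- t1) *s ?p + s1 *s ?q = 0" unfolding 0 by simp_all
  hence "s2 = 0" "s1 = 0" using two_pointsD[OF d] by fastforce+
  thus False using two_pointsD[OF d, of 1 0] by simp
qed

text \<open>On L both equations of M are multiples of one linear form y2 that vanishes at p. In the
  basis E, H of the pencil of A', B', with E vanishing on L, the Jacobian reduces to a single
  product along L. Euler's relation is used once, for H, and gives the 4.\<close>

lemma gram_meet:
  fixes F :: "'k::{alg_closed_field,field_char_0} ^ 4 \<Rightarrow> 'k"
  assumes "normalized_line F u v n1 n2 cu cv cg cd A B" "normalized_line F u' v' n1' n2' cu' cv' cg' cd' A' B'"
    and ne: "vec.span {u, v} \<noteq> vec.span {u', v'}" and p: "p \<in> vec.span {u, v}" "p \<in> vec.span {u', v'}" "p \<noteq> 0"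
  shows "quintic_line.\<phi> F u v n1 n2 (normalized_line.P\<^sub>6 u' v' A' B') = -4"
proof -
  interpret L: normalized_line F u v n1 n2 cu cv cg cd A B by fact
  interpret M: normalized_line F u' v' n1' n2' cu' cv' cg' cd' A' B' by fact
  interpret q: quintic F by (rule L.uv_XL)
  let ?L = "vec.span {u, v}" and ?M = "vec.span {u', v'}"
  have lines: "is_line ?L" "is_line ?M" using is_line_span2 L.dim_uv M.dim_uv by blast+
  have sL: "vec.subspace ?L" "vec.subspace ?M" by (rule vec.subspace_span)+
  obtain q where q: "q \<in> ?L" "q \<notin> vec.span {p}" "?L = vec.span {p, q}" using line_second_point[OF lines(1) p(1,3)] by blast
  obtain r where r: "r \<in> ?M" "r \<notin> vec.span {p}" "?M = vec.span {p, r}" using line_second_point[OF lines(2) p(2,3)] by blast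
  have pq: "vec.dim {p, q} = 2" and pr: "vec.dim {p, r} = 2" using two_points[OF p(3)] q(2) r(2) by blast+
  have qM: "q \<notin> ?M" using lineI2[OF lines(2) p(2) _ pq] q(3) ne by blast
  obtain s1 s2 where ps: "p = s1 *s u + s2 *s v" using p(1) unfolding mem_span2 by blast
  obtain t1 t2 where qs: "q = t1 *s u + t2 *s v" using q(1) unfolding mem_span2 by blast
  define k where "k = s1 * t2 - s2 * t1"
  have k: "k \<noteq> 0" using two_points_det pq unfolding ps qs k_def by blast
  define y1 where "y1 x = t2 / k * cu x + (- t1 / k) * cv x" for x
  define y2 where "y2 x = (- s2 / k) * cu x + s1 / k * cv x" for x
  have fy: "form 1 y1" "form 1 y2" unfolding y1_def[abs_def] y2_def[abs_def]
    by (intro form_add form_cmult L.coord_forms)+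
  have cpq: "cu p = s1" "cv p = s2" "cu q = t1" "cv q = t2"
    using L.coords_unique[of s1 s2 0 0] L.coords_unique[of t1 t2 0 0] ps qs by simp_all
  have ypq: "y1 p = 1" "y1 q = 0" "y2 p = 0" "y2 q = 1"
  proof -
    have "y1 p = (s1 * t2 - s2 * t1) / k" "y2 q = (s1 * t2 - s2 * t1) / k"
      unfolding y1_def y2_def cpq by (simp_all add: diff_divide_distrib mult.commute)
    thus "y1 p = 1" "y2 q = 1" using k by (simp_all add: k_def)
    show "y1 q = 0" "y2 p = 0" unfolding y1_def y2_def cpq by (simp_all add: mult.commute)
  qed
  have ydec: "x = y1 x *s p + y2 x *s q" if x: "x \<in> ?L" for x
  proof -
    obtain \<alpha> \<beta> where xe: "x = \<alpha> *s p + \<beta> *s q" using x unfolding q(3) mem_span2 by blast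
    hence "y1 x = \<alpha>" "y2 x = \<beta>" using form_1_linear[OF fy(1)] form_1_linear[OF fy(2)] ypq by simp_all
    thus ?thesis using xe by simp
  qed
  let ?e = "y1 u * y2 v - y1 v * y2 u"
  have uL: "u \<in> ?L" "v \<in> ?L" by (auto intro: vec.span_base)
  have ev: "vol u v x y = ?e * vol p q x y" for x y
  proof -
    have "vol u v x y = vol (y1 u *s p + y2 u *s q) (y1 v *s p + y2 v *s q) x y" using ydec uL by metis
    thus ?thesis unfolding vol_linear2 by (simp add: mult.commute)
  qed
  have e0: "?e \<noteq> 0" using ev[of n1 n2] L.vol1 by auto
  define c3 where "c3 = cg' q" define c4 where "c4 = cd' q"
  have "c3 \<noteq> 0 \<or> c4 \<noteq> 0" using qM M.on_line_iff by (auto simp: c3_def c4_def)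
  \<comment> \<open>Completes (c3, c4) to a matrix of determinant 1, so that E, H have the same
    Jacobian as A', B'.\<close>
  then obtain d3 d4 where d: "c3 * d4 - c4 * d3 = 1"
  proof
    assume "c3 \<noteq> 0" thus ?thesis by (intro that[of "1 / c3" 0]) simp
  next
    assume "c4 \<noteq> 0" thus ?thesis by (intro that[of 0 "- 1 / c4"]) simp
  qed
  define w where "w = 0 *s u' + 0 *s v' + d3 *s n1' + d4 *s n2'"
  have w: "cg' w = d3" "cd' w = d4" unfolding w_def by (rule M.coords_unique)+
  have p0: "cg' p = 0" "cd' p = 0" "cg' r = 0" "cd' r = 0" using p(2) r(1) M.on_line_iff by auto
  have cL: "cg' x = y2 x * c3" "cd' x = y2 x * c4" if x: "x \<in> ?L" for x
  proof -
    have "cg' x = cg' (y1 x *s p + y2 x *s q)" "cd' x = cd' (y1 x *s p + y2 x *s q)" using ydec[OF x] by simp_all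
    thus "cg' x = y2 x * c3" "cd' x = y2 x * c4"
      using form_1_linear[OF M.coord_forms(3)] form_1_linear[OF M.coord_forms(4)] p0 by (simp_all add: c3_def c4_def)
  qed
  define E where "E x = c3 * A' x + c4 * B' x" for x
  define H where "H x = d3 * A' x + d4 * B' x" for x
  have fEH: "form 4 E" "form 4 H" unfolding E_def[abs_def] H_def[abs_def] by (intro form_add form_cmult M.formAB)+
  have DE: "D E x y = c3 * D A' x y + c4 * D B' x y" and DH: "D H x y = d3 * D A' x y + d4 * D B' x y" for x y
    unfolding E_def[abs_def] H_def[abs_def]
    by (simp_all add: D_add[OF form_cmult form_cmult, OF M.formAB] D_cmult[OF M.formAB(1)] D_cmult[OF M.formAB(2)])
  have LX: "?L \<in> q.XL" by (rule L.uv_XL)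
  \<comment> \<open>On L the decomposition of F reads y2 E = 0, and y2 is not identically zero
    there.\<close>
  have E0: "E x = 0" if x: "x \<in> ?L" for x
  proof (rule form_mult_zero_on_line[OF fy(2) fEH(1) sL(1) _ q(1)])
    show "y2 x * E x = 0" if "x \<in> ?L" for x
      using M.split[of x] q.XL_D(2)[OF LX that] unfolding cL[OF that] E_def by (simp add: algebra_simps)
    show "y2 q \<noteq> 0" using ypq by simp
  qed fact
  have DE0: "D E x y = 0" if "x \<in> ?L" "y \<in> ?L" for x y
    by (rule D_along_zero[OF fEH(1)], rule E0) (use that sL(1) in \<open>auto intro!: vec.subspace_add vec.subspace_scale\<close>)
  have det: "L.\<phi> (\<lambda>x. 0 * (1/4 * D H x q + D E x w) - D E x r * (1/4 * D H x p)) * ?e = - vol u v r w"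
  proof (rule L.\<phi>_det[OF L.sep fy])
    show "form 3 (\<lambda>x. 0 :: 'k)" by (rule form_zero)
    show "form 3 (\<lambda>x. D E x r)" "form 3 (\<lambda>x. 1/4 * D H x p)" "form 3 (\<lambda>x. 1/4 * D H x q + D E x w)"
      by (intro form_add form_cmult form_D[OF fEH(1), simplified] form_D[OF fEH(2), simplified])+
    fix x assume x: "x \<in> ?L"
    show "D F x r = 0 * y1 x + D E x r * y2 x"
      using M.D_split[of x r] unfolding cL[OF x] p0 DE by (simp add: algebra_simps)
    have "4 * H x = D H x x" using D_euler[OF fEH(2), of x] by simp
    also have "\<dots> = D H x (y1 x *s p + y2 x *s q)" using ydec[OF x] by simp
    also have "\<dots> = y1 x * D H x p + y2 x * D H x q" by (rule D_linear[OF fEH(2)])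
    finally have "H x = 1/4 * (y1 x * D H x p + y2 x * D H x q)" by (simp add: field_simps)
    moreover have "D F x w = H x + y2 x * D E x w"
      using M.D_split[of x w] unfolding cL[OF x] w DE H_def by (simp add: algebra_simps)
    ultimately show "D F x w = 1/4 * D H x p * y1 x + (1/4 * D H x q + D E x w) * y2 x" by (simp add: algebra_simps)
  qed (use e0 L.vol1 in simp_all)
  obtain a1 a2 where pa: "p = a1 *s u' + a2 *s v'" using p(2) unfolding mem_span2 by blast
  obtain b1 b2 where rb: "r = b1 *s u' + b2 *s v'" using r(1) unfolding mem_span2 by blast
  define \<kappa> where "\<kappa> = a1 * b2 - a2 * b1"
  have \<kappa>: "\<kappa> \<noteq> 0" using two_points_det pr unfolding pa rb \<kappa>_def by blast
  have "vol p q r w = - \<kappa>"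
  proof -
    have "vol p r q w = \<kappa> * vol u' v' q w" unfolding pa rb \<kappa>_def by (rule vol_linear2)
    also have "vol u' v' q w = 1" unfolding M.vol_coords w c3_def[symmetric] c4_def[symmetric] using d by simp
    finally show ?thesis using vol_exchange[of p q r w] by simp
  qed
  hence "L.\<phi> (\<lambda>x. 0 * (1/4 * D H x q + D E x w) - D E x r * (1/4 * D H x p)) * ?e = \<kappa> * ?e"
    unfolding det ev by simp
  hence phi: "L.\<phi> (\<lambda>x. 0 * (1/4 * D H x q + D E x w) - D E x r * (1/4 * D H x p)) = \<kappa>" using e0 by simp
  have "0 * (1/4 * D H x q + D E x w) - D E x r * (1/4 * D H x p) = (- (\<kappa> / 4)) * M.P\<^sub>6 x" if x: "x \<in> ?L" for x
  proof -
    have "D E x p * D H x r - D E x r * D H x p = (c3 * d4 - c4 * d3) * (D A' x p * D B' x r - D A' x r * D B' x p)"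
      unfolding DE DH by (simp add: algebra_simps)
    also have "D A' x p * D B' x r - D A' x r * D B' x p = - (\<kappa> * M.P\<^sub>6 x)"
      unfolding pa rb D_linear[OF M.formAB(1)] D_linear[OF M.formAB(2)] \<kappa>_def M.P\<^sub>6_def by (simp add: algebra_simps)
    finally have "D E x r * D H x p = \<kappa> * M.P\<^sub>6 x" using d DE0[OF x p(1)] by simp
    thus ?thesis by simp
  qed
  hence "L.\<phi> (\<lambda>x. 0 * (1/4 * D H x q + D E x w) - D E x r * (1/4 * D H x p)) = L.\<phi> (\<lambda>x. (- (\<kappa> / 4)) * M.P\<^sub>6 x)"
    using L.pt_in_line by (intro L.\<phi>_cong[OF L.sep]) blast
  hence "\<kappa> = (- (\<kappa> / 4)) * L.\<phi> M.P\<^sub>6" unfolding phi L.\<phi>_cmult[OF L.sep] .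
  hence "4 * \<kappa> = 4 * ((- (\<kappa> / 4)) * L.\<phi> M.P\<^sub>6)" by (rule arg_cong)
  also have "\<dots> = - (\<kappa> * L.\<phi> M.P\<^sub>6)" by simp
  finally have "\<kappa> * (L.\<phi> M.P\<^sub>6 + 4) = 0" by (simp add: algebra_simps)
  thus ?thesis using \<kappa> by (simp add: eq_neg_iff_add_eq_0)
qed

text \<open>F is divided by cg and the remainder by cd; what is left is F on the projection to the
  line, hence zero.\<close>

lemma (in quintic) normalized_line_exists:
  assumes "L \<in> XL"
  shows "\<exists>u v n1 n2 cu cv cg cd A B. normalized_line F u v n1 n2 cu cv cg cd A B \<and> L = vec.span {u, v}"
proof -
  obtain u v where uv: "L = vec.span {u, v}" "vec.dim {u, v} = 2" using is_lineE[OF XL_D(1)[OF assms]] by blast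
  obtain m1 m2 where "quintic_line F u v m1 m2" using quintic_line_exists uv assms by blast
  then obtain n1 n2 where q: "quintic_line F u v n1 n2" "vol u v n1 n2 = 1" "card {z. poly (quintic_line.b F u v n2) z = 0} = 4"
    using quintic_line.separable_normal_exists by blast
  interpret Q: quintic_line F u v n1 n2 by (rule q(1))
  have "\<forall>x. \<exists>\<alpha> \<beta> \<gamma> \<delta>. x = \<alpha> *s u + \<beta> *s v + \<gamma> *s n1 + \<delta> *s n2" using Q.spans by blast
  then obtain cu cv cg cd where "\<forall>x. x = cu x *s u + cv x *s v + cg x *s n1 + cd x *s n2" by metis
  hence co: "x = cu x *s u + cv x *s v + cg x *s n1 + cd x *s n2" for x by blast
  have uniq: "cu x = \<alpha> \<and> cv x = \<beta> \<and> cg x = \<gamma> \<and> cd x = \<delta>" if x: "x = \<alpha> *s u + \<beta> *s v + \<gamma> *s n1 + \<delta> *s n2" for x \<alpha> \<beta> \<gamma> \<delta>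
    by (rule Q.coords_cancel) (use co[of x] x in simp)
  have add: "cu (x + y) = cu x + cu y \<and> cv (x + y) = cv x + cv y \<and> cg (x + y) = cg x + cg y \<and> cd (x + y) = cd x + cd y" for x y
  proof (rule uniq)
    have "x + y = (cu x *s u + cv x *s v + cg x *s n1 + cd x *s n2) + (cu y *s u + cv y *s v + cg y *s n1 + cd y *s n2)"
      using co[of x] co[of y] by simp
    thus "x + y = (cu x + cu y) *s u + (cv x + cv y) *s v + (cg x + cg y) *s n1 + (cd x + cd y) *s n2"
      by (simp add: vec.scale_left_distrib add_ac)
  qed
  have scl: "cu (s *s x) = s * cu x \<and> cv (s *s x) = s * cv x \<and> cg (s *s x) = s * cg x \<and> cd (s *s x) = s * cd x" for s x
  proof (rule uniq)
    have "s *s x = s *s (cu x *s u + cv x *s v + cg x *s n1 + cd x *s n2)" using co[of x] by simp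
    thus "s *s x = (s * cu x) *s u + (s * cv x) *s v + (s * cg x) *s n1 + (s * cd x) *s n2"
      by (simp add: vec.scale_right_distrib)
  qed
  have f1: "form 1 cu" "form 1 cv" "form 1 cg" "form 1 cd"
    by (rule form_of_linear; use add scl in blast)+
  obtain A where A: "form 4 A" "\<forall>x. F x = F (x - cg x *s n1) + cg x * A x" using form_divide[OF formF f1(3), of n1] by auto
  define F' where "F' x = F (x - cg x *s n1)" for x
  have "form 1 (\<lambda>x. (x - cg x *s n1) $ i)" for i
    using form_diff[OF form_nth[of i] form_cmult[OF f1(3), of "n1 $ i"]] by (simp add: mult.commute)
  hence F': "form 5 F'" unfolding F'_def[abs_def] by (rule form_comp[OF formF])
  obtain B where B: "form 4 B" "\<forall>x. F' x = F' (x - cd x *s n2) + cd x * B x" using form_divide[OF F' f1(4), of n2] by auto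
  have "F' (x - cd x *s n2) = 0" for x
  proof -
    have n2: "cg n2 = 0" using uniq[of n2 0 0 0 1] by simp
    have "cg (x - cd x *s n2) = cg x"
    proof -
      have "cg (x + (- cd x) *s n2) = cg x + (- cd x) * cg n2" using add[of x "(- cd x) *s n2"] scl[of "- cd x" n2] by metis
      thus ?thesis using n2 by simp
    qed
    hence "F' (x - cd x *s n2) = F (x - cd x *s n2 - cg x *s n1)" by (simp add: F'_def)
    also have "x - cd x *s n2 - cg x *s n1 = cu x *s u + cv x *s v"
      by (subst co[of x]) (simp add: vec_eq_iff)
    finally show ?thesis using Q.on_line by simp
  qed
  note zero = this
  have sp: "F x = cg x * A x + cd x * B x" for x
  proof -
    have "F x = F' x + cg x * A x" unfolding F'_def by (rule A(2)[rule_format])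
    also have "F' x = F' (x - cd x *s n2) + cd x * B x" by (rule B(2)[rule_format])
    finally show ?thesis unfolding zero by simp
  qed
  have "normalized_line F u v n1 n2 cu cv cg cd A B"
    by (intro normalized_line.intro normalized_line_axioms.intro q f1 co A(1) B(1) sp)
  thus ?thesis using uv(1) by blast
qed

section \<open>All lines of a smooth quintic over an algebraically closed field\<close>

locale quintic_poly =
  fixes G :: "'k::{alg_closed_field,field_char_0} poly4"
  assumes hom5: "homogeneous 5 G" and nonsingular: "\<And>x. x \<noteq> 0 \<Longrightarrow> \<exists>i. poly4_eval (partial i G) x \<noteq> 0"
begin

lemma D_axis: "D (poly4_eval G) x (axis l 1) = poly4_eval (partial l G) x"
  unfolding D_poly4_eval[OF hom5] by (simp add: axis_def if_distrib[of "\<lambda>a. a * _"] cong: if_cong)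

sublocale quintic "poly4_eval G"
proof
  show "form 5 (poly4_eval G)" by (rule form_poly4_eval[OF hom5])
  show "\<exists>w. D (poly4_eval G) x w \<noteq> 0" if "x \<noteq> 0" for x
  proof -
    have "\<exists>i. D (poly4_eval G) x (axis i 1) \<noteq> 0" using nonsingular[OF that] unfolding D_axis .
    thus ?thesis by blast
  qed
qed

sublocale form_ideal "\<lambda>l. partial l G" 4
proof
  show "homogeneous 4 (partial i G)" for i using homogeneous_partial[OF hom5, of i] by simp
  show "\<exists>i. poly4_eval (partial i G) x \<noteq> 0" if "x \<noteq> 0" for x by (rule nonsingular[OF that])
qed

text \<open>A relation, because functional and sextic depend on the chosen basis and on the
  decomposition of F; the pairing values do not.\<close>

definition line_functional :: "('k ^ 4) set \<Rightarrow> (('k ^ 4 \<Rightarrow> 'k) \<Rightarrow> 'k) \<Rightarrow> ('k ^ 4 \<Rightarrow> 'k) \<Rightarrow> bool" where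
  "line_functional L f P \<longleftrightarrow> (\<exists>u v n1 n2 cu cv cg cd A B. normalized_line (poly4_eval G) u v n1 n2 cu cv cg cd A B
     \<and> L = vec.span {u, v} \<and> f = quintic_line.\<phi> (poly4_eval G) u v n1 n2 \<and> P = normalized_line.P\<^sub>6 u v A B)"

lemma line_functional_exists: "L \<in> XL \<Longrightarrow> \<exists>f P. line_functional L f P"
  using normalized_line_exists[of L] unfolding line_functional_def by metis

lemma line_functional:
  assumes "line_functional L f P"
  shows "form 6 P" "form 2 q \<Longrightarrow> f (\<lambda>x. q x * poly4_eval (partial l G) x) = 0"
    "\<exists>\<Phi> wt pts. f = (\<lambda>g. \<Sum>x\<in>\<Phi>. wt (x :: 'k) * g (pts x :: 'k ^ 4))" "f P = 16"
proof -
  obtain u v n1 n2 cu cv cg cd A B where n: "normalized_line (poly4_eval G) u v n1 n2 cu cv cg cd A B"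
    and f: "f = quintic_line.\<phi> (poly4_eval G) u v n1 n2" and P: "P = normalized_line.P\<^sub>6 u v A B"
    using assms unfolding line_functional_def by blast
  interpret L: normalized_line "poly4_eval G" u v n1 n2 cu cv cg cd A B by (rule n)
  show "form 6 P" unfolding P by (rule L.form_P6)
  show "f P = 16" unfolding P f by (rule L.gram_self)
  show "f (\<lambda>x. q x * poly4_eval (partial l G) x) = 0" if "form 2 q"
    using L.\<phi>_kills[OF L.sep that] unfolding f D_axis[symmetric] .
  show "\<exists>\<Phi> wt pts. f = (\<lambda>g. \<Sum>x\<in>\<Phi>. wt (x :: 'k) * g (pts x :: 'k ^ 4))"
    unfolding f L.\<phi>_def[abs_def]
    by (intro exI[of _ "{z. poly L.b z = 0}"] exI[of _ "\<lambda>z. 1 / (poly L.a z * poly (pderiv L.b) z)"] exI[of _ L.pt] refl)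
qed

lemma line_functional_pair:
  assumes "line_functional L f P" "line_functional M g Q" "L \<noteq> M"
  shows "f Q = (if L \<inter> M = {0} then 1 else - 4)"
proof -
  obtain u v n1 n2 cu cv cg cd A B where n: "normalized_line (poly4_eval G) u v n1 n2 cu cv cg cd A B"
    and L: "L = vec.span {u, v}" and f: "f = quintic_line.\<phi> (poly4_eval G) u v n1 n2"
    using assms(1) unfolding line_functional_def by blast
  obtain u' v' n1' n2' cu' cv' cg' cd' A' B' where n': "normalized_line (poly4_eval G) u' v' n1' n2' cu' cv' cg' cd' A' B'"
    and M: "M = vec.span {u', v'}" and Q: "Q = normalized_line.P\<^sub>6 u' v' A' B'"
    using assms(2) unfolding line_functional_def by blast
  show ?thesis
  proof (cases "L \<inter> M = {0}")
    case True
    thus ?thesis using gram_skew[OF n n'] unfolding L M f Q by simp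
  next
    case False
    moreover have "0 \<in> L \<inter> M" unfolding L M by (simp add: vec.span_zero)
    ultimately obtain p where "p \<in> L" "p \<in> M" "p \<noteq> 0" by blast
    thus ?thesis using gram_meet[OF n n'] False assms(3) unfolding L M f Q by simp
  qed
qed

definition meets :: "('i::finite \<Rightarrow> ('k ^ 4) set) \<Rightarrow> 'i \<Rightarrow> 'i \<Rightarrow> bool" where
  "meets M i j \<longleftrightarrow> M i \<noteq> M j \<and> M i \<inter> M j \<noteq> {0}"

text \<open>Forty-five functionals are dependent on all sextics, in particular on those of the
  lines, where their values form the rows of the Gram matrix.\<close>

lemma gram_dependent:
  fixes M :: "'i::finite \<Rightarrow> ('k ^ 4) set"
  assumes M: "inj M" "\<And>i. M i \<in> XL" and B: "card B = 45"
  shows "\<exists>c :: 'i \<Rightarrow> 'k. (\<exists>i\<in>B. c i \<noteq> 0) \<and> (\<forall>j. (\<Sum>i\<in>B. c i * of_int (gram (meets M) i j)) = 0)"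
proof -
  have "\<forall>i. \<exists>d. line_functional (M i) (fst d) (snd d)" using line_functional_exists[OF M(2)] by simp
  from choice[OF this] obtain d where d: "\<And>i. line_functional (M i) (fst (d i)) (snd (d i))" by blast
  define f where "f i = fst (d i)" for i
  define P where "P i = snd (d i)" for i
  have fP: "line_functional (M i) (f i) (P i)" for i using d[of i] by (simp add: f_def P_def)
  have "\<forall>i. \<exists>s. f i = (\<lambda>g. \<Sum>x\<in>fst s. fst (snd s) (x :: 'k) * g (snd (snd s) x :: 'k ^ 4))"
    using line_functional(3)[OF fP] by simp
  from choice[OF this] obtain s where "\<forall>i. f i = (\<lambda>g. \<Sum>x\<in>fst (s i). fst (snd (s i)) (x :: 'k) * g (snd (snd (s i)) x))" by (rule exE)
  hence s: "f i = (\<lambda>g. \<Sum>x\<in>fst (s i). fst (snd (s i)) x * g (snd (snd (s i)) x))" for i by (rule spec)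
  have fB: "finite B" using B card.infinite by fastforce
  have "\<exists>c. (\<exists>i\<in>B. c i \<noteq> 0) \<and> (\<forall>g. form 6 g \<longrightarrow> (\<Sum>i\<in>B. c i * f i g) = 0)"
    unfolding s
  proof (rule sextic_functionals_dependent[OF refl fB B])
    fix i and q :: "'k ^ 4 \<Rightarrow> 'k" and l assume "i \<in> B" "form 2 q"
    thus "(\<Sum>x\<in>fst (s i). fst (snd (s i)) x * (q (snd (snd (s i)) x) * poly4_eval (partial l G) (snd (snd (s i)) x))) = 0"
      using line_functional(2)[OF fP, of q i l] unfolding s by simp
  qed
  then obtain c where c: "\<exists>i\<in>B. c i \<noteq> 0" "\<And>g. form 6 g \<Longrightarrow> (\<Sum>i\<in>B. c i * f i g) = 0" by blast
  have val: "f i (P j) = of_int (gram (meets M) i j)" for i j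
  proof (cases "i = j")
    case True thus ?thesis using line_functional(4)[OF fP[of i]] by (simp add: gram_def)
  next
    case False
    hence "M i \<noteq> M j" using M(1) by (auto dest: injD)
    thus ?thesis using line_functional_pair[OF fP[of i] fP[of j]] False by (auto simp: gram_def meets_def)
  qed
  show ?thesis using c(1) c(2)[OF line_functional(1)[OF fP]] unfolding val by blast
qed

text \<open>The Gram matrix of pairwise skew lines is \<open>15 I + J\<close>, which is nonsingular.\<close>

lemma no_45_skew_lines:
  assumes T: "T \<subseteq> XL" "finite T" "card T = 45"
  shows "\<exists>A\<in>T. \<exists>B\<in>T. A \<noteq> B \<and> A \<inter> B \<noteq> {0}"
proof (rule ccontr)
  assume "\<not> ?thesis"
  hence skew: "A \<inter> B = {0}" if "A \<in> T" "B \<in> T" "A \<noteq> B" for A B using that by blast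
  obtain M :: "45 \<Rightarrow> ('k ^ 4) set" where M: "bij_betw M UNIV T"
    using finite_same_card_bij[OF finite_class.finite_UNIV[where 'a = 45] T(2)] T(3) by auto
  have MT: "M i \<in> T" for i using bij_betwE[OF M] by simp
  have inj: "inj M" using M by (rule bij_betw_imp_inj_on)
  have g: "gram (meets M) i j = (if i = j then 16 else 1)" for i j
    using skew[OF MT[of i] MT[of j]] by (auto simp: gram_def meets_def)
  have "\<exists>c :: 45 \<Rightarrow> 'k. (\<exists>i\<in>UNIV. c i \<noteq> 0) \<and> (\<forall>j. (\<Sum>i\<in>UNIV. c i * of_int (gram (meets M) i j)) = 0)"
    by (rule gram_dependent[OF inj]) (use MT T(1) in auto)
  then obtain c :: "45 \<Rightarrow> 'k" where c: "\<exists>i. c i \<noteq> 0" "\<And>j. (\<Sum>i\<in>UNIV. c i * of_int (gram (meets M) i j)) = 0" by blast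
  define s where "s = sum c UNIV"
  have cj: "15 * c j + s = 0" for j
  proof -
    have "(\<Sum>i\<in>UNIV. c i * of_int (gram (meets M) i j)) = (\<Sum>i\<in>UNIV. c i + (if i = j then 15 * c i else 0))"
      unfolding g by (intro sum.cong) auto
    thus ?thesis unfolding c(2) by (simp add: sum.distrib s_def add.commute)
  qed
  \<comment> \<open>Summing over the 45 indices gives 60 s = 0, hence s = 0 in characteristic zero,
    and all coefficients vanish.\<close>
  have "(\<Sum>j\<in>(UNIV::45 set). 15 * c j + s) = 0" by (simp add: cj)
  hence "15 * s + 45 * s = 0" by (simp add: sum.distrib s_def sum_distrib_left)
  hence "s = 0" by simp
  thus False using cj c(1) by simp
qed

lemma no_128_lines:
  assumes S: "S \<subseteq> XL" "finite S" "card S = 128"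
  shows False
proof -
  have ns: "\<not> split_plane P" for P
  proof
    assume sp: "split_plane P"
    have "card S \<le> 127" by (rule split_bound[OF no_45_skew_lines sp S(2,1)])
    thus False using S(3) by simp
  qed
  obtain U V N1 N2 where "quintic_lines (poly4_eval G) S U V N1 N2" using quintic_lines_exists[OF S(2,1)] by blast
  then interpret Q: quintic_lines "poly4_eval G" S U V N1 N2 .
  have nf: "\<not> Q.flat L" if "L \<in> S" for L by (rule Q.not_flat[OF no_45_skew_lines that])
  have ram: "card (Q.triangles L) \<le> 2 * card {z. poly (Q.WL L) z = 0}" if "L \<in> S" "26 < card (Q.nb L)" for L
    using Q.card_triangles_ramified[OF ns that(1)] Q.valency(1)[OF that(1)] that(2) by fastforce
  have W0: "Q.WL L \<noteq> 0" if "L \<in> S" for L using Q.ql(3)[OF that] by auto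
  \<comment> \<open>At most six ramification points with two ordered pairs each. For valency 29 all
    ramification orders are 2, which leaves three points and the bound 6.\<close>
  have t12: "card (Q.triangles L) \<le> 12" if L: "L \<in> S" "26 < card (Q.nb L)" for L
    using ram[OF L] card_poly_roots_bound[OF W0[OF L(1)]] Q.ql(3)[OF L(1)] by simp
  have t6: "card (Q.triangles L) \<le> 6" if L: "L \<in> S" "card (Q.nb L) = 29" for L
  proof -
    have "(\<Sum>z | poly (Q.WL L) z = 0. order z (Q.WL L)) = 2 * card {z. poly (Q.WL L) z = 0}"
      using Q.valency(3)[OF L(1) nf[OF L(1)] L(2)] by simp
    moreover have "(\<Sum>z | poly (Q.WL L) z = 0. order z (Q.WL L)) \<le> 6"
      using sum_order_le_degree[OF W0[OF L(1)]] Q.ql(3)[OF L(1)] by simp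
    ultimately show ?thesis using ram[OF L(1)] L(2) by simp
  qed
  obtain M :: "128 \<Rightarrow> ('k ^ 4) set" where M: "bij_betw M UNIV S"
    using finite_same_card_bij[OF finite_class.finite_UNIV[where 'a = 128] S(2)] S(3) by auto
  have MS: "M i \<in> S" for i using bij_betwE[OF M] by simp
  have inj: "inj M" using M by (rule bij_betw_imp_inj_on)
  have surj: "\<exists>i. M i = L" if "L \<in> S" for L using M that unfolding bij_betw_def by blast
  have inS: "L \<in> Q.nb L' \<Longrightarrow> L \<in> S" for L L' by (simp add: Q.nb_def)
  have nb: "bij_betw M {j. meets M i j} (Q.nb (M i))" for i
    unfolding bij_betw_def
  proof
    show "inj_on M {j. meets M i j}" using inj by (rule inj_on_subset) simp
    show "M ` {j. meets M i j} = Q.nb (M i)"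
      using MS surj by (fastforce simp: Q.nb_def meets_def)
  qed
  let ?\<tau> = "\<lambda>i. {(j, k). meets M i j \<and> meets M i k \<and> meets M j k}"
  have tri: "bij_betw (map_prod M M) (?\<tau> i) (Q.triangles (M i))" for i
    unfolding bij_betw_def
  proof
    show "inj_on (map_prod M M) (?\<tau> i)"
      by (rule inj_on_subset[OF prod.inj_map[OF inj inj] subset_UNIV])
    show "(map_prod M M) ` ?\<tau> i = Q.triangles (M i)"
    proof
      show "(map_prod M M) ` ?\<tau> i \<subseteq> Q.triangles (M i)"
      proof
        fix x assume "x \<in> (map_prod M M) ` ?\<tau> i"
        then obtain j k where jk: "x = (M j, M k)" "meets M i j" "meets M i k" "meets M j k" by blast
        show "x \<in> Q.triangles (M i)"
          unfolding jk(1) Q.triangles_def Q.nb_def using jk(2-4) MS unfolding meets_def by blast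
      qed
      show "Q.triangles (M i) \<subseteq> (map_prod M M) ` ?\<tau> i"
      proof
        fix x assume x: "x \<in> Q.triangles (M i)"
        then obtain A B where AB: "x = (A, B)" "A \<in> Q.nb (M i)" "B \<in> Q.nb (M i)" "A \<noteq> B" "A \<inter> B \<noteq> {0}"
          unfolding Q.triangles_def by blast
        obtain j k where "A = M j" "B = M k" using surj inS AB(2,3) by metis
        thus "x \<in> (map_prod M M) ` ?\<tau> i"
          using AB by (intro image_eqI[of _ _ "(j, k)"]) (simp_all add: Q.nb_def meets_def not_sym)
      qed
    qed
  qed
  note cnb = bij_betw_same_card[OF nb] and ctri = bij_betw_same_card[OF tri]
  show False
  proof (rule gram_rank_contradiction[of "meets M"])
    show "CARD(128) = 128" by simp
    show "meets M i j \<Longrightarrow> meets M j i" for i j by (auto simp: meets_def)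
    show "\<not> meets M i i" for i by (simp add: meets_def)
    show "card {j. meets M i j} \<le> 29" for i unfolding cnb by (rule Q.valency(2)[OF MS nf[OF MS]])
    show "card (?\<tau> i) \<le> card {j. meets M i j}" for i
      unfolding cnb ctri by (rule Q.card_triangles_nb[OF ns MS])
    show "26 < card {j. meets M i j} \<Longrightarrow> card (?\<tau> i) \<le> 12" for i
      unfolding cnb ctri by (rule t12[OF MS])
    show "card {j. meets M i j} = 29 \<Longrightarrow> card (?\<tau> i) \<le> 6" for i
      unfolding cnb ctri by (rule t6[OF MS])
    show "dim (range (\<lambda>i. \<chi> j. real_of_int (gram (meets M) i j))) \<le> 44"
    proof (rule dim_range_le)
      fix I :: "128 set" assume "card I = Suc 44"
      hence "card I = 45" by simp
      from gram_dependent[OF inj _ this]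
      show "\<exists>c :: 128 \<Rightarrow> 'k. (\<exists>i\<in>I. c i \<noteq> 0) \<and> (\<forall>j. (\<Sum>i\<in>I. c i * of_int (gram (meets M) i j)) = 0)"
        using MS S(1) by blast
    qed
  qed
qed

text \<open>Finiteness comes with the bound, since an infinite set would contain 128 lines as
  well.\<close>

theorem card_XL: "finite XL" "card XL \<le> 127"
proof -
  have "\<not> (finite XL \<longrightarrow> 128 \<le> card XL)"
  proof
    assume "finite XL \<longrightarrow> 128 \<le> card XL"
    then obtain S where "S \<subseteq> XL" "card S = 128" "finite S"
      using infinite_arbitrarily_large[of XL 128] obtain_subset_with_card_n[of 128 XL] by metis
    thus False using no_128_lines by blast
  qed
  thus "finite XL" "card XL \<le> 127" by auto
qed

end

section \<open>Passage to the algebraic closure\<close>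

lemma lookup_base_change: "lookup (base_change F) m = to_ac (lookup F m)"
  by (simp add: base_change_def Poly_Mapping.map.rep_eq when_def)

lemma keys_base_change: "keys (base_change F) = keys F"
  by (auto simp: in_keys_iff lookup_base_change)

lemma base_change_sum: "base_change (\<Sum>x\<in>A. f x) = (\<Sum>x\<in>A. base_change (f x))"
  by (rule poly_mapping_eqI) (simp add: lookup_base_change lookup_sum to_ac_sum)

lemma base_change_single: "base_change (single m c) = single m (to_ac c)"
  by (rule poly_mapping_eqI) (simp add: lookup_base_change lookup_single when_def)

lemma base_change_partial: "base_change (partial i F) = partial i (base_change F)"
  unfolding partial_def base_change_sum base_change_single keys_base_change lookup_base_change by simp

lemma homogeneous_base_change: "homogeneous d F \<Longrightarrow> homogeneous d (base_change F)"
  by (simp add: homogeneous_def keys_base_change)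

definition geom :: "'a::field ^ 4 \<Rightarrow> 'a alg_closure ^ 4" where "geom v = (\<chi> i. to_ac (v $ i))"

lemma geom_nth [simp]: "geom v $ i = to_ac (v $ i)" by (simp add: geom_def)

lemma geom_eq_iff: "geom x = geom y \<longleftrightarrow> x = y" by (simp add: vec_eq_iff)

text \<open>In an echelon basis the coefficients of a vector can be read off from its entries i and
  j.\<close>

lemma line_echelon:
  assumes "is_line (L :: ('a::field ^ 4) set)"
  shows "\<exists>u v i j. L = vec.span {u, v} \<and> u $ i \<noteq> 0 \<and> v $ i = 0 \<and> v $ j \<noteq> 0"
proof -
  obtain u w where uw: "L = vec.span {u, w}" "vec.dim {u, w} = 2" using is_lineE[OF assms] by blast
  have ind: "s = 0 \<and> t = 0" if "s *s u + t *s w = 0" for s t using two_pointsD[OF uw(2) that] .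
  have "u \<noteq> 0" using ind[of 1 0] by auto
  then obtain i where i: "u $ i \<noteq> 0" by (auto simp: vec_eq_iff)
  define c where "c = w $ i / u $ i"
  define v where "v = w - c *s u"
  have "v = (- c) *s u + 1 *s w" by (simp add: v_def)
  hence "v \<noteq> 0" using ind[of "- c" 1] by auto
  then obtain j where j: "v $ j \<noteq> 0" by (auto simp: vec_eq_iff)
  have "w = 1 *s v + c *s u" by (simp add: v_def)
  hence "w \<in> vec.span {u, v}" unfolding mem_span2 by (metis add.commute)
  moreover have "v \<in> vec.span {u, w}" unfolding mem_span2 by (intro exI[of _ "- c"] exI[of _ 1]) (simp add: v_def)
  ultimately have "vec.span {u, w} = vec.span {u, v}"
    by (intro antisym vec.span_minimal) (auto intro: vec.span_base)
  thus ?thesis using uw(1) i j by (intro exI[of _ u] exI[of _ v] exI[of _ i] exI[of _ j]) (simp add: v_def c_def)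
qed

lemma geometric_points_line:
  assumes "is_line (L :: ('a::field ^ 4) set)"
  shows "is_line (geometric_points L)" "geom w \<in> geometric_points L \<longleftrightarrow> w \<in> L"
proof -
  obtain u v i j where L: "L = vec.span {u, v}" and i: "u $ i \<noteq> 0" "v $ i = 0" "v $ j \<noteq> 0"
    using line_echelon[OF assms] by blast
  have lin: "geom (s *s u + t *s v) = to_ac s *s geom u + to_ac t *s geom v" for s t
    by (simp add: vec_eq_iff)
  have gp: "geometric_points L = vec.span {geom u, geom v}"
  proof -
    have "geom ` L \<subseteq> vec.span {geom u, geom v}" unfolding L mem_span2[abs_def] using lin by (force simp: mem_span2)
    moreover have "{geom u, geom v} \<subseteq> geom ` L" unfolding L by (auto intro: vec.span_base)
    ultimately have "vec.span (geom ` L) = vec.span {geom u, geom v}"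
      by (intro antisym vec.span_minimal) (auto intro: vec.span_base)
    thus ?thesis by (simp add: geometric_points_def geom_def[abs_def])
  qed
  have u0: "geom u \<noteq> 0" using i(1) by (auto simp: vec_eq_iff)
  have "geom v \<notin> vec.span {geom u}"
  proof
    assume "geom v \<in> vec.span {geom u}"
    then obtain s where s: "geom v = s *s geom u" by (auto simp: vec.span_singleton)
    have "s * to_ac (u $ i) = 0" using arg_cong[OF s, of "\<lambda>x. x $ i"] i(2) by simp
    hence "geom v = 0" using s i(1) by simp
    thus False using i(3) by (auto simp: vec_eq_iff)
  qed
  hence "vec.dim {geom u, geom v} = 2" using two_points[OF u0] by blast
  thus "is_line (geometric_points L)" unfolding gp by (rule is_line_span2)
  show "geom w \<in> geometric_points L \<longleftrightarrow> w \<in> L"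
  proof
    assume "w \<in> L"
    thus "geom w \<in> geometric_points L" unfolding geometric_points_def geom_def by (intro vec.span_base imageI)
  next
    assume "geom w \<in> geometric_points L"
    then obtain s t where st: "geom w = s *s geom u + t *s geom v" unfolding gp mem_span2 by blast
    \<comment> \<open>The coefficients over the closure are computed from entries of
      \<open>w\<close>, \<open>u\<close> and \<open>v\<close>, so they come from the base
      field.\<close>
    define s' where "s' = w $ i / u $ i"
    define t' where "t' = (w $ j - s' * u $ j) / v $ j"
    have "to_ac (w $ i) = s * to_ac (u $ i)" using arg_cong[OF st, of "\<lambda>x. x $ i"] i(2) by simp
    hence s: "s = to_ac s'" using i(1) by (simp add: s'_def)
    have "to_ac (w $ j) = to_ac s' * to_ac (u $ j) + t * to_ac (v $ j)" using arg_cong[OF st, of "\<lambda>x. x $ j"] s by simp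
    hence "t = to_ac t'" using i(3) by (simp add: t'_def field_simps)
    hence "geom w = geom (s' *s u + t' *s v)" using st s lin by simp
    hence "w = s' *s u + t' *s v" unfolding geom_eq_iff .
    thus "w \<in> L" unfolding L mem_span2 by blast
  qed
qed

lemma inj_on_geometric_points: "inj_on geometric_points {L :: ('a::field ^ 4) set. is_line L}"
proof (rule inj_onI, clarify)
  fix L M :: "('a ^ 4) set" assume "is_line L" "is_line M" "geometric_points L = geometric_points M"
  hence "w \<in> L \<longleftrightarrow> w \<in> M" for w using geometric_points_line(2) by metis
  thus "L = M" by blast
qed

text \<open>By Euler's relation a common zero of the partial derivatives is a zero of the quintic,
  as 5 is invertible.\<close>

lemma quintic_poly_base_change:
  fixes F :: "'a::field_char_0 poly4"
  assumes "smooth_surface 5 F" shows "quintic_poly (base_change F)"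
proof
  show hom: "homogeneous 5 (base_change F)" using assms by (simp add: smooth_surface_def homogeneous_base_change)
  fix x :: "'a alg_closure ^ 4" assume x: "x \<noteq> 0"
  show "\<exists>i. poly4_eval (partial i (base_change F)) x \<noteq> 0"
  proof (rule ccontr)
    assume "\<not> ?thesis"
    hence p: "poly4_eval (partial i (base_change F)) x = 0" for i by blast
    have "5 * poly4_eval (base_change F) x = D (poly4_eval (base_change F)) x x"
      using D_euler[OF form_poly4_eval[OF hom], of x] by simp
    also have "\<dots> = 0" unfolding D_poly4_eval[OF hom] p by simp
    finally have "poly4_eval (base_change F) x = 0" by simp
    thus False using assms x p unfolding smooth_surface_def base_change_partial by blast
  qed
qed

lemma card_lines_on:
  fixes F :: "'a::field_char_0 poly4"
  assumes "smooth_surface 5 F" shows "finite (lines_on F)" "card (lines_on F) \<le> 127"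
proof -
  interpret quintic_poly "base_change F" by (rule quintic_poly_base_change[OF assms])
  have sub: "geometric_points ` lines_on F \<subseteq> XL"
    using geometric_points_line(1) by (auto simp: lines_on_def XL_def)
  have inj: "inj_on geometric_points (lines_on F)"
    by (rule inj_on_subset[OF inj_on_geometric_points]) (auto simp: lines_on_def)
  show "finite (lines_on F)" by (rule inj_on_finite[OF inj sub card_XL(1)])
  show "card (lines_on F) \<le> 127" using card_inj_on_le[OF inj sub card_XL(1)] card_XL(2) by linarith
qed

theorem theorem1p2:
  shows "(\<forall>F :: ('a::field_char_0) poly4. smooth_surface 5 F \<longrightarrow>
            finite (lines_on F) \<and> card (lines_on F) \<le> 127) \<and>
         max_lines TYPE('a) 5 \<le> 127"
proof
  show "\<forall>F :: 'a poly4. smooth_surface 5 F \<longrightarrow> finite (lines_on F) \<and> card (lines_on F) \<le> 127"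
    using card_lines_on by blast
  have "num_lines F \<le> 127" if "smooth_surface 5 F" for F :: "'a poly4"
    using card_lines_on[OF that] by (simp add: num_lines_def numeral_eq_enat)
  thus "max_lines TYPE('a) 5 \<le> 127" unfolding max_lines_def by (auto intro: Sup_least)
qed

end
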